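(* Let $m\ge3$ and $n\ge1$. Assume that $P_m(\partial_t,\partial_x)$ and $P_{m-1}(\partial_t,\partial_x)$ are strictly hyperbolic homogeneous operators of order $m$ and $m-1$ on $\mathbb{R}_t\times\mathbb{R}^n_x$, with $c_{m,0}=1$ and $c_{m-1,0}>0$, and that $P_{m-1}(\lambda,\xi')$ and $P_m(\lambda,\xi')$ strictly interlace for any $\xi'\in S^{n-1}$. Let $s_0\ge m-1$ and $$u_j\in H^{s_0-j}\cap L^1,\qquad j=0,\ldots,m-1 .$$ (a) Let $Q=Q_1=P_m+P_{m-1}$, let $$M=\int_{\mathbb{R}^n}\big(u_{m-1}(x)+c_{m-1,0}u_{m-2}(x)\big)\,dx,$$ and define $v$ by $$\hat v(t,\xi)=M\sum_{j=1}^{m-1}\frac{\exp\Big(i|\xi|b_j(\xi')t+|\xi|^2\frac{P_m(b_j(\xi'),\xi')}{\check P_{m-1,j}(b_j(\xi'),\xi')}t\Big)}{i^{m-2}\,\check P_{m-1,j}(b_j(\xi'),\xi')},\qquad \xi'=\xi/|\xi| .$$ Then the solution $u$ to the Cauchy problem $$Q(\partial_t,\partial_x)u=0\quad(t\ge0,\ x\in\mathbb{R}^n),\qquad \partial_t^ju(0,x)=u_j(x),\quad j=0,\ldots,m-1,$$ satisfies, as $t\to\infty$, $$\big\|\partial_t^k\big(u(t,\cdot)-I_{m-2}v(t,\cdot)\big)\big\|_{\dot H^s}=o\big((1+t)^{-\frac n4-\frac{k+s-(m-2)}2}\big)$$ for $k+s\le s_0$ such that $n/2+k+s>m-2$. (b)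 Assume, moreover, that $P_{m-2}(\partial_t,\partial_x)$ is a strictly hyperbolic homogeneous operator of order $m-2$ with $c_{m-2,0}>0$, and that $P_{m-2}(\lambda,\xi')$ and $P_{m-1}(\lambda,\xi')$ strictly interlace for any $\xi'\in S^{n-1}$. Let $Q=Q_2=P_m+P_{m-1}+P_{m-2}$, let $$M=\int_{\mathbb{R}^n}\big(u_{m-1}(x)+c_{m-1,0}u_{m-2}(x)+c_{m-2,0}u_{m-3}(x)\big)\,dx,$$ and define $w$ by $$\hat w(t,\xi)=M\sum_{j=1}^{m-2}\frac{\exp\Big(i|\xi|d_j(\xi')t+|\xi|^2\frac{P_{m-1}(d_j(\xi'),\xi')}{\check P_{m-2,j}(d_j(\xi'),\xi')}t\Big)}{i^{m-3}\,\check P_{m-2,j}(d_j(\xi'),\xi')},\qquad \xi'=\xi/|\xi| .$$ Then the solution $u$ to the same Cauchy problem with this $Q$ satisfies, as $t\to\infty$, $$\big\|\partial_t^k\big(u(t,\cdot)-I_{m-3}w(t,\cdot)\big)\big\|_{\dot H^s}=o\big((1+t)^{-\frac n4-\frac{k+s-(m-3)}2}\big)$$ for $k+s\le s_0$ such that $n/2+k+s>m-3$.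
   Context: A homogeneous operator of order $r$ is $P_r(\partial_t,\partial_x)=\sum_{k+|\alpha|=r}c_{k,\alpha}\partial_t^k\partial_x^\alpha$ with constant coefficients and $c_{r,0}>0$; its symbol is $P_r(\lambda,\xi)=\sum_{k+|\alpha|=r}c_{k,\alpha}\lambda^k\xi^\alpha$, $\xi\in\mathbb{R}^n$ (no factors of $i$). It is hyperbolic if, for every $\xi'\in S^{n-1}=\{\xi\in\mathbb{R}^n:|\xi|=1\}$, the polynomial $\lambda\mapsto P_r(\lambda,\xi')$ has only real roots, and strictly hyperbolic if in addition these roots are distinct for every $\xi'\in S^{n-1}$. If $p_{r-1}$, $p_r$ are polynomials of degree $r-1$, $r$ with real roots $\tilde\lambda_1\le\dots\le\tilde\lambda_{r-1}$ and $\lambda_1\le\dots\le\lambda_r$, they strictly interlace if $\lambda_1<\tilde\lambda_1<\lambda_2<\tilde\lambda_2<\dots<\tilde\lambda_{r-1}<\lambda_r$. For $\xi'\in S^{n-1}$, $b_1(\xi'),\ldots,b_{m-1}(\xi')$ are the roots of $P_{m-1}(\lambda,\xi')=c_{m-1,0}\prod_k(\lambda-b_k(\xi'))$ and $d_1(\xi'),\ldots,d_{m-2}(\xi')$ are the roots of $P_{m-2}(\lambda,\xi')=c_{m-2,0}\prod_k(\lambda-d_k(\xi'))$. We set $\check P_{m-1,j}(\lambda,\xi')=P_{m-1}(\lambda,\xi')/(\lambda-b_j(\xi'))$ and $\check P_{m-2,j}(\lambda,\xi')=P_{m-2}(\lambda,\xi')/(\lambda-d_j(\xi'))$ (polynomials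 in $\lambda$). Here $k\ge0$ is an integer and $s\ge0$ is real. $\hat f$ is the Fourier transform in $x$; $I_a$ is the Riesz potential, i.e. $\widehat{I_af}=|\xi|^{-a}\hat f$; $\|f\|_{H^\sigma}=\|(1+|\xi|^2)^{\sigma/2}\hat f\|_{L^2}$, $\|f\|_{\dot H^s}=\||\xi|^s\hat f\|_{L^2}$. *)

theory Defs
  imports "HOL-Analysis.Analysis" "HOL-Computational_Algebra.Polynomial" "HOL-Library.Landau_Symbols"
begin

text \<open>
  A family \<open>c k \<alpha>\<close> of coefficients encodes the operators of all orders at once: \<open>P\<^sub>r\<close> uses exactly the
  entries with \<open>k + |\<alpha>| = r\<close>. Real coefficients are no restriction, because a homogeneous operator
  with positive leading coefficient whose roots are real on the unit sphere has real coefficients.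
\<close>

type_synonym 'n coeffs = "nat \<Rightarrow> ('n \<Rightarrow> nat) \<Rightarrow> real"

definition mpow :: "'a::comm_monoid_mult ^ 'n::finite \<Rightarrow> ('n \<Rightarrow> nat) \<Rightarrow> 'a" where
  "mpow z \<alpha> = (\<Prod>i\<in>UNIV. z $ i ^ \<alpha> i)"

definition symbol_coeff ::
    "'n::finite coeffs \<Rightarrow> nat \<Rightarrow> nat \<Rightarrow> 'a::{real_algebra_1, comm_ring_1} ^ 'n \<Rightarrow> 'a" where
  "symbol_coeff c r k z = (\<Sum>\<alpha> | (\<Sum>i\<in>UNIV. \<alpha> i) = r - k. of_real (c k \<alpha>) * mpow z \<alpha>)"

text \<open>The polynomial \<open>\<lambda> \<mapsto> P\<^sub>r(\<lambda>, \<xi>)\<close>.\<close>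

definition symb :: "'n::finite coeffs \<Rightarrow> nat \<Rightarrow> real ^ 'n \<Rightarrow> real poly" where
  "symb c r \<xi> = (\<Sum>k\<le>r. monom (symbol_coeff c r k \<xi>) k)"

definition hyperbolic :: "'n::finite coeffs \<Rightarrow> nat \<Rightarrow> bool" where
  "hyperbolic c r \<longleftrightarrow>
     (\<forall>\<xi> \<in> sphere 0 1. \<forall>z::complex. poly (map_poly complex_of_real (symb c r \<xi>)) z = 0 \<longrightarrow> z \<in> \<real>)"

definition strictly_hyperbolic :: "'n::finite coeffs \<Rightarrow> nat \<Rightarrow> bool" where
  "strictly_hyperbolic c r \<longleftrightarrow> hyperbolic c r \<and> (\<forall>\<xi> \<in> sphere 0 1. rsquarefree (symb c r \<xi>))"

text \<open>The lists \<open>xs\<close>, \<open>ys\<close> are the roots of \<open>p\<close>, \<open>q\<close> in increasing order, with multiplicity.\<close>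

definition strictly_interlace :: "real poly \<Rightarrow> real poly \<Rightarrow> bool" where
  "strictly_interlace p q \<longleftrightarrow> p \<noteq> 0 \<and> q \<noteq> 0 \<and>
     (\<exists>xs ys. sorted xs \<and> sorted ys \<and> length ys = Suc (length xs) \<and>
        p = smult (lead_coeff p) (\<Prod>x\<leftarrow>xs. [:- x, 1:]) \<and>
        q = smult (lead_coeff q) (\<Prod>y\<leftarrow>ys. [:- y, 1:]) \<and>
        (\<forall>i<length xs. ys ! i < xs ! i \<and> xs ! i < ys ! Suc i))"

text \<open>
  Functions are Borel representatives of their almost everywhere classes. Norms are
  based on the nonnegative integral, so that divergence is not mistaken for \<open>0\<close>;
  \<open>L2_norm\<close> is only meaningful together with \<open>in_L2\<close>.
\<close>

definition L2_norm_sq :: "('a::euclidean_space \<Rightarrow> complex) \<Rightarrow> ennreal" where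
  "L2_norm_sq f = (\<integral>\<^sup>+ x. ennreal ((norm (f x))\<^sup>2) \<partial>lborel)"

definition in_L2 :: "('a::euclidean_space \<Rightarrow> complex) \<Rightarrow> bool" where
  "in_L2 f \<longleftrightarrow> f \<in> borel_measurable lborel \<and> L2_norm_sq f < \<infinity>"

definition L2_norm :: "('a::euclidean_space \<Rightarrow> complex) \<Rightarrow> real" where
  "L2_norm f = sqrt (enn2real (L2_norm_sq f))"

definition fourier_integral :: "('a::euclidean_space \<Rightarrow> complex) \<Rightarrow> 'a \<Rightarrow> complex" where
  "fourier_integral f \<xi> = (LINT x|lborel. exp (- (\<i> * of_real (x \<bullet> \<xi>))) * f x)"

text \<open>
  The transform on \<open>L\<^sup>2\<close> is the \<open>L\<^sup>2\<close> limit of the truncated Fourier integrals. It is determined up to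
  null sets, and agrees with \<open>fourier_integral\<close> on \<open>L\<^sup>1 \<inter> L\<^sup>2\<close>. The normalization (no factor
  \<open>2 \<pi>\<close>) is the one for which the value at \<open>0\<close> is the integral of the function.
\<close>

definition has_fourier :: "('a::euclidean_space \<Rightarrow> complex) \<Rightarrow> ('a \<Rightarrow> complex) \<Rightarrow> bool" where
  "has_fourier f g \<longleftrightarrow> in_L2 f \<and> in_L2 g \<and>
     ((\<lambda>R. L2_norm_sq (\<lambda>\<xi>. fourier_integral (\<lambda>x. indicator (cball 0 R) x *\<^sub>R f x) \<xi> - g \<xi>)) \<longlongrightarrow> 0) at_top"

definition fourier :: "('a::euclidean_space \<Rightarrow> complex) \<Rightarrow> 'a \<Rightarrow> complex" where
  "fourier f = (SOME g. has_fourier f g)"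

text \<open>
  For arbitrary real \<open>\<sigma>\<close> the Fourier transform identifies \<open>H\<^sup>\<sigma>\<close> with a weighted \<open>L\<^sup>2\<close> space. Elements
  of \<open>H\<^sup>\<sigma>\<close> with \<open>\<sigma> < 0\<close> need not be functions, hence the notions below, whose arguments
  are Fourier transforms.
\<close>

definition sobolev_weight :: "real \<Rightarrow> ('a::euclidean_space \<Rightarrow> complex) \<Rightarrow> 'a \<Rightarrow> complex" where
  "sobolev_weight \<sigma> F = (\<lambda>\<xi>. ((1 + (norm \<xi>)\<^sup>2) powr (\<sigma> / 2)) *\<^sub>R F \<xi>)"

definition in_sobolev_hat :: "real \<Rightarrow> ('a::euclidean_space \<Rightarrow> complex) \<Rightarrow> bool" where
  "in_sobolev_hat \<sigma> F \<longleftrightarrow> in_L2 (sobolev_weight \<sigma> F)"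

definition sobolev_hat_tendsto ::
    "real \<Rightarrow> ('b \<Rightarrow> 'a::euclidean_space \<Rightarrow> complex) \<Rightarrow> ('a \<Rightarrow> complex) \<Rightarrow> 'b filter \<Rightarrow> bool" where
  "sobolev_hat_tendsto \<sigma> F G net \<longleftrightarrow>
     ((\<lambda>i. L2_norm_sq (sobolev_weight \<sigma> (\<lambda>\<xi>. F i \<xi> - G \<xi>))) \<longlongrightarrow> 0) net"

text \<open>Used only for \<open>\<sigma> \<ge> 0\<close>, where the elements of \<open>H\<^sup>\<sigma>\<close> are \<open>L\<^sup>2\<close> functions.\<close>

definition in_sobolev :: "real \<Rightarrow> ('a::euclidean_space \<Rightarrow> complex) \<Rightarrow> bool" where
  "in_sobolev \<sigma> f \<longleftrightarrow> (\<exists>g. has_fourier f g \<and> in_sobolev_hat \<sigma> g)"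

text \<open>
  The value \<open>|0|\<^sup>s\<close> in \<open>hdot_weight\<close> is irrelevant, since \<open>{0}\<close> is a null set.
\<close>

definition hdot_weight :: "real \<Rightarrow> ('a::euclidean_space \<Rightarrow> complex) \<Rightarrow> 'a \<Rightarrow> complex" where
  "hdot_weight s F = (\<lambda>\<xi>. (norm \<xi> powr s) *\<^sub>R F \<xi>)"

definition in_hdot_hat :: "real \<Rightarrow> ('a::euclidean_space \<Rightarrow> complex) \<Rightarrow> bool" where
  "in_hdot_hat s F \<longleftrightarrow> in_L2 (hdot_weight s F)"

definition hdot_norm_hat :: "real \<Rightarrow> ('a::euclidean_space \<Rightarrow> complex) \<Rightarrow> real" where
  "hdot_norm_hat s F = L2_norm (hdot_weight s F)"

definition riesz_hat :: "real \<Rightarrow> ('a::euclidean_space \<Rightarrow> complex) \<Rightarrow> 'a \<Rightarrow> complex" where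
  "riesz_hat a F = (\<lambda>\<xi>. (norm \<xi> powr (- a)) *\<^sub>R F \<xi>)"

text \<open>Strong derivative at time \<open>t\<close> (one-sided at \<open>t = 0\<close>) of a curve in \<open>H\<^sup>\<sigma>\<close>.\<close>

definition has_sobolev_deriv ::
    "real \<Rightarrow> (real \<Rightarrow> 'a::euclidean_space \<Rightarrow> complex) \<Rightarrow> ('a \<Rightarrow> complex) \<Rightarrow> real \<Rightarrow> bool" where
  "has_sobolev_deriv \<sigma> F G t \<longleftrightarrow> in_sobolev_hat \<sigma> G \<and>
     sobolev_hat_tendsto \<sigma> (\<lambda>\<tau> \<xi>. (F \<tau> \<xi> - F t \<xi>) / of_real (\<tau> - t)) G (at t within {0..})"

text \<open>
  Time derivatives of a curve in \<open>H\<^sup>\<sigma>\<close>: the derivative of order \<open>j\<close> is formed in \<open>H\<^sup>\<sigma>\<^sup>-\<^sup>j\<close>.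
  It is determined up to null sets.
\<close>

primrec sobolev_dt ::
    "real \<Rightarrow> nat \<Rightarrow> (real \<Rightarrow> 'a::euclidean_space \<Rightarrow> complex) \<Rightarrow> real \<Rightarrow> 'a \<Rightarrow> complex" where
  "sobolev_dt \<sigma> 0 F = F"
| "sobolev_dt \<sigma> (Suc j) F = (\<lambda>t. SOME G. has_sobolev_deriv (\<sigma> - real (Suc j)) (sobolev_dt \<sigma> j F) G t)"

text \<open>The Fourier transform in \<open>x\<close> of \<open>\<partial>\<^sub>t\<^sup>j u\<close>, for \<open>u\<close> with values in \<open>H\<^sup>\<sigma>\<close>.\<close>

definition dt_hat ::
    "real \<Rightarrow> nat \<Rightarrow> (real \<Rightarrow> 'a::euclidean_space \<Rightarrow> complex) \<Rightarrow> real \<Rightarrow> 'a \<Rightarrow> complex" where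
  "dt_hat \<sigma> j u = sobolev_dt \<sigma> j (\<lambda>t. fourier (u t))"

text \<open>
  The Fourier transform in \<open>x\<close> of \<open>P\<^sub>r(\<partial>\<^sub>t, \<partial>\<^sub>x) u\<close>, where \<open>\<partial>\<^sub>x\<^sup>\<alpha>\<close> becomes multiplication by \<open>(i \<xi>)\<^sup>\<alpha>\<close> and
  \<open>U k\<close> is the transform of \<open>\<partial>\<^sub>t\<^sup>k u\<close> at a fixed time.
\<close>

definition op_hat ::
    "'n::finite coeffs \<Rightarrow> nat \<Rightarrow> (nat \<Rightarrow> real ^ 'n \<Rightarrow> complex) \<Rightarrow> real ^ 'n \<Rightarrow> complex" where
  "op_hat c r U \<xi> = (\<Sum>k\<le>r. symbol_coeff c r k (\<chi> i. \<i> * of_real (\<xi> $ i)) * U k \<xi>)"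

text \<open>
  \<open>u\<close> belongs to \<open>C\<^sup>j([0,\<infinity>), H\<^sup>\<sigma>\<^sup>-\<^sup>j)\<close> for \<open>j \<le> m\<close>, satisfies \<open>\<Sum>r\<in>R. P\<^sub>r(\<partial>\<^sub>t, \<partial>\<^sub>x) u = 0\<close> in
  \<open>H\<^sup>\<sigma>\<^sup>-\<^sup>m\<close> for all \<open>t \<ge> 0\<close>, and has initial data \<open>\<partial>\<^sub>t\<^sup>j u(0) = u0 j\<close> for \<open>j < m\<close>.
\<close>

definition solves_cauchy ::
    "'n::finite coeffs \<Rightarrow> nat set \<Rightarrow> nat \<Rightarrow> real \<Rightarrow> (nat \<Rightarrow> real ^ 'n \<Rightarrow> complex)
      \<Rightarrow> (real \<Rightarrow> real ^ 'n \<Rightarrow> complex) \<Rightarrow> bool" where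
  "solves_cauchy c R m \<sigma> u0 u \<longleftrightarrow>
     (\<forall>t\<ge>0. in_sobolev \<sigma> (u t)) \<and>
     (\<forall>j<m. \<forall>t\<ge>0. \<exists>G. has_sobolev_deriv (\<sigma> - real (Suc j)) (dt_hat \<sigma> j u) G t) \<and>
     (\<forall>j\<le>m. \<forall>t\<ge>0. sobolev_hat_tendsto (\<sigma> - real j) (dt_hat \<sigma> j u) (dt_hat \<sigma> j u t) (at t within {0..})) \<and>
     (\<forall>j\<le>m. \<forall>t\<ge>0. in_sobolev_hat (\<sigma> - real j) (dt_hat \<sigma> j u t)) \<and>
     (\<forall>t\<ge>0. AE \<xi> in lborel. (\<Sum>r\<in>R. op_hat c r (\<lambda>k. dt_hat \<sigma> k u t) \<xi>) = 0) \<and>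
     (\<forall>j<m. AE \<xi> in lborel. dt_hat \<sigma> j u 0 \<xi> = fourier (u0 j) \<xi>)"

text \<open>
  With \<open>r = m - 1\<close> this is the transform of \<open>v\<close>, with \<open>r = m - 2\<close> that of \<open>w\<close>. The roots of \<open>P\<^sub>r(\<cdot>, \<xi>')\<close> are
  distinct when \<open>P\<^sub>r\<close> is strictly hyperbolic, so the sum over the root set is the sum over
  the indices of the roots.
\<close>

definition symb_check :: "'n::finite coeffs \<Rightarrow> nat \<Rightarrow> real \<Rightarrow> real ^ 'n \<Rightarrow> real poly" where
  "symb_check c r b \<xi> = symb c r \<xi> div [:- b, 1:]"

definition profile_hat ::
    "'n::finite coeffs \<Rightarrow> nat \<Rightarrow> complex \<Rightarrow> real \<Rightarrow> real ^ 'n \<Rightarrow> complex" where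
  "profile_hat c r M t \<xi> =
     (let \<xi>' = \<xi> /\<^sub>R norm \<xi> in
      M * (\<Sum>b | poly (symb c r \<xi>') b = 0.
             exp (\<i> * of_real (norm \<xi> * b * t)
                  + of_real ((norm \<xi>)\<^sup>2 * (poly (symb c (r + 1) \<xi>') b / poly (symb_check c r b \<xi>') b) * t))
             / (\<i> ^ (r - 1) * of_real (poly (symb_check c r b \<xi>') b))))"

text \<open>
  The profiles are smooth in \<open>t\<close> for each \<open>\<xi>\<close>, but \<open>riesz_hat\<close> of a profile need not lie in any \<open>H\<^sup>\<sigma>\<close>
  because of its singularity at \<open>\<xi> = 0\<close>; their time derivatives are therefore taken pointwise in \<open>\<xi>\<close>.
\<close>

definition pointwise_dt ::
    "nat \<Rightarrow> (real \<Rightarrow> 'a \<Rightarrow> complex) \<Rightarrow> real \<Rightarrow> 'a \<Rightarrow> complex" where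
  "pointwise_dt k F t \<xi> = ((\<lambda>f \<tau>. vector_derivative f (at \<tau>)) ^^ k) (\<lambda>\<tau>. F \<tau> \<xi>) t"

end

theory Submission
  imports Defs "HOL-Computational_Algebra.Fundamental_Theorem_Algebra"
begin

text \<open>
  The Fourier transform in \<open>x\<close> turns the equation into the family of ordinary differential equations with
  characteristic polynomials \<open>\<Sum>\<^sub>l P\<^sub>l(\<lambda>, i \<xi>)\<close>. With \<open>\<xi> = \<rho> \<omega>\<close>, \<open>|\<omega>| = 1\<close> and \<open>\<lambda> = i \<rho> z\<close> the exponents are
  the solutions of \<open>\<Sum>\<^sub>l (i \<rho>)\<^sup>l P\<^sub>l(z, \<omega>) = 0\<close>. Both parts of the theorem are instances of a single statement
  about the orders \<open>r, \<dots>, m\<close>, with \<open>r = m - 1\<close> and \<open>r = m - 2\<close> (\<open>asymptotic_profile\<close>).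

  \<^emph>\<open>Dissipation.\<close> Interlacing means that \<open>P\<^sub>l\<^sub>-\<^sub>1 / P\<^sub>l\<close> has positive residues at its real poles, so that it maps
  the lower half-plane to the upper one. This excludes solutions \<open>z\<close> with \<open>Im z \<le> 0\<close>; hence \<open>Re \<lambda> < 0\<close> for all
  \<open>\<xi> \<noteq> 0\<close> (\<open>dissipative_symbol_two_orders\<close>, \<open>dissipative_symbol_three_orders\<close>).

  \<^emph>\<open>Frequencies away from \<open>0\<close>.\<close> On compact sets without \<open>0\<close> the exponents have a uniform distance to the
  imaginary axis (\<open>middle_frequencies\<close>). As \<open>\<rho> \<rightarrow> \<infinity>\<close> they are \<open>i \<rho> a - P\<^sub>m\<^sub>-\<^sub>1(a) / P\<^sub>m'(a) + O(1 / \<rho>)\<close> with \<open>a\<close>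
  running through the roots of \<open>P\<^sub>m\<close>, so the decay is again exponential; since these roots are uniformly
  separated, no derivatives are lost (\<open>high_frequencies\<close>).

  \<^emph>\<open>Frequencies near \<open>0\<close>.\<close> Here \<open>m - r\<close> exponents stay in a compact part of the left half-plane, and the others
  are \<open>i \<rho> b + \<rho>\<^sup>2 P\<^sub>r\<^sub>+\<^sub>1(b) / P\<^sub>r'(b) + O(\<rho>\<^sup>3)\<close> with \<open>b\<close> running through the roots of \<open>P\<^sub>r\<close>. These are the exponents
  of the profile, because \<open>P\<^sub>r / (\<lambda> - b)\<close> has the value \<open>P\<^sub>r'(b)\<close> at \<open>b\<close>. If \<open>\<Sum>\<^sub>l P\<^sub>l = (\<lambda> - \<lambda>\<^sub>0) h\<close> and \<open>y\<^sub>j\<close> is the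
  transform of the \<open>j\<close>-th initial value, then the mode \<open>exp (\<lambda>\<^sub>0 t)\<close> has the coefficient
  \<open>\<Sum>\<^sub>j h\<^sub>j y\<^sub>j\<close> divided by the derivative of the characteristic polynomial at \<open>\<lambda>\<^sub>0\<close>. The numerator tends to
  \<open>\<Sum>\<^bsub>j \<ge> r - 1\<^esub> c\<^bsub>j+1,0\<^esub> y\<^sub>j(0) = M\<close>, and the denominator is \<open>(i \<rho>)\<^bsup>r-1\<^esup> P\<^sub>r'(b) (1 + O(\<rho>))\<close>: this is the origin
  of the number \<open>M\<close> and of the Riesz potential (\<open>low_frequencies\<close>).

  \<^emph>\<open>The rate.\<close> Near \<open>\<xi> = 0\<close> the weighted difference is at most \<open>\<eta> \<rho>\<^sup>\<gamma> exp (- \<kappa> \<rho>\<^sup>2 t)\<close> with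
  \<open>\<gamma> = k + s - (r - 1)\<close>, up to exponentially small terms, where \<open>\<eta>\<close> is as small as desired: the transforms of the
  integrable initial values are continuous at \<open>0\<close>. By scaling the integral of \<open>\<rho>\<^bsup>2 \<gamma>\<^esup> exp (- 2 \<kappa> \<rho>\<^sup>2 t)\<close> over
  \<open>\<real>\<^sup>n\<close> is a multiple of \<open>t\<^bsup>- \<gamma> - n / 2\<^esup>\<close>, finite when \<open>n / 2 + \<gamma> > 0\<close> (\<open>difference_decay\<close>).

  \<^emph>\<open>Solutions with values in Sobolev spaces.\<close> Such a curve is only known up to a null set of frequencies at each
  time. That it is given by the solutions of the ordinary differential equations is shown by integrating
  against bounded functions of compact support and expanding in a Taylor series in \<open>t\<close> (\<open>sobolev_solution\<close>).
\<close>

section \<open>Polynomials acting on sequences by shifts\<close>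

text \<open>
  With \<open>S\<close> the shift of sequences this is \<open>p(S) y\<close>. For \<open>y\<^sub>n = \<partial>\<^sub>t\<^sup>n u(0)\<close> it is the sequence of
  derivatives at \<open>0\<close> of \<open>p(\<partial>\<^sub>t) u\<close>, so a linear ODE with constant coefficients becomes a
  linear recurrence.
\<close>

definition shift_act :: "complex poly \<Rightarrow> (nat \<Rightarrow> complex) \<Rightarrow> nat \<Rightarrow> complex" where
  "shift_act p y n = (\<Sum>i\<le>degree p. coeff p i * y (n + i))"

lemma shift_act_upto:
  assumes "degree p \<le> N"
  shows "shift_act p y n = (\<Sum>i\<le>N. coeff p i * y (n + i))"
  unfolding shift_act_def
  by (rule sum.mono_neutral_left) (use assms in \<open>auto intro: coeff_eq_0\<close>)

lemma shift_act_0 [simp]: "shift_act 0 y n = 0"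
  by (simp add: shift_act_def)

lemma shift_act_1 [simp]: "shift_act 1 y n = y n"
  by (simp add: shift_act_def)

lemma shift_act_add: "shift_act (p + q) y n = shift_act p y n + shift_act q y n"
proof -
  let ?N = "max (degree p) (degree q)"
  have "degree (p + q) \<le> ?N" by (rule degree_add_le) auto
  then show ?thesis
    by (simp add: shift_act_upto[of p ?N] shift_act_upto[of q ?N] shift_act_upto[of "p + q" ?N]
        algebra_simps sum.distrib)
qed

lemma shift_act_smult: "shift_act (smult a p) y n = a * shift_act p y n"
  by (subst shift_act_upto[of "smult a p" "degree p"])
     (auto simp: degree_smult_le shift_act_def sum_distrib_left mult_ac)

lemma shift_act_pCons: "shift_act (pCons a p) y n = a * y n + shift_act p y (Suc n)"
  by (subst shift_act_upto[of _ "Suc (degree p)"])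
     (auto simp: degree_pCons_le shift_act_def sum.atMost_Suc_shift simp del: sum.atMost_Suc)

lemma shift_act_mult: "shift_act (p * q) y n = shift_act p (shift_act q y) n"
  by (induction p arbitrary: n)
     (auto simp: shift_act_add shift_act_smult shift_act_pCons)

lemma shift_act_sum: "shift_act (sum f A) y n = (\<Sum>a\<in>A. shift_act (f a) y n)"
  by (induction A rule: infinite_finite_induct) (auto simp: shift_act_add)

lemma shift_act_diff_right: "shift_act p (\<lambda>n. y n - z n) n = shift_act p y n - shift_act p z n"
  by (simp add: shift_act_def right_diff_distrib sum_subtractf)

lemma shift_act_sum_right: "shift_act p (\<lambda>n. \<Sum>a\<in>A. f a n) n = (\<Sum>a\<in>A. shift_act p (f a) n)"
  by (simp add: shift_act_def sum_distrib_left sum.swap[of _ A])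

lemma shift_act_mult_right: "shift_act p (\<lambda>n. f n * c) n = shift_act p f n * c"
  by (simp add: shift_act_def sum_distrib_right mult.assoc)

lemma shift_act_power: "shift_act p (\<lambda>n. z ^ n) n = z ^ n * poly p z"
  by (simp add: shift_act_def poly_altdef power_add sum_distrib_left mult_ac)

lemma shift_act_shift: "shift_act p (\<lambda>n. y (n + k)) n = shift_act p y (n + k)"
  by (simp add: shift_act_def add_ac)

lemma shift_act_linear_factor_0:
  assumes "\<And>n. shift_act [:- l, 1:] z n = 0"
  shows "z n = l ^ n * z 0"
proof (induction n)
  case (Suc n)
  have "z (Suc n) = l * z n" using assms[of n] by (simp add: shift_act_pCons)
  with Suc show ?case by simp
qed simp

section \<open>Lagrange interpolation and the splitting of solutions\<close>

lemma degree_prod_linear: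
  "finite B \<Longrightarrow> degree (\<Prod>b\<in>B. [:- b, 1:] :: 'a::field poly) = card B"
  by (subst degree_prod_eq_sum_degree) auto

lemma pderiv_prod_linear_root:
  fixes f :: "'i \<Rightarrow> 'a::field"
  assumes "finite I" "i \<in> I"
  shows "poly (pderiv (\<Prod>j\<in>I. [:- f j, 1:])) (f i) = (\<Prod>j\<in>I - {i}. f i - f j)"
proof -
  have "(\<Prod>j\<in>I. [:- f j, 1:]) = [:- f i, 1:] * (\<Prod>j\<in>I - {i}. [:- f j, 1:])"
    using assms by (rule prod.remove)
  then show ?thesis
    by (simp add: pderiv_mult pderiv_pCons poly_prod del: mult_pCons_left mult_pCons_right)
qed

text \<open>
  The difference of the two sides vanishes on \<open>B\<close> and has degree less than the number of elements of \<open>B\<close>.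
\<close>

lemma lagrange_interpolation:
  fixes p :: "'a::field poly"
  assumes B: "finite B" and deg: "degree p < card B"
  shows "p = (\<Sum>b\<in>B. smult (poly p b / poly (pderiv (\<Prod>b\<in>B. [:- b, 1:])) b)
                       (\<Prod>b'\<in>B - {b}. [:- b', 1:]))" (is "p = ?L")
proof (rule ccontr)
  assume "p \<noteq> ?L"
  then have nz: "p - ?L \<noteq> 0" by simp
  have roots: "poly (p - ?L) b = 0" if "b \<in> B" for b
  proof -
    have zero: "(\<Prod>b''\<in>B - {b'}. b - b'') = 0" if "b' \<in> B - {b}" for b'
      by (rule prod_zero) (use B that \<open>b \<in> B\<close> in auto)
    have nz': "(\<Prod>b''\<in>B - {b}. b - b'') \<noteq> 0"
      using B by (auto simp: prod_zero_iff)
    have "poly ?L b = (\<Sum>b'\<in>B. poly p b' / poly (pderiv (\<Prod>b\<in>B. [:- b, 1:])) b'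
             * (\<Prod>b''\<in>B - {b'}. b - b''))"
      by (simp add: poly_sum poly_prod)
    also have "\<dots> = poly p b / poly (pderiv (\<Prod>b\<in>B. [:- b, 1:])) b * (\<Prod>b''\<in>B - {b}. b - b'')"
      by (subst sum.remove[OF B that]) (simp add: zero)
    also have "\<dots> = poly p b"
      using pderiv_prod_linear_root[OF B that, of "\<lambda>x. x"] nz' by simp
    finally show ?thesis by simp
  qed
  have degL: "degree ?L \<le> card B - 1"
  proof (rule degree_sum_le[OF B])
    fix b assume "b \<in> B"
    have "degree (smult (poly p b / poly (pderiv (\<Prod>b\<in>B. [:- b, 1:])) b)
        (\<Prod>b'\<in>B - {b}. [:- b', 1:])) \<le> degree (\<Prod>b'\<in>B - {b}. [:- b', 1:])"
      by (rule degree_smult_le)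
    also have "\<dots> = card B - 1" using B \<open>b \<in> B\<close> by (subst degree_prod_linear) auto
    finally show "degree (smult (poly p b / poly (pderiv (\<Prod>b\<in>B. [:- b, 1:])) b)
        (\<Prod>b'\<in>B - {b}. [:- b', 1:])) \<le> card B - 1" .
  qed
  have "degree (p - ?L) \<le> card B - 1"
    by (rule degree_diff_le) (use deg degL in auto)
  then have "card {x. poly (p - ?L) x = 0} \<le> card B - 1"
    using card_poly_roots_bound[OF nz] by linarith
  moreover have "card B \<le> card {x. poly (p - ?L) x = 0}"
    by (rule card_mono) (use roots poly_roots_finite[OF nz] in auto)
  ultimately show False using deg by linarith
qed

text \<open>
  Splitting of the solutions of \<open>q(S) y = 0\<close> along a factorization \<open>q = s g\<close>, where \<open>s\<close> has simple roots
  that are no roots of \<open>g\<close>. The coefficient of the mode \<open>b\<^sup>n\<close> is the value of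
  \<open>(q / (X - b))(S) y\<close> at \<open>0\<close> divided by \<open>q'(b)\<close>; the remainder solves \<open>g(S) w = 0\<close> because
  \<open>\<Sum>\<^sub>b (s / (X - b)) / s'(b) = 1\<close>. The roots of \<open>g\<close> may be multiple, which is what the fast part of the
  solutions at low frequencies requires.
\<close>

lemma shift_act_split:
  fixes B :: "complex set"
  assumes B: "finite B" "B \<noteq> {}"
    and q: "q = (\<Prod>b\<in>B. [:- b, 1:]) * g"
    and g: "\<And>b. b \<in> B \<Longrightarrow> poly g b \<noteq> 0"
    and y: "\<And>n. shift_act q y n = 0"
  shows "shift_act g (\<lambda>n. y n - (\<Sum>b\<in>B. b ^ n *
           (shift_act ((\<Prod>b'\<in>B - {b}. [:- b', 1:]) * g) y 0 / poly (pderiv q) b))) n = 0"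
proof -
  define s where "s = (\<Prod>b\<in>B. [:- b, 1:])"
  define h where "h b = (\<Prod>b'\<in>B - {b}. [:- b', 1:])" for b :: complex
  have qh: "q = [:- b, 1:] * (h b * g)" if "b \<in> B" for b
    unfolding q h_def using prod.remove[OF B(1) that, of "\<lambda>b. [:- b, 1:]"] by (simp add: mult_ac)
  have mode: "shift_act (h b * g) y n = b ^ n * shift_act (h b * g) y 0" if "b \<in> B" for b n
  proof (rule shift_act_linear_factor_0)
    fix n show "shift_act [:- b, 1:] (shift_act (h b * g) y) n = 0"
      using y[of n] by (simp add: qh[OF that] shift_act_mult del: mult_pCons_left mult_pCons_right)
  qed
  have qd: "poly (pderiv q) b = poly (pderiv s) b * poly g b" if "b \<in> B" for b
  proof -
    have "poly s b = 0" using B that by (auto simp: s_def poly_prod prod_zero_iff)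
    then show ?thesis by (simp add: q s_def[symmetric] pderiv_mult)
  qed
  have "shift_act g (\<lambda>n. y n - (\<Sum>b\<in>B. b ^ n * (shift_act (h b * g) y 0 / poly (pderiv q) b))) n
      = shift_act g y n - (\<Sum>b\<in>B. b ^ n * poly g b * (shift_act (h b * g) y 0 / poly (pderiv q) b))"
    by (simp only: shift_act_diff_right shift_act_sum_right shift_act_mult_right shift_act_power)
  also have "(\<Sum>b\<in>B. b ^ n * poly g b * (shift_act (h b * g) y 0 / poly (pderiv q) b))
     = (\<Sum>b\<in>B. shift_act (smult (poly 1 b / poly (pderiv s) b) (h b)) (shift_act g y) n)"
  proof (rule sum.cong[OF refl])
    fix b assume "b \<in> B"
    then show "b ^ n * poly g b * (shift_act (h b * g) y 0 / poly (pderiv q) b)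
       = shift_act (smult (poly 1 b / poly (pderiv s) b) (h b)) (shift_act g y) n"
      using g[of b] mode[of b n] by (simp add: qd shift_act_smult shift_act_mult)
  qed
  also have "\<dots> = shift_act (\<Sum>b\<in>B. smult (poly 1 b / poly (pderiv s) b) (h b)) (shift_act g y) n"
    by (simp add: shift_act_sum)
  also have "(\<Sum>b\<in>B. smult (poly 1 b / poly (pderiv s) b) (h b)) = 1"
    using lagrange_interpolation[OF B(1), of 1] B by (simp add: s_def h_def card_gt_0_iff)
  finally show ?thesis by (simp add: h_def)
qed

section \<open>Linear recurrences and exponential generating functions\<close>

lemma linear_recurrence_growth:
  assumes deg: "degree q = m" and lead: "lead_coeff q = 1"
    and y: "\<And>n. shift_act q y n = 0"
    and K: "\<And>i. i < m \<Longrightarrow> norm (coeff q i) \<le> K" "0 \<le> K"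
    and a: "\<And>j. j < m \<Longrightarrow> norm (y j) \<le> a" "0 \<le> a"
  shows "norm (y n) \<le> a * (1 + real m * K) ^ n"
proof (induction n rule: less_induct)
  case (less n)
  let ?B = "1 + real m * K"
  have B: "1 \<le> ?B" using K by simp
  show ?case
  proof (cases "n < m")
    case True
    have "norm (y n) \<le> a * 1" using a(1)[OF True] by simp
    also have "\<dots> \<le> a * ?B ^ n" by (rule mult_left_mono) (use B a in \<open>auto intro: one_le_power\<close>)
    finally show ?thesis .
  next
    case False
    show ?thesis
    proof (cases "m = 0")
      case True
      then have "q = 1" using deg lead by (metis degree_eq_zeroE lead_coeff_pCons(2) pCons_one)
      then have "y n = 0" using y[of n] by simp
      then show ?thesis using a B by simp
    next
      case m: False
      have n: "n = (n - m) + m" using False by simp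
      have "{..m} = insert m {..<m}" by auto
      then have "shift_act q y (n - m) = y n + (\<Sum>i<m. coeff q i * y (n - m + i))"
        using deg lead n by (simp add: shift_act_def)
      then have "y n = - (\<Sum>i<m. coeff q i * y (n - m + i))"
        using y[of "n - m"] by (simp add: eq_neg_iff_add_eq_0)
      then have "norm (y n) \<le> (\<Sum>i<m. norm (coeff q i * y (n - m + i)))"
        by (metis norm_minus_cancel norm_sum)
      also have "\<dots> \<le> (\<Sum>i<m. K * (a * ?B ^ (n - 1)))"
      proof (rule sum_mono)
        fix i assume "i \<in> {..<m}"
        then have i: "i < m" by simp
        have "norm (y (n - m + i)) \<le> a * ?B ^ (n - m + i)"
          using i False by (intro less) auto
        also have "\<dots> \<le> a * ?B ^ (n - 1)"
          by (intro mult_left_mono power_increasing) (use i False a B in auto)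
        finally show "norm (coeff q i * y (n - m + i)) \<le> K * (a * ?B ^ (n - 1))"
          unfolding norm_mult using K i by (intro mult_mono) auto
      qed
      also have "\<dots> = (real m * K) * (a * ?B ^ (n - 1))" by simp
      also have "\<dots> \<le> ?B * (a * ?B ^ (n - 1))"
        by (rule mult_right_mono) (use a B in auto)
      also have "\<dots> = a * ?B ^ n" using m False by (cases n) auto
      finally show ?thesis .
    qed
  qed
qed

text \<open>
  If \<open>y\<^sub>n\<close> is the \<open>n\<close>-th derivative at \<open>0\<close> of an entire function of exponential type, this is the function.
\<close>

definition egf :: "(nat \<Rightarrow> complex) \<Rightarrow> real \<Rightarrow> complex" where
  "egf y t = (\<Sum>n. y n * of_real t ^ n / fact n)"

definition exp_growth :: "(nat \<Rightarrow> complex) \<Rightarrow> bool" where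
  "exp_growth y \<longleftrightarrow> (\<exists>a b. \<forall>n. norm (y n) \<le> a * b ^ n)"

lemma exp_growthI: "(\<And>n. norm (y n) \<le> a * b ^ n) \<Longrightarrow> exp_growth y"
  unfolding exp_growth_def by blast

lemma exp_growth_nonneg:
  assumes "exp_growth y"
  obtains a b where "0 \<le> a" "0 \<le> b" "\<And>n. norm (y n) \<le> a * b ^ n"
proof -
  obtain a b where ab: "\<And>n. norm (y n) \<le> a * b ^ n" using assms unfolding exp_growth_def by blast
  have "norm (y n) \<le> \<bar>a\<bar> * \<bar>b\<bar> ^ n" for n
    using ab[of n] by (metis abs_ge_self abs_mult order.trans power_abs)
  then show ?thesis using that[of "\<bar>a\<bar>" "\<bar>b\<bar>"] by simp
qed

lemma egf_summable_norm:
  assumes "\<And>n. norm (y n) \<le> a * b ^ n"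
  shows "summable (\<lambda>n. norm (y n * of_real t ^ n / fact n))"
    and "norm (egf y t) \<le> a * exp (b * \<bar>t\<bar>)"
proof -
  have le: "norm (y n * of_real t ^ n / fact n) \<le> a * ((b * \<bar>t\<bar>) ^ n /\<^sub>R fact n)" for n
  proof -
    have "norm (y n * of_real t ^ n / fact n) = norm (y n) * \<bar>t\<bar> ^ n / fact n"
      by (simp add: norm_mult norm_divide norm_power)
    also have "\<dots> \<le> (a * b ^ n) * \<bar>t\<bar> ^ n / fact n"
      by (intro divide_right_mono mult_right_mono assms) auto
    finally show ?thesis by (simp add: power_mult_distrib divide_inverse mult_ac)
  qed
  have sums: "(\<lambda>n. a * ((b * \<bar>t\<bar>) ^ n /\<^sub>R fact n)) sums (a * exp (b * \<bar>t\<bar>))"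
    by (intro sums_mult exp_converges)
  show s: "summable (\<lambda>n. norm (y n * of_real t ^ n / fact n))"
    by (rule summable_comparison_test[OF _ sums_summable[OF sums]]) (use le in auto)
  have "norm (egf y t) \<le> (\<Sum>n. norm (y n * of_real t ^ n / fact n))"
    unfolding egf_def by (rule summable_norm[OF s])
  also have "\<dots> \<le> (\<Sum>n. a * ((b * \<bar>t\<bar>) ^ n /\<^sub>R fact n))"
    by (rule suminf_le[OF le s sums_summable[OF sums]])
  also have "\<dots> = a * exp (b * \<bar>t\<bar>)" using sums by (simp add: sums_iff)
  finally show "norm (egf y t) \<le> a * exp (b * \<bar>t\<bar>)" .
qed

lemma egf_summable: "exp_growth y \<Longrightarrow> summable (\<lambda>n. y n * of_real t ^ n / fact n)"
  by (metis egf_summable_norm(1) exp_growth_def summable_norm_cancel)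

lemma exp_growth_Suc: "exp_growth y \<Longrightarrow> exp_growth (\<lambda>n. y (Suc n))"
proof -
  assume "exp_growth y"
  then obtain a b where "\<And>n. norm (y n) \<le> a * b ^ n" unfolding exp_growth_def by blast
  then have "norm (y (Suc n)) \<le> (a * b) * b ^ n" for n by (metis mult.assoc power_Suc)
  then show ?thesis by (rule exp_growthI)
qed

lemma exp_growth_shift: "exp_growth y \<Longrightarrow> exp_growth (\<lambda>n. y (n + k))"
proof (induction k)
  case (Suc k)
  from exp_growth_Suc[OF Suc.IH[OF Suc.prems]] show ?case by simp
qed simp

lemma exp_growth_add: "exp_growth y \<Longrightarrow> exp_growth z \<Longrightarrow> exp_growth (\<lambda>n. y n + z n)"
proof -
  assume "exp_growth y" "exp_growth z"
  then obtain a b c d where *: "0 \<le> a" "0 \<le> b" "\<And>n. norm (y n) \<le> a * b ^ n"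
    "0 \<le> c" "0 \<le> d" "\<And>n. norm (z n) \<le> c * d ^ n" using exp_growth_nonneg by metis
  have "norm (y n + z n) \<le> (a + c) * (b + d) ^ n" for n
  proof -
    have "norm (y n + z n) \<le> a * b ^ n + c * d ^ n"
      using *(3,6)[of n] norm_triangle_ineq[of "y n" "z n"] by linarith
    also have "\<dots> \<le> a * (b + d) ^ n + c * (b + d) ^ n"
      by (intro add_mono mult_left_mono power_mono) (use * in auto)
    finally show ?thesis by (simp add: algebra_simps)
  qed
  then show ?thesis by (rule exp_growthI)
qed

lemma exp_growth_cmult: "exp_growth y \<Longrightarrow> exp_growth (\<lambda>n. c * y n)"
proof -
  assume "exp_growth y"
  then obtain a b where "\<And>n. norm (y n) \<le> a * b ^ n" unfolding exp_growth_def by blast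
  then have "norm (c * y n) \<le> (norm c * a) * b ^ n" for n
    unfolding norm_mult by (metis mult.assoc mult_left_mono norm_ge_zero)
  then show ?thesis by (rule exp_growthI)
qed

lemma exp_growth_power: "exp_growth (\<lambda>n. l ^ n)"
  by (rule exp_growthI[of _ 1 "norm l"]) (simp add: norm_power)

lemma exp_growth_sum:
  "(\<And>a. a \<in> A \<Longrightarrow> exp_growth (f a)) \<Longrightarrow> exp_growth (\<lambda>n. \<Sum>a\<in>A. f a n)"
proof (induction A rule: infinite_finite_induct)
  case (insert x F)
  then show ?case by (simp add: exp_growth_add)
qed (auto intro: exp_growthI[of _ 0 0])

lemma egf_add: "exp_growth y \<Longrightarrow> exp_growth z \<Longrightarrow> egf (\<lambda>n. y n + z n) t = egf y t + egf z t"
  unfolding egf_def by (subst suminf_add[OF egf_summable egf_summable]) (auto simp: field_simps)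

lemma egf_cmult: "exp_growth y \<Longrightarrow> egf (\<lambda>n. c * y n) t = c * egf y t"
  unfolding egf_def by (subst suminf_mult[OF egf_summable, symmetric]) (auto simp: field_simps)

lemma egf_diff:
  assumes "exp_growth y" "exp_growth z"
  shows "egf (\<lambda>n. y n - z n) t = egf y t - egf z t"
  using egf_add[OF assms(1) exp_growth_cmult[OF assms(2)], of "-1"] egf_cmult[OF assms(2), of "-1"]
  by simp

lemma egf_sum:
  "(\<And>a. a \<in> A \<Longrightarrow> exp_growth (f a)) \<Longrightarrow> egf (\<lambda>n. \<Sum>a\<in>A. f a n) t = (\<Sum>a\<in>A. egf (f a) t)"
proof (induction A rule: infinite_finite_induct)
  case (insert x F)
  then show ?case by (simp add: egf_add exp_growth_sum)
qed (auto simp: egf_def)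

lemma egf_power: "egf (\<lambda>n. l ^ n) t = exp (l * of_real t)"
proof -
  have "(\<lambda>n. l ^ n * of_real t ^ n / fact n) sums exp (l * of_real t)"
    using exp_converges[of "l * of_real t"]
    by (simp add: scaleR_conv_of_real field_simps power_mult_distrib)
  then show ?thesis unfolding egf_def by (simp add: sums_iff)
qed

lemma egf_0 [simp]: "egf y 0 = y 0"
  unfolding egf_def by (subst suminf_finite[of "{0}"]) auto

lemma egf_has_vector_derivative:
  assumes "exp_growth y"
  shows "(egf y has_vector_derivative egf (\<lambda>n. y (Suc n)) t) (at t within A)"
proof -
  define c where "c n = y n / fact n" for n
  have "((\<lambda>z. \<Sum>n. c n * z ^ n) has_field_derivative (\<Sum>n. diffs c n * of_real t ^ n)) (at (of_real t))"
  proof (rule termdiffs_strong_converges_everywhere)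
    fix z :: complex
    have "summable (\<lambda>n. norm (c n * z ^ n))"
    proof -
      obtain a b where ab: "\<And>n. norm (y n) \<le> a * b ^ n" using assms unfolding exp_growth_def by blast
      show ?thesis using egf_summable_norm(1)[OF ab, where t = "norm z"]
        by (simp add: c_def norm_mult norm_divide norm_power)
    qed
    then show "summable (\<lambda>n. c n * z ^ n)" by (rule summable_norm_cancel)
  qed
  moreover have "diffs c = (\<lambda>n. y (Suc n) / fact n)"
    by (auto simp: diffs_def c_def fun_eq_iff simp del: of_nat_Suc)
  ultimately have "((\<lambda>z. \<Sum>n. c n * z ^ n) has_field_derivative egf (\<lambda>n. y (Suc n)) t) (at (of_real t))"
    by (simp add: egf_def field_simps)
  from has_vector_derivative_real_field[OF this, of A]
  show ?thesis by (simp add: egf_def[abs_def] c_def)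
qed

text \<open>
  Exponential decay of the solutions of \<open>(\<Prod>(\<partial>\<^sub>t - \<lambda>\<^sub>i)) f = 0\<close> with a constant that depends on the \<open>\<lambda>\<^sub>i\<close>
  only through a bound for \<open>|\<lambda>\<^sub>i|\<close> and \<open>Re \<lambda>\<^sub>i\<close>: one integrates the first-order equations
  \<open>f' - \<lambda>\<^sub>1 f = h\<close> one after the other. The price of this uniformity is a polynomial factor in \<open>t\<close>, as for
  coinciding \<open>\<lambda>\<^sub>i\<close>.
\<close>

lemma cascade_decay:
  assumes "exp_growth y" "\<And>n. shift_act (\<Prod>l\<leftarrow>ls. [:- l, 1:]) y n = 0"
    and "\<And>l. l \<in> set ls \<Longrightarrow> Re l \<le> - c" "\<And>l. l \<in> set ls \<Longrightarrow> norm l \<le> L" "0 \<le> L"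
    and "\<And>j. j < length ls \<Longrightarrow> norm (y j) \<le> a" "0 \<le> a" "0 \<le> t"
  shows "norm (egf y t) \<le> a * (1 + L) ^ length ls * (2 + t) ^ length ls * exp (- c * t)"
  using assms
proof (induction ls arbitrary: y a t)
  case Nil
  then have "y = (\<lambda>n. 0)" by (simp add: fun_eq_iff)
  then show ?case using Nil by (simp add: egf_def)
next
  case (Cons l ls)
  define p where "p = (\<Prod>l\<leftarrow>ls. [:- l, 1:])"
  define v where "v n = y (Suc n) - l * y n" for n
  let ?k = "length ls"
  have v_eq: "v = shift_act [:- l, 1:] y" by (auto simp: v_def fun_eq_iff shift_act_pCons)
  have gv: "exp_growth v"
    unfolding v_def using exp_growth_add[OF exp_growth_Suc[OF Cons.prems(1)] exp_growth_cmult[OF Cons.prems(1), of "- l"]]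
    by simp
  have pv: "shift_act p v n = 0" for n
    using Cons.prems(2)[of n] unfolding v_eq p_def
    by (simp add: shift_act_mult[symmetric] mult.commute del: mult_pCons_left mult_pCons_right)
  have va: "norm (v j) \<le> a * (1 + L)" if "j < ?k" for j
  proof -
    have "norm (v j) \<le> norm (y (Suc j)) + norm l * norm (y j)"
      unfolding v_def by (metis norm_mult norm_triangle_ineq4)
    also have "\<dots> \<le> a + L * a"
      using Cons.prems(4)[of l] Cons.prems(5) Cons.prems(6)[of j] Cons.prems(6)[of "Suc j"] that
      by (intro add_mono mult_mono) auto
    finally show ?thesis by (simp add: algebra_simps)
  qed
  define A where "A = a * (1 + L) ^ Suc ?k"
  have A: "0 \<le> A" unfolding A_def using Cons.prems by simp
  have vt: "norm (egf v u) \<le> A * (2 + u) ^ ?k * exp (- c * u)" if "0 \<le> u" for u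
  proof -
    have "norm (egf v u) \<le> a * (1 + L) * (1 + L) ^ ?k * (2 + u) ^ ?k * exp (- c * u)"
      by (rule Cons.IH) (use gv pv Cons.prems va that in \<open>auto simp: p_def\<close>)
    then show ?thesis by (simp add: A_def mult_ac)
  qed
  \<comment> \<open>The integrating factor for \<open>f' - l f = v\<close>.\<close>
  define F where "F u = exp (- (l * of_real u)) * egf y u" for u
  have F': "(F has_vector_derivative exp (- (l * of_real u)) * egf v u) (at u within {0..t})" for u
  proof -
    have e: "((\<lambda>u. exp (- (l * of_real u))) has_vector_derivative (- l * exp (- (l * of_real u)))) (at u within {0..t})"
    proof -
      have "((\<lambda>z. exp (- (l * z))) has_field_derivative (- l * exp (- (l * of_real u)))) (at (of_real u))"
        by (auto intro!: derivative_eq_intros)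
      from has_vector_derivative_real_field[OF this] show ?thesis
        by (simp add: has_vector_derivative_at_within)
    qed
    have ev: "egf v u = egf (\<lambda>n. y (Suc n)) u - l * egf y u"
      unfolding v_def using Cons.prems(1)
      by (simp add: egf_diff egf_cmult exp_growth_Suc exp_growth_cmult)
    have "(F has_vector_derivative exp (- (l * of_real u)) * egf (\<lambda>n. y (Suc n)) u
        + (- l * exp (- (l * of_real u))) * egf y u) (at u within {0..t})"
      unfolding F_def
      by (rule has_vector_derivative_mult[OF e egf_has_vector_derivative[OF Cons.prems(1)]])
    then show ?thesis unfolding ev by (simp add: algebra_simps)
  qed
  have Rel: "0 \<le> - c - Re l" using Cons.prems(3)[of l] by simp
  have F'_le: "norm (exp (- (l * of_real u)) * egf v u) \<le> A * (2 + t) ^ ?k * exp ((- c - Re l) * t)"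
    if "u \<in> {0..t}" for u
  proof -
    have u: "0 \<le> u" "u \<le> t" using that by auto
    have "norm (exp (- (l * of_real u)) * egf v u) = exp (- Re l * u) * norm (egf v u)"
      by (simp add: norm_mult)
    also have "\<dots> \<le> exp (- Re l * u) * (A * (2 + u) ^ ?k * exp (- c * u))"
      by (intro mult_left_mono vt u) auto
    also have "\<dots> = A * (2 + u) ^ ?k * exp ((- c - Re l) * u)"
      by (simp add: exp_add[symmetric] algebra_simps)
    also have "\<dots> \<le> A * (2 + t) ^ ?k * exp ((- c - Re l) * t)"
      by (intro mult_mono mult_left_mono power_mono) (use u A Rel in \<open>auto intro!: mult_left_mono\<close>)
    finally show ?thesis .
  qed
  have "norm (F t - F 0) \<le> A * (2 + t) ^ ?k * exp ((- c - Re l) * t) * norm (t - 0)"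
  proof (rule differentiable_bound[where f' = "\<lambda>u h. h *\<^sub>R (exp (- (l * of_real u)) * egf v u)"])
    show "convex {0..t}" by simp
    show "(F has_derivative (\<lambda>h. h *\<^sub>R (exp (- (l * of_real u)) * egf v u))) (at u within {0..t})"
      if "u \<in> {0..t}" for u
      using F' unfolding has_vector_derivative_def .
    show "onorm (\<lambda>h. h *\<^sub>R (exp (- (l * of_real u)) * egf v u)) \<le> A * (2 + t) ^ ?k * exp ((- c - Re l) * t)"
      if "u \<in> {0..t}" for u
    proof (rule onorm_bound)
      show "0 \<le> A * (2 + t) ^ ?k * exp ((- c - Re l) * t)" using A Cons.prems by simp
      fix h :: real
      show "norm (h *\<^sub>R (exp (- (l * of_real u)) * egf v u))
          \<le> A * (2 + t) ^ ?k * exp ((- c - Re l) * t) * norm h"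
        unfolding norm_scaleR using mult_left_mono[OF F'_le[OF that], of "\<bar>h\<bar>"] by (simp add: mult_ac)
    qed
  qed (use Cons.prems in auto)
  then have Ft: "norm (F t) \<le> norm (y 0) + t * (A * (2 + t) ^ ?k * exp ((- c - Re l) * t))"
    using norm_triangle_sub[of "F t" "F 0"] Cons.prems by (simp add: F_def mult_ac)
  have "egf y t = exp (l * of_real t) * F t"
    unfolding F_def by (simp add: mult.assoc[symmetric] exp_add[symmetric])
  then have "norm (egf y t) = exp (Re l * t) * norm (F t)"
    by (simp add: norm_mult)
  also have "\<dots> \<le> exp (Re l * t) * (norm (y 0) + t * (A * (2 + t) ^ ?k * exp ((- c - Re l) * t)))"
    using Ft by (intro mult_left_mono) auto
  also have "\<dots> = exp (Re l * t) * norm (y 0) + t * (A * (2 + t) ^ ?k) * exp (- c * t)"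
    by (simp add: algebra_simps exp_add[symmetric])
  also have "\<dots> \<le> exp (- c * t) * A + t * (A * (2 + t) ^ ?k) * exp (- c * t)"
  proof (intro add_mono mult_mono)
    show "exp (Re l * t) \<le> exp (- c * t)" 
      using mult_right_mono[of "Re l" "- c" t] Rel Cons.prems by simp
    have "norm (y 0) \<le> a * 1" using Cons.prems(6)[of 0] by simp
    also have "\<dots> \<le> A" unfolding A_def using Cons.prems by (intro mult_left_mono one_le_power) auto
    finally show "norm (y 0) \<le> A" .
  qed (use A Cons.prems(8) in auto)
  also have "\<dots> = A * exp (- c * t) * (1 + t * (2 + t) ^ ?k)"
    by (simp add: algebra_simps)
  also have "\<dots> \<le> A * exp (- c * t) * (2 + t) ^ Suc ?k"
  proof (rule mult_left_mono)
    have "(1::real) \<le> (2 + t) ^ ?k" using Cons.prems by (intro one_le_power) auto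
    then show "1 + t * (2 + t) ^ ?k \<le> (2 + t) ^ Suc ?k" by (simp add: algebra_simps)
  qed (use A in auto)
  finally show ?case by (simp add: A_def mult_ac)
qed

section \<open>Perturbation of simple roots\<close>

lemma complex_poly_factor_list:
  fixes p :: "complex poly"
  assumes "p \<noteq> 0"
  obtains zs where "length zs = degree p" "p = smult (lead_coeff p) (\<Prod>z\<leftarrow>zs. [:- z, 1:])"
proof -
  obtain A where A: "size A = degree p" "p = smult (lead_coeff p) (\<Prod>x\<in>#A. [:-x, 1:])"
    using alg_closed_imp_factorization[OF assms] by blast
  obtain zs where zs: "mset zs = A" using ex_mset by blast
  have "(\<Prod>x\<in>#A. [:-x, 1:]) = (\<Prod>z\<leftarrow>zs. [:- z, 1:])"
    unfolding zs[symmetric] by (metis mset_map prod_mset_prod_list)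
  then show ?thesis using that[of zs] A zs by auto
qed

lemma pderiv_prod_list_linear:
  fixes a :: complex
  assumes "a \<notin> set zs"
  shows "poly (pderiv (\<Prod>z\<leftarrow>zs. [:- z, 1:])) a
       = poly (\<Prod>z\<leftarrow>zs. [:- z, 1:]) a * (\<Sum>z\<leftarrow>zs. 1 / (a - z))"
  using assms
proof (induction zs)
  case (Cons z zs)
  then have "a - z \<noteq> 0" by auto
  with Cons show ?case
    by (simp add: pderiv_mult pderiv_pCons field_simps del: mult_pCons_left mult_pCons_right)
qed simp

text \<open>
  Newton's step controls the distance to the nearest root, because
  \<open>p'(a) / p(a)\<close> is the sum of \<open>1 / (a - z)\<close> over the roots \<open>z\<close> of \<open>p\<close>.
\<close>

lemma root_near_newton:
  fixes p :: "complex poly"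
  assumes d: "poly (pderiv p) a \<noteq> 0"
  obtains z where "poly p z = 0"
    "norm (z - a) \<le> real (degree p) * norm (poly p a) / norm (poly (pderiv p) a)"
proof (cases "poly p a = 0")
  case True
  then show ?thesis using that[of a] by simp
next
  case False
  have p0: "p \<noteq> 0" using d by auto
  obtain zs where len: "length zs = degree p" and fac: "p = smult (lead_coeff p) (\<Prod>z\<leftarrow>zs. [:- z, 1:])"
    using complex_poly_factor_list[OF p0] .
  define r where "r = real (degree p) * norm (poly p a) / norm (poly (pderiv p) a)"
  have root: "poly p z = 0" if "z \<in> set zs" for z
  proof -
    have "poly (\<Prod>z\<leftarrow>zs. [:- z, 1:]) z = 0"
      using that by (induction zs) (auto simp del: mult_pCons_left mult_pCons_right)
    then show ?thesis by (subst fac) simp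
  qed
  have a: "a \<notin> set zs" using root False by blast
  have "poly (pderiv p) a = poly p a * (\<Sum>z\<leftarrow>zs. 1 / (a - z))"
    by (subst (1 2) fac) (simp add: pderiv_smult pderiv_prod_list_linear[OF a])
  then have eq: "norm (poly (pderiv p) a) = norm (poly p a) * norm (\<Sum>z\<leftarrow>zs. 1 / (a - z))"
    by (simp add: norm_mult)
  have deg: "degree p \<noteq> 0" using d by (metis degree_eq_zeroE pderiv_singleton poly_0 pderiv_pCons pCons_0_0 add_0_right)
  then have r: "0 < r" unfolding r_def using False d by simp
  have "\<exists>z\<in>set zs. norm (z - a) \<le> r"
  proof (rule ccontr)
    assume "\<not> ?thesis"
    then have far: "r < norm (z - a)" if "z \<in> set zs" for z using that by force
    have "norm (\<Sum>z\<leftarrow>zs. 1 / (a - z)) \<le> (\<Sum>z\<leftarrow>zs. norm (1 / (a - z)))"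
      by (induction zs) (auto intro: order_trans[OF norm_triangle_ineq])
    also have "\<dots> < (\<Sum>z\<leftarrow>zs. 1 / r)"
    proof (rule sum_list_strict_mono)
      show "zs \<noteq> []" using deg len by auto
      fix z assume "z \<in> set zs"
      then show "norm (1 / (a - z)) < 1 / r"
        using less_imp_inverse_less[OF far[of z] r]
        by (simp add: norm_divide norm_minus_commute inverse_eq_divide)
    qed
    also have "\<dots> = real (degree p) / r" using len by (simp add: sum_list_triv)
    also have "\<dots> = norm (poly (pderiv p) a) / norm (poly p a)"
      using deg by (simp add: r_def)
    finally show False using eq False by (simp add: field_simps)
  qed
  then show ?thesis using that root unfolding r_def by blast
qed

lemma norm_poly_le:
  fixes p :: "complex poly"
  assumes "degree p \<le> D" "\<And>i. norm (coeff p i) \<le> K" "norm z \<le> Z" "1 \<le> Z"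
  shows "norm (poly p z) \<le> real (Suc D) * K * Z ^ D"
proof -
  have K: "0 \<le> K" using assms(2)[of 0] norm_ge_zero order_trans by blast
  have "norm (poly p z) \<le> (\<Sum>i\<le>degree p. norm (coeff p i * z ^ i))"
    unfolding poly_altdef by (rule norm_sum)
  also have "\<dots> \<le> (\<Sum>i\<le>degree p. K * Z ^ D)"
  proof (rule sum_mono)
    fix i assume i: "i \<in> {..degree p}"
    have "norm z ^ i \<le> Z ^ i" using assms by (intro power_mono) auto
    also have "\<dots> \<le> Z ^ D" using i assms by (intro power_increasing) auto
    finally show "norm (coeff p i * z ^ i) \<le> K * Z ^ D"
      unfolding norm_mult norm_power using assms K by (intro mult_mono) auto
  qed
  also have "\<dots> = real (Suc (degree p)) * (K * Z ^ D)" by simp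
  also have "\<dots> \<le> real (Suc D) * (K * Z ^ D)"
    by (rule mult_right_mono) (use assms K in auto)
  finally show ?thesis by (simp add: mult_ac)
qed

lemma norm_coeff_pderiv_le:
  fixes p :: "complex poly"
  assumes "degree p \<le> D" "\<And>i. norm (coeff p i) \<le> K"
  shows "degree (pderiv p) \<le> D" "norm (coeff (pderiv p) i) \<le> real D * K"
proof -
  have K: "0 \<le> K" using assms(2)[of 0] norm_ge_zero order_trans by blast
  show "degree (pderiv p) \<le> D" using assms(1) by (simp add: degree_pderiv)
  show "norm (coeff (pderiv p) i) \<le> real D * K"
  proof (cases "Suc i \<le> D")
    case True
    have "norm (coeff (pderiv p) i) = real (Suc i) * norm (coeff p (Suc i))"
      unfolding coeff_pderiv norm_mult norm_of_nat ..
    also have "\<dots> \<le> real D * K" by (rule mult_mono) (use True assms K in auto)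
    finally show ?thesis .
  next
    case False
    then have "coeff p (Suc i) = 0" using assms(1) by (intro coeff_eq_0) auto
    then show ?thesis using K by (simp add: coeff_pderiv)
  qed
qed

lemma norm_diff_diff_le:
  fixes a b c :: "'a::real_normed_vector"
  shows "norm (a - b - c) \<le> norm a + norm b + norm c"
  using norm_triangle_ineq4[of "a - b" c] norm_triangle_ineq4[of a b] by linarith

lemma norm_add_add_le:
  fixes a b c :: "'a::real_normed_vector"
  shows "norm (a + b + c) \<le> norm a + norm b + norm c"
  using norm_triangle_ineq[of "a + b" c] norm_triangle_ineq[of a b] by linarith

lemma pderiv_sum: "pderiv (sum f A) = (\<Sum>a\<in>A. pderiv (f a))"
  by (induction A rule: infinite_finite_induct) (simp_all add: pderiv_add)

definition taylor_const :: "nat \<Rightarrow> real \<Rightarrow> real \<Rightarrow> real" where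
  "taylor_const D K Z = real (Suc D) * (real D * (real D * K)) * Z ^ D"

lemma poly_taylor_bounds:
  fixes p :: "complex poly"
  assumes "degree p \<le> D" "\<And>i. norm (coeff p i) \<le> K" "1 \<le> Z" "norm z \<le> Z" "norm b \<le> Z"
  shows "norm (poly p z - poly p b - poly (pderiv p) b * (z - b)) \<le> taylor_const D K Z * (norm (z - b))\<^sup>2"
    and "norm (poly (pderiv p) z - poly (pderiv p) b) \<le> taylor_const D K Z * norm (z - b)"
proof -
  define f where "f i = poly ((pderiv ^^ i) p)" for i
  have bd2: "norm (f 2 x) \<le> taylor_const D K Z" if "x \<in> cball 0 Z" for x
  proof -
    have 1: "degree (pderiv p) \<le> D" "\<And>i. norm (coeff (pderiv p) i) \<le> real D * K"
      using norm_coeff_pderiv_le[OF assms(1,2)] by auto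
    have 2: "degree (pderiv (pderiv p)) \<le> D" "\<And>i. norm (coeff (pderiv (pderiv p)) i) \<le> real D * (real D * K)"
      using norm_coeff_pderiv_le[OF 1] by auto
    show ?thesis using norm_poly_le[OF 2 _ assms(3), of x] that
      by (simp add: f_def numeral_2_eq_2 taylor_const_def)
  qed
  have der: "(f i has_field_derivative f (Suc i) x) (at x within S)" for i x S
    unfolding f_def using poly_DERIV[of "(pderiv ^^ i) p" x] by (simp add: has_field_derivative_at_within)
  have "norm (f 0 z - (\<Sum>i\<le>1. f i b * (z - b) ^ i / fact i)) \<le> taylor_const D K Z * norm (z - b) ^ Suc 1 / fact 1"
    by (rule complex_Taylor[of "cball 0 Z"]) (use der bd2 assms in \<open>auto simp: numeral_2_eq_2\<close>)
  then show "norm (poly p z - poly p b - poly (pderiv p) b * (z - b)) \<le> taylor_const D K Z * (norm (z - b))\<^sup>2"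
    by (simp add: f_def power2_eq_square algebra_simps)
  have "norm (f 1 z - f 1 b) \<le> taylor_const D K Z * norm (z - b)"
    by (rule field_differentiable_bound[of "cball 0 Z" _ "f 2"])
       (use der[of 1] bd2 assms in \<open>auto simp: numeral_2_eq_2\<close>)
  then show "norm (poly (pderiv p) z - poly (pderiv p) b) \<le> taylor_const D K Z * norm (z - b)"
    by (simp add: f_def)
qed

text \<open>
  First-order perturbation theory of simple roots for the family \<open>\<Sum>\<^sub>i \<tau>\<^sup>i A\<^sub>i(w)\<close>, uniformly in the
  parameter \<open>w\<close>. With \<open>\<tau> = i |\<xi>|\<close> it describes the slow modes at low frequencies, with
  \<open>\<tau> = 1 / (i |\<xi>|)\<close> all modes at high frequencies.
\<close>

lemma root_perturbation:
  fixes A :: "nat \<Rightarrow> 'w \<Rightarrow> complex poly" and B :: "'w \<Rightarrow> complex set" and N :: nat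
  defines "F \<equiv> \<lambda>w \<tau>. \<Sum>i\<le>N. smult (\<tau> ^ i) (A i w)"
  assumes N: "1 \<le> N" and deg: "\<And>i w. i \<le> N \<Longrightarrow> w \<in> S \<Longrightarrow> degree (A i w) \<le> D"
    and K: "\<And>i w j. i \<le> N \<Longrightarrow> w \<in> S \<Longrightarrow> norm (coeff (A i w) j) \<le> K"
    and Z: "1 \<le> Z" and \<delta>: "0 < \<delta>"
    and root: "\<And>w b. w \<in> S \<Longrightarrow> b \<in> B w \<Longrightarrow> poly (A 0 w) b = 0"
    and bd: "\<And>w b. w \<in> S \<Longrightarrow> b \<in> B w \<Longrightarrow> norm b \<le> Z"
    and sep: "\<And>w b. w \<in> S \<Longrightarrow> b \<in> B w \<Longrightarrow> \<delta> \<le> norm (poly (pderiv (A 0 w)) b)"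
  obtains \<epsilon> C where "0 < \<epsilon>" "\<epsilon> \<le> 1" "0 < C"
    "\<And>w \<tau>. w \<in> S \<Longrightarrow> norm \<tau> \<le> \<epsilon> \<Longrightarrow> \<exists>\<zeta>. inj_on \<zeta> (B w) \<and>
       (\<forall>b\<in>B w. poly (F w \<tau>) (\<zeta> b) = 0 \<and> norm (\<zeta> b - b) \<le> C * norm \<tau> \<and> norm (\<zeta> b - b) \<le> 1 \<and>
          norm (\<zeta> b - b + \<tau> * (poly (A 1 w) b / poly (pderiv (A 0 w)) b)) \<le> C * (norm \<tau>)\<^sup>2 \<and>
          norm (poly (pderiv (F w \<tau>)) (\<zeta> b) - poly (pderiv (A 0 w)) b) \<le> C * norm \<tau>)"
proof (cases "S = {}")
  case True
  then show ?thesis using that[of 1 1] by auto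
next
  case False
  then have K0: "0 \<le> K" using K[of 0] norm_ge_zero order_trans by blast
  define K1 where "K1 = real (Suc N) * (K + 1)"
  define M2 where "M2 = taylor_const D K1 (Z + 1) + 1"
  define P where "P = real (Suc D) * (K + real D * K) * Z ^ D + 1"
  define NP where "NP = real N * P"
  have P: "0 < P" unfolding P_def using K0 Z by (intro add_nonneg_pos) auto
  have NP: "0 < NP" unfolding NP_def using P N by simp
  have K1: "0 \<le> K1" unfolding K1_def using K0 by simp
  have M2: "0 < M2" unfolding M2_def taylor_const_def using K1 Z by (intro add_nonneg_pos) auto
  define C1 where "C1 = real (Suc D) * NP / (\<delta> / 2)"
  have C1: "0 < C1" unfolding C1_def using NP \<delta> by simp
  define C where "C = C1 + (M2 * C1\<^sup>2 + NP + NP * C1) / \<delta> + M2 * C1 + NP"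
  \<comment> \<open>The entries bound \<open>|\<tau>|\<close>, keep the derivative at \<open>b\<close> above \<open>\<delta> / 2\<close>,
    keep the displacement below \<open>1\<close>, and below half the separation of the roots.\<close>
  define \<epsilon> where "\<epsilon> = Min {1, \<delta> / (2 * NP), 1 / C1, \<delta> / (4 * M2 * C1)}"
  have \<epsilon>: "0 < \<epsilon>" "\<epsilon> \<le> 1" "\<epsilon> \<le> \<delta> / (2 * NP)" "\<epsilon> \<le> 1 / C1" "\<epsilon> \<le> \<delta> / (4 * M2 * C1)"
    unfolding \<epsilon>_def using \<delta> NP C1 M2 by auto
  have C0: "0 \<le> (M2 * C1\<^sup>2 + NP + NP * C1) / \<delta>" using M2 NP C1 \<delta> by simp
  have M2C1: "0 < M2 * C1" using M2 C1 by simp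
  have C: "0 < C" "C1 \<le> C" "(M2 * C1\<^sup>2 + NP + NP * C1) / \<delta> \<le> C" "M2 * C1 + NP \<le> C"
    unfolding C_def using C0 M2C1 C1 NP by linarith+
  have PA: "norm (poly (A i w) z) \<le> P" "norm (poly (pderiv (A i w)) z) \<le> P"
    if "i \<le> N" "w \<in> S" "norm z \<le> Z" for i w z
  proof -
    have "norm (poly (A i w) z) \<le> real (Suc D) * K * Z ^ D"
      by (rule norm_poly_le) (use that deg K Z in auto)
    also have "\<dots> \<le> real (Suc D) * (K + real D * K) * Z ^ D"
      using K0 Z by (intro mult_right_mono mult_left_mono) auto
    finally show "norm (poly (A i w) z) \<le> P" by (simp add: P_def)
    have "norm (poly (pderiv (A i w)) z) \<le> real (Suc D) * (real D * K) * Z ^ D"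
      by (rule norm_poly_le) (use that norm_coeff_pderiv_le[OF deg K] Z in auto)
    also have "\<dots> \<le> real (Suc D) * (K + real D * K) * Z ^ D"
      using K0 Z by (intro mult_right_mono mult_left_mono) auto
    finally show "norm (poly (pderiv (A i w)) z) \<le> P" by (simp add: P_def)
  qed
  have split1: "(\<Sum>i\<le>N. f i) = f 0 + (\<Sum>i=1..N. f i)" for f :: "nat \<Rightarrow> complex"
    by (simp add: atLeast1_atMost_eq_remove0 sum.remove[of "{..N}" 0])
  have tail: "norm (\<Sum>i=k..N. \<tau> ^ i * f i) \<le> NP * norm \<tau> ^ k"
    if f: "\<And>i. i \<le> N \<Longrightarrow> norm (f i) \<le> P" and \<tau>: "norm \<tau> \<le> 1" and k: "1 \<le> k" for \<tau> k and f :: "nat \<Rightarrow> complex"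
  proof -
    have "norm (\<Sum>i=k..N. \<tau> ^ i * f i) \<le> (\<Sum>i=k..N. norm \<tau> ^ k * P)"
    proof (rule sum_norm_le)
      fix i assume i: "i \<in> {k..N}"
      show "norm (\<tau> ^ i * f i) \<le> norm \<tau> ^ k * P"
        unfolding norm_mult norm_power
        by (intro mult_mono power_decreasing f) (use i \<tau> in auto)
    qed
    also have "\<dots> = real (Suc N - k) * (P * norm \<tau> ^ k)" by simp
    also have "\<dots> \<le> real N * (P * norm \<tau> ^ k)"
      by (rule mult_right_mono) (use k P in auto)
    finally show ?thesis by (simp add: NP_def mult_ac)
  qed
  have main: "\<exists>\<zeta>. inj_on \<zeta> (B w) \<and>
       (\<forall>b\<in>B w. poly (F w \<tau>) (\<zeta> b) = 0 \<and> norm (\<zeta> b - b) \<le> C * norm \<tau> \<and> norm (\<zeta> b - b) \<le> 1 \<and>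
          norm (\<zeta> b - b + \<tau> * (poly (A 1 w) b / poly (pderiv (A 0 w)) b)) \<le> C * (norm \<tau>)\<^sup>2 \<and>
          norm (poly (pderiv (F w \<tau>)) (\<zeta> b) - poly (pderiv (A 0 w)) b) \<le> C * norm \<tau>)"
    if w: "w \<in> S" and \<tau>: "norm \<tau> \<le> \<epsilon>" for w \<tau>
  proof -
    have \<tau>1: "norm \<tau> \<le> 1" using \<tau> \<epsilon> by linarith
    have degF: "degree (F w \<tau>) \<le> D" unfolding F_def
      by (intro degree_sum_le order_trans[OF degree_smult_le] deg) (use w in auto)
    have KF: "norm (coeff (F w \<tau>) j) \<le> K1" for j
    proof -
      have "norm (coeff (F w \<tau>) j) \<le> (\<Sum>i\<le>N. norm (\<tau> ^ i * coeff (A i w) j))"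
        unfolding F_def coeff_sum coeff_smult by (rule norm_sum)
      also have "\<dots> \<le> (\<Sum>i\<le>N. 1 * K)"
        unfolding norm_mult norm_power
        by (intro sum_mono mult_mono power_le_one K) (use \<tau>1 w in auto)
      also have "\<dots> \<le> K1" unfolding K1_def by (simp add: algebra_simps)
      finally show ?thesis .
    qed
    have KA: "norm (coeff (A 0 w) j) \<le> K1" for j
    proof -
      have "norm (coeff (A 0 w) j) \<le> K" using K[of 0] w by simp
      also have "K \<le> K1" unfolding K1_def using K0 by (simp add: algebra_simps)
      finally show ?thesis .
    qed
    have polyF: "poly (F w \<tau>) z = poly (A 0 w) z + (\<Sum>i=1..N. \<tau> ^ i * poly (A i w) z)"
      "poly (pderiv (F w \<tau>)) z = poly (pderiv (A 0 w)) z + (\<Sum>i=1..N. \<tau> ^ i * poly (pderiv (A i w)) z)" for z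
      unfolding F_def by (simp_all add: poly_sum pderiv_sum pderiv_smult split1 del: sum.atMost_Suc)
    have Fb: "norm (poly (F w \<tau>) b) \<le> NP * norm \<tau>"
        "norm (poly (F w \<tau>) b - \<tau> * poly (A 1 w) b) \<le> NP * (norm \<tau>)\<^sup>2"
        "norm (poly (pderiv (F w \<tau>)) b - poly (pderiv (A 0 w)) b) \<le> NP * norm \<tau>"
        "\<delta> / 2 \<le> norm (poly (pderiv (F w \<tau>)) b)"
      if b: "b \<in> B w" for b
    proof -
      have Zb: "norm b \<le> Z" using bd w b by blast
      show "norm (poly (F w \<tau>) b) \<le> NP * norm \<tau>"
        using tail[of "\<lambda>i. poly (A i w) b" \<tau> 1] PA(1)[OF _ w Zb] \<tau>1 root[OF w b] by (simp add: polyF)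
      have "{1..N} = insert 1 {2..N}" using N by auto
      then have "(\<Sum>i=1..N. \<tau> ^ i * poly (A i w) b) = \<tau> * poly (A 1 w) b + (\<Sum>i=2..N. \<tau> ^ i * poly (A i w) b)"
        by simp
      then show "norm (poly (F w \<tau>) b - \<tau> * poly (A 1 w) b) \<le> NP * (norm \<tau>)\<^sup>2"
        using tail[of "\<lambda>i. poly (A i w) b" \<tau> 2] PA(1)[OF _ w Zb] \<tau>1 root[OF w b] by (simp add: polyF)
      show d: "norm (poly (pderiv (F w \<tau>)) b - poly (pderiv (A 0 w)) b) \<le> NP * norm \<tau>"
        using tail[of "\<lambda>i. poly (pderiv (A i w)) b" \<tau> 1] PA(2)[OF _ w Zb] \<tau>1 by (simp add: polyF)
      have "NP * norm \<tau> \<le> NP * (\<delta> / (2 * NP))" using \<tau> \<epsilon> NP by (intro mult_left_mono) auto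
      also have "\<dots> = \<delta> / 2" using NP by simp
      finally show "\<delta> / 2 \<le> norm (poly (pderiv (F w \<tau>)) b)"
        using d sep[OF w b] norm_triangle_ineq2[of "poly (pderiv (A 0 w)) b" "poly (pderiv (F w \<tau>)) b"]
        by (simp add: norm_minus_commute)
    qed
    have "\<exists>z. poly (F w \<tau>) z = 0 \<and> norm (z - b) \<le> C1 * norm \<tau>" if b: "b \<in> B w" for b
    proof -
      have "poly (pderiv (F w \<tau>)) b \<noteq> 0" using Fb(4)[OF b] \<delta> by auto
      then obtain z where z: "poly (F w \<tau>) z = 0"
        "norm (z - b) \<le> real (degree (F w \<tau>)) * norm (poly (F w \<tau>) b) / norm (poly (pderiv (F w \<tau>)) b)"
        by (rule root_near_newton)
      note z(2)
      also have "real (degree (F w \<tau>)) * norm (poly (F w \<tau>) b) / norm (poly (pderiv (F w \<tau>)) b)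
          \<le> real (Suc D) * (NP * norm \<tau>) / (\<delta> / 2)"
        by (intro frac_le mult_mono Fb b) (use degF \<delta> NP in auto)
      also have "\<dots> = C1 * norm \<tau>" by (simp add: C1_def)
      finally show ?thesis using z(1) by blast
    qed
    then obtain \<zeta> where \<zeta>: "\<And>b. b \<in> B w \<Longrightarrow> poly (F w \<tau>) (\<zeta> b) = 0"
      "\<And>b. b \<in> B w \<Longrightarrow> norm (\<zeta> b - b) \<le> C1 * norm \<tau>" by metis
    have C1\<tau>: "C1 * norm \<tau> \<le> 1" "C1 * norm \<tau> \<le> \<delta> / (4 * M2)"
    proof -
      have "C1 * norm \<tau> \<le> C1 * \<epsilon>" using \<tau> C1 by (intro mult_left_mono) auto
      moreover have "C1 * \<epsilon> \<le> C1 * (1 / C1)" "C1 * \<epsilon> \<le> C1 * (\<delta> / (4 * M2 * C1))"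
        using \<epsilon> C1 by (intro mult_left_mono; simp)+
      moreover have "C1 * (1 / C1) = 1" "C1 * (\<delta> / (4 * M2 * C1)) = \<delta> / (4 * M2)" using C1 by auto
      ultimately show "C1 * norm \<tau> \<le> 1" "C1 * norm \<tau> \<le> \<delta> / (4 * M2)" by linarith+
    qed
    have "inj_on \<zeta> (B w)"
    proof (rule inj_onI, rule ccontr)
      fix b b' assume b: "b \<in> B w" "b' \<in> B w" "\<zeta> b = \<zeta> b'" "b \<noteq> b'"
      have "norm (poly (A 0 w) b' - poly (A 0 w) b - poly (pderiv (A 0 w)) b * (b' - b))
          \<le> taylor_const D K1 (Z + 1) * (norm (b' - b))\<^sup>2"
        by (rule poly_taylor_bounds) (use deg w KA Z bd[OF w b(1)] bd[OF w b(2)] in auto)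
      then have "norm (poly (pderiv (A 0 w)) b) * norm (b' - b) \<le> taylor_const D K1 (Z + 1) * (norm (b' - b))\<^sup>2"
        using root[OF w] b by (simp add: norm_mult)
      then have "norm (poly (pderiv (A 0 w)) b) \<le> taylor_const D K1 (Z + 1) * norm (b' - b)"
        using b by (simp add: power2_eq_square mult.assoc[symmetric])
      also have "\<dots> \<le> M2 * norm (b' - b)" unfolding M2_def by (intro mult_right_mono) auto
      finally have "\<delta> \<le> M2 * norm (b' - b)" using sep[OF w b(1)] by linarith
      moreover have "norm (b' - b) \<le> 2 * (\<delta> / (4 * M2))"
      proof -
        have "b' - b = (\<zeta> b - b) - (\<zeta> b' - b')" using b by simp
        then have "norm (b' - b) \<le> norm (\<zeta> b - b) + norm (\<zeta> b' - b')" by (metis norm_triangle_ineq4)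
        then show ?thesis using \<zeta>(2)[OF b(1)] \<zeta>(2)[OF b(2)] C1\<tau>(2) by linarith
      qed
      then have "M2 * norm (b' - b) \<le> M2 * (2 * (\<delta> / (4 * M2)))" using M2 by (intro mult_left_mono) auto
      moreover have "M2 * (2 * (\<delta> / (4 * M2))) = \<delta> / 2" using M2 by simp
      ultimately show False using \<delta> by linarith
    qed
    moreover have "poly (F w \<tau>) (\<zeta> b) = 0 \<and> norm (\<zeta> b - b) \<le> C * norm \<tau> \<and> norm (\<zeta> b - b) \<le> 1 \<and>
          norm (\<zeta> b - b + \<tau> * (poly (A 1 w) b / poly (pderiv (A 0 w)) b)) \<le> C * (norm \<tau>)\<^sup>2 \<and>
          norm (poly (pderiv (F w \<tau>)) (\<zeta> b) - poly (pderiv (A 0 w)) b) \<le> C * norm \<tau>" if b: "b \<in> B w" for b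
    proof (intro conjI)
      show "poly (F w \<tau>) (\<zeta> b) = 0" by (rule \<zeta>(1)[OF b])
      show "norm (\<zeta> b - b) \<le> C * norm \<tau>"
        using \<zeta>(2)[OF b] C(2) by (meson mult_right_mono norm_ge_zero order_trans)
      show n1: "norm (\<zeta> b - b) \<le> 1" using \<zeta>(2)[OF b] C1\<tau>(1) by linarith
      have Zb: "norm b \<le> Z + 1" using bd[OF w b] by simp
      have Z\<zeta>: "norm (\<zeta> b) \<le> Z + 1"
        using n1 bd[OF w b] norm_triangle_sub[of "\<zeta> b" b] by linarith
      have sq: "(norm (\<zeta> b - b))\<^sup>2 \<le> C1\<^sup>2 * (norm \<tau>)\<^sup>2"
        using power_mono[OF \<zeta>(2)[OF b], of 2] by (simp add: power_mult_distrib)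
      have Z1: "1 \<le> Z + 1" using Z by simp
      note T = poly_taylor_bounds[OF degF KF Z1 Z\<zeta> Zb]
      have tM: "taylor_const D K1 (Z + 1) \<le> M2" by (simp add: M2_def)
      let ?d = "poly (pderiv (A 0 w)) b" and ?dF = "poly (pderiv (F w \<tau>)) b" and ?x = "\<zeta> b - b"
      have e1: "norm (poly (F w \<tau>) b + ?dF * ?x) \<le> M2 * C1\<^sup>2 * (norm \<tau>)\<^sup>2"
      proof -
        have "norm (poly (F w \<tau>) b + ?dF * ?x) \<le> taylor_const D K1 (Z + 1) * (norm ?x)\<^sup>2"
        proof -
          have e: "poly (F w \<tau>) (\<zeta> b) - poly (F w \<tau>) b - ?dF * ?x = - (poly (F w \<tau>) b + ?dF * ?x)"
            unfolding \<zeta>(1)[OF b] by (simp only: diff_0 minus_add_distrib diff_conv_add_uminus add_0_left)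
          show ?thesis using T(1) unfolding e norm_minus_cancel .
        qed
        also have "\<dots> \<le> M2 * (C1\<^sup>2 * (norm \<tau>)\<^sup>2)"
          by (intro mult_mono tM sq) (use M2 in auto)
        finally show ?thesis by (simp add: mult_ac)
      qed
      have e2: "norm ((?dF - ?d) * ?x) \<le> NP * C1 * (norm \<tau>)\<^sup>2"
      proof -
        have "norm ((?dF - ?d) * ?x) \<le> (NP * norm \<tau>) * (C1 * norm \<tau>)"
          unfolding norm_mult by (intro mult_mono Fb(3) \<zeta>(2) b) (use NP in auto)
        then show ?thesis by (simp add: power2_eq_square mult_ac)
      qed
      have d0: "?d \<noteq> 0" using sep[OF w b] \<delta> by auto
      have "norm (?d * (?x + \<tau> * (poly (A 1 w) b / ?d))) \<le> (M2 * C1\<^sup>2 + NP + NP * C1) * (norm \<tau>)\<^sup>2"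
      proof -
        have "?d * (?x + \<tau> * (poly (A 1 w) b / ?d)) = (poly (F w \<tau>) b + ?dF * ?x) - (poly (F w \<tau>) b - \<tau> * poly (A 1 w) b) - (?dF - ?d) * ?x"
          using d0 by (simp add: algebra_simps)
        then have "norm (?d * (?x + \<tau> * (poly (A 1 w) b / ?d))) \<le> norm (poly (F w \<tau>) b + ?dF * ?x)
            + norm (poly (F w \<tau>) b - \<tau> * poly (A 1 w) b) + norm ((?dF - ?d) * ?x)"
          using norm_diff_diff_le by metis
        then show ?thesis using e1 e2 Fb(2)[OF b] unfolding distrib_right by linarith
      qed
      moreover have "\<delta> * norm (?x + \<tau> * (poly (A 1 w) b / ?d)) \<le> norm (?d * (?x + \<tau> * (poly (A 1 w) b / ?d)))"
        unfolding norm_mult[of ?d] by (intro mult_right_mono sep w b) auto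
      ultimately have "norm (?x + \<tau> * (poly (A 1 w) b / ?d)) \<le> (M2 * C1\<^sup>2 + NP + NP * C1) / \<delta> * (norm \<tau>)\<^sup>2"
        using \<delta> by (simp add: field_simps)
      also have "\<dots> \<le> C * (norm \<tau>)\<^sup>2" by (intro mult_right_mono C) auto
      finally show "norm (?x + \<tau> * (poly (A 1 w) b / ?d)) \<le> C * (norm \<tau>)\<^sup>2" .
      have "norm (poly (pderiv (F w \<tau>)) (\<zeta> b) - ?d) \<le> norm (poly (pderiv (F w \<tau>)) (\<zeta> b) - ?dF) + norm (?dF - ?d)"
        using norm_triangle_ineq[of "poly (pderiv (F w \<tau>)) (\<zeta> b) - ?dF" "?dF - ?d"] by simp
      also have "\<dots> \<le> M2 * (C1 * norm \<tau>) + NP * norm \<tau>"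
        using T(2) Fb(3)[OF b] mult_mono[OF tM \<zeta>(2)[OF b]] M2 by auto
      also have "\<dots> = (M2 * C1 + NP) * norm \<tau>" by (simp add: algebra_simps)
      also have "\<dots> \<le> C * norm \<tau>" by (intro mult_right_mono C) auto
      finally show "norm (poly (pderiv (F w \<tau>)) (\<zeta> b) - ?d) \<le> C * norm \<tau>" .
    qed
    ultimately show ?thesis by blast
  qed
  show ?thesis by (rule that[OF \<epsilon>(1,2) C(1) main])
qed

section \<open>Division by linear factors\<close>

text \<open>
  Horner's scheme.
\<close>

lemma coeff_linear_factor:
  fixes h :: "'a::comm_ring_1 poly"
  assumes "q = [:- l, 1:] * h" "degree h < m"
  shows "coeff h j = (\<Sum>i\<in>{Suc j..m}. coeff q i * l ^ (i - Suc j))"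
proof (induction "m - j" arbitrary: j)
  case 0
  then show ?case using assms by (simp add: coeff_eq_0)
next
  case (Suc k)
  then have j: "j < m" by simp
  have "coeff q (Suc j) = coeff h j - l * coeff h (Suc j)"
    unfolding assms(1) by simp
  moreover have "coeff h (Suc j) = (\<Sum>i\<in>{Suc (Suc j)..m}. coeff q i * l ^ (i - Suc (Suc j)))"
    using Suc by (intro Suc(1)) auto
  moreover have "{Suc j..m} = insert (Suc j) {Suc (Suc j)..m}" using j by auto
  moreover have "l * (\<Sum>i\<in>{Suc (Suc j)..m}. coeff q i * l ^ (i - Suc (Suc j)))
     = (\<Sum>i\<in>{Suc (Suc j)..m}. coeff q i * l ^ (i - Suc j))"
    unfolding sum_distrib_left
  proof (rule sum.cong[OF refl])
    fix i assume "i \<in> {Suc (Suc j)..m}"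
    then have "i - Suc j = Suc (i - Suc (Suc j))" by auto
    then show "l * (coeff q i * l ^ (i - Suc (Suc j))) = coeff q i * l ^ (i - Suc j)" by simp
  qed
  ultimately show ?case by simp
qed

text \<open>
  This is the homogeneous bound for high frequencies: the \<open>i\<close>-th coefficient of the characteristic polynomial
  has size \<open>\<rho>\<^bsup>m-i\<^esup>\<close>, and exponents have size \<open>\<rho>\<close>.
\<close>

lemma norm_coeff_linear_factor_scaled:
  fixes h :: "complex poly"
  assumes "q = [:- l, 1:] * h" "degree h < m" "\<And>i. i \<le> m \<Longrightarrow> norm (coeff q i) \<le> K * \<rho> ^ (m - i)"
    and "norm l \<le> L * \<rho>" "1 \<le> L" "0 \<le> \<rho>" "0 \<le> K" "j < m"
  shows "norm (coeff h j) \<le> real m * K * L ^ m * \<rho> ^ (m - Suc j)"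
proof -
  have "norm (coeff h j) \<le> (\<Sum>i\<in>{Suc j..m}. norm (coeff q i * l ^ (i - Suc j)))"
    unfolding coeff_linear_factor[OF assms(1,2)] by (rule norm_sum)
  also have "\<dots> \<le> (\<Sum>i\<in>{Suc j..m}. K * L ^ m * \<rho> ^ (m - Suc j))"
  proof (rule sum_mono)
    fix i assume i: "i \<in> {Suc j..m}"
    have "norm (l ^ (i - Suc j)) \<le> (L * \<rho>) ^ (i - Suc j)"
      unfolding norm_power using assms by (intro power_mono) auto
    also have "\<dots> \<le> L ^ m * \<rho> ^ (i - Suc j)"
      unfolding power_mult_distrib using assms i by (intro mult_right_mono power_increasing) auto
    finally have "norm (coeff q i * l ^ (i - Suc j)) \<le> (K * \<rho> ^ (m - i)) * (L ^ m * \<rho> ^ (i - Suc j))"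
      unfolding norm_mult using assms i by (intro mult_mono) auto
    also have "\<dots> = K * L ^ m * (\<rho> ^ (m - i + (i - Suc j)))" by (simp only: power_add mult_ac)
    also have "m - i + (i - Suc j) = m - Suc j" using i by auto
    finally show "norm (coeff q i * l ^ (i - Suc j)) \<le> K * L ^ m * \<rho> ^ (m - Suc j)" .
  qed
  also have "\<dots> = real (m - j) * (K * L ^ m * \<rho> ^ (m - Suc j))" using assms by (simp add: Suc_diff_le)
  also have "\<dots> \<le> real m * (K * L ^ m * \<rho> ^ (m - Suc j))"
    using assms by (intro mult_right_mono) auto
  finally show ?thesis by (simp add: mult_ac)
qed

lemma norm_coeff_linear_factor_small:
  fixes h :: "complex poly"
  assumes q: "q = [:- l, 1:] * h" and deg: "degree h < m" and K: "\<And>i. norm (coeff q i) \<le> K"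
    and l: "norm l \<le> 1"
  shows "norm (coeff h j) \<le> real m * K" "norm (coeff h j - coeff q (Suc j)) \<le> real m * K * norm l"
proof -
  have 1: "norm (coeff h j) \<le> real m * K" for j
  proof -
    have K0: "0 \<le> K" using K[of 0] norm_ge_zero order_trans by blast
    have "norm (coeff h j) \<le> (\<Sum>i\<in>{Suc j..m}. norm (coeff q i * l ^ (i - Suc j)))"
      unfolding coeff_linear_factor[OF q deg] by (rule norm_sum)
    also have "\<dots> \<le> (\<Sum>i\<in>{Suc j..m}. K * 1)"
      unfolding norm_mult norm_power by (intro sum_mono mult_mono power_le_one K) (use l K0 in auto)
    also have "\<dots> \<le> real m * K" using K0 by (auto intro!: mult_right_mono)
    finally show ?thesis .
  qed
  then show "norm (coeff h j) \<le> real m * K" .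
  have "coeff h j - coeff q (Suc j) = l * coeff h (Suc j)" unfolding q by simp
  then show "norm (coeff h j - coeff q (Suc j)) \<le> real m * K * norm l"
    using mult_left_mono[OF 1[of "Suc j"], of "norm l"] by (simp add: norm_mult mult_ac)
qed

text \<open>
  Division by \<open>X - b\<close> with small \<open>b\<close> is almost division by \<open>X\<close>, a shift of the coefficients. In the limit
  \<open>\<xi> \<rightarrow> 0\<close> this identifies the polynomial of the exponents that do not tend to \<open>0\<close>.
\<close>

lemma norm_coeff_small_factors:
  fixes g :: "complex poly"
  assumes B: "finite B" and deg: "degree ((\<Prod>b\<in>B. [:- b, 1:]) * g) \<le> m"
    and K: "\<And>i. norm (coeff ((\<Prod>b\<in>B. [:- b, 1:]) * g) i) \<le> K"
    and \<eta>: "\<eta> \<le> 1" "\<And>b. b \<in> B \<Longrightarrow> norm b \<le> \<eta>" "0 \<le> \<eta>"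
  shows "norm (coeff g j - coeff ((\<Prod>b\<in>B. [:- b, 1:]) * g) (j + card B)) \<le> real (card B) * real (Suc m) ^ card B * K * \<eta>"
  using assms
proof (induction B arbitrary: K j)
  case (insert b B)
  let ?h = "(\<Prod>b\<in>B. [:- b, 1:]) * g"
  define q where "q = (\<Prod>b\<in>insert b B. [:- b, 1:]) * g"
  have q: "q = [:- b, 1:] * ?h" unfolding q_def using insert by (simp add: mult_ac)
  have K0: "0 \<le> K" using insert.prems(2)[of 0] norm_ge_zero order_trans by blast
  have degh: "degree ?h \<le> m" "degree ?h < Suc m"
  proof -
    have "degree ?h \<le> degree q"
    proof (cases "?h = 0")
      case True
      then show ?thesis by (metis degree_0 le0)
    next
      case False
      have "degree q = degree [:- b, 1:] + degree ?h"
        unfolding q by (rule degree_mult_eq) (use False in auto)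
      then show ?thesis by simp
    qed
    then show "degree ?h \<le> m" "degree ?h < Suc m" using insert.prems(1) unfolding q_def by auto
  qed
  note s = norm_coeff_linear_factor_small[OF q degh(2)]
  have b: "norm b \<le> 1" "norm b \<le> \<eta>" using insert.prems(3,4) by (auto intro: order_trans)
  have Kq: "norm (coeff q i) \<le> K" for i using insert.prems(2) unfolding q_def .
  let ?k = "card B"
  have IH: "norm (coeff g j - coeff ?h (j + ?k)) \<le> real ?k * real (Suc m) ^ ?k * (real (Suc m) * K) * \<eta>"
    by (rule insert.IH) (use degh s(1)[OF Kq b(1)] insert.prems(3,4,5) in auto)
  have 2: "norm (coeff ?h (j + ?k) - coeff q (Suc (j + ?k))) \<le> real (Suc m) * K * \<eta>"
    using s(2)[OF Kq b(1), of "j + ?k"] b(2) K0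
    by (meson mult_left_mono mult_nonneg_nonneg of_nat_0_le_iff order_trans)
  have 3: "real (Suc m) * K * \<eta> \<le> real (Suc m) ^ Suc ?k * K * \<eta>"
    using K0 insert.prems(5) self_le_power[of "real (Suc m)" "Suc ?k"] by (intro mult_right_mono) auto
  have "norm (coeff g j - coeff q (Suc (j + ?k))) \<le> norm (coeff g j - coeff ?h (j + ?k))
      + norm (coeff ?h (j + ?k) - coeff q (Suc (j + ?k)))"
    using norm_triangle_ineq[of "coeff g j - coeff ?h (j + ?k)" "coeff ?h (j + ?k) - coeff q (Suc (j + ?k))"]
    by simp
  also have "\<dots> \<le> real ?k * real (Suc m) ^ ?k * (real (Suc m) * K) * \<eta> + real (Suc m) ^ Suc ?k * K * \<eta>"
    using IH 2 3 by linarith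
  also have "\<dots> = real (Suc ?k) * real (Suc m) ^ Suc ?k * K * \<eta>"
    by (simp add: algebra_simps)
  finally show ?case using insert.hyps by (simp add: q_def)
qed simp

lemma prod_linear_dvd:
  fixes q :: "complex poly"
  assumes "finite B" "\<And>b. b \<in> B \<Longrightarrow> poly q b = 0"
  shows "(\<Prod>b\<in>B. [:- b, 1:]) dvd q"
  using assms
proof (induction B)
  case (insert b B)
  then obtain g where g: "q = (\<Prod>b\<in>B. [:- b, 1:]) * g" by (auto elim: dvdE)
  have "poly (\<Prod>b\<in>B. [:- b, 1:]) b \<noteq> 0"
    using insert by (auto simp: poly_prod prod_zero_iff)
  then have "poly g b = 0" using insert.prems[of b] g by simp
  then obtain h where "g = [:- b, 1:] * h" by (auto simp: poly_eq_0_iff_dvd elim: dvdE)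
  then have "q = (\<Prod>b\<in>insert b B. [:- b, 1:]) * h" 
    using g insert by (simp add: mult_ac del: mult_pCons_left mult_pCons_right)
  then show ?case by simp
qed simp

section \<open>The full symbol\<close>

lemma mpow_scale:
  fixes z :: "'a::comm_ring_1 ^ 'n::finite"
  shows "mpow (\<chi> i. a * z $ i) \<alpha> = a ^ (\<Sum>i\<in>UNIV. \<alpha> i) * mpow z \<alpha>"
  by (simp add: mpow_def power_mult_distrib prod.distrib power_sum)

lemma symbol_coeff_scale:
  fixes \<omega> :: "real ^ 'n::finite"
  shows "symbol_coeff c l k (\<rho> *\<^sub>R \<omega>) = \<rho> ^ (l - k) * symbol_coeff c l k \<omega>"
proof -
  have e: "\<rho> *\<^sub>R \<omega> = (\<chi> i. \<rho> * \<omega> $ i)" by (simp add: vec_eq_iff)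
  show ?thesis unfolding symbol_coeff_def sum_distrib_left e
    by (rule sum.cong[OF refl]) (simp add: mpow_scale mult_ac)
qed

lemma symbol_coeff_imaginary:
  fixes \<xi> :: "real ^ 'n::finite"
  shows "symbol_coeff c l k (\<chi> i. \<i> * of_real (\<xi> $ i)) = \<i> ^ (l - k) * complex_of_real (symbol_coeff c l k \<xi>)"
proof -
  have m: "mpow (\<chi> i. \<i> * complex_of_real (\<xi> $ i)) \<alpha> = \<i> ^ (\<Sum>i\<in>UNIV. \<alpha> i) * of_real (mpow \<xi> \<alpha>)" for \<alpha>
    using mpow_scale[of \<i> "\<chi> i. complex_of_real (\<xi> $ i)" \<alpha>] by (simp add: mpow_def)
  show ?thesis unfolding symbol_coeff_def of_real_sum sum_distrib_left
    by (rule sum.cong[OF refl]) (simp add: m mult_ac)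
qed

lemma symbol_coeff_top:
  fixes z :: "'a::{real_algebra_1, comm_ring_1} ^ 'n::finite"
  shows "symbol_coeff c l l z = of_real (c l (\<lambda>_. 0))"
proof -
  have "{\<alpha> :: 'n \<Rightarrow> nat. (\<Sum>i\<in>UNIV. \<alpha> i) = l - l} = {\<lambda>_. 0}" by auto
  then show ?thesis by (simp add: symbol_coeff_def mpow_def)
qed

lemma continuous_on_symbol_coeff [continuous_intros]:
  fixes c :: "'n::finite coeffs" and f :: "'b::topological_space \<Rightarrow> real ^ 'n"
  assumes "continuous_on A f"
  shows "continuous_on A (\<lambda>x. symbol_coeff c l k (f x))"
  unfolding symbol_coeff_def mpow_def by (intro continuous_intros assms)

lemma coeff_symb: "coeff (symb c l \<xi>) k = (if k \<le> l then symbol_coeff c l k \<xi> else 0)"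
  by (simp add: symb_def coeff_sum)

lemma degree_symb_le: "degree (symb c l \<xi>) \<le> l"
  by (rule degree_le) (simp add: coeff_symb)

lemma degree_symb: "c l (\<lambda>_. 0) \<noteq> 0 \<Longrightarrow> degree (symb c l \<xi>) = l"
  by (intro antisym degree_symb_le le_degree) (simp add: coeff_symb symbol_coeff_top)

lemma lead_coeff_symb: "c l (\<lambda>_. 0) \<noteq> 0 \<Longrightarrow> lead_coeff (symb c l \<xi>) = c l (\<lambda>_. 0)"
  by (simp add: degree_symb coeff_symb symbol_coeff_top)

lemma poly_symb: "poly (symb c l \<xi>) b = (\<Sum>k\<le>l. symbol_coeff c l k \<xi> * b ^ k)"
  by (simp add: symb_def poly_sum poly_monom)

lemma pderiv_symb: "poly (pderiv (symb c l \<xi>)) b = (\<Sum>k\<le>l. symbol_coeff c l k \<xi> * (real k * b ^ (k - 1)))"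
  by (simp add: symb_def pderiv_sum poly_sum pderiv_monom poly_monom mult_ac)

lemma continuous_on_poly_symb:
  fixes c :: "'n::finite coeffs" and f :: "'b::topological_space \<Rightarrow> real ^ 'n"
  assumes "continuous_on A f" "continuous_on A g"
  shows "continuous_on A (\<lambda>x. poly (symb c l (f x)) (g x))"
    "continuous_on A (\<lambda>x. poly (pderiv (symb c l (f x))) (g x))"
  unfolding poly_symb pderiv_symb by (intro continuous_intros assms)+

lemma norm_symbol_coeff_sphere_le:
  fixes \<omega> :: "real ^ 'n::finite"
  assumes "norm \<omega> = 1"
  shows "\<bar>symbol_coeff c l k \<omega>\<bar> \<le> (\<Sum>\<alpha> | (\<Sum>i\<in>UNIV. \<alpha> i) = l - k. \<bar>c k \<alpha>\<bar>)"
proof -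
  have "\<bar>mpow \<omega> \<alpha>\<bar> \<le> 1" for \<alpha>
    unfolding mpow_def abs_prod power_abs
    by (intro prod_le_1 conjI power_le_one zero_le_power) (use component_le_norm_cart[of \<omega>] assms in auto)
  then have *: "\<bar>c k \<alpha> * mpow \<omega> \<alpha>\<bar> \<le> \<bar>c k \<alpha>\<bar>" for \<alpha>
    using mult_left_mono[of "\<bar>mpow \<omega> \<alpha>\<bar>" 1 "\<bar>c k \<alpha>\<bar>"] by (simp add: abs_mult)
  show ?thesis unfolding symbol_coeff_def
    by (rule order_trans[OF sum_abs sum_mono]) (use * in simp)
qed

lemma coeff_symb_sphere_bounded:
  fixes c :: "'n::finite coeffs"
  obtains K where "0 < K" "\<And>l k (\<omega> :: real ^ 'n). l \<le> m \<Longrightarrow> norm \<omega> = 1 \<Longrightarrow> \<bar>coeff (symb c l \<omega>) k\<bar> \<le> K"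
proof -
  define K0 where "K0 l k = (\<Sum>\<alpha> | (\<Sum>i\<in>UNIV. \<alpha> i) = l - k. \<bar>c k \<alpha>\<bar>)" for l k
  define K where "K = (\<Sum>l\<le>m. \<Sum>k\<le>l. K0 l k) + 1"
  have K0: "0 \<le> K0 l k" for l k unfolding K0_def by (intro sum_nonneg) auto
  have "\<bar>coeff (symb c l \<omega>) k\<bar> \<le> K" if "l \<le> m" "norm \<omega> = 1" for l k and \<omega> :: "real ^ 'n"
  proof (cases "k \<le> l")
    case True
    have "\<bar>coeff (symb c l \<omega>) k\<bar> \<le> K0 l k"
      using norm_symbol_coeff_sphere_le[OF that(2)] True by (simp add: coeff_symb K0_def)
    also have "K0 l k \<le> (\<Sum>k\<le>l. K0 l k)" by (rule member_le_sum) (use True K0 in auto)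
    also have "\<dots> \<le> (\<Sum>l\<le>m. \<Sum>k\<le>l. K0 l k)"
      by (rule member_le_sum[of l "{..m}" "\<lambda>l. \<Sum>k\<le>l. K0 l k"]) (use that K0 in \<open>auto intro: sum_nonneg\<close>)
    finally show ?thesis by (simp add: K_def)
  next
    case False
    then show ?thesis unfolding coeff_symb K_def using K0 by (simp add: sum_nonneg add_nonneg_nonneg)
  qed
  moreover have "0 < K" unfolding K_def using K0 by (intro add_nonneg_pos sum_nonneg) auto
  ultimately show ?thesis using that by blast
qed

definition csymb :: "'n::finite coeffs \<Rightarrow> nat \<Rightarrow> real ^ 'n \<Rightarrow> complex poly" where
  "csymb c l \<omega> = map_poly complex_of_real (symb c l \<omega>)"

lemma coeff_csymb [simp]: "coeff (csymb c l \<omega>) k = of_real (coeff (symb c l \<omega>) k)"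
  by (simp add: csymb_def coeff_map_poly)

lemma degree_csymb [simp]: "degree (csymb c l \<omega>) = degree (symb c l \<omega>)"
  by (simp add: csymb_def degree_map_poly)

lemma poly_csymb_of_real [simp]: "poly (csymb c l \<omega>) (of_real b) = of_real (poly (symb c l \<omega>) b)"
  by (simp add: poly_altdef of_real_sum)

lemma pderiv_csymb: "pderiv (csymb c l \<omega>) = map_poly complex_of_real (pderiv (symb c l \<omega>))"
  by (rule poly_eqI) (simp add: coeff_pderiv coeff_map_poly)

lemma poly_pderiv_csymb_of_real [simp]:
  "poly (pderiv (csymb c l \<omega>)) (of_real b) = of_real (poly (pderiv (symb c l \<omega>)) b)"
  unfolding pderiv_csymb by (simp add: poly_altdef of_real_sum degree_map_poly coeff_map_poly)

text \<open>The polynomial \<open>\<lambda> \<mapsto> \<Sum>\<^sub>l P\<^sub>l(\<lambda>, i \<xi>)\<close>, whose roots are the exponents of the solutions at frequency \<open>\<xi>\<close>.\<close>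

definition full_symbol :: "'n::finite coeffs \<Rightarrow> nat set \<Rightarrow> real ^ 'n \<Rightarrow> complex poly" where
  "full_symbol c R \<xi> = (\<Sum>l\<in>R. \<Sum>k\<le>l. monom (symbol_coeff c l k (\<chi> i. \<i> * of_real (\<xi> $ i))) k)"

lemma coeff_full_symbol:
  "coeff (full_symbol c R (\<rho> *\<^sub>R \<omega>)) k = (\<Sum>l\<in>R. (\<i> * of_real \<rho>) ^ (l - k) * of_real (coeff (symb c l \<omega>) k))"
  unfolding full_symbol_def coeff_sum
proof (rule sum.cong[OF refl])
  fix l assume "l \<in> R"
  have "symbol_coeff c l k (\<chi> i. \<i> * complex_of_real ((\<rho> *\<^sub>R \<omega>) $ i))
      = (\<i> * of_real \<rho>) ^ (l - k) * of_real (symbol_coeff c l k \<omega>)"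
    unfolding symbol_coeff_imaginary symbol_coeff_scale by (simp add: power_mult_distrib)
  then show "(\<Sum>i\<le>l. coeff (monom (symbol_coeff c l i (\<chi> ia. \<i> * complex_of_real ((\<rho> *\<^sub>R \<omega>) $ ia))) i) k)
      = (\<i> * of_real \<rho>) ^ (l - k) * of_real (coeff (symb c l \<omega>) k)"
    by (simp add: coeff_symb)
qed

text \<open>
  Homogeneity of \<open>P\<^sub>l\<close> turns \<open>P\<^sub>l(i \<rho> z, i \<rho> \<omega>)\<close> into \<open>(i \<rho>)\<^sup>l P\<^sub>l(z, \<omega>)\<close>. Dividing by the lowest or by the highest power
  of \<open>i \<rho>\<close> exhibits the full symbol as a perturbation of \<open>P\<^sub>r\<close> at low and of \<open>P\<^sub>m\<close> at high frequencies.
\<close>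

lemma full_symbol_scale:
  "pcompose (full_symbol c R (\<rho> *\<^sub>R \<omega>)) [:0, \<i> * of_real \<rho>:] = (\<Sum>l\<in>R. smult ((\<i> * of_real \<rho>) ^ l) (csymb c l \<omega>))"
proof (rule poly_eqI)
  fix k
  show "coeff (pcompose (full_symbol c R (\<rho> *\<^sub>R \<omega>)) [:0, \<i> * of_real \<rho>:]) k
      = coeff (\<Sum>l\<in>R. smult ((\<i> * of_real \<rho>) ^ l) (csymb c l \<omega>)) k"
    unfolding coeff_pcompose_linear coeff_full_symbol coeff_sum sum_distrib_left
  proof (rule sum.cong[OF refl])
    fix l assume "l \<in> R"
    show "(\<i> * complex_of_real \<rho>) ^ k * ((\<i> * of_real \<rho>) ^ (l - k) * of_real (coeff (symb c l \<omega>) k))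
        = coeff (smult ((\<i> * of_real \<rho>) ^ l) (csymb c l \<omega>)) k"
    proof (cases "k \<le> l")
      case True
      then have "(\<i> * complex_of_real \<rho>) ^ l = (\<i> * of_real \<rho>) ^ k * (\<i> * of_real \<rho>) ^ (l - k)"
        by (simp add: power_add[symmetric])
      then show ?thesis by simp
    qed (simp add: coeff_symb)
  qed
qed

lemma smult_sum_right: "smult a (sum f A) = (\<Sum>x\<in>A. smult a (f x))"
  by (induction A rule: infinite_finite_induct) (simp_all add: smult_add_right)

lemma full_symbol_scale_low:
  assumes "r \<le> m"
  shows "pcompose (full_symbol c {r..m} (\<rho> *\<^sub>R \<omega>)) [:0, \<i> * of_real \<rho>:]
    = smult ((\<i> * of_real \<rho>) ^ r) (\<Sum>i\<le>m - r. smult ((\<i> * of_real \<rho>) ^ i) (csymb c (r + i) \<omega>))"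
  unfolding full_symbol_scale smult_sum_right
  by (rule sum.reindex_bij_witness[of _ "\<lambda>i. r + i" "\<lambda>l. l - r"])
     (use assms in \<open>auto simp: power_add[symmetric]\<close>)

lemma full_symbol_scale_high:
  assumes "r \<le> m" "\<rho> \<noteq> 0"
  shows "pcompose (full_symbol c {r..m} (\<rho> *\<^sub>R \<omega>)) [:0, \<i> * of_real \<rho>:]
    = smult ((\<i> * of_real \<rho>) ^ m) (\<Sum>i\<le>m - r. smult ((1 / (\<i> * of_real \<rho>)) ^ i) (csymb c (m - i) \<omega>))"
  unfolding full_symbol_scale smult_sum_right
proof (rule sum.reindex_bij_witness[of _ "\<lambda>i. m - i" "\<lambda>l. m - l"])
  fix l assume l: "l \<in> {r..m}"
  then have "(\<i> * complex_of_real \<rho>) ^ m = (\<i> * of_real \<rho>) ^ l * (\<i> * of_real \<rho>) ^ (m - l)"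
    by (simp add: power_add[symmetric])
  then have "(\<i> * complex_of_real \<rho>) ^ m * (1 / (\<i> * of_real \<rho>)) ^ (m - l) = (\<i> * of_real \<rho>) ^ l"
    using assms by (simp add: power_divide)
  then show "smult ((\<i> * complex_of_real \<rho>) ^ m) (smult ((1 / (\<i> * of_real \<rho>)) ^ (m - l)) (csymb c (m - (m - l)) \<omega>))
      = smult ((\<i> * of_real \<rho>) ^ l) (csymb c l \<omega>)" using l by simp
qed (use assms in auto)

lemma poly_scaled:
  assumes "pcompose q [:0, a:] = smult (a ^ d) F"
  shows "poly q (a * z) = a ^ d * poly F z"
    "a \<noteq> 0 \<Longrightarrow> 1 \<le> d \<Longrightarrow> poly (pderiv q) (a * z) = a ^ (d - 1) * poly (pderiv F) (z :: complex)"
proof -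
  show "poly q (a * z) = a ^ d * poly F z"
    using arg_cong[OF assms, of "\<lambda>p. poly p z"] by (simp add: poly_pcompose mult.commute)
  assume a: "a \<noteq> 0" and d: "1 \<le> d"
  have "a * poly (pderiv q) (a * z) = a ^ d * poly (pderiv F) z"
    using arg_cong[OF assms, of "\<lambda>p. poly (pderiv p) z"]
    by (simp add: pderiv_pcompose poly_pcompose pderiv_pCons pderiv_smult mult.commute)
  also have "a ^ d = a * a ^ (d - 1)" using d by (cases d) auto
  finally show "poly (pderiv q) (a * z) = a ^ (d - 1) * poly (pderiv F) z" using a by simp
qed

lemma poly_root_bound:
  fixes p :: "complex poly"
  assumes "degree p \<le> l" "coeff p l = a" "a \<noteq> 0" "\<And>i. norm (coeff p i) \<le> K" "poly p z = 0"
  shows "norm z \<le> 1 + real l * K / norm a"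
proof (cases "norm z \<le> 1")
  case True
  have "0 \<le> K" using assms(4)[of 0] norm_ge_zero order_trans by blast
  then have "0 \<le> real l * K / norm a" by simp
  then show ?thesis using True by linarith
next
  case False
  have l: "l \<noteq> 0"
  proof
    assume "l = 0"
    then have "p = [:a:]" using assms(1,2) by (metis degree_eq_zeroE lead_coeff_pCons(2) le_zero_eq pCons_0_0 coeff_pCons_0)
    then show False using assms(3,5) by simp
  qed
  have K: "0 \<le> K" using assms(4)[of 0] norm_ge_zero order_trans by blast
  have "{..l} = insert l {..<l}" by auto
  moreover have "poly p z = (\<Sum>i\<le>l. coeff p i * z ^ i)"
    unfolding poly_altdef by (rule sum.mono_neutral_left) (use assms(1) in \<open>auto intro: coeff_eq_0\<close>)
  ultimately have "a * z ^ l = - (\<Sum>i<l. coeff p i * z ^ i)"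
    using assms(2,5) by (simp add: eq_neg_iff_add_eq_0)
  then have "norm a * norm z ^ l = norm (\<Sum>i<l. coeff p i * z ^ i)"
    by (metis norm_minus_cancel norm_mult norm_power)
  also have "\<dots> \<le> (\<Sum>i<l. K * norm z ^ (l - 1))"
    unfolding norm_mult norm_power
    by (rule sum_norm_le) (use assms(4) K False in \<open>auto simp: norm_mult norm_power intro!: mult_mono power_increasing\<close>)
  also have "\<dots> = real l * K * norm z ^ (l - 1)" by simp
  finally have "norm a * norm z * norm z ^ (l - 1) \<le> real l * K * norm z ^ (l - 1)"
    using l by (cases l) (auto simp: mult_ac)
  moreover have "0 < norm z ^ (l - 1)" using False by (intro zero_less_power) auto
  ultimately have "norm a * norm z \<le> real l * K"
    using False by (auto simp: mult_le_cancel_right)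
  then have "norm z \<le> real l * K / norm a" using assms(3) by (simp add: field_simps)
  then show ?thesis by simp
qed

lemma compact_pos_lower_bound:
  fixes f :: "'a::topological_space \<Rightarrow> real"
  assumes "compact Z" "continuous_on Z f" "\<And>z. z \<in> Z \<Longrightarrow> 0 < f z"
  obtains \<delta> where "0 < \<delta>" "\<And>z. z \<in> Z \<Longrightarrow> \<delta> \<le> f z"
proof (cases "Z = {}")
  case True
  then show ?thesis using that[of 1] by auto
next
  case False
  then obtain z where "z \<in> Z" "\<And>x. x \<in> Z \<Longrightarrow> f z \<le> f x"
    using continuous_attains_inf[OF assms(1) _ assms(2)] by blast
  then show ?thesis using that[of "f z"] assms(3) by blast
qed

text \<open>
  Compactness of this set makes all bounds at the roots of \<open>P\<^sub>l(\<cdot>, \<omega>)\<close> uniform in the direction \<open>\<omega>\<close>, so that the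
  roots need not be selected continuously.
\<close>

definition root_bundle :: "'n::finite coeffs \<Rightarrow> nat \<Rightarrow> ((real ^ 'n) \<times> real) set" where
  "root_bundle c l = {(\<omega>, b). norm \<omega> = 1 \<and> poly (symb c l \<omega>) b = 0}"

lemma symb_root_bound:
  fixes c :: "'n::finite coeffs"
  assumes "c l (\<lambda>_. 0) \<noteq> 0"
  obtains Z where "1 \<le> Z" "\<And>(\<omega> :: real ^ 'n) b. norm \<omega> = 1 \<Longrightarrow> poly (symb c l \<omega>) b = 0 \<Longrightarrow> \<bar>b\<bar> \<le> Z"
proof -
  obtain K where K: "0 < K" "\<And>l' k (\<omega> :: real ^ 'n). l' \<le> l \<Longrightarrow> norm \<omega> = 1 \<Longrightarrow> \<bar>coeff (symb c l' \<omega>) k\<bar> \<le> K"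
    using coeff_symb_sphere_bounded by blast
  have "\<bar>b\<bar> \<le> 1 + real l * K / \<bar>c l (\<lambda>_. 0)\<bar>" if "norm \<omega> = 1" "poly (symb c l \<omega>) b = 0" for \<omega> :: "real ^ 'n" and b
    using poly_root_bound[of "csymb c l \<omega>" l "of_real (c l (\<lambda>_. 0))" K "of_real b"] that K assms
    by (simp add: degree_symb_le coeff_symb symbol_coeff_top)
  moreover have "1 \<le> 1 + real l * K / \<bar>c l (\<lambda>_. 0)\<bar>" using K by simp
  ultimately show ?thesis using that by blast
qed

lemma compact_root_bundle:
  fixes c :: "'n::finite coeffs"
  assumes "c l (\<lambda>_. 0) \<noteq> 0"
  shows "compact (root_bundle c l)"
proof -
  obtain Z where Z: "1 \<le> Z" "\<And>(\<omega> :: real ^ 'n) b. norm \<omega> = 1 \<Longrightarrow> poly (symb c l \<omega>) b = 0 \<Longrightarrow> \<bar>b\<bar> \<le> Z"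
    using symb_root_bound[of c l, OF assms] by blast
  have "root_bundle c l = (sphere 0 1 \<times> cball 0 Z) \<inter> (\<lambda>x. poly (symb c l (fst x)) (snd x)) -` {0}"
    using Z by (auto simp: root_bundle_def)
  moreover have "closed ((\<lambda>x :: (real ^ 'n) \<times> real. poly (symb c l (fst x)) (snd x)) -` {0})"
    by (rule continuous_closed_vimage) (use continuous_on_poly_symb(1)[OF continuous_on_fst[OF continuous_on_id] continuous_on_snd[OF continuous_on_id], of UNIV c l] in \<open>auto simp: continuous_on_eq_continuous_at\<close>)
  ultimately show ?thesis by (simp add: compact_Times compact_Int_closed)
qed

lemma continuous_on_root_bundle:
  "continuous_on A (\<lambda>x. poly (symb c l (fst x)) (snd x))"
  "continuous_on A (\<lambda>x. poly (pderiv (symb c l (fst x))) (snd x))"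
  by (intro continuous_on_poly_symb continuous_intros)+

lemma strictly_hyperbolic_pderiv_nonzero:
  assumes "strictly_hyperbolic c l" "norm \<omega> = 1" "poly (symb c l \<omega>) b = 0"
  shows "poly (pderiv (symb c l \<omega>)) b \<noteq> 0"
  using assms unfolding strictly_hyperbolic_def rsquarefree_roots by auto

lemma strictly_hyperbolic_pderiv_lower:
  fixes c :: "'n::finite coeffs"
  assumes "strictly_hyperbolic c l" "c l (\<lambda>_. 0) \<noteq> 0"
  obtains \<delta> where "0 < \<delta>"
    "\<And>(\<omega> :: real ^ 'n) b. norm \<omega> = 1 \<Longrightarrow> poly (symb c l \<omega>) b = 0 \<Longrightarrow> \<delta> \<le> \<bar>poly (pderiv (symb c l \<omega>)) b\<bar>"
proof -
  obtain \<delta> where "0 < \<delta>" "\<And>z. z \<in> root_bundle c l \<Longrightarrow> \<delta> \<le> \<bar>poly (pderiv (symb c l (fst z))) (snd z)\<bar>"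
    by (rule compact_pos_lower_bound[OF compact_root_bundle[of c l, OF assms(2)], of "\<lambda>z. \<bar>poly (pderiv (symb c l (fst z))) (snd z)\<bar>"])
       (auto intro!: continuous_intros continuous_on_root_bundle simp: root_bundle_def strictly_hyperbolic_pderiv_nonzero[OF assms(1)])
  then show ?thesis using that[of \<delta>] by (force simp: root_bundle_def)
qed

lemma strictly_hyperbolic_card_roots:
  fixes c :: "'n::finite coeffs"
  assumes sh: "strictly_hyperbolic c l" and lead: "c l (\<lambda>_. 0) \<noteq> 0" and \<omega>: "norm \<omega> = 1"
  shows "finite {b. poly (symb c l \<omega>) b = 0}" "card {b. poly (symb c l \<omega>) b = 0} = l"
    and "{z. poly (csymb c l \<omega>) z = 0} = complex_of_real ` {b. poly (symb c l \<omega>) b = 0}"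
proof -
  have nz: "symb c l \<omega> \<noteq> 0" using lead degree_symb[of c l \<omega>] coeff_symb[of c l \<omega> l] by (auto simp: symbol_coeff_top)
  show fin: "finite {b. poly (symb c l \<omega>) b = 0}" by (rule poly_roots_finite[OF nz])
  show eq: "{z. poly (csymb c l \<omega>) z = 0} = complex_of_real ` {b. poly (symb c l \<omega>) b = 0}"
  proof (intro set_eqI iffI)
    fix z assume z: "z \<in> {z. poly (csymb c l \<omega>) z = 0}"
    then have "z \<in> \<real>" using sh \<omega> unfolding strictly_hyperbolic_def hyperbolic_def csymb_def by auto
    then obtain b where b: "z = of_real b" by (auto elim: Reals_cases)
    then show "z \<in> complex_of_real ` {b. poly (symb c l \<omega>) b = 0}" using z by simp
  qed auto
  have cnz: "csymb c l \<omega> \<noteq> 0" using nz by (simp add: csymb_def map_poly_eq_0_iff)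
  obtain zs where zs: "length zs = degree (csymb c l \<omega>)" "csymb c l \<omega> = smult (lead_coeff (csymb c l \<omega>)) (\<Prod>z\<leftarrow>zs. [:- z, 1:])"
    using complex_poly_factor_list[OF cnz] .
  have sq: "poly (pderiv (csymb c l \<omega>)) z \<noteq> 0" if "poly (csymb c l \<omega>) z = 0" for z
  proof -
    have "z \<in> {z. poly (csymb c l \<omega>) z = 0}" using that by simp
    then have "z \<in> complex_of_real ` {b. poly (symb c l \<omega>) b = 0}" unfolding eq .
    then obtain b where "z = of_real b" "poly (symb c l \<omega>) b = 0" by blast
    then show ?thesis using strictly_hyperbolic_pderiv_nonzero[OF sh \<omega>] by simp
  qed
  have root: "poly (csymb c l \<omega>) z = 0 \<longleftrightarrow> z \<in> set zs" for z
  proof -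
    have "poly (\<Prod>z\<leftarrow>zs. [:- z, 1:]) z = 0 \<longleftrightarrow> z \<in> set zs"
      by (induction zs) (auto simp del: mult_pCons_left mult_pCons_right)
    then show ?thesis using nz by (subst zs(2)) simp
  qed
  have "distinct zs"
  proof (rule ccontr)
    assume "\<not> distinct zs"
    then obtain xs ys us z where d: "zs = xs @ [z] @ ys @ [z] @ us" using not_distinct_decomp by blast
    have "csymb c l \<omega> = [:- z, 1:] * ([:- z, 1:] * smult (lead_coeff (csymb c l \<omega>)) (\<Prod>z\<leftarrow>xs @ ys @ us. [:- z, 1:]))"
      by (subst zs(2)) (simp add: d mult_ac del: mult_pCons_left mult_pCons_right)
    then obtain g where g: "csymb c l \<omega> = [:- z, 1:] * ([:- z, 1:] * g)" by blast
    have "poly (pderiv (csymb c l \<omega>)) z = 0" unfolding g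
      by (simp add: pderiv_mult del: mult_pCons_left mult_pCons_right)
    moreover have "poly (csymb c l \<omega>) z = 0" unfolding g by simp
    ultimately show False using sq by blast
  qed
  then have "card {z. poly (csymb c l \<omega>) z = 0} = degree (csymb c l \<omega>)"
    using zs(1) root distinct_card[of zs] by (simp add: set_eq_iff Collect_mem_eq)
  then show "card {b. poly (symb c l \<omega>) b = 0} = l"
    unfolding eq using degree_symb[of c l \<omega>, OF lead] by (simp add: card_image inj_on_def)
qed

section \<open>Uniform estimates at a fixed frequency\<close>

lemma norm_exp_diff_le:
  fixes a b :: complex
  assumes "Re a \<le> s" "Re b \<le> s"
  shows "norm (exp a - exp b) \<le> norm (a - b) * exp s"
proof -
  have "norm (exp a - exp b) \<le> exp s * norm (a - b)"
  proof (rule field_differentiable_bound[of "{z. Re z \<le> s}" exp exp])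
    show "convex {z. Re z \<le> s}" by (rule convex_halfspace_Re_le)
    show "(exp has_field_derivative exp z) (at z within {z. Re z \<le> s})" if "z \<in> {z. Re z \<le> s}" for z :: complex
      by (rule DERIV_subset[OF DERIV_exp]) simp
  qed (use assms in auto)
  then show ?thesis by (simp add: mult.commute)
qed

lemma norm_power_diff_le:
  fixes a b :: complex
  assumes "norm a \<le> L" "norm b \<le> L"
  shows "norm (a ^ k - b ^ k) \<le> real k * L ^ (k - 1) * norm (a - b)"
proof (cases k)
  case (Suc n)
  have L: "0 \<le> L" using assms norm_ge_zero order_trans by blast
  have "a ^ k - b ^ k = (a - b) * (\<Sum>p<Suc n. a ^ p * b ^ (n - p))"
    unfolding Suc by (rule diff_power_eq_sum)
  also have "norm \<dots> \<le> norm (a - b) * (\<Sum>p<Suc n. L ^ n)"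
    unfolding norm_mult
  proof (intro mult_left_mono sum_norm_le)
    fix p assume "p \<in> {..<Suc n}"
    then have "norm (a ^ p * b ^ (n - p)) \<le> L ^ p * L ^ (n - p)"
      unfolding norm_mult norm_power using assms L by (intro mult_mono power_mono) auto
    also have "\<dots> = L ^ n" using \<open>p \<in> {..<Suc n}\<close> by (simp add: power_add[symmetric])
    finally show "norm (a ^ p * b ^ (n - p)) \<le> L ^ n" .
  qed auto
  finally show ?thesis using Suc by (simp add: mult_ac)
qed simp

lemma power_le_exp:
  fixes x :: real
  assumes "0 \<le> x" "0 < \<kappa>"
  shows "x ^ N \<le> fact N / \<kappa> ^ N * exp (\<kappa> * x)"
proof -
  have "(\<kappa> * x) ^ N / fact N \<le> (\<Sum>n\<in>{..N}. (\<kappa> * x) ^ n / fact n)"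
    by (rule member_le_sum[of N "{..N}" "\<lambda>n. (\<kappa> * x) ^ n / fact n"]) (use assms in auto)
  also have "\<dots> \<le> (\<Sum>n. (\<kappa> * x) ^ n / fact n)"
    by (rule sum_le_suminf) (use assms summable_exp[of "\<kappa> * x"] in \<open>auto simp: divide_inverse mult.commute\<close>)
  also have "\<dots> = exp (\<kappa> * x)" by (simp add: exp_def divide_inverse scaleR_conv_of_real mult.commute)
  finally show ?thesis using assms by (simp add: field_simps)
qed

lemma poly_times_exp_decay:
  assumes "0 < (c::real)"
  obtains C where "0 < C" "\<And>t. 0 \<le> t \<Longrightarrow> (2 + t) ^ p * exp (- c * t) \<le> C * exp (- (c / 2) * t)"
proof -
  define C where "C = fact p * (2 / c) ^ p * exp c"
  have "(2 + t) ^ p * exp (- c * t) \<le> C * exp (- (c / 2) * t)" if "0 \<le> t" for t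
  proof -
    define x where "x = c / 2 * (2 + t)"
    have x: "0 \<le> x" using assms that by (simp add: x_def)
    have "x ^ p \<le> fact p * exp x" using power_le_exp[OF x zero_less_one] by simp
    moreover have "(2 + t) ^ p = (2 / c) ^ p * x ^ p"
    proof -
      have "2 + t = 2 / c * x" using assms by (simp add: x_def field_simps)
      then show ?thesis by (simp only: power_mult_distrib)
    qed
    ultimately have "(2 + t) ^ p \<le> (2 / c) ^ p * (fact p * exp x)"
      using assms by (simp add: mult_left_mono)
    then have "(2 + t) ^ p * exp (- c * t) \<le> (2 / c) ^ p * (fact p * exp x) * exp (- c * t)"
      by (intro mult_right_mono) auto
    also have "\<dots> = fact p * (2 / c) ^ p * exp (x - c * t)" by (simp add: exp_diff exp_minus field_simps)
    also have "x - c * t = c + - (c / 2) * t" unfolding x_def by (simp add: field_simps)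
    finally show ?thesis by (simp only: C_def exp_add mult_ac)
  qed
  moreover have "0 < C" using assms by (simp add: C_def)
  ultimately show ?thesis using that by blast
qed

text \<open>
  Comparison of an exact slow mode with its parabolic approximation. The exponents differ by
  \<open>O(\<rho>\<^sup>3)\<close>, and \<open>\<rho>\<^sup>3 t\<close> is \<open>O(\<rho>)\<close> when weighed against a part of the decay \<open>exp (- \<kappa> \<rho>\<^sup>2 t)\<close>.
\<close>

lemma mode_comparison:
  fixes C L \<kappa> \<delta> :: real and k :: nat
  assumes "0 \<le> C" "1 \<le> L" "0 < \<kappa>" "0 < \<delta>"
  obtains G where "0 < G"
    "\<And>\<rho> l \<mu> N M D d t. \<lbrakk>0 < \<rho>; \<rho> \<le> 1; norm l \<le> L * \<rho>; norm \<mu> \<le> L * \<rho>; norm (l - \<mu>) \<le> C * \<rho> ^ 3;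
       Re l \<le> - \<kappa> * \<rho>\<^sup>2; Re \<mu> \<le> - \<kappa> * \<rho>\<^sup>2; \<delta> \<le> norm D; \<delta> \<le> norm d; norm (D - d) \<le> C * \<rho>; 0 \<le> t\<rbrakk> \<Longrightarrow>
      norm (l ^ k * (N / D) * exp (l * of_real t) - \<mu> ^ k * (M / d) * exp (\<mu> * of_real t))
      \<le> G * \<rho> ^ k * exp (- (\<kappa> / 2) * \<rho>\<^sup>2 * t) * (norm (N - M) + \<rho> * norm M)"
proof -
  define G1 where "G1 = L ^ k / \<delta>"
  define G2 where "G2 = L ^ k * C / \<delta>\<^sup>2"
  define G3 where "G3 = (real k * L ^ k * C + L ^ k * C * (2 / \<kappa>)) / \<delta>"
  define G where "G = G1 + G2 + G3"
  have G1: "0 < G1" unfolding G1_def using assms by simp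
  have G23: "0 \<le> G2" "0 \<le> G3" unfolding G2_def G3_def using assms by simp_all
  have "norm (l ^ k * (N / D) * exp (l * of_real t) - \<mu> ^ k * (M / d) * exp (\<mu> * of_real t))
      \<le> G * \<rho> ^ k * exp (- (\<kappa> / 2) * \<rho>\<^sup>2 * t) * (norm (N - M) + \<rho> * norm M)"
    if \<rho>: "0 < \<rho>" "\<rho> \<le> 1" and l: "norm l \<le> L * \<rho>" and \<mu>: "norm \<mu> \<le> L * \<rho>"
      and lm: "norm (l - \<mu>) \<le> C * \<rho> ^ 3" and Re: "Re l \<le> - \<kappa> * \<rho>\<^sup>2" "Re \<mu> \<le> - \<kappa> * \<rho>\<^sup>2"
      and D: "\<delta> \<le> norm D" "\<delta> \<le> norm d" "norm (D - d) \<le> C * \<rho>" and t: "0 \<le> t" for \<rho> l \<mu> N M D d t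
  proof -
    define E where "E = exp (- (\<kappa> / 2) * \<rho>\<^sup>2 * t)"
    define X where "X = l ^ k * exp (l * of_real t)"
    define Y where "Y = \<mu> ^ k * exp (\<mu> * of_real t)"
    have E0: "0 < E" by (simp add: E_def)
    have D0: "D \<noteq> 0" "d \<noteq> 0" using D assms by auto
    have Ret: "Re (l * of_real t) \<le> - \<kappa> * \<rho>\<^sup>2 * t" "Re (\<mu> * of_real t) \<le> - \<kappa> * \<rho>\<^sup>2 * t"
      using mult_right_mono[OF Re(1) t] mult_right_mono[OF Re(2) t] by auto
    have EE: "exp (- \<kappa> * \<rho>\<^sup>2 * t) \<le> E" unfolding E_def using assms t by (simp add: mult_right_mono)
    have pw: "norm (z ^ k) \<le> L ^ k * \<rho> ^ k" if "norm z \<le> L * \<rho>" for z :: complex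
      using power_mono[OF that, of k] by (simp add: norm_power power_mult_distrib)
    have X: "norm X \<le> L ^ k * \<rho> ^ k * E"
      unfolding X_def norm_mult
      by (rule mult_mono[OF pw[OF l]]) (use Ret(1) EE assms \<rho> in \<open>auto intro: order_trans\<close>)
    have X_Y: "norm (X - Y) \<le> (real k * L ^ k * C + L ^ k * C * (2 / \<kappa>)) * (\<rho> ^ k * \<rho>) * E"
    proof -
      have "X - Y = (l ^ k - \<mu> ^ k) * exp (l * of_real t) + \<mu> ^ k * (exp (l * of_real t) - exp (\<mu> * of_real t))"
        by (simp add: X_def Y_def algebra_simps)
      then have "norm (X - Y) \<le> norm (l ^ k - \<mu> ^ k) * norm (exp (l * of_real t))
          + norm (\<mu> ^ k) * norm (exp (l * of_real t) - exp (\<mu> * of_real t))"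
        by (metis norm_mult norm_triangle_ineq)
      moreover have "norm (l ^ k - \<mu> ^ k) * norm (exp (l * of_real t)) \<le> (real k * L ^ k * C) * (\<rho> ^ k * \<rho>) * E"
      proof (rule mult_mono)
        show "norm (exp (l * of_real t)) \<le> E" using Ret(1) EE by (auto intro: order_trans)
        have "norm (l ^ k - \<mu> ^ k) \<le> real k * (L * \<rho>) ^ (k - 1) * norm (l - \<mu>)"
          by (rule norm_power_diff_le[OF l \<mu>])
        also have "\<dots> \<le> real k * (L * \<rho>) ^ (k - 1) * (C * \<rho> ^ 3)"
          using lm assms \<rho> by (intro mult_left_mono) auto
        also have "\<dots> \<le> real k * L ^ k * C * (\<rho> ^ k * \<rho>)"
        proof (cases k)
          case (Suc n)
          have Ln: "L ^ n \<le> L ^ Suc n" using assms by (intro power_increasing) auto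
          have "\<rho> ^ 3 \<le> \<rho> * \<rho>"
            using \<rho> mult_right_mono[of \<rho> 1 "\<rho> * \<rho>"] by (simp add: power3_eq_cube mult.assoc)
          then have \<rho>n: "\<rho> ^ n * \<rho> ^ 3 \<le> \<rho> ^ Suc n * \<rho>"
          proof -
            have "\<rho> ^ n * \<rho> ^ 3 \<le> \<rho> ^ n * (\<rho> * \<rho>)"
              by (rule mult_left_mono[OF \<open>\<rho> ^ 3 \<le> \<rho> * \<rho>\<close>]) (use \<rho> in simp)
            then show ?thesis by (simp only: power_Suc mult_ac)
          qed
          have "L ^ n * (\<rho> ^ n * \<rho> ^ 3) \<le> L ^ Suc n * (\<rho> ^ Suc n * \<rho>)"
            by (rule mult_mono[OF Ln \<rho>n]) (use assms \<rho> in auto)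
          then have "real k * C * (L ^ n * (\<rho> ^ n * \<rho> ^ 3)) \<le> real k * C * (L ^ Suc n * (\<rho> ^ Suc n * \<rho>))"
            using assms by (intro mult_left_mono) auto
          then show ?thesis using Suc by (simp add: power_mult_distrib mult_ac)
        qed simp
        finally show "norm (l ^ k - \<mu> ^ k) \<le> real k * L ^ k * C * (\<rho> ^ k * \<rho>)" .
      qed (use assms \<rho> in auto)
      moreover have "norm (\<mu> ^ k) * norm (exp (l * of_real t) - exp (\<mu> * of_real t)) \<le> (L ^ k * \<rho> ^ k) * (C * (2 / \<kappa>) * \<rho> * E)"
      proof (rule mult_mono[OF pw[OF \<mu>]])
        have "norm (exp (l * of_real t) - exp (\<mu> * of_real t)) \<le> norm (l * of_real t - \<mu> * of_real t) * exp (- \<kappa> * \<rho>\<^sup>2 * t)"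
          by (rule norm_exp_diff_le[OF Ret])
        also have "norm (l * of_real t - \<mu> * of_real t) = norm (l - \<mu>) * t"
          using t by (simp add: left_diff_distrib[symmetric] norm_mult)
        also have "norm (l - \<mu>) * t * exp (- \<kappa> * \<rho>\<^sup>2 * t) \<le> C * \<rho> ^ 3 * t * exp (- \<kappa> * \<rho>\<^sup>2 * t)"
          using lm t by (intro mult_right_mono) auto
        also have "\<dots> = C * \<rho> * (2 / \<kappa>) * (\<kappa> / 2 * \<rho>\<^sup>2 * t * exp (- \<kappa> * \<rho>\<^sup>2 * t))"
          using assms by (simp add: power2_eq_square power3_eq_cube)
        also have "\<dots> \<le> C * \<rho> * (2 / \<kappa>) * E"
        proof (rule mult_left_mono)
          have "\<kappa> / 2 * \<rho>\<^sup>2 * t \<le> exp (\<kappa> / 2 * \<rho>\<^sup>2 * t)"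
            using exp_ge_add_one_self[of "\<kappa> / 2 * \<rho>\<^sup>2 * t"] by linarith
          then have "\<kappa> / 2 * \<rho>\<^sup>2 * t * exp (- \<kappa> * \<rho>\<^sup>2 * t) \<le> exp (\<kappa> / 2 * \<rho>\<^sup>2 * t) * exp (- \<kappa> * \<rho>\<^sup>2 * t)"
            by (rule mult_right_mono) auto
          also have "\<dots> = E" unfolding E_def exp_add[symmetric] by (simp add: field_simps)
          finally show "\<kappa> / 2 * \<rho>\<^sup>2 * t * exp (- \<kappa> * \<rho>\<^sup>2 * t) \<le> E" .
        qed (use assms \<rho> in auto)
        finally show "norm (exp (l * of_real t) - exp (\<mu> * of_real t)) \<le> C * (2 / \<kappa>) * \<rho> * E" by (simp add: mult_ac)
      qed (use assms \<rho> in auto)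
      ultimately show ?thesis by (simp add: algebra_simps)
    qed
    have "l ^ k * (N / D) * exp (l * of_real t) - \<mu> ^ k * (M / d) * exp (\<mu> * of_real t)
        = X / D * (N - M) + X * M * ((d - D) / (D * d)) + (X - Y) / d * M"
      using D0 by (simp add: X_def Y_def field_simps)
    then have "norm (l ^ k * (N / D) * exp (l * of_real t) - \<mu> ^ k * (M / d) * exp (\<mu> * of_real t))
        \<le> norm (X / D * (N - M)) + norm (X * M * ((d - D) / (D * d))) + norm ((X - Y) / d * M)"
      using norm_add_add_le by metis
    moreover have "norm (X / D * (N - M)) \<le> G1 * (\<rho> ^ k * E) * norm (N - M)"
    proof -
      have "norm X / norm D \<le> (L ^ k * \<rho> ^ k * E) / \<delta>" by (rule frac_le) (use X D assms E0 \<rho> in auto)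
      then show ?thesis unfolding norm_mult norm_divide G1_def by (intro mult_right_mono) (auto simp: mult_ac)
    qed
    moreover have "norm (X * M * ((d - D) / (D * d))) \<le> G2 * (\<rho> ^ k * E) * (\<rho> * norm M)"
    proof -
      have "norm (d - D) / (norm D * norm d) \<le> C * \<rho> / (\<delta> * \<delta>)"
        by (rule frac_le) (use D assms \<rho> in \<open>auto simp: norm_minus_commute intro!: mult_mono\<close>)
      then have "norm X * norm M * (norm (d - D) / (norm D * norm d)) \<le> (L ^ k * \<rho> ^ k * E) * norm M * (C * \<rho> / (\<delta> * \<delta>))"
        using X E0 \<rho> assms by (intro mult_mono mult_right_mono) auto
      then show ?thesis unfolding norm_mult norm_divide G2_def by (simp add: power2_eq_square mult_ac)
    qed
    moreover have "norm ((X - Y) / d * M) \<le> G3 * (\<rho> ^ k * E) * (\<rho> * norm M)"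
    proof -
      have "norm (X - Y) / norm d \<le> ((real k * L ^ k * C + L ^ k * C * (2 / \<kappa>)) * (\<rho> ^ k * \<rho>) * E) / \<delta>"
        by (rule frac_le) (use X_Y D assms E0 \<rho> in auto)
      then have "norm (X - Y) / norm d * norm M \<le> ((real k * L ^ k * C + L ^ k * C * (2 / \<kappa>)) * (\<rho> ^ k * \<rho>) * E) / \<delta> * norm M"
        by (rule mult_right_mono) auto
      then show ?thesis unfolding norm_mult norm_divide G3_def by (simp add: mult_ac)
    qed
    moreover have "G1 * (\<rho> ^ k * E) * norm (N - M) \<le> G * (\<rho> ^ k * E) * norm (N - M)"
      "G2 * (\<rho> ^ k * E) * (\<rho> * norm M) + G3 * (\<rho> ^ k * E) * (\<rho> * norm M) \<le> G * (\<rho> ^ k * E) * (\<rho> * norm M)"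
      unfolding distrib_right[symmetric]
      by (intro mult_right_mono; use G1 G23 \<rho> E0 in \<open>simp add: G_def\<close>)+
    ultimately show ?thesis unfolding E_def[symmetric] by (simp add: algebra_simps)
  qed
  moreover have "0 < G" unfolding G_def using G1 G23 by linarith
  ultimately show ?thesis using that by blast
qed

text \<open>
  The hypotheses on the symbols from which decay follows. In the variable \<open>z\<close> with \<open>\<lambda> = i \<rho> z\<close>,
  \<open>dissipative\<close> places all exponents in the open left half-plane for \<open>\<xi> \<noteq> 0\<close>; \<open>slow_rate\<close> and \<open>fast_rate\<close> are the first-order corrections
  of the slow exponents at low frequencies and of all exponents at high frequencies; \<open>fast_stable\<close>
  concerns the exponents that do not vanish at \<open>\<xi> = 0\<close>.
\<close>

locale dissipative_symbol =
  fixes c :: "'n::finite coeffs" and m r :: nat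
  assumes r1: "1 \<le> r" and rm: "r < m"
    and lead_m: "c m (\<lambda>_. 0) = 1" and lead_r: "c r (\<lambda>_. 0) \<noteq> 0"
    and sh_m: "strictly_hyperbolic c m" and sh_r: "strictly_hyperbolic c r"
    and dissipative: "\<And>(\<omega> :: real ^ 'n) \<rho> z. norm \<omega> = 1 \<Longrightarrow> 0 < \<rho> \<Longrightarrow>
       poly (\<Sum>i\<le>m - r. smult ((\<i> * of_real \<rho>) ^ i) (csymb c (r + i) \<omega>)) z = 0 \<Longrightarrow> 0 < Im z"
    and slow_rate: "\<And>(\<omega> :: real ^ 'n) b. norm \<omega> = 1 \<Longrightarrow> poly (symb c r \<omega>) b = 0 \<Longrightarrow>
       poly (symb c (Suc r) \<omega>) b / poly (pderiv (symb c r \<omega>)) b < 0"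
    and fast_rate: "\<And>(\<omega> :: real ^ 'n) a. norm \<omega> = 1 \<Longrightarrow> poly (symb c m \<omega>) a = 0 \<Longrightarrow>
       0 < poly (symb c (m - 1) \<omega>) a / poly (pderiv (symb c m \<omega>)) a"
    and fast_stable: "\<And>l. poly (\<Sum>i\<le>m - r. monom (complex_of_real (c (r + i) (\<lambda>_. 0))) i) l = 0 \<Longrightarrow> Re l < 0"
begin

abbreviation Q :: "real ^ 'n \<Rightarrow> complex poly" where
  "Q \<equiv> full_symbol c {r..m}"

lemma polar:
  assumes "\<xi> \<noteq> (0 :: real ^ 'n)"
  obtains \<omega> where "norm \<omega> = 1" "\<xi> = norm \<xi> *\<^sub>R \<omega>" "\<omega> = \<xi> /\<^sub>R norm \<xi>"
  using that[of "\<xi> /\<^sub>R norm \<xi>"] assms by simp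

lemma coeff_Q_top: "coeff (Q \<xi>) m = 1"
proof -
  have "coeff (Q (1 *\<^sub>R \<xi>)) m = (\<Sum>l\<in>{r..m}. if l = m then 1 else 0)"
    unfolding coeff_full_symbol
    by (rule sum.cong[OF refl]) (auto simp: coeff_symb symbol_coeff_top lead_m)
  then show ?thesis using rm by simp
qed

lemma degree_Q: "degree (Q \<xi>) = m"
proof (rule antisym)
  show "degree (Q \<xi>) \<le> m"
    unfolding full_symbol_def
    by (intro degree_sum_le order_trans[OF degree_monom_le]) auto
  show "m \<le> degree (Q \<xi>)" by (rule le_degree) (simp add: coeff_Q_top)
qed

lemma lead_coeff_Q: "lead_coeff (Q \<xi>) = 1"
  by (simp add: degree_Q coeff_Q_top)

lemma Q_nonzero: "Q \<xi> \<noteq> 0"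
  using degree_Q[of \<xi>] rm by auto

lemma Q_low:
  assumes "0 < \<rho>"
  shows "poly (Q (\<rho> *\<^sub>R \<omega>)) (\<i> * of_real \<rho> * z)
      = (\<i> * of_real \<rho>) ^ r * poly (\<Sum>i\<le>m - r. smult ((\<i> * of_real \<rho>) ^ i) (csymb c (r + i) \<omega>)) z"
    "poly (pderiv (Q (\<rho> *\<^sub>R \<omega>))) (\<i> * of_real \<rho> * z)
      = (\<i> * of_real \<rho>) ^ (r - 1) * poly (pderiv (\<Sum>i\<le>m - r. smult ((\<i> * of_real \<rho>) ^ i) (csymb c (r + i) \<omega>))) z"
  using poly_scaled[OF full_symbol_scale_low[of r m c \<rho> \<omega>], of z] rm r1 assms by auto

lemma Q_high:
  assumes "0 < \<rho>"
  shows "poly (Q (\<rho> *\<^sub>R \<omega>)) (\<i> * of_real \<rho> * z)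
      = (\<i> * of_real \<rho>) ^ m * poly (\<Sum>i\<le>m - r. smult ((1 / (\<i> * of_real \<rho>)) ^ i) (csymb c (m - i) \<omega>)) z"
    "poly (pderiv (Q (\<rho> *\<^sub>R \<omega>))) (\<i> * of_real \<rho> * z)
      = (\<i> * of_real \<rho>) ^ (m - 1) * poly (pderiv (\<Sum>i\<le>m - r. smult ((1 / (\<i> * of_real \<rho>)) ^ i) (csymb c (m - i) \<omega>))) z"
  using poly_scaled[OF full_symbol_scale_high[of r m \<rho> c \<omega>], of z] rm r1 assms by auto

lemma Re_root_negative:
  assumes "\<xi> \<noteq> 0" "poly (Q \<xi>) l = 0"
  shows "Re l < 0"
proof -
  obtain \<omega> where \<omega>: "norm \<omega> = 1" "\<xi> = norm \<xi> *\<^sub>R \<omega>" using polar[OF assms(1)] by blast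
  define \<rho> where "\<rho> = norm \<xi>"
  have \<rho>: "0 < \<rho>" using assms(1) by (simp add: \<rho>_def)
  define z where "z = l / (\<i> * of_real \<rho>)"
  have l: "l = \<i> * of_real \<rho> * z" using \<rho> by (simp add: z_def)
  have "0 < Im z"
    by (rule dissipative[OF \<omega>(1) \<rho>])
       (use assms(2) \<rho> Q_low(1)[OF \<rho>, of \<omega> z] \<omega>(2) l in \<open>simp add: \<rho>_def\<close>)
  then show ?thesis using \<rho> by (simp add: l)
qed

lemma coeff_Q_bound:
  obtains K where "0 < K"
    "\<And>\<xi> i. i \<le> m \<Longrightarrow> norm (coeff (Q \<xi>) i) \<le> K * (1 + norm \<xi>) ^ (m - i)"
    "\<And>\<xi> i. i \<le> m \<Longrightarrow> 1 \<le> norm \<xi> \<Longrightarrow> norm (coeff (Q \<xi>) i) \<le> K * norm \<xi> ^ (m - i)"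
    "\<And>\<xi> i. norm \<xi> \<le> 1 \<Longrightarrow> norm (coeff (Q \<xi>) i) \<le> K"
    "\<And>\<xi> i. \<xi> \<noteq> 0 \<Longrightarrow> norm \<xi> \<le> 1 \<Longrightarrow>
       norm (coeff (Q \<xi>) i - (if r \<le> i \<and> i \<le> m then of_real (c i (\<lambda>_. 0)) else 0)) \<le> K * norm \<xi>"
proof -
  obtain K where K: "0 < K" "\<And>l k (\<omega> :: real ^ 'n). l \<le> m \<Longrightarrow> norm \<omega> = 1 \<Longrightarrow> \<bar>coeff (symb c l \<omega>) k\<bar> \<le> K"
    using coeff_symb_sphere_bounded by blast
  define K' where "K' = real (Suc m) * K"
  have K': "0 < K'" using K by (simp add: K'_def)
  have main: "norm (coeff (Q \<xi>) i) \<le> K' * s ^ (m - i)" if s: "1 \<le> s" "norm \<xi> \<le> s" "i \<le> m" for \<xi> i s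
  proof -
    have "\<exists>\<rho> \<omega>. \<xi> = \<rho> *\<^sub>R \<omega> \<and> norm \<omega> = 1 \<and> \<rho> = norm \<xi>"
    proof (cases "\<xi> = 0")
      case True
      have "\<exists>\<omega> :: real ^ 'n. norm \<omega> = 1" by (metis vector_choose_size zero_le_one)
      then show ?thesis using True by auto
    next
      case False
      then show ?thesis using polar[OF False] by metis
    qed
    then obtain \<rho> \<omega> where \<rho>: "\<xi> = \<rho> *\<^sub>R \<omega>" "norm \<omega> = 1" "\<rho> = norm \<xi>" by blast
    have "norm (coeff (Q \<xi>) i) \<le> (\<Sum>l\<in>{r..m}. K * s ^ (m - i))"
      unfolding \<rho>(1) coeff_full_symbol
    proof (rule sum_norm_le)
      fix l assume l: "l \<in> {r..m}"
      show "norm ((\<i> * complex_of_real \<rho>) ^ (l - i) * complex_of_real (coeff (symb c l \<omega>) i)) \<le> K * s ^ (m - i)"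
      proof -
        have \<rho>s: "0 \<le> \<rho>" "\<rho> \<le> s" using s(2) \<rho>(3) by auto
        have "\<rho> ^ (l - i) \<le> s ^ (l - i)" by (intro power_mono \<rho>s)
        also have "\<dots> \<le> s ^ (m - i)" using s l by (intro power_increasing) auto
        finally have "\<rho> ^ (l - i) * \<bar>coeff (symb c l \<omega>) i\<bar> \<le> s ^ (m - i) * K"
          using K l \<rho>(2) s(1) by (intro mult_mono) auto
        then show ?thesis using \<rho>s(1) by (simp add: norm_mult norm_power mult.commute)
      qed
    qed
    also have "\<dots> = real (card {r..m}) * (K * s ^ (m - i))" by simp
    also have "\<dots> \<le> real (Suc m) * (K * s ^ (m - i))" using K s by (intro mult_right_mono) auto
    finally show ?thesis by (simp add: K'_def mult_ac)
  qed
  have small: "norm (coeff (Q \<xi>) i - (if r \<le> i \<and> i \<le> m then of_real (c i (\<lambda>_. 0)) else 0)) \<le> K' * norm \<xi>"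
    if \<xi>: "\<xi> \<noteq> 0" "norm \<xi> \<le> 1" for \<xi> i
  proof -
    obtain \<omega> where \<omega>: "norm \<omega> = 1" "\<xi> = norm \<xi> *\<^sub>R \<omega>" using polar[OF \<xi>(1)] by blast
    define \<rho> where "\<rho> = norm \<xi>"
    have \<rho>: "\<xi> = \<rho> *\<^sub>R \<omega>" "0 \<le> \<rho>" "\<rho> \<le> 1" using \<omega> \<xi> by (auto simp: \<rho>_def)
    have e: "(if r \<le> i \<and> i \<le> m then complex_of_real (c i (\<lambda>_. 0)) else 0)
        = (\<Sum>l\<in>{r..m}. if l = i then complex_of_real (c i (\<lambda>_. 0)) else 0)" by simp
    have "norm (coeff (Q \<xi>) i - (if r \<le> i \<and> i \<le> m then of_real (c i (\<lambda>_. 0)) else 0)) \<le> (\<Sum>l\<in>{r..m}. K * \<rho>)"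
      unfolding \<rho>(1) coeff_full_symbol e sum_subtractf[symmetric]
    proof (rule sum_norm_le)
      fix l assume l: "l \<in> {r..m}"
      consider "l = i" | "l < i" | "i < l" by linarith
      then show "norm ((\<i> * complex_of_real \<rho>) ^ (l - i) * complex_of_real (coeff (symb c l \<omega>) i) - (if l = i then complex_of_real (c i (\<lambda>_. 0)) else 0)) \<le> K * \<rho>"
      proof cases
        case 3
        have "\<rho> ^ (l - i) \<le> \<rho> ^ 1" using \<rho> 3 by (intro power_decreasing) auto
        then have "\<rho> ^ (l - i) * \<bar>coeff (symb c l \<omega>) i\<bar> \<le> \<rho> * K"
          using K l \<omega> \<rho> by (intro mult_mono) auto
        then show ?thesis using \<rho> 3 by (simp add: norm_mult norm_power mult.commute)
      qed (use K \<rho> in \<open>auto simp: coeff_symb symbol_coeff_top\<close>)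
    qed
    also have "\<dots> = real (card {r..m}) * (K * \<rho>)" by simp
    also have "\<dots> \<le> real (Suc m) * (K * \<rho>)" using K \<rho> by (intro mult_right_mono) auto
    finally show ?thesis by (simp add: K'_def \<rho>_def mult_ac)
  qed
  show ?thesis
  proof (rule that[OF K'])
    fix \<xi> :: "real ^ 'n" and i assume "i \<le> m"
    show "norm (coeff (Q \<xi>) i) \<le> K' * (1 + norm \<xi>) ^ (m - i)" by (rule main) (use \<open>i \<le> m\<close> in auto)
    show "norm (coeff (Q \<xi>) i) \<le> K' * norm \<xi> ^ (m - i)" if "1 \<le> norm \<xi>" by (rule main) (use that \<open>i \<le> m\<close> in auto)
  next
    fix \<xi> :: "real ^ 'n" and i assume "norm \<xi> \<le> 1"
    show "norm (coeff (Q \<xi>) i) \<le> K'"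
    proof (cases "i \<le> m")
      case True
      then show ?thesis using main[of 1 \<xi> i] \<open>norm \<xi> \<le> 1\<close> by simp
    next
      case False
      then show ?thesis using degree_Q[of \<xi>] K' by (simp add: coeff_eq_0)
    qed
  qed (rule small)
qed

lemma continuous_on_coeff_Q: "continuous_on A (\<lambda>\<xi>. coeff (Q \<xi>) i)"
proof -
  have "coeff (Q \<xi>) i = (\<Sum>l\<in>{r..m}. if i \<le> l then \<i> ^ (l - i) * complex_of_real (symbol_coeff c l i \<xi>) else 0)" for \<xi>
    using coeff_full_symbol[of c "{r..m}" 1 \<xi> i] by (auto simp: coeff_symb intro!: sum.cong)
  then have e: "(\<lambda>\<xi>. coeff (Q \<xi>) i) = (\<lambda>\<xi>. \<Sum>l\<in>{r..m}. if i \<le> l then \<i> ^ (l - i) * complex_of_real (symbol_coeff c l i \<xi>) else 0)"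
    by (rule ext)
  show ?thesis unfolding e
  proof (rule continuous_on_sum)
    fix l
    show "continuous_on A (\<lambda>\<xi>. if i \<le> l then \<i> ^ (l - i) * complex_of_real (symbol_coeff c l i \<xi>) else 0)"
      by (cases "i \<le> l")
         (simp_all add: continuous_on_mult continuous_on_of_real continuous_on_symbol_coeff)
  qed
qed

lemma poly_Q: "poly (Q \<xi>) l = (\<Sum>i\<le>m. coeff (Q \<xi>) i * l ^ i)"
  by (simp add: poly_altdef degree_Q)

section \<open>Middle and high frequencies\<close>

text \<open>
  On a compact set of frequencies without \<open>0\<close> the exponents stay in a compact part of the left half-plane.
\<close>

lemma middle_frequencies:
  assumes "0 < \<epsilon>"
  obtains C d where "0 < C" "0 < d"
    "\<And>\<xi> y t. \<lbrakk>\<epsilon> \<le> norm \<xi>; norm \<xi> \<le> R; 0 \<le> t; \<And>n. shift_act (Q \<xi>) y n = 0\<rbrakk> \<Longrightarrow>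
       norm (egf (\<lambda>n. y (n + k)) t) \<le> C * exp (- d * t) * (\<Sum>j<m. norm (y j))"
proof (cases "\<epsilon> \<le> R")
  case False
  then show ?thesis using that[of 1 1] by force
next
  case R: True
  obtain K where K: "0 < K" "\<And>\<xi> i. i \<le> m \<Longrightarrow> norm (coeff (Q \<xi>) i) \<le> K * (1 + norm \<xi>) ^ (m - i)"
    using coeff_Q_bound by metis
  define K1 where "K1 = K * (1 + R) ^ m"
  have R0: "0 < R" using assms R by simp
  have K1: "0 < K1" using K R0 by (simp add: K1_def)
  have KQ: "norm (coeff (Q \<xi>) i) \<le> K1" if "norm \<xi> \<le> R" for \<xi> i
  proof (cases "i \<le> m")
    case True
    have "(1 + norm \<xi>) ^ (m - i) \<le> (1 + R) ^ (m - i)" using that by (intro power_mono) auto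
    also have "\<dots> \<le> (1 + R) ^ m" using R0 by (intro power_increasing) auto
    finally have "K * (1 + norm \<xi>) ^ (m - i) \<le> K * (1 + R) ^ m" using K by (intro mult_left_mono) auto
    then show ?thesis using K(2)[OF True, of \<xi>] by (simp add: K1_def)
  next
    case False
    then show ?thesis using degree_Q[of \<xi>] K1 by (simp add: coeff_eq_0)
  qed
  define L where "L = 1 + real m * K1"
  have L: "1 \<le> L" using K1 by (simp add: L_def)
  have rootL: "norm l \<le> L" if "norm \<xi> \<le> R" "poly (Q \<xi>) l = 0" for \<xi> l
    using poly_root_bound[of "Q \<xi>" m 1 K1 l] that KQ degree_Q coeff_Q_top by (simp add: L_def)
  define T where "T = {x :: (real ^ 'n) \<times> complex. \<epsilon> \<le> norm (fst x)} \<inter> (cball 0 R \<times> cball 0 L) \<inter> (\<lambda>x. poly (Q (fst x)) (snd x)) -` {0}"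
  have cont: "continuous_on UNIV (\<lambda>x :: (real ^ 'n) \<times> complex. poly (Q (fst x)) (snd x))"
    unfolding poly_Q
    by (intro continuous_intros continuous_on_compose2[OF continuous_on_coeff_Q[of UNIV] continuous_on_fst[OF continuous_on_id]]) auto
  have "closed ((\<lambda>x :: (real ^ 'n) \<times> complex. poly (Q (fst x)) (snd x)) -` {0})"
    by (rule continuous_closed_vimage) (use cont in \<open>auto simp: continuous_on_eq_continuous_at\<close>)
  moreover have "closed {x :: (real ^ 'n) \<times> complex. \<epsilon> \<le> norm (fst x)}"
    by (intro closed_Collect_le continuous_intros)
  ultimately have "compact T" unfolding T_def
    by (intro compact_Int_closed closed_Int_compact compact_Times compact_cball)
  then obtain d where d: "0 < d" "\<And>x. x \<in> T \<Longrightarrow> d \<le> - Re (snd x)"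
  proof (rule compact_pos_lower_bound[where f = "\<lambda>x. - Re (snd x)"])
    show "continuous_on T (\<lambda>x. - Re (snd x))" by (intro continuous_intros)
    show "0 < - Re (snd x)" if "x \<in> T" for x
    proof -
      have "fst x \<noteq> 0" using that assms by (auto simp: T_def)
      then show ?thesis using Re_root_negative[of "fst x" "snd x"] that by (simp add: T_def)
    qed
  qed blast
  obtain C0 where C0: "0 < C0" "\<And>t. 0 \<le> t \<Longrightarrow> (2 + t) ^ m * exp (- d * t) \<le> C0 * exp (- (d / 2) * t)"
    using poly_times_exp_decay[OF d(1)] by blast
  define C where "C = L ^ (k + m) * (1 + L) ^ m * C0"
  have "norm (egf (\<lambda>n. y (n + k)) t) \<le> C * exp (- (d / 2) * t) * (\<Sum>j<m. norm (y j))"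
    if \<xi>: "\<epsilon> \<le> norm \<xi>" "norm \<xi> \<le> R" and t: "0 \<le> t" and y: "\<And>n. shift_act (Q \<xi>) y n = 0" for \<xi> y t
  proof -
    define a where "a = (\<Sum>j<m. norm (y j))"
    have a: "0 \<le> a" "\<And>j. j < m \<Longrightarrow> norm (y j) \<le> a"
      unfolding a_def by (auto intro!: sum_nonneg member_le_sum)
    have gy: "norm (y n) \<le> a * L ^ n" for n
      unfolding L_def
      by (rule linear_recurrence_growth[OF degree_Q lead_coeff_Q y]) (use KQ[OF \<xi>(2)] K1 a in auto)
    obtain ls where ls: "length ls = m" "Q \<xi> = (\<Prod>l\<leftarrow>ls. [:- l, 1:])"
      using complex_poly_factor_list[OF Q_nonzero[of \<xi>]] by (metis degree_Q lead_coeff_Q smult_1_left)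
    have root: "poly (Q \<xi>) l = 0" if "l \<in> set ls" for l
      unfolding ls(2) using that by (induction ls) (auto simp del: mult_pCons_left mult_pCons_right)
    have "norm (egf (\<lambda>n. y (n + k)) t) \<le> (a * L ^ (k + m)) * (1 + L) ^ length ls * (2 + t) ^ length ls * exp (- d * t)"
    proof (rule cascade_decay)
      show "exp_growth (\<lambda>n. y (n + k))" by (intro exp_growth_shift exp_growthI[OF gy])
      show "shift_act (\<Prod>l\<leftarrow>ls. [:- l, 1:]) (\<lambda>n. y (n + k)) n = 0" for n
        using y[of "n + k"] unfolding ls(2)[symmetric] by (simp add: shift_act_shift)
      show "Re l \<le> - d" if "l \<in> set ls" for l
        using d(2)[of "(\<xi>, l)"] root[OF that] rootL[OF \<xi>(2) root[OF that]] \<xi> by (simp add: T_def)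
      show "norm l \<le> L" if "l \<in> set ls" for l by (rule rootL[OF \<xi>(2) root[OF that]])
      show "norm (y (j + k)) \<le> a * L ^ (k + m)" if "j < length ls" for j
      proof -
        have "L ^ (j + k) \<le> L ^ (k + m)" using that ls L by (intro power_increasing) auto
        then show ?thesis using gy[of "j + k"] mult_left_mono[of "L ^ (j + k)" "L ^ (k + m)" a] a by linarith
      qed
    qed (use L a t in auto)
    also have "\<dots> = (a * L ^ (k + m) * (1 + L) ^ m) * ((2 + t) ^ m * exp (- d * t))" by (simp add: ls mult_ac)
    also have "\<dots> \<le> (a * L ^ (k + m) * (1 + L) ^ m) * (C0 * exp (- (d / 2) * t))"
      by (intro mult_left_mono C0 t) (use a L in auto)
    finally show ?thesis by (simp add: C_def a_def mult_ac)
  qed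
  moreover have "0 < C" using C0 L by (simp add: C_def)
  ultimately show ?thesis using that[of C "d / 2"] d by auto
qed

text \<open>
  Since the exponents \<open>\<lambda>\<close> are simple, the solution is the sum of the \<open>m\<close> modes with the coefficients of the splitting
  lemma. The derivative of the characteristic polynomial has size \<open>\<rho>\<^bsup>m-1\<^esup>\<close> at \<open>\<lambda>\<close>, and the numerator has size
  \<open>\<Sum>\<^sub>j \<rho>\<^bsup>m-1-j\<^esup> |y\<^sub>j|\<close>; the quotient has the weights \<open>\<rho>\<^bsup>-j\<^esup>\<close> that match the Sobolev spaces of the data. The real parts
  are negative because \<open>\<lambda> = i \<rho> a - q + O(1 / \<rho>)\<close>, where \<open>q > 0\<close> is the quotient in \<open>fast_rate\<close>.
\<close>

lemma high_frequencies:
  obtains R C d where "1 \<le> R" "0 < C" "0 < d"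
    "\<And>\<xi> y t. \<lbrakk>R \<le> norm \<xi>; 0 \<le> t; \<And>n. shift_act (Q \<xi>) y n = 0\<rbrakk> \<Longrightarrow>
       norm (egf (\<lambda>n. y (n + k)) t) \<le> C * exp (- d * t) * (\<Sum>j<m. norm \<xi> ^ k / norm \<xi> ^ j * norm (y j))"
proof -
  have m1: "1 \<le> m" using rm by simp
  have lead_m0: "c m (\<lambda>_. 0) \<noteq> 0" using lead_m by simp
  obtain K0 where K0: "0 < K0" "\<And>l k (\<omega> :: real ^ 'n). l \<le> m \<Longrightarrow> norm \<omega> = 1 \<Longrightarrow> \<bar>coeff (symb c l \<omega>) k\<bar> \<le> K0"
    using coeff_symb_sphere_bounded by blast
  obtain Z where Z: "1 \<le> Z" "\<And>(\<omega> :: real ^ 'n) b. norm \<omega> = 1 \<Longrightarrow> poly (symb c m \<omega>) b = 0 \<Longrightarrow> \<bar>b\<bar> \<le> Z"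
    using symb_root_bound[of c m, OF lead_m0] by blast
  obtain \<delta> where \<delta>: "0 < \<delta>" "\<And>(\<omega> :: real ^ 'n) b. norm \<omega> = 1 \<Longrightarrow> poly (symb c m \<omega>) b = 0 \<Longrightarrow> \<delta> \<le> \<bar>poly (pderiv (symb c m \<omega>)) b\<bar>"
    using strictly_hyperbolic_pderiv_lower[of c m, OF sh_m lead_m0] by blast
  obtain d where d: "0 < d" "\<And>(\<omega> :: real ^ 'n) a. norm \<omega> = 1 \<Longrightarrow> poly (symb c m \<omega>) a = 0 \<Longrightarrow>
       d \<le> poly (symb c (m - 1) \<omega>) a / poly (pderiv (symb c m \<omega>)) a"
  proof -
    obtain d where "0 < d" "\<And>z. z \<in> root_bundle c m \<Longrightarrow>
        d \<le> poly (symb c (m - 1) (fst z)) (snd z) / poly (pderiv (symb c m (fst z))) (snd z)"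
    proof (rule compact_pos_lower_bound[OF compact_root_bundle[of c m, OF lead_m0],
          of "\<lambda>z. poly (symb c (m - 1) (fst z)) (snd z) / poly (pderiv (symb c m (fst z))) (snd z)"])
      show "continuous_on (root_bundle c m) (\<lambda>z. poly (symb c (m - 1) (fst z)) (snd z) / poly (pderiv (symb c m (fst z))) (snd z))"
        by (intro continuous_on_divide continuous_on_root_bundle)
           (auto simp: root_bundle_def strictly_hyperbolic_pderiv_nonzero[OF sh_m])
      show "0 < poly (symb c (m - 1) (fst z)) (snd z) / poly (pderiv (symb c m (fst z))) (snd z)"
        if "z \<in> root_bundle c m" for z
        by (rule fast_rate) (use that in \<open>auto simp: root_bundle_def\<close>)
    qed blast
    then show ?thesis using that[of d] by (force simp: root_bundle_def)
  qed
  define B where "B \<omega> = {z. poly (csymb c m \<omega>) z = 0}" for \<omega> :: "real ^ 'n"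
  define F where "F \<omega> \<tau> = (\<Sum>i\<le>m - r. smult (\<tau> ^ i) (csymb c (m - i) \<omega>))" for \<omega> :: "real ^ 'n" and \<tau>
  have B_real: "\<exists>b. z = of_real b \<and> poly (symb c m \<omega>) b = 0" if "norm \<omega> = 1" "z \<in> B \<omega>" for z \<omega>
    using that strictly_hyperbolic_card_roots(3)[of c m \<omega>, OF sh_m lead_m0] by (auto simp: B_def)
  obtain \<epsilon> C1 where \<epsilon>: "0 < \<epsilon>" "\<epsilon> \<le> 1" and C1: "0 < C1"
    and pert: "\<And>\<omega> \<tau>. \<omega> \<in> {\<omega> :: real ^ 'n. norm \<omega> = 1} \<Longrightarrow> norm \<tau> \<le> \<epsilon> \<Longrightarrow> \<exists>\<zeta>. inj_on \<zeta> (B \<omega>) \<and>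
       (\<forall>b\<in>B \<omega>. poly (F \<omega> \<tau>) (\<zeta> b) = 0 \<and> norm (\<zeta> b - b) \<le> C1 * norm \<tau> \<and> norm (\<zeta> b - b) \<le> 1 \<and>
          norm (\<zeta> b - b + \<tau> * (poly (csymb c (m - 1) \<omega>) b / poly (pderiv (csymb c (m - 0) \<omega>)) b)) \<le> C1 * (norm \<tau>)\<^sup>2 \<and>
          norm (poly (pderiv (F \<omega> \<tau>)) (\<zeta> b) - poly (pderiv (csymb c (m - 0) \<omega>)) b) \<le> C1 * norm \<tau>)"
  proof (rule root_perturbation[of "m - r" "{\<omega> :: real ^ 'n. norm \<omega> = 1}" "\<lambda>i \<omega>. csymb c (m - i) \<omega>" m K0 Z \<delta> B], goal_cases)
    case (2 i w)
    then show ?case using degree_symb_le[of c "m - i" w] by simp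
  next
    case (6 w b)
    then show ?case by (simp add: B_def)
  next
    case (7 w b)
    then show ?case using B_real[of w b] Z(2)[of w] by auto
  next
    case (8 w b)
    then show ?case using B_real[of w b] \<delta>(2)[of w] by auto
  next
    case (9 \<epsilon> C)
    then show ?case using that unfolding F_def by blast
  qed (use rm K0 Z \<delta> in auto)
  obtain K where K: "0 < K" "\<And>\<xi> i. i \<le> m \<Longrightarrow> 1 \<le> norm \<xi> \<Longrightarrow> norm (coeff (Q \<xi>) i) \<le> K * norm \<xi> ^ (m - i)"
    using coeff_Q_bound by metis
  \<comment> \<open>Beyond \<open>R\<close> the expansion of the exponents is valid, and the derivatives at them and their decay rates are at least half of the limits.\<close>
  define R where "R = Max {1, 1 / \<epsilon>, 2 * C1 / \<delta>, 2 * C1 / d}"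
  have R: "1 \<le> R" "1 / \<epsilon> \<le> R" "2 * C1 / \<delta> \<le> R" "2 * C1 / d \<le> R" unfolding R_def by auto
  define L where "L = Z + 1"
  have L: "1 \<le> L" using Z by (simp add: L_def)
  define H where "H = real m * K * L ^ m"
  have H: "0 < H" using m1 K L by (simp add: H_def)
  define C where "C = real m * (L ^ k * H / (\<delta> / 2))"
  have C: "0 < C" unfolding C_def using m1 L H \<delta> by simp
  have main: "norm (egf (\<lambda>n. y (n + k)) t) \<le> C * exp (- (d / 2) * t) * (\<Sum>j<m. norm \<xi> ^ k / norm \<xi> ^ j * norm (y j))"
    if \<xi>: "R \<le> norm \<xi>" and t: "0 \<le> t" and y: "\<And>n. shift_act (Q \<xi>) y n = 0" for \<xi> y t
  proof -
    define \<rho> where "\<rho> = norm \<xi>"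
    have \<rho>1: "1 \<le> \<rho>" "R \<le> \<rho>" using \<xi> R by (auto simp: \<rho>_def)
    then have \<rho>0: "0 < \<rho>" by simp
    then have \<xi>0: "\<xi> \<noteq> 0" by (auto simp: \<rho>_def)
    obtain \<omega> where \<omega>: "norm \<omega> = 1" "\<xi> = \<rho> *\<^sub>R \<omega>" using polar[OF \<xi>0] unfolding \<rho>_def by metis
    define \<tau> where "\<tau> = 1 / (\<i> * complex_of_real \<rho>)"
    have n\<tau>: "norm \<tau> = 1 / \<rho>" using \<rho>0 by (simp add: \<tau>_def norm_divide norm_mult)
    have "norm \<tau> \<le> \<epsilon>"
    proof -
      have "1 / \<epsilon> \<le> \<rho>" using R(2) \<rho>1 by linarith
      then show ?thesis unfolding n\<tau> using \<epsilon> \<rho>0 by (simp add: field_simps)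
    qed
    then obtain \<zeta> where \<zeta>: "inj_on \<zeta> (B \<omega>)" and \<zeta>b:
       "\<And>b. b \<in> B \<omega> \<Longrightarrow> poly (F \<omega> \<tau>) (\<zeta> b) = 0 \<and> norm (\<zeta> b - b) \<le> C1 * norm \<tau> \<and> norm (\<zeta> b - b) \<le> 1 \<and>
          norm (\<zeta> b - b + \<tau> * (poly (csymb c (m - 1) \<omega>) b / poly (pderiv (csymb c (m - 0) \<omega>)) b)) \<le> C1 * (norm \<tau>)\<^sup>2 \<and>
          norm (poly (pderiv (F \<omega> \<tau>)) (\<zeta> b) - poly (pderiv (csymb c (m - 0) \<omega>)) b) \<le> C1 * norm \<tau>"
      using pert[of \<omega> \<tau>] \<omega> by auto
    define la where "la b = \<i> * of_real \<rho> * \<zeta> b" for b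
    define \<Lambda> where "\<Lambda> = la ` B \<omega>"
    have finB: "finite (B \<omega>)" and cardB: "card (B \<omega>) = m"
      using strictly_hyperbolic_card_roots[of c m \<omega>, OF sh_m lead_m0 \<omega>(1)]
      by (auto simp: B_def card_image inj_on_def)
    have inj: "inj_on la (B \<omega>)" using \<zeta> \<rho>0 unfolding inj_on_def la_def by simp
    have fin: "finite \<Lambda>" and card: "card \<Lambda> = m" using finB cardB inj by (auto simp: \<Lambda>_def card_image)
    have root: "poly (Q \<xi>) l = 0" if "l \<in> \<Lambda>" for l
      using that \<zeta>b Q_high(1)[OF \<rho>0, of \<omega>] unfolding \<Lambda>_def la_def \<omega>(2) F_def \<tau>_def by auto
    have prodQ: "Q \<xi> = (\<Prod>l\<in>\<Lambda>. [:- l, 1:])"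
    proof -
      obtain g where g: "Q \<xi> = (\<Prod>l\<in>\<Lambda>. [:- l, 1:]) * g" using prod_linear_dvd[OF fin root] by (auto elim: dvdE)
      have nz: "(\<Prod>l\<in>\<Lambda>. [:- l, 1:]) \<noteq> 0" "g \<noteq> 0" using g Q_nonzero[of \<xi>] by auto
      have "degree g = 0" using degree_mult_eq[OF nz] degree_prod_linear[OF fin] degree_Q[of \<xi>] g card by simp
      moreover have "lead_coeff g = 1"
        using lead_coeff_mult[of "\<Prod>l\<in>\<Lambda>. [:- l, 1:]" g] lead_coeff_Q[of \<xi>] g by (simp add: lead_coeff_prod)
      ultimately have "g = 1" by (metis degree_eq_zeroE lead_coeff_pCons(2) pCons_one)
      then show ?thesis using g by simp
    qed
    define h where "h l = (\<Prod>l'\<in>\<Lambda> - {l}. [:- l', 1:]) * (1 :: complex poly)" for l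
    define N where "N l = shift_act (h l) y 0" for l
    define e where "e l = N l / poly (pderiv (Q \<xi>)) l" for l
    have rep: "y n = (\<Sum>l\<in>\<Lambda>. l ^ n * e l)" for n
    proof -
      have "\<Lambda> \<noteq> {}" using card m1 by auto
      from shift_act_split[OF fin this _ _ y, of 1 n] prodQ show ?thesis
        by (simp add: e_def N_def h_def)
    qed
    have egf_y: "egf (\<lambda>n. y (n + k)) t = (\<Sum>l\<in>\<Lambda>. l ^ k * e l * exp (l * of_real t))"
    proof -
      have "egf (\<lambda>n. y (n + k)) t = egf (\<lambda>n. \<Sum>l\<in>\<Lambda>. (l ^ k * e l) * l ^ n) t"
        by (rule arg_cong[of _ _ "\<lambda>f. egf f t"]) (simp add: rep power_add mult_ac fun_eq_iff)
      also have "\<dots> = (\<Sum>l\<in>\<Lambda>. egf (\<lambda>n. (l ^ k * e l) * l ^ n) t)"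
        by (intro egf_sum exp_growth_cmult exp_growth_power)
      finally show ?thesis by (simp add: egf_cmult exp_growth_power egf_power)
    qed
    define S where "S = (\<Sum>j<m. \<rho> ^ k / \<rho> ^ j * norm (y j))"
    have each: "norm (l ^ k * e l * exp (l * of_real t)) \<le> (L ^ k * H / (\<delta> / 2)) * exp (- (d / 2) * t) * S" if "l \<in> \<Lambda>" for l
    proof -
      obtain z where z: "z \<in> B \<omega>" "l = la z" using \<open>l \<in> \<Lambda>\<close> by (auto simp: \<Lambda>_def)
      obtain b where b: "z = of_real b" "poly (symb c m \<omega>) b = 0" using B_real[OF \<omega>(1) z(1)] by blast
      note zb = \<zeta>b[OF z(1)]
      define P' where "P' = poly (pderiv (symb c m \<omega>)) b"
      have P': "\<delta> \<le> \<bar>P'\<bar>" using \<delta>(2)[OF \<omega>(1) b(2)] by (simp add: P'_def)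
      have nl: "norm l \<le> L * \<rho>"
      proof -
        have "norm (\<zeta> z) \<le> norm (\<zeta> z - z) + norm z" using norm_triangle_sub[of "\<zeta> z" z] by simp
        also have "\<dots> \<le> 1 + Z" using zb Z(2)[OF \<omega>(1) b(2)] b by (intro add_mono) auto
        finally show ?thesis using \<rho>0 by (simp add: z la_def norm_mult L_def mult.commute)
      qed
      have Q': "norm (poly (pderiv (Q \<xi>)) l) \<ge> \<rho> ^ (m - 1) * (\<delta> / 2)"
      proof -
        have "C1 * norm \<tau> \<le> \<delta> / 2" 
        proof -
          have "2 * C1 / \<delta> \<le> \<rho>" using R(3) \<rho>1 by linarith
          then show ?thesis unfolding n\<tau> using \<delta> \<rho>0 by (simp add: field_simps)
        qed
        then have "norm (poly (pderiv (F \<omega> \<tau>)) (\<zeta> z) - of_real P') \<le> \<delta> / 2" using zb b by (simp add: P'_def)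
        then have "\<delta> / 2 \<le> norm (poly (pderiv (F \<omega> \<tau>)) (\<zeta> z))"
          using P' norm_triangle_ineq2[of "complex_of_real P'" "poly (pderiv (F \<omega> \<tau>)) (\<zeta> z)"]
          by (simp add: norm_minus_commute)
        then show ?thesis
          using Q_high(2)[OF \<rho>0, of \<omega> "\<zeta> z"] \<rho>0 \<omega>(2) by (simp add: z la_def F_def \<tau>_def norm_mult norm_power mult_left_mono)
      qed
      have Re_l: "Re l \<le> - (d / 2)"
      proof -
        define q where "q = poly (symb c (m - 1) \<omega>) b / P'"
        have q: "d \<le> q" using d(2)[OF \<omega>(1) b(2)] by (simp add: q_def P'_def)
        define err where "err = \<zeta> z - z + \<tau> * of_real q"
        have err: "norm err \<le> C1 / \<rho>\<^sup>2" using zb b n\<tau> by (simp add: err_def q_def P'_def power_divide)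
        have "l = \<i> * of_real (\<rho> * b) - of_real q + \<i> * of_real \<rho> * err"
          using \<rho>0 by (simp add: z la_def err_def b(1)[symmetric] \<tau>_def algebra_simps)
        then have "Re l = - q + Re (\<i> * of_real \<rho> * err)" by simp
        also have "\<dots> \<le> - d + norm (\<i> * of_real \<rho> * err)" using q complex_Re_le_cmod[of "\<i> * of_real \<rho> * err"] by linarith
        also have "norm (\<i> * of_real \<rho> * err) \<le> \<rho> * (C1 / \<rho>\<^sup>2)" using mult_left_mono[OF err, of \<rho>] \<rho>0 by (simp add: norm_mult)
        also have "\<rho> * (C1 / \<rho>\<^sup>2) = C1 / \<rho>" using \<rho>0 by (simp add: power2_eq_square)
        also have "C1 / \<rho> \<le> d / 2" 
        proof -
          have "2 * C1 / d \<le> \<rho>" using R(4) \<rho>1 by linarith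
          then show ?thesis using d \<rho>0 by (simp add: field_simps)
        qed
        finally show ?thesis by simp
      qed
      have qh: "Q \<xi> = [:- l, 1:] * h l"
        unfolding prodQ h_def using prod.remove[OF fin that, of "\<lambda>l. [:- l, 1:]"] by simp
      have degh: "degree (h l) = m - 1"
      proof -
        have "card (\<Lambda> - {l}) = m - 1" using fin card that by (simp add: card_Diff_singleton)
        then show ?thesis unfolding h_def using degree_prod_linear[of "\<Lambda> - {l}"] fin by simp
      qed
      have "norm (N l) \<le> (\<Sum>j\<le>m - 1. H * \<rho> ^ (m - Suc j) * norm (y j))"
        unfolding N_def shift_act_def degh
      proof (rule sum_norm_le)
        fix j assume "j \<in> {..m - 1}"
        then have "j < m" using m1 by auto
        have "norm (coeff (h l) j) \<le> real m * K * L ^ m * \<rho> ^ (m - Suc j)"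
          by (rule norm_coeff_linear_factor_scaled[OF qh]) (use degh m1 K \<rho>1 nl L \<open>j < m\<close> in \<open>auto simp: \<rho>_def\<close>)
        then show "norm (coeff (h l) j * y (0 + j)) \<le> H * \<rho> ^ (m - Suc j) * norm (y j)"
          by (simp add: norm_mult H_def mult_right_mono)
      qed
      also have "{..m - 1} = {..<m}" using m1 by auto
      also have "(\<Sum>j<m. H * \<rho> ^ (m - Suc j) * norm (y j)) = H * \<rho> ^ (m - 1) * (\<Sum>j<m. norm (y j) / \<rho> ^ j)"
        unfolding sum_distrib_left
      proof (rule sum.cong[OF refl])
        fix j assume "j \<in> {..<m}"
        then have "\<rho> ^ (m - 1) = \<rho> ^ (m - Suc j) * \<rho> ^ j" by (simp add: power_add[symmetric])
        then show "H * \<rho> ^ (m - Suc j) * norm (y j) = H * \<rho> ^ (m - 1) * (norm (y j) / \<rho> ^ j)"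
          using \<rho>0 by simp
      qed
      finally have Nl: "norm (N l) \<le> H * \<rho> ^ (m - 1) * (\<Sum>j<m. norm (y j) / \<rho> ^ j)" .
      have S0: "0 \<le> (\<Sum>j<m. norm (y j) / \<rho> ^ j)" using \<rho>0 by (intro sum_nonneg) auto
      have el: "norm (e l) \<le> H / (\<delta> / 2) * (\<Sum>j<m. norm (y j) / \<rho> ^ j)"
      proof -
        have "norm (e l) \<le> (H * \<rho> ^ (m - 1) * (\<Sum>j<m. norm (y j) / \<rho> ^ j)) / (\<rho> ^ (m - 1) * (\<delta> / 2))"
          unfolding e_def norm_divide by (rule frac_le) (use Nl Q' \<rho>0 \<delta> H S0 in auto)
        then show ?thesis using \<rho>0 by (simp add: mult_ac)
      qed
      have "norm (l ^ k * e l * exp (l * of_real t)) = norm l ^ k * norm (e l) * exp (Re l * t)"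
        by (simp add: norm_mult norm_power)
      also have "\<dots> \<le> (L * \<rho>) ^ k * (H / (\<delta> / 2) * (\<Sum>j<m. norm (y j) / \<rho> ^ j)) * exp (- (d / 2) * t)"
      proof (intro mult_mono power_mono nl el)
        show "exp (Re l * t) \<le> exp (- (d / 2) * t)" using mult_right_mono[OF Re_l t] by simp
      qed (use H \<delta> S0 L \<rho>0 in auto)
      also have "\<dots> = (L ^ k * H / (\<delta> / 2)) * exp (- (d / 2) * t) * (\<rho> ^ k * (\<Sum>j<m. norm (y j) / \<rho> ^ j))"
        by (simp add: power_mult_distrib mult_ac)
      also have "\<rho> ^ k * (\<Sum>j<m. norm (y j) / \<rho> ^ j) = S"
        by (simp add: S_def sum_distrib_left)
      finally show ?thesis .
    qed
    have "norm (egf (\<lambda>n. y (n + k)) t) \<le> (\<Sum>l\<in>\<Lambda>. (L ^ k * H / (\<delta> / 2)) * exp (- (d / 2) * t) * S)"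
      unfolding egf_y by (rule sum_norm_le[OF each])
    then show ?thesis using card by (simp add: C_def S_def \<rho>_def mult_ac)
  qed
  show ?thesis by (rule that[OF R(1) C, of "d / 2"]) (use d main in auto)
qed

section \<open>Low frequencies\<close>

definition slow_exponent :: "real ^ 'n \<Rightarrow> real \<Rightarrow> real \<Rightarrow> complex" where
  "slow_exponent \<omega> \<rho> b = \<i> * of_real (\<rho> * b)
     + of_real (\<rho>\<^sup>2 * (poly (symb c (Suc r) \<omega>) b / poly (pderiv (symb c r \<omega>)) b))"

text \<open>
  The Fourier transform of the \<open>k\<close>-th time derivative of the asymptotic profile, up to the factor
  \<open>\<rho> ^ (r - 1)\<close> of the Riesz potential.
\<close>

definition slow_profile :: "nat \<Rightarrow> complex \<Rightarrow> real \<Rightarrow> real ^ 'n \<Rightarrow> real \<Rightarrow> complex" where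
  "slow_profile k M t \<omega> \<rho> = (\<Sum>b | poly (symb c r \<omega>) b = 0.
     slow_exponent \<omega> \<rho> b ^ k * (M / of_real (poly (pderiv (symb c r \<omega>)) b)) * exp (slow_exponent \<omega> \<rho> b * of_real t))
     / \<i> ^ (r - 1)"

lemma slow_constants:
  obtains Z \<delta> \<kappa> where "1 \<le> Z" "0 < \<delta>" "0 < \<kappa>"
    "\<And>(\<omega> :: real ^ 'n) b. norm \<omega> = 1 \<Longrightarrow> poly (symb c r \<omega>) b = 0 \<Longrightarrow> \<bar>b\<bar> \<le> Z"
    "\<And>(\<omega> :: real ^ 'n) b. norm \<omega> = 1 \<Longrightarrow> poly (symb c r \<omega>) b = 0 \<Longrightarrow> \<delta> \<le> \<bar>poly (pderiv (symb c r \<omega>)) b\<bar>"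
    "\<And>(\<omega> :: real ^ 'n) b. norm \<omega> = 1 \<Longrightarrow> poly (symb c r \<omega>) b = 0 \<Longrightarrow>
       poly (symb c (Suc r) \<omega>) b / poly (pderiv (symb c r \<omega>)) b \<le> - \<kappa>"
    "\<And>(\<omega> :: real ^ 'n) b \<rho>. norm \<omega> = 1 \<Longrightarrow> poly (symb c r \<omega>) b = 0 \<Longrightarrow> 0 \<le> \<rho> \<Longrightarrow>
       norm (slow_exponent \<omega> \<rho> b) \<le> Z * (\<rho> + \<rho>\<^sup>2)"
proof -
  obtain Z1 where Z1: "1 \<le> Z1" "\<And>(\<omega> :: real ^ 'n) b. norm \<omega> = 1 \<Longrightarrow> poly (symb c r \<omega>) b = 0 \<Longrightarrow> \<bar>b\<bar> \<le> Z1"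
    using symb_root_bound[of c r, OF lead_r] by blast
  obtain \<delta> where \<delta>: "0 < \<delta>" "\<And>(\<omega> :: real ^ 'n) b. norm \<omega> = 1 \<Longrightarrow> poly (symb c r \<omega>) b = 0 \<Longrightarrow> \<delta> \<le> \<bar>poly (pderiv (symb c r \<omega>)) b\<bar>"
    using strictly_hyperbolic_pderiv_lower[of c r, OF sh_r lead_r] by blast
  define f where "f z = poly (symb c (Suc r) (fst z)) (snd z) / poly (pderiv (symb c r (fst z))) (snd z)" for z :: "(real ^ 'n) \<times> real"
  have cont: "continuous_on (root_bundle c r) f"
    unfolding f_def by (intro continuous_on_divide continuous_on_root_bundle)
      (auto simp: root_bundle_def strictly_hyperbolic_pderiv_nonzero[OF sh_r])
  obtain \<kappa> where \<kappa>: "0 < \<kappa>" "\<And>z. z \<in> root_bundle c r \<Longrightarrow> \<kappa> \<le> - f z"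
  proof (rule compact_pos_lower_bound[OF compact_root_bundle[of c r, OF lead_r], of "\<lambda>z. - f z"])
    show "continuous_on (root_bundle c r) (\<lambda>z. - f z)" by (intro continuous_on_minus cont)
    show "0 < - f z" if "z \<in> root_bundle c r" for z
      using slow_rate[of "fst z" "snd z"] that by (auto simp: root_bundle_def f_def)
  qed blast
  have "bounded (f ` root_bundle c r)"
    by (intro compact_imp_bounded compact_continuous_image cont compact_root_bundle lead_r)
  then obtain A where A: "\<And>z. z \<in> root_bundle c r \<Longrightarrow> \<bar>f z\<bar> \<le> A" unfolding bounded_iff by auto
  define Z where "Z = max Z1 A"
  show ?thesis
  proof (rule that[of Z \<delta> \<kappa>])
    fix \<omega> :: "real ^ 'n" and b \<rho> :: real
    assume w: "norm \<omega> = 1" "poly (symb c r \<omega>) b = 0"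
    then have z: "(\<omega>, b) \<in> root_bundle c r" by (simp add: root_bundle_def)
    show "\<bar>b\<bar> \<le> Z" using Z1(2)[OF w] by (simp add: Z_def)
    show "\<delta> \<le> \<bar>poly (pderiv (symb c r \<omega>)) b\<bar>" by (rule \<delta>(2)[OF w])
    show "poly (symb c (Suc r) \<omega>) b / poly (pderiv (symb c r \<omega>)) b \<le> - \<kappa>" using \<kappa>(2)[OF z] by (simp add: f_def)
    assume \<rho>: "0 \<le> \<rho>"
    have "norm (slow_exponent \<omega> \<rho> b) \<le> norm (\<i> * complex_of_real (\<rho> * b)) + norm (complex_of_real (\<rho>\<^sup>2 * f (\<omega>, b)))"
      unfolding slow_exponent_def f_def fst_conv snd_conv by (rule norm_triangle_ineq)
    also have "\<dots> = \<rho> * \<bar>b\<bar> + \<rho>\<^sup>2 * \<bar>f (\<omega>, b)\<bar>" using \<rho> by (simp only: norm_mult norm_of_real) (simp add: abs_mult)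
    also have "\<dots> \<le> \<rho> * Z + \<rho>\<^sup>2 * Z"
      using Z1(2)[OF w] A[OF z] \<rho> by (intro add_mono mult_left_mono) (auto simp: Z_def)
    finally show "norm (slow_exponent \<omega> \<rho> b) \<le> Z * (\<rho> + \<rho>\<^sup>2)" by (simp add: algebra_simps)
  qed (use Z1 \<delta> \<kappa> in \<open>auto simp: Z_def\<close>)
qed

lemma norm_slow_profile_le:
  obtains C \<kappa> where "0 < C" "0 < \<kappa>"
    "\<And>(\<omega> :: real ^ 'n) \<rho> M t. norm \<omega> = 1 \<Longrightarrow> 0 \<le> \<rho> \<Longrightarrow> 0 \<le> t \<Longrightarrow>
       norm (slow_profile k M t \<omega> \<rho>) \<le> C * norm M * (\<rho> + \<rho>\<^sup>2) ^ k * exp (- \<kappa> * \<rho>\<^sup>2 * t)"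
proof -
  obtain Z \<delta> \<kappa> where Z: "1 \<le> Z" and \<delta>: "0 < \<delta>" and \<kappa>: "0 < \<kappa>"
    and \<delta>b: "\<And>(\<omega> :: real ^ 'n) b. norm \<omega> = 1 \<Longrightarrow> poly (symb c r \<omega>) b = 0 \<Longrightarrow> \<delta> \<le> \<bar>poly (pderiv (symb c r \<omega>)) b\<bar>"
    and \<kappa>b: "\<And>(\<omega> :: real ^ 'n) b. norm \<omega> = 1 \<Longrightarrow> poly (symb c r \<omega>) b = 0 \<Longrightarrow>
       poly (symb c (Suc r) \<omega>) b / poly (pderiv (symb c r \<omega>)) b \<le> - \<kappa>"
    and s: "\<And>(\<omega> :: real ^ 'n) b \<rho>. norm \<omega> = 1 \<Longrightarrow> poly (symb c r \<omega>) b = 0 \<Longrightarrow> 0 \<le> \<rho> \<Longrightarrow>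
       norm (slow_exponent \<omega> \<rho> b) \<le> Z * (\<rho> + \<rho>\<^sup>2)"
    by (rule slow_constants, rule that)
  have "norm (slow_profile k M t \<omega> \<rho>) \<le> (real r * Z ^ k / \<delta>) * norm M * (\<rho> + \<rho>\<^sup>2) ^ k * exp (- \<kappa> * \<rho>\<^sup>2 * t)"
    if \<omega>: "norm \<omega> = 1" and \<rho>: "0 \<le> \<rho>" and t: "0 \<le> t" for \<omega> :: "real ^ 'n" and \<rho> M t
  proof -
    have "norm (slow_profile k M t \<omega> \<rho>)
        \<le> (\<Sum>b | poly (symb c r \<omega>) b = 0. (Z * (\<rho> + \<rho>\<^sup>2)) ^ k * (norm M / \<delta>) * exp (- \<kappa> * \<rho>\<^sup>2 * t))"
      unfolding slow_profile_def norm_divide norm_power norm_ii power_one div_by_1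
    proof (rule sum_norm_le)
      fix b assume "b \<in> {b. poly (symb c r \<omega>) b = 0}"
      then have b: "poly (symb c r \<omega>) b = 0" by simp
      have "Re (slow_exponent \<omega> \<rho> b * of_real t) = \<rho>\<^sup>2 * (poly (symb c (Suc r) \<omega>) b / poly (pderiv (symb c r \<omega>)) b) * t"
        unfolding slow_exponent_def by simp
      also have "\<dots> \<le> \<rho>\<^sup>2 * (- \<kappa>) * t" by (intro mult_right_mono mult_left_mono \<kappa>b \<omega> b t) auto
      finally have e: "exp (Re (slow_exponent \<omega> \<rho> b * of_real t)) \<le> exp (- \<kappa> * \<rho>\<^sup>2 * t)" by (simp add: mult_ac)
      show "norm (slow_exponent \<omega> \<rho> b ^ k * (M / of_real (poly (pderiv (symb c r \<omega>)) b)) * exp (slow_exponent \<omega> \<rho> b * of_real t))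
          \<le> (Z * (\<rho> + \<rho>\<^sup>2)) ^ k * (norm M / \<delta>) * exp (- \<kappa> * \<rho>\<^sup>2 * t)"
        unfolding norm_mult norm_power norm_divide norm_exp_eq_Re
        by (intro mult_mono power_mono s \<omega> b \<rho> e frac_le) (use Z \<rho> \<delta> \<delta>b[OF \<omega> b] in auto)
    qed
    also have "\<dots> = (real r * Z ^ k / \<delta>) * norm M * (\<rho> + \<rho>\<^sup>2) ^ k * exp (- \<kappa> * \<rho>\<^sup>2 * t)"
      using strictly_hyperbolic_card_roots(2)[of c r \<omega>, OF sh_r lead_r \<omega>] by (simp add: power_mult_distrib mult_ac)
    finally show ?thesis .
  qed
  then show ?thesis using that[of "real r * Z ^ k / \<delta>" \<kappa>] Z \<delta> \<kappa> r1 by auto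
qed

text \<open>
  At low frequencies \<open>r\<close> exponents are close to \<open>i \<rho> b\<close> with a root \<open>b\<close> of \<open>P\<^sub>r\<close>; they are simple and their
  modes are computed individually. The remaining \<open>m - r\<close> exponents are close to the roots of the polynomial in
  \<open>fast_stable\<close>; these may be multiple, hence they are only used through the
  polynomial \<open>g\<close> with these roots. The limit polynomial is bounded away from \<open>0\<close> on bounded sets to
  the right of a vertical line, and there it dominates the error of the coefficients of \<open>g\<close>.
\<close>

lemma fast_factor_stable:
  obtains d where "0 < d"
    "\<And>A. \<exists>\<epsilon>>0. \<forall>g. degree g = m - r \<longrightarrow>
       (\<forall>i\<le>m - r. norm (coeff g i - complex_of_real (c (r + i) (\<lambda>_. 0))) \<le> \<epsilon>) \<longrightarrow>
       (\<forall>l. norm l \<le> A \<longrightarrow> poly g l = 0 \<longrightarrow> Re l \<le> - d)"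
proof -
  define f where "f = (\<Sum>i\<le>m - r. monom (complex_of_real (c (r + i) (\<lambda>_. 0))) i)"
  have cf: "coeff f i = (if i \<le> m - r then complex_of_real (c (r + i) (\<lambda>_. 0)) else 0)" for i
    by (simp add: f_def coeff_sum)
  have f0: "f \<noteq> 0" using cf[of "m - r"] rm lead_m by auto
  have finf: "finite {l. poly f l = 0}" by (rule poly_roots_finite[OF f0])
  obtain d where d: "0 < d" "\<And>l. poly f l = 0 \<Longrightarrow> Re l < - d"
  proof (cases "{l. poly f l = 0} = {}")
    case True
    then show ?thesis using that[of 1] by auto
  next
    case False
    define d where "d = Min ((\<lambda>l. - Re l) ` {l. poly f l = 0})"
    have "0 < d" unfolding d_def using finf False fast_stable by (auto simp: f_def)
    moreover have "Re l < - (d / 2)" if "poly f l = 0" for l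
    proof -
      have "d \<le> - Re l" unfolding d_def using finf that by (intro Min_le) auto
      then show ?thesis using \<open>0 < d\<close> by linarith
    qed
    ultimately show ?thesis using that[of "d / 2"] by auto
  qed
  have degf: "degree f \<le> m - r" by (rule degree_le) (simp add: cf)
  have "\<exists>\<epsilon>>0. \<forall>g. degree g = m - r \<longrightarrow>
       (\<forall>i\<le>m - r. norm (coeff g i - complex_of_real (c (r + i) (\<lambda>_. 0))) \<le> \<epsilon>) \<longrightarrow>
       (\<forall>l. norm l \<le> A \<longrightarrow> poly g l = 0 \<longrightarrow> Re l \<le> - d)" for A
  proof -
    obtain e where e: "0 < e" "\<And>l. l \<in> cball 0 A \<inter> {l. - d \<le> Re l} \<Longrightarrow> e \<le> norm (poly f l)"
    proof (rule compact_pos_lower_bound[of "cball 0 A \<inter> {l. - d \<le> Re l}" "\<lambda>l. norm (poly f l)"])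
      show "compact (cball 0 A \<inter> {l. - d \<le> Re l})"
        by (intro compact_Int_closed compact_cball closed_halfspace_Re_ge)
      show "continuous_on (cball 0 A \<inter> {l. - d \<le> Re l}) (\<lambda>l. norm (poly f l))"
        by (intro continuous_intros)
      show "0 < norm (poly f l)" if "l \<in> cball 0 A \<inter> {l. - d \<le> Re l}" for l
        using d(2)[of l] that by auto
    qed blast
    define A1 where "A1 = max A 1"
    define W where "W = real (Suc (m - r)) * A1 ^ (m - r)"
    have W: "0 < W" unfolding W_def A1_def by simp
    show ?thesis
    proof (intro exI[of _ "e / (2 * W)"] conjI allI impI)
      show "0 < e / (2 * W)" using e W by simp
      fix g l
      assume dg: "degree g = m - r" and g: "\<forall>i\<le>m - r. norm (coeff g i - complex_of_real (c (r + i) (\<lambda>_. 0))) \<le> e / (2 * W)"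
        and l: "norm l \<le> A" "poly g l = 0"
      have cc: "norm (coeff (f - g) i) \<le> e / (2 * W)" for i
      proof (cases "i \<le> m - r")
        case True
        then show ?thesis using g by (simp add: cf norm_minus_commute)
      next
        case False
        then show ?thesis using dg e W by (simp add: cf coeff_eq_0)
      qed
      have "norm (poly (f - g) l) \<le> real (Suc (m - r)) * (e / (2 * W)) * A1 ^ (m - r)"
        by (rule norm_poly_le[OF _ cc]) (use degf dg l in \<open>auto simp: A1_def intro: degree_diff_le\<close>)
      also have "\<dots> = W * (e / (2 * W))" by (simp add: W_def)
      also have "\<dots> = e / 2" using W by simp
      finally have "norm (poly f l) \<le> e / 2" using l by simp
      then show "Re l \<le> - d" using e(2)[of l] e(1) l by (force simp: not_le)
    qed
  qed
  then show ?thesis using that[OF d(1)] by blast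
qed

text \<open>
  The first summand on the right compares slow modes with the profile: the numerators of their
  coefficients are \<open>\<Sum>\<^bsub>j \<ge> r - 1\<^esub> c\<^bsub>j+1,0\<^esub> y\<^sub>j + O(\<rho>)\<close>, since the quotient of the characteristic polynomial by \<open>X - \<lambda>\<close>
  has nearly the coefficients \<open>c\<^bsub>j+1,0\<^esub>\<close>. The second one is the contribution of the fast exponents. Its factor
  \<open>\<rho>\<^sup>k / \<rho>\<^bsup>r-1\<^esup>\<close> comes from the slow modes, which are subtracted from \<open>y\<close> and have coefficients of size \<open>\<rho>\<^bsup>-(r-1)\<^esup>\<close>.
\<close>

lemma low_frequencies:
  obtains \<epsilon> C \<kappa> d where "0 < \<epsilon>" "\<epsilon> \<le> 1" "0 < C" "0 < \<kappa>" "0 < d"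
    "\<And>\<rho> \<omega> y t M. \<lbrakk>0 < \<rho>; \<rho> \<le> \<epsilon>; norm \<omega> = 1; 0 \<le> t; \<And>n. shift_act (Q (\<rho> *\<^sub>R \<omega>)) y n = 0\<rbrakk> \<Longrightarrow>
       norm (egf (\<lambda>n. y (n + k)) t - slow_profile k M t \<omega> \<rho> / of_real (\<rho> ^ (r - 1)))
       \<le> C * (\<rho> ^ k / \<rho> ^ (r - 1)) * exp (- \<kappa> * \<rho>\<^sup>2 * t) *
           (norm ((\<Sum>j\<in>{r - 1..<m}. of_real (c (Suc j) (\<lambda>_. 0)) * y j) - M) + \<rho> * ((\<Sum>j<m. norm (y j)) + norm M))
         + C * (1 + \<rho> ^ k / \<rho> ^ (r - 1)) * exp (- d * t) * (\<Sum>j<m. norm (y j))"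
proof -
  obtain K0 where K0: "0 < K0" "\<And>l k (\<omega> :: real ^ 'n). l \<le> m \<Longrightarrow> norm \<omega> = 1 \<Longrightarrow> \<bar>coeff (symb c l \<omega>) k\<bar> \<le> K0"
    using coeff_symb_sphere_bounded by blast
  obtain Z \<delta> \<kappa> where Z: "1 \<le> Z" and \<delta>: "0 < \<delta>" and \<kappa>: "0 < \<kappa>"
    and Zb: "\<And>(\<omega> :: real ^ 'n) b. norm \<omega> = 1 \<Longrightarrow> poly (symb c r \<omega>) b = 0 \<Longrightarrow> \<bar>b\<bar> \<le> Z"
    and \<delta>b: "\<And>(\<omega> :: real ^ 'n) b. norm \<omega> = 1 \<Longrightarrow> poly (symb c r \<omega>) b = 0 \<Longrightarrow> \<delta> \<le> \<bar>poly (pderiv (symb c r \<omega>)) b\<bar>"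
    and \<kappa>b: "\<And>(\<omega> :: real ^ 'n) b. norm \<omega> = 1 \<Longrightarrow> poly (symb c r \<omega>) b = 0 \<Longrightarrow>
       poly (symb c (Suc r) \<omega>) b / poly (pderiv (symb c r \<omega>)) b \<le> - \<kappa>"
    and slow: "\<And>(\<omega> :: real ^ 'n) b \<rho>. norm \<omega> = 1 \<Longrightarrow> poly (symb c r \<omega>) b = 0 \<Longrightarrow> 0 \<le> \<rho> \<Longrightarrow>
       norm (slow_exponent \<omega> \<rho> b) \<le> Z * (\<rho> + \<rho>\<^sup>2)"
    by (rule slow_constants, rule that)
  define B where "B \<omega> = {z. poly (csymb c r \<omega>) z = 0}" for \<omega> :: "real ^ 'n"
  define F where "F \<omega> \<tau> = (\<Sum>i\<le>m - r. smult (\<tau> ^ i) (csymb c (r + i) \<omega>))" for \<omega> :: "real ^ 'n" and \<tau>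
  have B_eq: "B \<omega> = complex_of_real ` {b. poly (symb c r \<omega>) b = 0}" if "norm \<omega> = 1" for \<omega>
    using that strictly_hyperbolic_card_roots(3)[of c r \<omega>, OF sh_r lead_r] by (simp add: B_def)
  have B_real: "\<exists>b. z = of_real b \<and> poly (symb c r \<omega>) b = 0" if "norm \<omega> = 1" "z \<in> B \<omega>" for z \<omega>
    using that B_eq by auto
  obtain \<epsilon>1 C1 where \<epsilon>1: "0 < \<epsilon>1" "\<epsilon>1 \<le> 1" and C1: "0 < C1"
    and pert: "\<And>\<omega> \<tau>. \<omega> \<in> {\<omega> :: real ^ 'n. norm \<omega> = 1} \<Longrightarrow> norm \<tau> \<le> \<epsilon>1 \<Longrightarrow> \<exists>\<zeta>. inj_on \<zeta> (B \<omega>) \<and>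
       (\<forall>b\<in>B \<omega>. poly (F \<omega> \<tau>) (\<zeta> b) = 0 \<and> norm (\<zeta> b - b) \<le> C1 * norm \<tau> \<and> norm (\<zeta> b - b) \<le> 1 \<and>
          norm (\<zeta> b - b + \<tau> * (poly (csymb c (r + 1) \<omega>) b / poly (pderiv (csymb c (r + 0) \<omega>)) b)) \<le> C1 * (norm \<tau>)\<^sup>2 \<and>
          norm (poly (pderiv (F \<omega> \<tau>)) (\<zeta> b) - poly (pderiv (csymb c (r + 0) \<omega>)) b) \<le> C1 * norm \<tau>)"
  proof (rule root_perturbation[of "m - r" "{\<omega> :: real ^ 'n. norm \<omega> = 1}" "\<lambda>i \<omega>. csymb c (r + i) \<omega>" m K0 Z \<delta> B], goal_cases)
    case (2 i w)
    then show ?case using degree_symb_le[of c "r + i" w] rm by simp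
  next
    case (6 w b)
    then show ?case by (simp add: B_def)
  next
    case (7 w b)
    then show ?case using B_real[of w b] Zb[of w] by auto
  next
    case (8 w b)
    then show ?case using B_real[of w b] \<delta>b[of w] by auto
  next
    case (9 \<epsilon> C)
    then show ?case using that unfolding F_def by blast
  qed (use rm K0 Z \<delta> in auto)
  obtain K where K: "0 < K" "\<And>\<xi> i. norm \<xi> \<le> 1 \<Longrightarrow> norm (coeff (Q \<xi>) i) \<le> K"
    and K': "\<And>\<xi> i. \<xi> \<noteq> 0 \<Longrightarrow> norm \<xi> \<le> 1 \<Longrightarrow>
       norm (coeff (Q \<xi>) i - (if r \<le> i \<and> i \<le> m then of_real (c i (\<lambda>_. 0)) else 0)) \<le> K * norm \<xi>"
    using coeff_Q_bound by metis
  define L where "L = 2 * Z"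
  have L: "1 \<le> L" using Z by (simp add: L_def)
  define X where "X = 1 + real m * K"
  have X: "1 \<le> X" using K by (simp add: X_def)
  obtain d where d: "0 < d" and dA: "\<And>A. \<exists>\<epsilon>>0. \<forall>g. degree g = m - r \<longrightarrow>
       (\<forall>i\<le>m - r. norm (coeff g i - complex_of_real (c (r + i) (\<lambda>_. 0))) \<le> \<epsilon>) \<longrightarrow>
       (\<forall>l. norm l \<le> A \<longrightarrow> poly g l = 0 \<longrightarrow> Re l \<le> - d)"
    using fast_factor_stable by blast
  obtain \<epsilon>2 where \<epsilon>2: "0 < \<epsilon>2" and stab: "\<And>g l. degree g = m - r \<Longrightarrow>
       (\<And>i. i \<le> m - r \<Longrightarrow> norm (coeff g i - complex_of_real (c (r + i) (\<lambda>_. 0))) \<le> \<epsilon>2) \<Longrightarrow>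
       norm l \<le> X \<Longrightarrow> poly g l = 0 \<Longrightarrow> Re l \<le> - d"
    using dA[of X] by blast
  define G1 where "G1 = real r * real (Suc m) ^ r * K * L + K"
  have G1: "0 < G1" unfolding G1_def using K L by (intro add_nonneg_pos) auto
  \<comment> \<open>The entries make the expansion of the exponents valid, the slow exponents at most \<open>1\<close>,
    the derivatives at them and their decay rates at least half of the limits, and the fast exponents stable.\<close>
  define \<epsilon> where "\<epsilon> = Min {\<epsilon>1, 1 / L, \<delta> / (2 * C1), \<kappa> / (2 * C1), \<epsilon>2 / G1}"
  have \<epsilon>: "0 < \<epsilon>" "\<epsilon> \<le> \<epsilon>1" "\<epsilon> \<le> 1 / L" "\<epsilon> \<le> \<delta> / (2 * C1)" "\<epsilon> \<le> \<kappa> / (2 * C1)" "\<epsilon> \<le> \<epsilon>2 / G1"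
    unfolding \<epsilon>_def using \<epsilon>1 L \<delta> C1 \<kappa> \<epsilon>2 G1 by auto
  obtain G where G: "0 < G" and modes:
    "\<And>\<rho> l \<mu> N M D d t. \<lbrakk>0 < \<rho>; \<rho> \<le> 1; norm l \<le> L * \<rho>; norm \<mu> \<le> L * \<rho>; norm (l - \<mu>) \<le> C1 * \<rho> ^ 3;
       Re l \<le> - (\<kappa> / 2) * \<rho>\<^sup>2; Re \<mu> \<le> - (\<kappa> / 2) * \<rho>\<^sup>2; \<delta> / 2 \<le> norm D; \<delta> / 2 \<le> norm d; norm (D - d) \<le> C1 * \<rho>; 0 \<le> t\<rbrakk> \<Longrightarrow>
      norm (l ^ k * (N / D) * exp (l * of_real t) - \<mu> ^ k * (M / d) * exp (\<mu> * of_real t))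
      \<le> G * \<rho> ^ k * exp (- ((\<kappa> / 2) / 2) * \<rho>\<^sup>2 * t) * (norm (N - M) + \<rho> * norm M)"
    using mode_comparison[of C1 L "\<kappa> / 2" "\<delta> / 2" k] C1 L \<kappa> \<delta> by (metis half_gt_zero less_imp_le)
  obtain C0 where C0: "0 < C0" "\<And>t. 0 \<le> t \<Longrightarrow> (2 + t) ^ (m - r) * exp (- d * t) \<le> C0 * exp (- (d / 2) * t)"
    using poly_times_exp_decay[OF d] by blast
  define H where "H = real m * K * L + K"
  define H' where "H' = real m * K"
  have H: "0 < H" "0 \<le> H'" using K L by (auto simp: H_def H'_def intro: add_nonneg_pos)
  define HL where "HL = L ^ k * (H' / (\<delta> / 2))"
  have HL: "0 \<le> HL" using H L \<delta> by (simp add: HL_def)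
  define V where "V = X ^ (k + m) + real r * HL"
  have V: "0 < V" unfolding V_def using X HL by (intro add_pos_nonneg) auto
  define C where "C = real r * G * (1 + H) + V * (1 + X) ^ (m - r) * C0"
  have Cpos: "0 < V * (1 + X) ^ (m - r) * C0" using V X C0 by simp
  have C: "0 < C" "real r * G * (1 + H) \<le> C" "V * (1 + X) ^ (m - r) * C0 \<le> C"
    unfolding C_def using Cpos G H by (auto intro: add_nonneg_pos)
  have main: "norm (egf (\<lambda>n. y (n + k)) t - slow_profile k M t \<omega> \<rho> / of_real (\<rho> ^ (r - 1)))
       \<le> C * (\<rho> ^ k / \<rho> ^ (r - 1)) * exp (- (\<kappa> / 4) * \<rho>\<^sup>2 * t) *
           (norm ((\<Sum>j\<in>{r - 1..<m}. of_real (c (Suc j) (\<lambda>_. 0)) * y j) - M) + \<rho> * ((\<Sum>j<m. norm (y j)) + norm M))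
         + C * (1 + \<rho> ^ k / \<rho> ^ (r - 1)) * exp (- (d / 2) * t) * (\<Sum>j<m. norm (y j))"
    if \<rho>0: "0 < \<rho>" and \<rho>\<epsilon>: "\<rho> \<le> \<epsilon>" and \<omega>: "norm \<omega> = 1" and t: "0 \<le> t"
      and y: "\<And>n. shift_act (Q (\<rho> *\<^sub>R \<omega>)) y n = 0" for \<rho> \<omega> y t M
  proof -
    define \<xi> where "\<xi> = \<rho> *\<^sub>R \<omega>"
    define i\<rho> where "i\<rho> = \<i> * complex_of_real \<rho>"
    have i\<rho>: "i\<rho> \<noteq> 0" "norm i\<rho> = \<rho>" using \<rho>0 by (auto simp: i\<rho>_def norm_mult)
    have n\<xi>: "norm \<xi> = \<rho>" "\<xi> \<noteq> 0" using \<rho>0 \<omega> by (auto simp: \<xi>_def)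
    have \<rho>1: "\<rho> \<le> 1" using \<rho>\<epsilon> \<epsilon> \<epsilon>1 by linarith
    have L\<rho>: "L * \<rho> \<le> 1"
    proof -
      have "L * \<rho> \<le> L * (1 / L)" using \<rho>\<epsilon> \<epsilon>(3) L by (intro mult_left_mono) auto
      then show ?thesis using L by simp
    qed
    have C1\<rho>: "C1 * \<rho> \<le> \<delta> / 2" "C1 * \<rho> \<le> \<kappa> / 2"
    proof -
      have "C1 * \<rho> \<le> C1 * (\<delta> / (2 * C1))" "C1 * \<rho> \<le> C1 * (\<kappa> / (2 * C1))"
        using \<rho>\<epsilon> \<epsilon>(4,5) C1 by (intro mult_left_mono; simp)+
      moreover have "C1 * (\<delta> / (2 * C1)) = \<delta> / 2" "C1 * (\<kappa> / (2 * C1)) = \<kappa> / 2" using C1 by auto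
      ultimately show "C1 * \<rho> \<le> \<delta> / 2" "C1 * \<rho> \<le> \<kappa> / 2" by linarith+
    qed
    obtain \<zeta> where \<zeta>: "inj_on \<zeta> (B \<omega>)" and \<zeta>b:
       "\<And>b. b \<in> B \<omega> \<Longrightarrow> poly (F \<omega> i\<rho>) (\<zeta> b) = 0 \<and> norm (\<zeta> b - b) \<le> C1 * norm i\<rho> \<and> norm (\<zeta> b - b) \<le> 1 \<and>
          norm (\<zeta> b - b + i\<rho> * (poly (csymb c (r + 1) \<omega>) b / poly (pderiv (csymb c (r + 0) \<omega>)) b)) \<le> C1 * (norm i\<rho>)\<^sup>2 \<and>
          norm (poly (pderiv (F \<omega> i\<rho>)) (\<zeta> b) - poly (pderiv (csymb c (r + 0) \<omega>)) b) \<le> C1 * norm i\<rho>"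
      using pert[of \<omega> i\<rho>] \<omega> i\<rho> \<rho>\<epsilon> \<epsilon>(2) by auto
    define la where "la b = i\<rho> * \<zeta> b" for b
    define \<Lambda> where "\<Lambda> = la ` B \<omega>"
    have finB: "finite (B \<omega>)" and cardB: "card (B \<omega>) = r"
      using strictly_hyperbolic_card_roots[of c r \<omega>, OF sh_r lead_r \<omega>]
      by (auto simp: B_def card_image inj_on_def)
    have inj: "inj_on la (B \<omega>)" using \<zeta> i\<rho> unfolding inj_on_def la_def by simp
    have fin: "finite \<Lambda>" and card: "card \<Lambda> = r" using finB cardB inj by (auto simp: \<Lambda>_def card_image)
    have root: "poly (Q \<xi>) l = 0" if "l \<in> \<Lambda>" for l
      using that \<zeta>b Q_low(1)[OF \<rho>0, of \<omega>] unfolding \<Lambda>_def la_def \<xi>_def F_def i\<rho>_def by auto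
    define D where "D z = poly (pderiv (F \<omega> i\<rho>)) (\<zeta> z)" for z
    have Q': "poly (pderiv (Q \<xi>)) (la z) = i\<rho> ^ (r - 1) * D z" for z
      using Q_low(2)[OF \<rho>0, of \<omega> "\<zeta> z"] unfolding la_def \<xi>_def F_def i\<rho>_def D_def by simp
    have zfacts: "norm (la z) \<le> L * \<rho>" "norm (la z - slow_exponent \<omega> \<rho> b) \<le> C1 * \<rho> ^ 3"
        "Re (la z) \<le> - (\<kappa> / 2) * \<rho>\<^sup>2" "Re (slow_exponent \<omega> \<rho> b) \<le> - (\<kappa> / 2) * \<rho>\<^sup>2"
        "\<delta> / 2 \<le> norm (D z)" "norm (D z - of_real (poly (pderiv (symb c r \<omega>)) b)) \<le> C1 * \<rho>"
      if z: "z \<in> B \<omega>" and b: "z = of_real b" "poly (symb c r \<omega>) b = 0" for z b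
    proof -
      note zb = \<zeta>b[OF z]
      have "norm (\<zeta> z) \<le> norm (\<zeta> z - z) + norm z" using norm_triangle_sub[of "\<zeta> z" z] by simp
      also have "\<dots> \<le> 1 + Z" using zb Zb[OF \<omega> b(2)] b by (intro add_mono) auto
      also have "\<dots> \<le> L" using Z by (simp add: L_def)
      finally show "norm (la z) \<le> L * \<rho>" using \<rho>0 i\<rho> by (simp add: la_def norm_mult mult.commute)
      define q where "q = poly (symb c (Suc r) \<omega>) b / poly (pderiv (symb c r \<omega>)) b"
      have q: "q \<le> - \<kappa>" using \<kappa>b[OF \<omega> b(2)] by (simp add: q_def)
      define err where "err = \<zeta> z - z + i\<rho> * of_real q"
      have err: "norm err \<le> C1 * \<rho>\<^sup>2" using zb b i\<rho> by (simp add: err_def q_def)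
      have "la z - slow_exponent \<omega> \<rho> b = i\<rho> * err"
        by (simp add: la_def err_def slow_exponent_def q_def[symmetric] b(1) i\<rho>_def algebra_simps power2_eq_square)
      then have ls: "norm (la z - slow_exponent \<omega> \<rho> b) = \<rho> * norm err" using i\<rho> by (simp add: norm_mult)
      also have "\<dots> \<le> \<rho> * (C1 * \<rho>\<^sup>2)" using err \<rho>0 by (intro mult_left_mono) auto
      finally show ls': "norm (la z - slow_exponent \<omega> \<rho> b) \<le> C1 * \<rho> ^ 3" by (simp add: power3_eq_cube power2_eq_square mult_ac)
      have Re_s: "Re (slow_exponent \<omega> \<rho> b) = \<rho>\<^sup>2 * q" unfolding slow_exponent_def q_def by simp
      have q\<rho>: "\<rho>\<^sup>2 * q \<le> \<rho>\<^sup>2 * (- \<kappa>)" by (intro mult_left_mono q) auto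
      have \<kappa>\<rho>: "0 \<le> \<kappa> * \<rho>\<^sup>2" using \<kappa> by simp
      show "Re (slow_exponent \<omega> \<rho> b) \<le> - (\<kappa> / 2) * \<rho>\<^sup>2" unfolding Re_s using q\<rho> \<kappa>\<rho> by (simp add: mult.commute)
      have "Re (la z) = Re (slow_exponent \<omega> \<rho> b) + Re (la z - slow_exponent \<omega> \<rho> b)" by simp
      also have "\<dots> \<le> \<rho>\<^sup>2 * (- \<kappa>) + (C1 * \<rho>) * \<rho>\<^sup>2"
        using q\<rho> ls' complex_Re_le_cmod[of "la z - slow_exponent \<omega> \<rho> b"] unfolding Re_s
        by (simp add: power3_eq_cube power2_eq_square mult_ac)
      also have "\<dots> \<le> \<rho>\<^sup>2 * (- \<kappa>) + (\<kappa> / 2) * \<rho>\<^sup>2" by (intro add_left_mono mult_right_mono C1\<rho>) auto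
      finally show "Re (la z) \<le> - (\<kappa> / 2) * \<rho>\<^sup>2" by (simp add: mult.commute)
      show Dd: "norm (D z - of_real (poly (pderiv (symb c r \<omega>)) b)) \<le> C1 * \<rho>"
        using zb b i\<rho> by (simp add: D_def)
      show "\<delta> / 2 \<le> norm (D z)"
        using Dd C1\<rho>(1) \<delta>b[OF \<omega> b(2)] norm_triangle_ineq2[of "complex_of_real (poly (pderiv (symb c r \<omega>)) b)" "D z"]
        by (simp add: norm_minus_commute)
    qed
    have la_le: "norm l \<le> L * \<rho>" if "l \<in> \<Lambda>" for l
      using that zfacts(1) B_real[OF \<omega>] unfolding \<Lambda>_def by blast
    have la_le1: "norm l \<le> 1" if "l \<in> \<Lambda>" for l using la_le[OF that] L\<rho> by linarith
    obtain g where g: "Q \<xi> = (\<Prod>l\<in>\<Lambda>. [:- l, 1:]) * g" using prod_linear_dvd[OF fin root] by (auto elim: dvdE)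
    have nz: "(\<Prod>l\<in>\<Lambda>. [:- l, 1:]) \<noteq> 0" "g \<noteq> 0" using g Q_nonzero[of \<xi>] by auto
    have degg: "degree g = m - r" using degree_mult_eq[OF nz] degree_prod_linear[OF fin] degree_Q[of \<xi>] g card by simp
    have leadg: "lead_coeff g = 1"
      using lead_coeff_mult[of "\<Prod>l\<in>\<Lambda>. [:- l, 1:]" g] lead_coeff_Q[of \<xi>] g by (simp add: lead_coeff_prod)
    have Q'nz: "poly (pderiv (Q \<xi>)) l \<noteq> 0" if "l \<in> \<Lambda>" for l
      using that zfacts(5) B_real[OF \<omega>] \<delta> Q' i\<rho> unfolding \<Lambda>_def by fastforce
    have g_nz: "poly g l \<noteq> 0" if "l \<in> \<Lambda>" for l
    proof
      assume "poly g l = 0"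
      moreover have "poly (\<Prod>l\<in>\<Lambda>. [:- l, 1:]) l = 0" using fin that by (auto simp: poly_prod prod_zero_iff)
      ultimately have "poly (pderiv (Q \<xi>)) l = 0" unfolding g by (simp add: pderiv_mult)
      then show False using Q'nz[OF that] by simp
    qed
    have KQ: "norm (coeff (Q \<xi>) i) \<le> K" for i using K(2)[of \<xi> i] n\<xi> \<rho>1 by simp
    have KQ': "norm (coeff (Q \<xi>) i - (if r \<le> i \<and> i \<le> m then of_real (c i (\<lambda>_. 0)) else 0)) \<le> K * \<rho>" for i
      using K'[of \<xi> i] n\<xi> \<rho>1 by simp
    have coeffg: "norm (coeff g i - complex_of_real (c (r + i) (\<lambda>_. 0))) \<le> \<epsilon>2" if "i \<le> m - r" for i
    proof -
      have "norm (coeff g i - coeff ((\<Prod>l\<in>\<Lambda>. [:- l, 1:]) * g) (i + card \<Lambda>)) \<le> real (card \<Lambda>) * real (Suc m) ^ card \<Lambda> * K * (L * \<rho>)"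
        by (rule norm_coeff_small_factors) (use fin g degree_Q[of \<xi>] KQ L\<rho> la_le L \<rho>0 in auto)
      then have 1: "norm (coeff g i - coeff (Q \<xi>) (i + r)) \<le> real r * real (Suc m) ^ r * K * (L * \<rho>)"
        unfolding g[symmetric] card .
      have 2: "norm (coeff (Q \<xi>) (i + r) - complex_of_real (c (r + i) (\<lambda>_. 0))) \<le> K * \<rho>"
      proof -
        have "i + r \<le> m" using that rm by simp
        then show ?thesis using KQ'[of "i + r"] by (simp add: add.commute)
      qed
      have "norm (coeff g i - complex_of_real (c (r + i) (\<lambda>_. 0))) \<le> G1 * \<rho>"
        using 1 2 norm_triangle_ineq[of "coeff g i - coeff (Q \<xi>) (i + r)" "coeff (Q \<xi>) (i + r) - complex_of_real (c (r + i) (\<lambda>_. 0))"]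
        by (simp add: G1_def algebra_simps)
      also have "\<dots> \<le> G1 * (\<epsilon>2 / G1)" using \<rho>\<epsilon> \<epsilon>(6) G1 by (intro mult_left_mono) auto
      finally show ?thesis using G1 by simp
    qed
    define h where "h l = (\<Prod>l'\<in>\<Lambda> - {l}. [:- l', 1:]) * g" for l
    define N where "N l = shift_act (h l) y 0" for l
    define e where "e l = N l / poly (pderiv (Q \<xi>)) l" for l
    define w where "w n = y n - (\<Sum>l\<in>\<Lambda>. l ^ n * e l)" for n
    define a where "a = (\<Sum>j<m. norm (y j))"
    have a: "0 \<le> a" "\<And>j. j < m \<Longrightarrow> norm (y j) \<le> a"
      unfolding a_def by (auto intro!: sum_nonneg member_le_sum)
    have gy: "norm (y n) \<le> a * X ^ n" for n
      unfolding X_def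
      by (rule linear_recurrence_growth[OF degree_Q lead_coeff_Q y[folded \<xi>_def]]) (use KQ K a in auto)
    have egy: "exp_growth y" by (rule exp_growthI[OF gy])
    have gw: "shift_act g w n = 0" for n
      using shift_act_split[OF fin _ g g_nz y[folded \<xi>_def], of n] card r1
      unfolding w_def e_def N_def h_def by fastforce
    have egw: "exp_growth w"
    proof -
      have "exp_growth (\<lambda>n. y n + (\<Sum>l\<in>\<Lambda>. (- e l) * l ^ n))"
        by (intro exp_growth_add egy exp_growth_sum exp_growth_cmult exp_growth_power)
      then show ?thesis by (simp add: w_def[abs_def] sum_negf mult.commute)
    qed
    have degh: "degree (h l) < m" "Q \<xi> = [:- l, 1:] * h l" if "l \<in> \<Lambda>" for l
    proof -
      show qh: "Q \<xi> = [:- l, 1:] * h l"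
        unfolding g h_def using prod.remove[OF fin that, of "\<lambda>l. [:- l, 1:]"] by (simp add: mult.assoc del: mult_pCons_left mult_pCons_right)
      have "h l \<noteq> 0" using qh Q_nonzero[of \<xi>] by auto
      then have "degree (Q \<xi>) = 1 + degree (h l)" unfolding qh by (subst degree_mult_eq) auto
      then show "degree (h l) < m" using degree_Q[of \<xi>] by simp
    qed
    have N_sum: "N l = (\<Sum>j<m. coeff (h l) j * y j)" if "l \<in> \<Lambda>" for l
    proof -
      have "N l = (\<Sum>j\<le>m - 1. coeff (h l) j * y (0 + j))"
        unfolding N_def by (rule shift_act_upto) (use degh(1)[OF that] in simp)
      also have "{..m - 1} = {..<m}" using rm by auto
      finally show ?thesis by simp
    qed
    have N_le: "norm (N l) \<le> H' * a" if "l \<in> \<Lambda>" for l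
    proof -
      have "norm (N l) \<le> (\<Sum>j<m. H' * norm (y j))"
        unfolding N_sum[OF that]
        by (rule sum_norm_le)
           (use norm_coeff_linear_factor_small(1)[OF degh(2,1)[OF that] KQ la_le1[OF that]] in \<open>auto simp: H'_def norm_mult intro!: mult_right_mono\<close>)
      then show ?thesis by (simp add: a_def sum_distrib_left)
    qed
    define M' where "M' = (\<Sum>j\<in>{r - 1..<m}. of_real (c (Suc j) (\<lambda>_. 0)) * y j)"
    have N_M': "norm (N l - M') \<le> H * \<rho> * a" if "l \<in> \<Lambda>" for l
    proof -
      have "M' = (\<Sum>j<m. (if r \<le> Suc j \<and> Suc j \<le> m then of_real (c (Suc j) (\<lambda>_. 0)) else 0) * y j)"
        unfolding M'_def by (rule sum.mono_neutral_cong_left) auto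
      then have "N l - M' = (\<Sum>j<m. (coeff (h l) j - (if r \<le> Suc j \<and> Suc j \<le> m then of_real (c (Suc j) (\<lambda>_. 0)) else 0)) * y j)"
        by (simp add: N_sum[OF that] sum_subtractf left_diff_distrib)
      also have "norm \<dots> \<le> (\<Sum>j<m. H * \<rho> * norm (y j))"
      proof (rule sum_norm_le)
        fix j
        let ?c = "if r \<le> Suc j \<and> Suc j \<le> m then complex_of_real (c (Suc j) (\<lambda>_. 0)) else 0"
        have "norm (coeff (h l) j - coeff (Q \<xi>) (Suc j)) \<le> real m * K * norm l"
          by (rule norm_coeff_linear_factor_small(2)[OF degh(2,1)[OF that] KQ la_le1[OF that]])
        also have "\<dots> \<le> real m * K * (L * \<rho>)" using la_le[OF that] K by (intro mult_left_mono) auto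
        finally have "norm (coeff (h l) j - ?c) \<le> real m * K * (L * \<rho>) + K * \<rho>"
          using KQ'[of "Suc j"] norm_triangle_ineq[of "coeff (h l) j - coeff (Q \<xi>) (Suc j)" "coeff (Q \<xi>) (Suc j) - ?c"]
          by simp
        also have "\<dots> = H * \<rho>" by (simp add: H_def algebra_simps)
        finally show "norm ((coeff (h l) j - ?c) * y j) \<le> H * \<rho> * norm (y j)"
          unfolding norm_mult by (rule mult_right_mono) simp
      qed
      finally show ?thesis by (simp add: a_def sum_distrib_left)
    qed
    have e_le: "norm (e l) \<le> H' / (\<delta> / 2) * a / \<rho> ^ (r - 1)" if "l \<in> \<Lambda>" for l
    proof -
      obtain z where z: "z \<in> B \<omega>" "l = la z" using \<open>l \<in> \<Lambda>\<close> by (auto simp: \<Lambda>_def)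
      obtain b where b: "z = of_real b" "poly (symb c r \<omega>) b = 0" using B_real[OF \<omega> z(1)] by blast
      have "\<rho> ^ (r - 1) * (\<delta> / 2) \<le> norm (poly (pderiv (Q \<xi>)) l)"
        using zfacts(5)[OF z(1) b] \<rho>0 i\<rho> by (simp add: z Q' norm_mult norm_power mult_left_mono)
      then have "norm (e l) \<le> (H' * a) / (\<rho> ^ (r - 1) * (\<delta> / 2))"
        unfolding e_def norm_divide by (intro frac_le) (use N_le[OF that] H a \<rho>0 \<delta> in auto)
      then show ?thesis by (simp add: field_simps)
    qed
    let ?q = "\<rho> ^ k / \<rho> ^ (r - 1)"
    have q0: "0 \<le> ?q" using \<rho>0 by simp
    have w_le: "norm (w (j + k)) \<le> V * (1 + ?q) * a" if "j < m - r" for j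
    proof -
      have "norm (w (j + k)) \<le> norm (y (j + k)) + norm (\<Sum>l\<in>\<Lambda>. l ^ (j + k) * e l)"
        unfolding w_def by (rule norm_triangle_ineq4)
      also have "norm (\<Sum>l\<in>\<Lambda>. l ^ (j + k) * e l) \<le> (\<Sum>l\<in>\<Lambda>. HL * a * ?q)"
      proof (rule sum_norm_le)
        fix l assume l: "l \<in> \<Lambda>"
        have "norm (l ^ (j + k)) \<le> \<rho> ^ k * L ^ k"
        proof -
          have "norm l ^ (j + k) \<le> norm l ^ k" using la_le1[OF l] by (intro power_decreasing) auto
          also have "\<dots> \<le> (L * \<rho>) ^ k" using la_le[OF l] by (intro power_mono) auto
          finally show ?thesis by (simp add: norm_power power_mult_distrib mult.commute)
        qed
        then have "norm (l ^ (j + k) * e l) \<le> (\<rho> ^ k * L ^ k) * (H' / (\<delta> / 2) * a / \<rho> ^ (r - 1))"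
          unfolding norm_mult by (rule mult_mono[OF _ e_le[OF l]]) (use \<rho>0 L in auto)
        then show "norm (l ^ (j + k) * e l) \<le> HL * a * ?q" by (simp add: HL_def mult_ac)
      qed
      also have "\<dots> = real r * HL * ?q * a" using card by simp
      also have "norm (y (j + k)) \<le> X ^ (k + m) * a"
      proof -
        have "X ^ (j + k) \<le> X ^ (k + m)" using that X by (intro power_increasing) auto
        then show ?thesis using gy[of "j + k"] mult_left_mono[of "X ^ (j + k)" "X ^ (k + m)" a] a by (simp add: mult.commute)
      qed
      also have "X ^ (k + m) * a + real r * HL * ?q * a \<le> V * (1 + ?q) * a"
      proof -
        have gen: "x + h * q \<le> (x + h) * (1 + q)" if "0 \<le> x * q + h" for x h q :: real
          using that by (simp add: algebra_simps)
        have "0 \<le> X ^ (k + m) * ?q + real r * HL"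
          by (intro add_nonneg_nonneg mult_nonneg_nonneg) (use X HL q0 in auto)
        then have "X ^ (k + m) + real r * HL * ?q \<le> V * (1 + ?q)" unfolding V_def by (rule gen)
        from mult_right_mono[OF this a(1)] show ?thesis by (simp only: distrib_right)
      qed
      finally show ?thesis by simp
    qed
    have fast: "norm (egf (\<lambda>n. w (n + k)) t) \<le> C * (1 + ?q) * exp (- (d / 2) * t) * a"
    proof -
      obtain ls where ls: "length ls = m - r" "g = (\<Prod>l\<leftarrow>ls. [:- l, 1:])"
        using complex_poly_factor_list[OF nz(2)] by (metis degg leadg smult_1_left)
      have rootg: "poly g l = 0" if "l \<in> set ls" for l
        unfolding ls(2) using that by (induction ls) (auto simp del: mult_pCons_left mult_pCons_right)
      have lX: "norm l \<le> X" if "l \<in> set ls" for l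
      proof -
        have "poly (Q \<xi>) l = 0" unfolding g using rootg[OF that] by simp
        then show ?thesis
          using poly_root_bound[of "Q \<xi>" m 1 K l] KQ degree_Q[of \<xi>] coeff_Q_top[of \<xi>] by (simp add: X_def)
      qed
      have "norm (egf (\<lambda>n. w (n + k)) t) \<le> (V * (1 + ?q) * a) * (1 + X) ^ length ls * (2 + t) ^ length ls * exp (- d * t)"
      proof (rule cascade_decay)
        show "exp_growth (\<lambda>n. w (n + k))" by (rule exp_growth_shift[OF egw])
        show "shift_act (\<Prod>l\<leftarrow>ls. [:- l, 1:]) (\<lambda>n. w (n + k)) n = 0" for n
          using gw[of "n + k"] unfolding ls(2)[symmetric] by (simp add: shift_act_shift)
        show "Re l \<le> - d" if "l \<in> set ls" for l
          by (rule stab[OF degg coeffg lX[OF that] rootg[OF that]])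
        show "norm (w (j + k)) \<le> V * (1 + ?q) * a" if "j < length ls" for j
          by (rule w_le) (use that ls in simp)
        show "0 \<le> V * (1 + ?q) * a" using V q0 a by simp
      qed (use lX X t in auto)
      also have "\<dots> = (V * (1 + ?q) * a * (1 + X) ^ (m - r)) * ((2 + t) ^ (m - r) * exp (- d * t))"
        by (simp only: ls mult_ac)
      also have "\<dots> \<le> (V * (1 + ?q) * a * (1 + X) ^ (m - r)) * (C0 * exp (- (d / 2) * t))"
        by (intro mult_left_mono C0 t) (use V q0 a X in simp)
      also have "\<dots> = (V * (1 + X) ^ (m - r) * C0) * ((1 + ?q) * exp (- (d / 2) * t) * a)"
        by (simp only: mult_ac)
      also have "\<dots> \<le> C * ((1 + ?q) * exp (- (d / 2) * t) * a)"
        by (rule mult_right_mono[OF C(3)]) (use q0 a in simp)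
      finally show ?thesis by (simp only: mult_ac)
    qed
    have slow_sum: "norm ((\<Sum>l\<in>\<Lambda>. l ^ k * e l * exp (l * of_real t)) - slow_profile k M t \<omega> \<rho> / of_real (\<rho> ^ (r - 1)))
       \<le> C * ?q * exp (- (\<kappa> / 4) * \<rho>\<^sup>2 * t) * (norm (M' - M) + \<rho> * (a + norm M))"
    proof -
      define R where "R = {b. poly (symb c r \<omega>) b = 0}"
      define P' where "P' b = poly (pderiv (symb c r \<omega>)) b" for b
      define \<mu> where "\<mu> b = slow_exponent \<omega> \<rho> b" for b
      define E where "E = exp (- (\<kappa> / 4) * \<rho>\<^sup>2 * t)"
      have BR: "B \<omega> = complex_of_real ` R" unfolding R_def by (rule B_eq[OF \<omega>])
      have cardR: "card R = r" unfolding R_def by (rule strictly_hyperbolic_card_roots(2)[of c r \<omega>, OF sh_r lead_r \<omega>])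
      let ?l = "\<lambda>b. la (complex_of_real b)"
      have "(\<Sum>l\<in>\<Lambda>. l ^ k * e l * exp (l * of_real t)) = (\<Sum>z\<in>B \<omega>. la z ^ k * e (la z) * exp (la z * of_real t))"
        unfolding \<Lambda>_def by (simp add: sum.reindex[OF inj])
      also have "\<dots> = (\<Sum>b\<in>R. ?l b ^ k * e (?l b) * exp (?l b * of_real t))"
        unfolding BR by (subst sum.reindex) (auto simp: inj_on_def)
      also have "\<dots> = (\<Sum>b\<in>R. ?l b ^ k * (N (?l b) / D (of_real b)) * exp (?l b * of_real t)) / i\<rho> ^ (r - 1)"
        unfolding e_def Q' sum_divide_distrib by (simp add: mult_ac)
      finally have 1: "(\<Sum>l\<in>\<Lambda>. l ^ k * e l * exp (l * of_real t))
        = (\<Sum>b\<in>R. ?l b ^ k * (N (?l b) / D (of_real b)) * exp (?l b * of_real t)) / i\<rho> ^ (r - 1)" .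
      have 2: "slow_profile k M t \<omega> \<rho> / of_real (\<rho> ^ (r - 1))
        = (\<Sum>b\<in>R. \<mu> b ^ k * (M / of_real (P' b)) * exp (\<mu> b * of_real t)) / i\<rho> ^ (r - 1)"
        by (simp add: slow_profile_def R_def \<mu>_def P'_def i\<rho>_def power_mult_distrib)
      have each: "norm (?l b ^ k * (N (?l b) / D (of_real b)) * exp (?l b * of_real t) - \<mu> b ^ k * (M / of_real (P' b)) * exp (\<mu> b * of_real t))
          \<le> G * \<rho> ^ k * E * ((norm (M' - M) + H * \<rho> * a) + \<rho> * norm M)" if "b \<in> R" for b
      proof -
        have z: "of_real b \<in> B \<omega>" "poly (symb c r \<omega>) b = 0" using that BR by (auto simp: R_def)
        have l: "?l b \<in> \<Lambda>" using z by (simp add: \<Lambda>_def)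
        have \<mu>L: "norm (\<mu> b) \<le> L * \<rho>"
        proof -
          have "norm (\<mu> b) \<le> Z * (\<rho> + \<rho>\<^sup>2)" unfolding \<mu>_def by (rule slow[OF \<omega> z(2)]) (use \<rho>0 in simp)
          also have "\<dots> \<le> Z * (\<rho> + \<rho> * 1)"
            unfolding power2_eq_square by (intro mult_left_mono add_left_mono) (use Z \<rho>0 \<rho>1 in auto)
          finally show ?thesis by (simp add: L_def mult_ac)
        qed
        have "norm (?l b ^ k * (N (?l b) / D (of_real b)) * exp (?l b * of_real t) - \<mu> b ^ k * (M / of_real (P' b)) * exp (\<mu> b * of_real t))
          \<le> G * \<rho> ^ k * exp (- ((\<kappa> / 2) / 2) * \<rho>\<^sup>2 * t) * (norm (N (?l b) - M) + \<rho> * norm M)"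
        proof (rule modes[OF \<rho>0 \<rho>1 _ \<mu>L])
          show "norm (?l b) \<le> L * \<rho>" by (rule la_le[OF l])
          show "\<delta> / 2 \<le> norm (complex_of_real (P' b))" using \<delta>b[OF \<omega> z(2)] \<delta> by (simp add: P'_def)
        qed (use zfacts[OF z(1) refl z(2)] t in \<open>auto simp: \<mu>_def P'_def\<close>)
        also have "\<dots> = G * \<rho> ^ k * E * (norm (N (?l b) - M) + \<rho> * norm M)" by (simp add: E_def)
        also have "\<dots> \<le> G * \<rho> ^ k * E * ((norm (M' - M) + H * \<rho> * a) + \<rho> * norm M)"
        proof (rule mult_left_mono)
          show "norm (N (?l b) - M) + \<rho> * norm M \<le> (norm (M' - M) + H * \<rho> * a) + \<rho> * norm M"
            using N_M'[OF l] norm_triangle_ineq[of "N (?l b) - M'" "M' - M"] by simp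
        qed (use G \<rho>0 in \<open>simp add: E_def\<close>)
        finally show ?thesis .
      qed
      have "norm ((\<Sum>l\<in>\<Lambda>. l ^ k * e l * exp (l * of_real t)) - slow_profile k M t \<omega> \<rho> / of_real (\<rho> ^ (r - 1)))
         = norm (\<Sum>b\<in>R. ?l b ^ k * (N (?l b) / D (of_real b)) * exp (?l b * of_real t) - \<mu> b ^ k * (M / of_real (P' b)) * exp (\<mu> b * of_real t)) / \<rho> ^ (r - 1)"
        unfolding 1 2 sum_subtractf diff_divide_distrib[symmetric] norm_divide norm_power i\<rho> ..
      also have "\<dots> \<le> (\<Sum>b\<in>R. G * \<rho> ^ k * E * ((norm (M' - M) + H * \<rho> * a) + \<rho> * norm M)) / \<rho> ^ (r - 1)"
        by (intro divide_right_mono sum_norm_le each) (use \<rho>0 in auto)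
      also have "\<dots> = real r * G * (?q * E) * ((norm (M' - M) + H * \<rho> * a) + \<rho> * norm M)" using cardR by simp
      also have "\<dots> \<le> real r * G * (?q * E) * ((1 + H) * (norm (M' - M) + \<rho> * (a + norm M)))"
      proof (rule mult_left_mono)
        have "0 \<le> H * norm (M' - M) + (\<rho> * a + H * (\<rho> * norm M))" using H \<rho>0 a by simp
        then show "norm (M' - M) + H * \<rho> * a + \<rho> * norm M \<le> (1 + H) * (norm (M' - M) + \<rho> * (a + norm M))"
          by (simp add: algebra_simps)
      qed (intro mult_nonneg_nonneg, use G q0 in \<open>auto simp: E_def\<close>)
      also have "\<dots> = (real r * G * (1 + H)) * (?q * E * (norm (M' - M) + \<rho> * (a + norm M)))" by (simp only: mult_ac)
      also have "\<dots> \<le> C * (?q * E * (norm (M' - M) + \<rho> * (a + norm M)))"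
        by (rule mult_right_mono[OF C(2)]) (use q0 \<rho>0 a in \<open>simp add: E_def\<close>)
      finally show ?thesis by (simp only: E_def mult_ac)
    qed
    have "egf (\<lambda>n. y (n + k)) t = egf (\<lambda>n. w (n + k) + (\<Sum>l\<in>\<Lambda>. (l ^ k * e l) * l ^ n)) t"
      by (rule arg_cong[of _ _ "\<lambda>f. egf f t"]) (simp add: w_def power_add mult_ac fun_eq_iff)
    also have "\<dots> = egf (\<lambda>n. w (n + k)) t + (\<Sum>l\<in>\<Lambda>. egf (\<lambda>n. (l ^ k * e l) * l ^ n) t)"
      by (subst egf_add) (auto intro!: egf_sum exp_growth_sum exp_growth_cmult exp_growth_power exp_growth_shift egw)
    also have "\<dots> = egf (\<lambda>n. w (n + k)) t + (\<Sum>l\<in>\<Lambda>. l ^ k * e l * exp (l * of_real t))"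
      by (simp add: egf_cmult exp_growth_power egf_power)
    finally have "norm (egf (\<lambda>n. y (n + k)) t - slow_profile k M t \<omega> \<rho> / of_real (\<rho> ^ (r - 1)))
      \<le> norm ((\<Sum>l\<in>\<Lambda>. l ^ k * e l * exp (l * of_real t)) - slow_profile k M t \<omega> \<rho> / of_real (\<rho> ^ (r - 1)))
        + norm (egf (\<lambda>n. w (n + k)) t)"
      using norm_triangle_ineq[of "(\<Sum>l\<in>\<Lambda>. l ^ k * e l * exp (l * of_real t)) - slow_profile k M t \<omega> \<rho> / of_real (\<rho> ^ (r - 1))" "egf (\<lambda>n. w (n + k)) t"]
      by (simp add: algebra_simps)
    then show ?thesis using fast slow_sum unfolding M'_def a_def by linarith
  qed
  show ?thesis by (rule that[OF \<epsilon>(1) _ C(1) _ _ main]) (use \<epsilon> \<epsilon>1 \<kappa> d in auto)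
qed

end

section \<open>Weighted square-integrable functions\<close>

lemma L2_norm_sq_cong_AE:
  "AE x in lborel. f x = g x \<Longrightarrow> L2_norm_sq f = L2_norm_sq g"
  unfolding L2_norm_sq_def by (rule nn_integral_cong_AE) auto

lemma L2_norm_sq_add_le:
  fixes f g :: "'a::euclidean_space \<Rightarrow> complex"
  assumes [measurable]: "f \<in> borel_measurable lborel" "g \<in> borel_measurable lborel"
  shows "L2_norm_sq (\<lambda>x. f x + g x) \<le> 2 * L2_norm_sq f + 2 * L2_norm_sq g"
proof -
  have "(norm (f x + g x))\<^sup>2 \<le> 2 * (norm (f x))\<^sup>2 + 2 * (norm (g x))\<^sup>2" for x
  proof -
    have "(norm (f x + g x))\<^sup>2 \<le> (norm (f x) + norm (g x))\<^sup>2"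
      by (intro power_mono norm_triangle_ineq) auto
    also have "\<dots> \<le> 2 * (norm (f x))\<^sup>2 + 2 * (norm (g x))\<^sup>2"
      using zero_le_power2[of "norm (f x) - norm (g x)"] by (simp add: power2_sum power2_diff)
    finally show ?thesis .
  qed
  then have "ennreal ((norm (f x + g x))\<^sup>2) \<le> 2 * ennreal ((norm (f x))\<^sup>2) + 2 * ennreal ((norm (g x))\<^sup>2)" for x
  proof -
    have "ennreal ((norm (f x + g x))\<^sup>2) \<le> ennreal (2 * (norm (f x))\<^sup>2 + 2 * (norm (g x))\<^sup>2)"
      by (rule ennreal_leI) fact
    then show ?thesis by (simp add: ennreal_plus ennreal_mult)
  qed
  then have "L2_norm_sq (\<lambda>x. f x + g x)
      \<le> (\<integral>\<^sup>+ x. 2 * ennreal ((norm (f x))\<^sup>2) + 2 * ennreal ((norm (g x))\<^sup>2) \<partial>lborel)"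
    unfolding L2_norm_sq_def by (intro nn_integral_mono) auto
  also have "\<dots> = 2 * L2_norm_sq f + 2 * L2_norm_sq g"
    unfolding L2_norm_sq_def by (simp add: nn_integral_add nn_integral_cmult)
  finally show ?thesis .
qed

lemma L2_norm_sq_mono:
  "(\<And>x. norm (f x) \<le> norm (g x)) \<Longrightarrow> L2_norm_sq f \<le> L2_norm_sq g"
  unfolding L2_norm_sq_def by (intro nn_integral_mono ennreal_leI power_mono) auto

lemma L2_norm_sq_scale:
  assumes [measurable]: "f \<in> borel_measurable lborel"
  shows "L2_norm_sq (\<lambda>x. a * f x) = ennreal ((norm a)\<^sup>2) * L2_norm_sq f"
  unfolding L2_norm_sq_def
  by (simp add: norm_mult power_mult_distrib ennreal_mult nn_integral_cmult)

lemma L2_norm_sq_bound: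
  assumes [measurable]: "g \<in> borel_measurable lborel"
    and "\<And>x. norm (f x) \<le> C * norm (g x)" "0 \<le> C"
  shows "L2_norm_sq f \<le> ennreal (C\<^sup>2) * L2_norm_sq g"
proof -
  have "L2_norm_sq f \<le> L2_norm_sq (\<lambda>x. of_real C * g x)"
    by (rule L2_norm_sq_mono) (use assms in \<open>simp add: norm_mult\<close>)
  then show ?thesis by (simp add: L2_norm_sq_scale)
qed

lemma L2_norm_sq_eq_0_imp_AE:
  assumes [measurable]: "f \<in> borel_measurable lborel" and "L2_norm_sq f = 0"
  shows "AE x in lborel. f x = 0"
proof -
  have "AE x in lborel. ennreal ((norm (f x))\<^sup>2) = 0"
    using assms(2) unfolding L2_norm_sq_def by (subst (asm) nn_integral_0_iff_AE) auto
  then show ?thesis by eventually_elim simp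
qed

lemma sobolev_weight_measurable:
  assumes [measurable]: "F \<in> borel_measurable lborel"
  shows "sobolev_weight \<sigma> F \<in> borel_measurable lborel"
  unfolding sobolev_weight_def by measurable

lemma sobolev_weight_pos: "0 < (1 + (norm \<xi>)\<^sup>2) powr a"
  by (metis add_pos_nonneg powr_gt_zero zero_le_power2 zero_less_one less_irrefl)

lemma measurable_if_sobolev_weight_measurable:
  fixes F :: "'a::euclidean_space \<Rightarrow> complex"
  assumes [measurable]: "sobolev_weight \<sigma> F \<in> borel_measurable lborel"
  shows "F \<in> borel_measurable lborel"
proof -
  have "F = (\<lambda>\<xi>. ((1 + (norm \<xi>)\<^sup>2) powr (- (\<sigma> / 2))) *\<^sub>R sobolev_weight \<sigma> F \<xi>)"
  proof
    fix \<xi> :: 'a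
    have "(1 + (norm \<xi>)\<^sup>2) powr (- (\<sigma> / 2)) * (1 + (norm \<xi>)\<^sup>2) powr (\<sigma> / 2) = 1"
      using sobolev_weight_pos[of \<xi> "\<sigma> / 2"] by (simp add: powr_minus)
    then show "F \<xi> = ((1 + (norm \<xi>)\<^sup>2) powr (- (\<sigma> / 2))) *\<^sub>R sobolev_weight \<sigma> F \<xi>"
      by (simp add: sobolev_weight_def)
  qed
  moreover have "(\<lambda>\<xi>. ((1 + (norm \<xi>)\<^sup>2) powr (- (\<sigma> / 2))) *\<^sub>R sobolev_weight \<sigma> F \<xi>) \<in> borel_measurable lborel"
    by measurable
  ultimately show ?thesis by simp
qed

lemma in_sobolev_hat_measurable: "in_sobolev_hat \<sigma> F \<Longrightarrow> F \<in> borel_measurable lborel"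
  unfolding in_sobolev_hat_def in_L2_def by (blast intro: measurable_if_sobolev_weight_measurable)

lemma in_sobolev_hat_finite: "in_sobolev_hat \<sigma> F \<Longrightarrow> L2_norm_sq (sobolev_weight \<sigma> F) < \<infinity>"
  unfolding in_sobolev_hat_def in_L2_def by blast

lemma in_sobolev_hatI:
  "F \<in> borel_measurable lborel \<Longrightarrow> L2_norm_sq (sobolev_weight \<sigma> F) < \<infinity> \<Longrightarrow> in_sobolev_hat \<sigma> F"
  unfolding in_sobolev_hat_def in_L2_def by (blast intro: sobolev_weight_measurable)

lemma sobolev_weight_cong_AE:
  "AE \<xi> in lborel. F \<xi> = G \<xi> \<Longrightarrow> L2_norm_sq (sobolev_weight \<sigma> F) = L2_norm_sq (sobolev_weight \<sigma> G)"
  by (rule L2_norm_sq_cong_AE) (auto simp: sobolev_weight_def elim: eventually_mono)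

lemma in_sobolev_hat_cong_AE:
  assumes "in_sobolev_hat \<sigma> F" "AE \<xi> in lborel. F \<xi> = G \<xi>" "G \<in> borel_measurable lborel"
  shows "in_sobolev_hat \<sigma> G"
  using assms in_sobolev_hat_finite[OF assms(1)] sobolev_weight_cong_AE[OF assms(2), of \<sigma>]
  by (intro in_sobolev_hatI) auto

lemma sobolev_weight_add_le:
  fixes F G :: "'a::euclidean_space \<Rightarrow> complex"
  assumes "F \<in> borel_measurable lborel" "G \<in> borel_measurable lborel"
  shows "L2_norm_sq (sobolev_weight \<sigma> (\<lambda>\<xi>. F \<xi> + G \<xi>))
     \<le> 2 * L2_norm_sq (sobolev_weight \<sigma> F) + 2 * L2_norm_sq (sobolev_weight \<sigma> G)"
  using L2_norm_sq_add_le[OF sobolev_weight_measurable[OF assms(1)] sobolev_weight_measurable[OF assms(2)], of \<sigma> \<sigma>]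
  by (simp add: sobolev_weight_def scaleR_add_right)

lemma sobolev_weight_uminus: "L2_norm_sq (sobolev_weight \<sigma> (\<lambda>\<xi>. - F \<xi>)) = L2_norm_sq (sobolev_weight \<sigma> F)"
  by (simp add: L2_norm_sq_def sobolev_weight_def)

lemma in_sobolev_hat_add:
  fixes F G :: "'a::euclidean_space \<Rightarrow> complex"
  assumes "in_sobolev_hat \<sigma> F" "in_sobolev_hat \<sigma> G"
  shows "in_sobolev_hat \<sigma> (\<lambda>\<xi>. F \<xi> + G \<xi>)"
proof (rule in_sobolev_hatI)
  note [measurable] = in_sobolev_hat_measurable[OF assms(1)] in_sobolev_hat_measurable[OF assms(2)]
  show "(\<lambda>\<xi>. F \<xi> + G \<xi>) \<in> borel_measurable lborel" by measurable
  show "L2_norm_sq (sobolev_weight \<sigma> (\<lambda>\<xi>. F \<xi> + G \<xi>)) < \<infinity>"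
    by (rule le_less_trans[OF sobolev_weight_add_le])
       (use in_sobolev_hat_finite[OF assms(1)] in_sobolev_hat_finite[OF assms(2)] in
         \<open>auto simp: in_sobolev_hat_measurable[OF assms(1)] in_sobolev_hat_measurable[OF assms(2)] ennreal_mult_less_top\<close>)
qed

text \<open>
  A multiplier of order \<open>p\<close> maps \<open>H\<^sup>\<sigma>\<close> to \<open>H\<^bsup>\<sigma>-p\<^esup>\<close>.
\<close>

lemma multiplier_bound:
  fixes a F :: "'a::euclidean_space \<Rightarrow> complex"
  assumes "\<And>\<xi>. norm (a \<xi>) \<le> C * (1 + (norm \<xi>)\<^sup>2) powr (p / 2)" "0 \<le> C" and [measurable]: "F \<in> borel_measurable lborel"
  shows "L2_norm_sq (sobolev_weight (\<sigma> - p) (\<lambda>\<xi>. a \<xi> * F \<xi>)) \<le> ennreal (C\<^sup>2) * L2_norm_sq (sobolev_weight \<sigma> F)"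
proof (rule L2_norm_sq_bound[OF sobolev_weight_measurable])
  fix \<xi> :: 'a
  let ?w = "1 + (norm \<xi>)\<^sup>2"
  have w: "0 < ?w" by (metis add_pos_nonneg zero_le_power2 zero_less_one)
  have "norm (sobolev_weight (\<sigma> - p) (\<lambda>\<xi>. a \<xi> * F \<xi>) \<xi>) = ?w powr ((\<sigma> - p) / 2) * norm (a \<xi>) * norm (F \<xi>)"
    by (simp add: sobolev_weight_def norm_mult)
  also have "\<dots> \<le> ?w powr ((\<sigma> - p) / 2) * (C * ?w powr (p / 2)) * norm (F \<xi>)"
    by (intro mult_right_mono mult_left_mono assms) auto
  also have "\<dots> = C * (?w powr ((\<sigma> - p) / 2 + p / 2)) * norm (F \<xi>)" by (simp only: powr_add mult_ac)
  also have "(\<sigma> - p) / 2 + p / 2 = \<sigma> / 2" by (simp add: field_simps)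
  finally show "norm (sobolev_weight (\<sigma> - p) (\<lambda>\<xi>. a \<xi> * F \<xi>) \<xi>) \<le> C * norm (sobolev_weight \<sigma> F \<xi>)"
    by (simp add: sobolev_weight_def mult_ac)
qed (use assms in auto)

section \<open>Strong derivatives in Sobolev spaces\<close>

lemma at_within_Ici_neq_bot:
  assumes "0 \<le> (t::real)"
  shows "at t within {0..} \<noteq> bot"
proof -
  have "t islimpt {0..}"
  proof (rule connected_imp_perfect)
    fix x :: real
    show "{0..} \<noteq> {x}"
    proof
      assume e: "{0..} = {x}"
      have "0 \<in> {0::real..}" "1 \<in> {0::real..}" by auto
      then show False unfolding e by simp
    qed
  qed (use assms in auto)
  then show ?thesis by (simp add: trivial_limit_within)
qed

lemma eventually_at_Ici: "eventually (\<lambda>\<tau>. 0 \<le> \<tau>) (at (t::real) within {0..})"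
  by (auto simp: eventually_at_filter)

lemma has_sobolev_deriv_cong_AE:
  assumes "has_sobolev_deriv \<sigma> F G t" "\<And>\<tau>. 0 \<le> \<tau> \<Longrightarrow> AE \<xi> in lborel. F \<tau> \<xi> = F' \<tau> \<xi>"
    "AE \<xi> in lborel. G \<xi> = G' \<xi>" "G' \<in> borel_measurable lborel" "0 \<le> t"
  shows "has_sobolev_deriv \<sigma> F' G' t"
proof -
  have "eventually (\<lambda>\<tau>. L2_norm_sq (sobolev_weight \<sigma> (\<lambda>\<xi>. (F \<tau> \<xi> - F t \<xi>) / of_real (\<tau> - t) - G \<xi>))
       = L2_norm_sq (sobolev_weight \<sigma> (\<lambda>\<xi>. (F' \<tau> \<xi> - F' t \<xi>) / of_real (\<tau> - t) - G' \<xi>))) (at t within {0..})"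
    using eventually_at_Ici
  proof eventually_elim
    case (elim \<tau>)
    show ?case
      by (rule sobolev_weight_cong_AE) (use assms(2)[OF elim] assms(2)[OF assms(5)] assms(3) in eventually_elim, simp)
  qed
  from tendsto_cong[OF this] show ?thesis
    using assms(1) in_sobolev_hat_cong_AE[OF _ assms(3,4)]
    unfolding has_sobolev_deriv_def sobolev_hat_tendsto_def by blast
qed

lemma tendsto_ennreal_squeeze_0:
  fixes f g :: "'b \<Rightarrow> ennreal"
  assumes "(g \<longlongrightarrow> 0) net" "eventually (\<lambda>x. f x \<le> g x) net"
  shows "(f \<longlongrightarrow> 0) net"
  by (rule tendsto_sandwich[OF _ assms(2) tendsto_const assms(1)]) auto

lemma tendsto_ennreal_cmult_0:
  fixes f :: "'b \<Rightarrow> ennreal"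
  assumes "(f \<longlongrightarrow> 0) net" "c < \<infinity>"
  shows "((\<lambda>x. c * f x) \<longlongrightarrow> 0) net"
  using ennreal_tendsto_cmult[of c f 0 net] assms by auto

lemma has_sobolev_deriv_unique:
  assumes G: "has_sobolev_deriv \<sigma> F G t" and G': "has_sobolev_deriv \<sigma> F G' t" and t: "0 \<le> t"
    and F: "\<And>\<tau>. 0 \<le> \<tau> \<Longrightarrow> F \<tau> \<in> borel_measurable lborel"
  shows "AE \<xi> in lborel. G \<xi> = G' \<xi>"
proof -
  have mG[measurable]: "G \<in> borel_measurable lborel" "G' \<in> borel_measurable lborel"
    using G G' unfolding has_sobolev_deriv_def by (blast intro: in_sobolev_hat_measurable)+
  let ?q = "\<lambda>\<tau> \<xi>. (F \<tau> \<xi> - F t \<xi>) / of_real (\<tau> - t)"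
  let ?N = "\<lambda>F. L2_norm_sq (sobolev_weight \<sigma> F)"
  have l: "((\<lambda>\<tau>. 2 * ?N (\<lambda>\<xi>. ?q \<tau> \<xi> - G \<xi>)) \<longlongrightarrow> 0) (at t within {0..})" "((\<lambda>\<tau>. 2 * ?N (\<lambda>\<xi>. ?q \<tau> \<xi> - G' \<xi>)) \<longlongrightarrow> 0) (at t within {0..})"
    using G G' unfolding has_sobolev_deriv_def sobolev_hat_tendsto_def by (auto intro!: tendsto_ennreal_cmult_0)
  have "((\<lambda>\<tau>. ?N (\<lambda>\<xi>. G \<xi> - G' \<xi>)) \<longlongrightarrow> 0) (at t within {0..})"
  proof (rule tendsto_ennreal_squeeze_0)
    show "((\<lambda>\<tau>. 2 * ?N (\<lambda>\<xi>. ?q \<tau> \<xi> - G' \<xi>) + 2 * ?N (\<lambda>\<xi>. ?q \<tau> \<xi> - G \<xi>)) \<longlongrightarrow> 0) (at t within {0..})"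
      using tendsto_add[OF l(2,1)] by simp
    show "\<forall>\<^sub>F \<tau> in at t within {0..}. ?N (\<lambda>\<xi>. G \<xi> - G' \<xi>) \<le> 2 * ?N (\<lambda>\<xi>. ?q \<tau> \<xi> - G' \<xi>) + 2 * ?N (\<lambda>\<xi>. ?q \<tau> \<xi> - G \<xi>)"
      using eventually_at_Ici
    proof eventually_elim
      case (elim \<tau>)
      note [measurable] = F[OF elim] F[OF t]
      have "?N (\<lambda>\<xi>. (?q \<tau> \<xi> - G' \<xi>) + (- (?q \<tau> \<xi> - G \<xi>))) \<le> 2 * ?N (\<lambda>\<xi>. ?q \<tau> \<xi> - G' \<xi>) + 2 * ?N (\<lambda>\<xi>. - (?q \<tau> \<xi> - G \<xi>))"
        by (rule sobolev_weight_add_le) measurable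
      then show ?case unfolding sobolev_weight_uminus by (simp add: algebra_simps)
    qed
  qed
  then have "?N (\<lambda>\<xi>. G \<xi> - G' \<xi>) = 0"
    using tendsto_unique[OF at_within_Ici_neq_bot[OF t] tendsto_const] by blast
  then have "AE \<xi> in lborel. sobolev_weight \<sigma> (\<lambda>\<xi>. G \<xi> - G' \<xi>) \<xi> = 0"
    by (intro L2_norm_sq_eq_0_imp_AE sobolev_weight_measurable) auto
  then show ?thesis
  proof eventually_elim
    case (elim \<xi>)
    then show ?case using sobolev_weight_pos[of \<xi> "\<sigma> / 2"] by (auto simp: sobolev_weight_def)
  qed
qed

lemma has_sobolev_deriv_add:
  assumes F: "has_sobolev_deriv \<sigma> F G t" and F': "has_sobolev_deriv \<sigma> F' G' t" and t: "0 \<le> t"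
    and mF: "\<And>\<tau>. 0 \<le> \<tau> \<Longrightarrow> F \<tau> \<in> borel_measurable lborel" "\<And>\<tau>. 0 \<le> \<tau> \<Longrightarrow> F' \<tau> \<in> borel_measurable lborel"
  shows "has_sobolev_deriv \<sigma> (\<lambda>\<tau> \<xi>. F \<tau> \<xi> + F' \<tau> \<xi>) (\<lambda>\<xi>. G \<xi> + G' \<xi>) t"
  unfolding has_sobolev_deriv_def sobolev_hat_tendsto_def
proof
  have iG: "in_sobolev_hat \<sigma> G" "in_sobolev_hat \<sigma> G'" using F F' unfolding has_sobolev_deriv_def by auto
  then show "in_sobolev_hat \<sigma> (\<lambda>\<xi>. G \<xi> + G' \<xi>)" by (rule in_sobolev_hat_add)
  note [measurable] = in_sobolev_hat_measurable[OF iG(1)] in_sobolev_hat_measurable[OF iG(2)]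
  let ?N = "\<lambda>F. L2_norm_sq (sobolev_weight \<sigma> F)"
  let ?q = "\<lambda>F \<tau> \<xi>. (F \<tau> \<xi> - F t \<xi>) / of_real (\<tau> - t)"
  show "((\<lambda>\<tau>. ?N (\<lambda>\<xi>. (F \<tau> \<xi> + F' \<tau> \<xi> - (F t \<xi> + F' t \<xi>)) / of_real (\<tau> - t) - (G \<xi> + G' \<xi>))) \<longlongrightarrow> 0) (at t within {0..})"
  proof (rule tendsto_ennreal_squeeze_0)
    have "((\<lambda>\<tau>. 2 * ?N (\<lambda>\<xi>. ?q F \<tau> \<xi> - G \<xi>)) \<longlongrightarrow> 0) (at t within {0..})" "((\<lambda>\<tau>. 2 * ?N (\<lambda>\<xi>. ?q F' \<tau> \<xi> - G' \<xi>)) \<longlongrightarrow> 0) (at t within {0..})"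
      using F F' unfolding has_sobolev_deriv_def sobolev_hat_tendsto_def by (auto intro!: tendsto_ennreal_cmult_0)
    from tendsto_add[OF this]
    show "((\<lambda>\<tau>. 2 * ?N (\<lambda>\<xi>. ?q F \<tau> \<xi> - G \<xi>) + 2 * ?N (\<lambda>\<xi>. ?q F' \<tau> \<xi> - G' \<xi>)) \<longlongrightarrow> 0) (at t within {0..})" by simp
    show "\<forall>\<^sub>F \<tau> in at t within {0..}. ?N (\<lambda>\<xi>. (F \<tau> \<xi> + F' \<tau> \<xi> - (F t \<xi> + F' t \<xi>)) / of_real (\<tau> - t) - (G \<xi> + G' \<xi>))
        \<le> 2 * ?N (\<lambda>\<xi>. ?q F \<tau> \<xi> - G \<xi>) + 2 * ?N (\<lambda>\<xi>. ?q F' \<tau> \<xi> - G' \<xi>)"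
      using eventually_at_Ici
    proof eventually_elim
      case (elim \<tau>)
      note [measurable] = mF(1)[OF elim] mF(2)[OF elim] mF(1)[OF t] mF(2)[OF t]
      have "(\<lambda>\<xi>. (F \<tau> \<xi> + F' \<tau> \<xi> - (F t \<xi> + F' t \<xi>)) / of_real (\<tau> - t) - (G \<xi> + G' \<xi>))
          = (\<lambda>\<xi>. (?q F \<tau> \<xi> - G \<xi>) + (?q F' \<tau> \<xi> - G' \<xi>))"
        by (simp add: fun_eq_iff add_divide_distrib diff_divide_distrib)
      then show ?case by (simp only:) (rule sobolev_weight_add_le, measurable)
    qed
  qed
qed

lemma has_sobolev_deriv_multiplier:
  assumes F: "has_sobolev_deriv \<sigma> F G t" and t: "0 \<le> t"
    and mF: "\<And>\<tau>. 0 \<le> \<tau> \<Longrightarrow> F \<tau> \<in> borel_measurable lborel"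
    and [measurable]: "a \<in> borel_measurable lborel"
    and a: "\<And>\<xi>. norm (a \<xi>) \<le> C * (1 + (norm \<xi>)\<^sup>2) powr (p / 2)" "0 \<le> C"
  shows "has_sobolev_deriv (\<sigma> - p) (\<lambda>\<tau> \<xi>. a \<xi> * F \<tau> \<xi>) (\<lambda>\<xi>. a \<xi> * G \<xi>) t"
  unfolding has_sobolev_deriv_def sobolev_hat_tendsto_def
proof
  have iG: "in_sobolev_hat \<sigma> G" using F unfolding has_sobolev_deriv_def by auto
  note [measurable] = in_sobolev_hat_measurable[OF iG]
  show "in_sobolev_hat (\<sigma> - p) (\<lambda>\<xi>. a \<xi> * G \<xi>)"
  proof (rule in_sobolev_hatI)
    show "L2_norm_sq (sobolev_weight (\<sigma> - p) (\<lambda>\<xi>. a \<xi> * G \<xi>)) < \<infinity>"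
      by (rule le_less_trans[OF multiplier_bound[OF a]])
         (use in_sobolev_hat_finite[OF iG] in \<open>auto simp: ennreal_mult_less_top\<close>)
  qed measurable
  let ?q = "\<lambda>\<tau> \<xi>. (F \<tau> \<xi> - F t \<xi>) / of_real (\<tau> - t)"
  show "((\<lambda>\<tau>. L2_norm_sq (sobolev_weight (\<sigma> - p) (\<lambda>\<xi>. (a \<xi> * F \<tau> \<xi> - a \<xi> * F t \<xi>) / of_real (\<tau> - t) - a \<xi> * G \<xi>))) \<longlongrightarrow> 0) (at t within {0..})"
  proof (rule tendsto_ennreal_squeeze_0)
    show "((\<lambda>\<tau>. ennreal (C\<^sup>2) * L2_norm_sq (sobolev_weight \<sigma> (\<lambda>\<xi>. ?q \<tau> \<xi> - G \<xi>))) \<longlongrightarrow> 0) (at t within {0..})"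
      using F unfolding has_sobolev_deriv_def sobolev_hat_tendsto_def by (auto intro!: tendsto_ennreal_cmult_0)
    show "\<forall>\<^sub>F \<tau> in at t within {0..}. L2_norm_sq (sobolev_weight (\<sigma> - p) (\<lambda>\<xi>. (a \<xi> * F \<tau> \<xi> - a \<xi> * F t \<xi>) / of_real (\<tau> - t) - a \<xi> * G \<xi>))
      \<le> ennreal (C\<^sup>2) * L2_norm_sq (sobolev_weight \<sigma> (\<lambda>\<xi>. ?q \<tau> \<xi> - G \<xi>))"
      using eventually_at_Ici
    proof eventually_elim
      case (elim \<tau>)
      note [measurable] = mF[OF elim] mF[OF t]
      have "(\<lambda>\<xi>. (a \<xi> * F \<tau> \<xi> - a \<xi> * F t \<xi>) / of_real (\<tau> - t) - a \<xi> * G \<xi>) = (\<lambda>\<xi>. a \<xi> * (?q \<tau> \<xi> - G \<xi>))"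
        by (simp add: fun_eq_iff algebra_simps diff_divide_distrib)
      then show ?case by (simp only:) (rule multiplier_bound[OF a], measurable)
    qed
  qed
qed

lemma has_sobolev_deriv_sum:
  assumes "finite A" "\<And>j. j \<in> A \<Longrightarrow> has_sobolev_deriv \<sigma> (F j) (G j) t" "0 \<le> t"
    "\<And>j \<tau>. j \<in> A \<Longrightarrow> 0 \<le> \<tau> \<Longrightarrow> F j \<tau> \<in> borel_measurable lborel"
  shows "has_sobolev_deriv \<sigma> (\<lambda>\<tau> \<xi>. \<Sum>j\<in>A. F j \<tau> \<xi>) (\<lambda>\<xi>. \<Sum>j\<in>A. G j \<xi>) t"
  using assms
proof (induction A rule: finite_induct)
  case empty
  then show ?case
    by (simp add: has_sobolev_deriv_def sobolev_hat_tendsto_def in_sobolev_hat_def in_L2_def sobolev_weight_def L2_norm_sq_def)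
next
  case (insert x A)
  have "has_sobolev_deriv \<sigma> (\<lambda>\<tau> \<xi>. F x \<tau> \<xi> + (\<Sum>j\<in>A. F j \<tau> \<xi>)) (\<lambda>\<xi>. G x \<xi> + (\<Sum>j\<in>A. G j \<xi>)) t"
    by (rule has_sobolev_deriv_add) (use insert in \<open>auto intro!: borel_measurable_sum\<close>)
  then show ?case using insert by simp
qed

section \<open>Local integrability\<close>

text \<open>
  By the Cauchy-Schwarz inequality, because on a ball the weight is bounded above and below. Sobolev-valued
  curves can therefore be integrated against bounded functions of compact support, for every order \<open>\<sigma>\<close>.
\<close>

lemma local_L1_bound:
  fixes \<sigma> R :: real
  obtains K where "0 \<le> K"
    "\<And>F :: 'a::euclidean_space \<Rightarrow> complex. in_sobolev_hat \<sigma> F \<Longrightarrow>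
       integrable lborel (\<lambda>\<xi>. indicator (cball 0 R) \<xi> *\<^sub>R F \<xi>) \<and>
       (LINT \<xi>|lborel. norm (indicator (cball 0 R) \<xi> *\<^sub>R F \<xi>)) \<le> sqrt (K * enn2real (L2_norm_sq (sobolev_weight \<sigma> F)))"
proof -
  define W where "W = (1 + R\<^sup>2) powr (\<bar>\<sigma>\<bar> / 2)"
  define g where "g \<xi> = indicator (cball 0 R) \<xi> * (1 + (norm \<xi>)\<^sup>2) powr (- \<sigma> / 2)" for \<xi> :: 'a
  have gW: "0 \<le> g \<xi>" "g \<xi> \<le> W * indicator (cball 0 R) \<xi>" for \<xi>
  proof -
    show "0 \<le> g \<xi>" by (simp add: g_def)
    show "g \<xi> \<le> W * indicator (cball 0 R) \<xi>"
    proof (cases "\<xi> \<in> cball 0 R")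
      case True
      have 1: "1 \<le> 1 + (norm \<xi>)\<^sup>2" by simp
      have "(1 + (norm \<xi>)\<^sup>2) powr (- \<sigma> / 2) \<le> (1 + (norm \<xi>)\<^sup>2) powr (\<bar>\<sigma>\<bar> / 2)"
        by (rule powr_mono[OF _ 1]) auto
      also have "\<dots> \<le> W" unfolding W_def
        by (intro powr_mono2) (use True in \<open>auto intro!: power_mono\<close>)
      finally show ?thesis using True by (simp add: g_def)
    qed (simp add: g_def)
  qed
  have [measurable]: "g \<in> borel_measurable lborel"
    unfolding g_def
    by (intro borel_measurable_times borel_measurable_indicator powr_real_measurable) auto
  define k where "k = (\<integral>\<^sup>+ \<xi>. (ennreal (g \<xi>))\<^sup>2 \<partial>lborel)"
  have "k \<le> (\<integral>\<^sup>+ \<xi>. ennreal (W\<^sup>2) * indicator (cball 0 R) \<xi> \<partial>(lborel :: 'a measure))"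
    unfolding k_def
  proof (rule nn_integral_mono)
    fix \<xi> :: 'a
    have "(g \<xi>)\<^sup>2 \<le> (W * indicator (cball 0 R) \<xi>)\<^sup>2" by (rule power_mono[OF gW(2,1)])
    then show "(ennreal (g \<xi>))\<^sup>2 \<le> ennreal (W\<^sup>2) * indicator (cball 0 R) \<xi>"
      using gW(1)[of \<xi>] by (auto simp: ennreal_power indicator_def intro!: ennreal_leI)
  qed
  also have "\<dots> = ennreal (W\<^sup>2) * emeasure lborel (cball (0::'a) R)"
    by (rule nn_integral_cmult_indicator) simp
  also have "\<dots> < \<infinity>" using emeasure_lborel_cball_finite[of "0::'a" R] by (simp add: ennreal_mult_less_top)
  finally have kfin: "k < \<infinity>" .
  show ?thesis
  proof (rule that[of "enn2real k"])
    fix F :: "'a \<Rightarrow> complex" assume F: "in_sobolev_hat \<sigma> F"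
    note [measurable] = in_sobolev_hat_measurable[OF F] sobolev_weight_measurable[OF in_sobolev_hat_measurable[OF F]]
    let ?L = "L2_norm_sq (sobolev_weight \<sigma> F)"
    let ?I = "\<lambda>\<xi>. indicator (cball 0 R) \<xi> *\<^sub>R F \<xi>"
    have eq: "ennreal (norm (?I \<xi>)) = ennreal (g \<xi>) * ennreal (norm (sobolev_weight \<sigma> F \<xi>))" for \<xi>
    proof -
      have "(1 + (norm \<xi>)\<^sup>2) powr (- \<sigma> / 2) * (1 + (norm \<xi>)\<^sup>2) powr (\<sigma> / 2) = 1"
        using sobolev_weight_pos[of \<xi> "\<sigma> / 2"] by (simp add: powr_minus)
      then have "norm (?I \<xi>) = g \<xi> * norm (sobolev_weight \<sigma> F \<xi>)"
        by (simp add: g_def sobolev_weight_def mult.assoc[symmetric])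
      then show ?thesis using gW(1)[of \<xi>] by (simp add: ennreal_mult)
    qed
    have "(\<integral>\<^sup>+ \<xi>. ennreal (norm (?I \<xi>)) \<partial>lborel)\<^sup>2 \<le> k * (\<integral>\<^sup>+ \<xi>. (ennreal (norm (sobolev_weight \<sigma> F \<xi>)))\<^sup>2 \<partial>lborel)"
      unfolding eq k_def by (rule Cauchy_Schwarz_nn_integral) measurable
    also have "(\<integral>\<^sup>+ \<xi>. (ennreal (norm (sobolev_weight \<sigma> F \<xi>)))\<^sup>2 \<partial>lborel) = ?L"
      unfolding L2_norm_sq_def by (simp add: ennreal_power)
    finally have CS: "(\<integral>\<^sup>+ \<xi>. ennreal (norm (?I \<xi>)) \<partial>lborel)\<^sup>2 \<le> k * ?L" .
    have fin: "k * ?L < \<infinity>" using kfin in_sobolev_hat_finite[OF F] by (simp add: ennreal_mult_less_top)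
    have "(\<integral>\<^sup>+ \<xi>. ennreal (norm (?I \<xi>)) \<partial>lborel) < \<infinity>"
      using le_less_trans[OF CS fin] by (simp add: power_less_top_ennreal)
    moreover have "?I \<in> borel_measurable lborel"
      by (intro borel_measurable_scaleR borel_measurable_indicator in_sobolev_hat_measurable[OF F]) simp
    ultimately have int: "integrable lborel ?I" by (intro integrableI_bounded)
    define J where "J = (LINT \<xi>|lborel. norm (?I \<xi>))"
    have "(\<integral>\<^sup>+ \<xi>. ennreal (norm (?I \<xi>)) \<partial>lborel) = ennreal J"
      unfolding J_def by (rule nn_integral_eq_integral) (use integrable_norm[OF int] in auto)
    then have "ennreal (J\<^sup>2) \<le> k * ?L" using CS by (simp add: ennreal_power J_def)
    also have "\<dots> = ennreal (enn2real k * enn2real ?L)"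
      using kfin in_sobolev_hat_finite[OF F] by (simp add: ennreal_mult)
    finally have "J\<^sup>2 \<le> enn2real k * enn2real ?L" by (simp add: ennreal_le_iff)
    then have "J \<le> sqrt (enn2real k * enn2real ?L)" by (rule real_le_rsqrt)
    then show "integrable lborel ?I \<and> (LINT \<xi>|lborel. norm (?I \<xi>)) \<le> sqrt (enn2real k * enn2real ?L)"
      using int by (simp add: J_def)
  qed simp
qed

section \<open>Solutions are given by their Taylor series in time\<close>

text \<open>The sequence with \<open>y\<^bsub>n+m\<^esub> = - \<Sum>\<^sub>j a\<^sub>j y\<^bsub>n+j\<^esub>\<close> and given first \<open>m\<close> entries.\<close>

fun rec_seq :: "nat \<Rightarrow> (nat \<Rightarrow> complex) \<Rightarrow> (nat \<Rightarrow> complex) \<Rightarrow> nat \<Rightarrow> complex" where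
  "rec_seq m a y n = (if n < m then y n else - (\<Sum>j<m. a j * rec_seq m a y (n - m + j)))"

declare rec_seq.simps [simp del]

lemma rec_seq_init: "n < m \<Longrightarrow> rec_seq m a y n = y n"
  by (subst rec_seq.simps) simp

lemma rec_seq_step: "rec_seq m a y (n + m) = - (\<Sum>j<m. a j * rec_seq m a y (n + j))"
  by (subst rec_seq.simps) simp

lemma rec_seq_cong:
  assumes "\<And>j. j < m \<Longrightarrow> y j = z j"
  shows "rec_seq m a y n = rec_seq m a z n"
proof (induction n rule: less_induct)
  case (less n)
  show ?case
  proof (cases "n < m")
    case False
    then show ?thesis
      by (subst (1 2) rec_seq.simps) (auto intro!: sum.cong less)
  qed (simp add: rec_seq_init assms)
qed

lemma rec_seq_measurable:
  assumes "\<And>j. j < m \<Longrightarrow> (\<lambda>x. a x j) \<in> borel_measurable M" "\<And>j. j < m \<Longrightarrow> (\<lambda>x. y x j) \<in> borel_measurable M"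
  shows "(\<lambda>x. rec_seq m (a x) (y x) n) \<in> borel_measurable M"
proof (induction n rule: less_induct)
  case (less n)
  show ?case
  proof (cases "n < m")
    case True
    then show ?thesis using assms by (simp add: rec_seq_init)
  next
    case False
    then have "(\<lambda>x. rec_seq m (a x) (y x) n) = (\<lambda>x. - (\<Sum>j<m. a x j * rec_seq m (a x) (y x) (n - m + j)))"
      by (subst rec_seq.simps) simp
    moreover have "(\<lambda>x. - (\<Sum>j<m. a x j * rec_seq m (a x) (y x) (n - m + j))) \<in> borel_measurable M"
      using assms False by (intro borel_measurable_uminus borel_measurable_sum borel_measurable_times less) auto
    ultimately show ?thesis by simp
  qed
qed

lemma rec_seq_shift_act:
  assumes "degree q = m" "coeff q m = 1"
  shows "shift_act q (rec_seq m (coeff q) y) n = 0"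
proof -
  have "{..m} = insert m {..<m}" by auto
  then show ?thesis unfolding shift_act_def assms(1) by (simp add: rec_seq_step assms(2))
qed

lemma rec_seq_growth:
  assumes K: "\<And>j. j < m \<Longrightarrow> norm (a j) \<le> K" "0 \<le> K"
  shows "norm (rec_seq m a y n) \<le> (\<Sum>j<m. norm (y j)) * (1 + real m * K) ^ n"
proof -
  define q where "q = monom 1 m + (\<Sum>j<m. monom (a j) j)"
  have cq: "coeff q i = (if i = m then 1 else if i < m then a i else 0)" for i
    by (auto simp: q_def coeff_sum)
  have deg: "degree q = m" by (intro antisym degree_le le_degree) (auto simp: cq)
  have rec_eq: "rec_seq m a y k = rec_seq m (coeff q) y k" for k
  proof (induction k rule: less_induct)
    case (less k)
    show ?case
    proof (cases "k < m")
      case False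
      have "coeff q j = a j" if "j < m" for j using that by (simp add: cq)
      then show ?thesis using False by (subst (1 2) rec_seq.simps) (auto intro!: sum.cong simp: less)
    qed (simp add: rec_seq_init)
  qed
  have "shift_act q (rec_seq m a y) k = 0" for k
  proof -
    have "rec_seq m a y = rec_seq m (coeff q) y" by (rule ext) (rule rec_eq)
    then show ?thesis using rec_seq_shift_act[of q m y k] deg cq[of m] by simp
  qed
  then show ?thesis
    by (intro linear_recurrence_growth[OF deg _ _ _ K(2)])
       (auto simp: deg cq K rec_seq_init intro!: member_le_sum[of _ "{..<m}" "\<lambda>j. norm (y j)"] sum_nonneg)
qed

lemma has_vector_derivative_withinI:
  fixes f :: "real \<Rightarrow> 'a::real_normed_vector"
  assumes "((\<lambda>\<tau>. norm ((f \<tau> - f t) /\<^sub>R (\<tau> - t) - f')) \<longlongrightarrow> 0) (at t within S)"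
  shows "(f has_vector_derivative f') (at t within S)"
  unfolding has_vector_derivative_def has_derivative_within
proof
  show "bounded_linear (\<lambda>x. x *\<^sub>R f')" by (rule bounded_linear_scaleR_left)
  have ne: "\<forall>\<^sub>F \<tau> in at t within S. \<tau> \<noteq> t" by (auto simp: eventually_at_filter)
  have "((\<lambda>\<tau>. norm ((1 / norm (\<tau> - t)) *\<^sub>R (f \<tau> - (f t + (\<tau> - t) *\<^sub>R f')))) \<longlongrightarrow> 0) (at t within S)"
  proof (rule Lim_transform_eventually[OF assms])
    show "\<forall>\<^sub>F \<tau> in at t within S. norm ((f \<tau> - f t) /\<^sub>R (\<tau> - t) - f')
       = norm ((1 / norm (\<tau> - t)) *\<^sub>R (f \<tau> - (f t + (\<tau> - t) *\<^sub>R f')))"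
      using ne
    proof eventually_elim
      case (elim \<tau>)
      have "f \<tau> - (f t + (\<tau> - t) *\<^sub>R f') = (\<tau> - t) *\<^sub>R ((f \<tau> - f t) /\<^sub>R (\<tau> - t) - f')"
        using elim by (simp add: scaleR_diff_right)
      then show ?case using elim by simp
    qed
  qed
  then show "((\<lambda>\<tau>. (1 / norm (\<tau> - t)) *\<^sub>R (f \<tau> - (f t + (\<tau> - t) *\<^sub>R f'))) \<longlongrightarrow> 0) (at t within S)"
    by (simp only: tendsto_norm_zero_iff)
qed

text \<open>
  A curve \<open>U\<^sub>0\<close> in \<open>H\<^sup>\<sigma>\<close> with derivatives \<open>U\<^sub>1, U\<^sub>2, \<dots>\<close> that solves the transformed equation
  agrees for almost every frequency with the classical solution. The difficulty is that the exceptional null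
  set may depend on \<open>t\<close>. Hence one pairs with a bounded \<open>\<psi>\<close> of compact support: the function
  \<open>h\<^sub>n(t) = \<integral> \<psi> U\<^sub>n(t)\<close> satisfies \<open>h\<^sub>n' = h\<^sub>n\<^sub>+\<^sub>1\<close>, grows at most geometrically in \<open>n\<close> because all frequencies in the
  support are bounded, and is therefore the sum of its Taylor series, which determines \<open>U\<^sub>n(t)\<close>.
\<close>

locale sobolev_solution =
  fixes m :: nat and \<sigma> :: real and a :: "nat \<Rightarrow> 'a::euclidean_space \<Rightarrow> complex" and C :: real
    and U :: "nat \<Rightarrow> real \<Rightarrow> 'a \<Rightarrow> complex"
  assumes a_meas: "\<And>j. j < m \<Longrightarrow> a j \<in> borel_measurable lborel"
    and a_bound: "\<And>j \<xi>. j < m \<Longrightarrow> norm (a j \<xi>) \<le> C * (1 + (norm \<xi>)\<^sup>2) powr (real (m - j) / 2)"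
    and C: "0 \<le> C" and m: "0 < m"
    and U_Suc: "\<And>j t. U (Suc j) t = (SOME G. has_sobolev_deriv (\<sigma> - real (Suc j)) (U j) G t)"
    and U_deriv: "\<And>j t. j < m \<Longrightarrow> 0 \<le> t \<Longrightarrow> \<exists>G. has_sobolev_deriv (\<sigma> - real (Suc j)) (U j) G t"
    and U_cont: "\<And>j t. j \<le> m \<Longrightarrow> 0 \<le> t \<Longrightarrow> sobolev_hat_tendsto (\<sigma> - real j) (U j) (U j t) (at t within {0..})"
    and U_in: "\<And>j t. j \<le> m \<Longrightarrow> 0 \<le> t \<Longrightarrow> in_sobolev_hat (\<sigma> - real j) (U j t)"
    and U_eq: "\<And>t. 0 \<le> t \<Longrightarrow> AE \<xi> in lborel. U m t \<xi> + (\<Sum>j<m. a j \<xi> * U j t \<xi>) = 0"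
begin

text \<open>
  \<open>U n\<close> for \<open>n > m\<close> is a choice of a derivative of which nothing is assumed. The functions \<open>V n\<close> are the
  derivatives that the differentiated equation predicts.
\<close>

definition V :: "nat \<Rightarrow> real \<Rightarrow> 'a \<Rightarrow> complex" where
  "V n t \<xi> = rec_seq m (\<lambda>j. a j \<xi>) (\<lambda>j. U j t \<xi>) n"

lemma V_init: "n < m \<Longrightarrow> V n = U n"
  by (simp add: V_def fun_eq_iff rec_seq_init)

lemma V_measurable: "0 \<le> t \<Longrightarrow> V n t \<in> borel_measurable lborel"
  unfolding V_def
  by (rule rec_seq_measurable) (use a_meas in_sobolev_hat_measurable[OF U_in] in auto)

lemma U_has_deriv:
  assumes "j < m" "0 \<le> t"
  shows "has_sobolev_deriv (\<sigma> - real (Suc j)) (U j) (U (Suc j) t) t"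
  unfolding U_Suc
  by (rule someI_ex[where P = "\<lambda>G. has_sobolev_deriv (\<sigma> - real (Suc j)) (U j) G t"]) (rule U_deriv[OF assms])

text \<open>
  Differentiating the recurrence: the coefficient \<open>a\<^sub>j\<close> is a multiplier of order \<open>m - j\<close>, which is the number of
  derivatives that separates \<open>V\<^bsub>n-m+j\<^esub>\<close> from \<open>V\<^sub>n\<close>.
\<close>

lemma V_deriv: "0 \<le> t \<Longrightarrow> has_sobolev_deriv (\<sigma> - real (Suc n)) (V n) (V (Suc n) t) t"
proof (induction n arbitrary: t rule: less_induct)
  case (less n)
  show ?case
  proof (cases "n < m")
    case True
    have "AE \<xi> in lborel. U (Suc n) t \<xi> = V (Suc n) t \<xi>"
    proof (cases "Suc n < m")
      case True
      then show ?thesis by (simp add: V_init)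
    next
      case False
      then have mn: "Suc n = m" using \<open>n < m\<close> by simp
      have "V m t \<xi> = - (\<Sum>j<m. a j \<xi> * U j t \<xi>)" for \<xi>
        using rec_seq_step[of m _ _ 0] by (simp add: V_def rec_seq_init)
      then show ?thesis using U_eq[OF less.prems] mn by (auto simp: add_eq_0_iff2 elim: eventually_mono)
    qed
    then show ?thesis
      using has_sobolev_deriv_cong_AE[OF U_has_deriv[OF True less.prems], of "V n" "V (Suc n) t"]
        V_measurable[OF less.prems] less.prems V_init[OF True] by simp
  next
    case False
    have e: "V n' \<tau> = (\<lambda>\<xi>. \<Sum>j<m. (- a j \<xi>) * V (n' - m + j) \<tau> \<xi>)" if "m \<le> n'" for n' \<tau>
      using rec_seq_step[of m _ _ "n' - m"] that by (simp add: V_def fun_eq_iff sum_negf)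
    have "has_sobolev_deriv (\<sigma> - real (Suc n)) (\<lambda>\<tau> \<xi>. \<Sum>j<m. (- a j \<xi>) * V (n - m + j) \<tau> \<xi>)
       (\<lambda>\<xi>. \<Sum>j<m. (- a j \<xi>) * V (Suc n - m + j) t \<xi>) t"
    proof (rule has_sobolev_deriv_sum[OF _ _ less.prems])
      fix j assume j: "j \<in> {..<m}"
      then have d: "has_sobolev_deriv (\<sigma> - real (Suc (n - m + j))) (V (n - m + j)) (V (Suc (n - m + j)) t) t"
        using False by (intro less) (use less.prems in auto)
      have "has_sobolev_deriv (\<sigma> - real (Suc (n - m + j)) - real (m - j)) (\<lambda>\<tau> \<xi>. (- a j \<xi>) * V (n - m + j) \<tau> \<xi>)
         (\<lambda>\<xi>. (- a j \<xi>) * V (Suc (n - m + j)) t \<xi>) t"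
        by (rule has_sobolev_deriv_multiplier[OF d less.prems V_measurable, where C = C])
           (use a_bound[of j] a_meas[of j] C j in auto)
      moreover have "\<sigma> - real (Suc (n - m + j)) - real (m - j) = \<sigma> - real (Suc n)"
        using j False by (simp add: of_nat_diff)
      moreover have "Suc (n - m + j) = Suc n - m + j" using False by simp
      ultimately show "has_sobolev_deriv (\<sigma> - real (Suc n)) (\<lambda>\<tau> \<xi>. (- a j \<xi>) * V (n - m + j) \<tau> \<xi>)
         (\<lambda>\<xi>. (- a j \<xi>) * V (Suc n - m + j) t \<xi>) t" by (simp only:)
    next
      fix j and \<tau> :: real assume "j \<in> {..<m}" "0 \<le> \<tau>"
      then show "(\<lambda>\<xi>. (- a j \<xi>) * V (n - m + j) \<tau> \<xi>) \<in> borel_measurable lborel"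
        using a_meas[of j] V_measurable[of \<tau>] by (intro borel_measurable_times borel_measurable_uminus) auto
    qed auto
    moreover have "V n = (\<lambda>\<tau> \<xi>. \<Sum>j<m. (- a j \<xi>) * V (n - m + j) \<tau> \<xi>)"
      by (rule ext, rule e) (use False in simp)
    ultimately show ?thesis using e[of "Suc n" t] False by simp
  qed
qed

lemma V_in: "0 \<le> t \<Longrightarrow> in_sobolev_hat (\<sigma> - real n) (V n t)"
proof (cases n)
  case 0
  assume "0 \<le> t"
  then show ?thesis using U_in[of 0 t] V_init[OF m] 0 by simp
next
  case (Suc k)
  assume "0 \<le> t"
  then show ?thesis using V_deriv[of t k] Suc unfolding has_sobolev_deriv_def by simp
qed

lemma U_eq_V: "0 \<le> t \<Longrightarrow> U n t \<in> borel_measurable lborel \<and> (AE \<xi> in lborel. U n t \<xi> = V n t \<xi>)"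
proof (induction n arbitrary: t)
  case 0
  then show ?case using V_init[OF m] V_measurable[of t 0] by simp
next
  case (Suc n)
  have d: "has_sobolev_deriv (\<sigma> - real (Suc n)) (U n) (V (Suc n) t) t"
  proof (rule has_sobolev_deriv_cong_AE[OF V_deriv[OF Suc.prems]])
    show "AE \<xi> in lborel. V n \<tau> \<xi> = U n \<tau> \<xi>" if "0 \<le> \<tau>" for \<tau>
      using conjunct2[OF Suc.IH[OF that]] by eventually_elim simp
  qed (use Suc.prems V_measurable in auto)
  then have d': "has_sobolev_deriv (\<sigma> - real (Suc n)) (U n) (U (Suc n) t) t"
    unfolding U_Suc by (rule someI[where P = "\<lambda>G. has_sobolev_deriv (\<sigma> - real (Suc n)) (U n) G t"])
  have "U (Suc n) t \<in> borel_measurable lborel"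
    using d' unfolding has_sobolev_deriv_def by (blast intro: in_sobolev_hat_measurable)
  moreover have "AE \<xi> in lborel. U (Suc n) t \<xi> = V (Suc n) t \<xi>"
    by (rule has_sobolev_deriv_unique[OF d' d Suc.prems]) (use Suc.IH in blast)
  ultimately show ?case ..
qed

lemma a_bound_ball:
  assumes "0 \<le> R"
  obtains K where "0 \<le> K" "\<And>j \<xi>. j < m \<Longrightarrow> norm \<xi> \<le> R \<Longrightarrow> norm (a j \<xi>) \<le> K"
proof (rule that[of "C * (1 + R\<^sup>2) powr (real m / 2)"])
  show "0 \<le> C * (1 + R\<^sup>2) powr (real m / 2)" using C by simp
  fix j \<xi> assume j: "j < m" and \<xi>: "norm (\<xi> :: 'a) \<le> R"
  have "(1 + (norm \<xi>)\<^sup>2) powr (real (m - j) / 2) \<le> (1 + R\<^sup>2) powr (real (m - j) / 2)"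
    using \<xi> by (intro powr_mono2) (auto intro!: power_mono)
  also have "\<dots> \<le> (1 + R\<^sup>2) powr (real m / 2)" by (rule powr_mono) auto
  finally show "norm (a j \<xi>) \<le> C * (1 + R\<^sup>2) powr (real m / 2)"
    using a_bound[OF j, of \<xi>] C by (meson mult_left_mono order_trans)
qed

text \<open>
  The test function \<open>\<psi>\<close> is the conjugate of the sign of the difference of the two sides, which makes the integral
  of \<open>\<psi>\<close> against this difference its \<open>L\<^sup>1\<close> norm over the ball.
\<close>

lemma V_series_ball:
  assumes t: "0 \<le> t" and R: "0 \<le> R"
  shows "AE \<xi> in lborel. \<xi> \<in> cball 0 R \<longrightarrow> V k t \<xi> = egf (\<lambda>n. V (n + k) 0 \<xi>) t"
proof -
  obtain K where K: "0 \<le> K" "\<And>j \<xi>. j < m \<Longrightarrow> norm \<xi> \<le> R \<Longrightarrow> norm (a j \<xi>) \<le> K"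
    using a_bound_ball[OF R] by blast
  define X where "X = 1 + real m * K"
  have X: "1 \<le> X" using K by (simp add: X_def)
  have growth: "norm (V n \<tau> \<xi>) \<le> (\<Sum>j<m. norm (U j \<tau> \<xi>)) * X ^ n" if "norm \<xi> \<le> R" for n \<tau> \<xi>
    unfolding V_def X_def by (rule rec_seq_growth) (use K that in auto)
  let ?I = "\<lambda>\<xi> z. indicator (cball (0::'a) R) \<xi> *\<^sub>R (z :: complex)"
  have Vint: "integrable lborel (\<lambda>\<xi>. ?I \<xi> (V n \<tau> \<xi>))" if "0 \<le> \<tau>" for n \<tau>
    using local_L1_bound V_in[OF that] by metis
  have Uint: "integrable lborel (\<lambda>\<xi>. ?I \<xi> (U j \<tau> \<xi>))" if "0 \<le> \<tau>" "j < m" for j \<tau>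
    using Vint[OF that(1), of j] V_init[OF that(2)] by simp
  \<comment> \<open>Convergence in a Sobolev space implies convergence in \<open>L\<^sup>1\<close> of the ball.\<close>
  have loc0: "((\<lambda>\<tau>. LINT \<xi>|lborel. norm (?I \<xi> (F \<tau> \<xi>))) \<longlongrightarrow> 0) (at s within {0..})"
    if lim: "((\<lambda>\<tau>. L2_norm_sq (sobolev_weight \<rho> (F \<tau>))) \<longlongrightarrow> 0) (at s within {0..})"
      and meas: "\<And>\<tau>. 0 \<le> \<tau> \<Longrightarrow> F \<tau> \<in> borel_measurable lborel" for F \<rho> and s :: real
  proof -
    obtain B where B: "0 \<le> B" "\<And>F :: 'a \<Rightarrow> complex. in_sobolev_hat \<rho> F \<Longrightarrow>
       integrable lborel (\<lambda>\<xi>. ?I \<xi> (F \<xi>)) \<and>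
       (LINT \<xi>|lborel. norm (?I \<xi> (F \<xi>))) \<le> sqrt (B * enn2real (L2_norm_sq (sobolev_weight \<rho> F)))"
      using local_L1_bound[of \<rho> R] by metis
    have "\<forall>\<^sub>F \<tau> in at s within {0..}. L2_norm_sq (sobolev_weight \<rho> (F \<tau>)) < \<infinity>"
      using order_tendstoD(2)[OF lim, of \<infinity>] by simp
    then have ev: "\<forall>\<^sub>F \<tau> in at s within {0..}. (LINT \<xi>|lborel. norm (?I \<xi> (F \<tau> \<xi>))) \<le> sqrt (B * enn2real (L2_norm_sq (sobolev_weight \<rho> (F \<tau>))))"
      using eventually_at_Ici
    proof eventually_elim
      case (elim \<tau>)
      then show ?case using B(2)[OF in_sobolev_hatI[OF meas]] by blast
    qed
    have "((\<lambda>\<tau>. enn2real (L2_norm_sq (sobolev_weight \<rho> (F \<tau>)))) \<longlongrightarrow> 0) (at s within {0..})"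
      by (rule tendsto_enn2real) (use lim in simp_all)
    from tendsto_real_sqrt[OF tendsto_mult_left[OF this, of B]]
    have "((\<lambda>\<tau>. sqrt (B * enn2real (L2_norm_sq (sobolev_weight \<rho> (F \<tau>))))) \<longlongrightarrow> 0) (at s within {0..})" by simp
    from tendsto_sandwich[OF _ ev tendsto_const this] show ?thesis by simp
  qed
  have "\<exists>A. \<forall>\<tau>\<in>{0..t}. (LINT \<xi>|lborel. norm (?I \<xi> (U j \<tau> \<xi>))) \<le> A" if j: "j < m" for j
  proof -
    let ?\<nu> = "\<lambda>\<tau>. LINT \<xi>|lborel. norm (?I \<xi> (U j \<tau> \<xi>))"
    have "continuous_on {0..t} ?\<nu>"
      unfolding continuous_on_def
    proof
      fix s assume s: "s \<in> {0..t}"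
      then have s0: "0 \<le> s" by simp
      have l: "((\<lambda>\<tau>. LINT \<xi>|lborel. norm (?I \<xi> (U j \<tau> \<xi> - U j s \<xi>))) \<longlongrightarrow> 0) (at s within {0..})"
      proof (rule loc0)
        show "((\<lambda>\<tau>. L2_norm_sq (sobolev_weight (\<sigma> - real j) (\<lambda>\<xi>. U j \<tau> \<xi> - U j s \<xi>))) \<longlongrightarrow> 0) (at s within {0..})"
          using U_cont[of j s] j s0 unfolding sobolev_hat_tendsto_def by simp
        show "(\<lambda>\<xi>. U j \<tau> \<xi> - U j s \<xi>) \<in> borel_measurable lborel" if "0 \<le> \<tau>" for \<tau>
          using U_eq_V[OF that, of j] U_eq_V[OF s0, of j] by (intro borel_measurable_diff) auto
      qed
      have "(?\<nu> \<longlongrightarrow> ?\<nu> s) (at s within {0..})"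
      proof (rule LIM_zero_cancel, rule Lim_null_comparison[OF _ l])
        show "\<forall>\<^sub>F \<tau> in at s within {0..}. norm (?\<nu> \<tau> - ?\<nu> s) \<le> (LINT \<xi>|lborel. norm (?I \<xi> (U j \<tau> \<xi> - U j s \<xi>)))"
          using eventually_at_Ici
        proof eventually_elim
          case (elim \<tau>)
          have i: "integrable lborel (\<lambda>\<xi>. ?I \<xi> (U j \<tau> \<xi>))" "integrable lborel (\<lambda>\<xi>. ?I \<xi> (U j s \<xi>))"
            using Uint elim s0 j by auto
          then have i': "integrable lborel (\<lambda>\<xi>. ?I \<xi> (U j \<tau> \<xi> - U j s \<xi>))"
            using Bochner_Integration.integrable_diff[OF i] by (simp add: scaleR_diff_right)
          have "norm (?\<nu> \<tau> - ?\<nu> s) = norm (LINT \<xi>|lborel. norm (?I \<xi> (U j \<tau> \<xi>)) - norm (?I \<xi> (U j s \<xi>)))"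
            by (subst Bochner_Integration.integral_diff[OF integrable_norm[OF i(1)] integrable_norm[OF i(2)]]) (rule refl)
          also have "\<dots> \<le> (LINT \<xi>|lborel. norm (norm (?I \<xi> (U j \<tau> \<xi>)) - norm (?I \<xi> (U j s \<xi>))))"
            by (rule integral_norm_bound)
          also have "\<dots> \<le> (LINT \<xi>|lborel. norm (?I \<xi> (U j \<tau> \<xi> - U j s \<xi>)))"
          proof (rule integral_mono)
            show "integrable lborel (\<lambda>\<xi>. norm (norm (?I \<xi> (U j \<tau> \<xi>)) - norm (?I \<xi> (U j s \<xi>))))"
              by (intro integrable_norm Bochner_Integration.integrable_diff i)
            show "integrable lborel (\<lambda>\<xi>. norm (?I \<xi> (U j \<tau> \<xi> - U j s \<xi>)))" using i' by (rule integrable_norm)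
            show "norm (norm (?I \<xi> (U j \<tau> \<xi>)) - norm (?I \<xi> (U j s \<xi>))) \<le> norm (?I \<xi> (U j \<tau> \<xi> - U j s \<xi>))" for \<xi>
              unfolding scaleR_diff_right real_norm_def by (rule norm_triangle_ineq3)
          qed
          finally show ?case .
        qed
      qed
      then show "(?\<nu> \<longlongrightarrow> ?\<nu> s) (at s within {0..t})" by (rule tendsto_within_subset) auto
    qed
    then have "bounded (?\<nu> ` {0..t})" by (intro compact_imp_bounded compact_continuous_image) auto
    then show ?thesis unfolding bounded_iff by (force intro: order_trans[OF abs_ge_self])
  qed
  then obtain A0 where A0: "\<And>j \<tau>. j < m \<Longrightarrow> \<tau> \<in> {0..t} \<Longrightarrow> (LINT \<xi>|lborel. norm (?I \<xi> (U j \<tau> \<xi>))) \<le> A0 j"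
    by metis
  define A where "A = (\<Sum>j<m. A0 j)"
  have VA: "(LINT \<xi>|lborel. norm (?I \<xi> (V n \<tau> \<xi>))) \<le> A * X ^ n" if \<tau>: "\<tau> \<in> {0..t}" for n \<tau>
  proof -
    have \<tau>0: "0 \<le> \<tau>" using \<tau> by simp
    have i: "integrable lborel (\<lambda>\<xi>. \<Sum>j<m. norm (?I \<xi> (U j \<tau> \<xi>)))"
      using Uint[OF \<tau>0] by (intro Bochner_Integration.integrable_sum integrable_norm) auto
    have "(LINT \<xi>|lborel. norm (?I \<xi> (V n \<tau> \<xi>))) \<le> (LINT \<xi>|lborel. (\<Sum>j<m. norm (?I \<xi> (U j \<tau> \<xi>))) * X ^ n)"
    proof (rule integral_mono)
      show "integrable lborel (\<lambda>\<xi>. norm (?I \<xi> (V n \<tau> \<xi>)))" using Vint[OF \<tau>0] by (rule integrable_norm)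
      show "integrable lborel (\<lambda>\<xi>. (\<Sum>j<m. norm (?I \<xi> (U j \<tau> \<xi>))) * X ^ n)" by (rule integrable_mult_left) (rule i)
      show "norm (?I \<xi> (V n \<tau> \<xi>)) \<le> (\<Sum>j<m. norm (?I \<xi> (U j \<tau> \<xi>))) * X ^ n" for \<xi>
        using growth[of \<xi> n \<tau>] by (cases "\<xi> \<in> cball 0 R") auto
    qed
    also have "\<dots> = (\<Sum>j<m. LINT \<xi>|lborel. norm (?I \<xi> (U j \<tau> \<xi>))) * X ^ n"
    proof -
      have "(LINT \<xi>|lborel. (\<Sum>j<m. norm (?I \<xi> (U j \<tau> \<xi>)))) = (\<Sum>j<m. LINT \<xi>|lborel. norm (?I \<xi> (U j \<tau> \<xi>)))"
      proof (rule Bochner_Integration.integral_sum)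
        fix j assume "j \<in> {..<m}"
        then show "integrable lborel (\<lambda>\<xi>. norm (?I \<xi> (U j \<tau> \<xi>)))" by (intro integrable_norm Uint[OF \<tau>0]) simp
      qed
      then show ?thesis by (simp only: integral_mult_left_zero)
    qed
    also have "\<dots> \<le> A * X ^ n" unfolding A_def
      by (intro mult_right_mono sum_mono A0) (use \<tau> X in auto)
    finally show ?thesis .
  qed
  define E where "E \<xi> = egf (\<lambda>n. V (n + k) 0 \<xi>) t" for \<xi>
  define D where "D \<xi> = V k t \<xi> - E \<xi>" for \<xi>
  have mE[measurable]: "E \<in> borel_measurable lborel"
    unfolding E_def egf_def
    by (intro borel_measurable_suminf borel_measurable_divide borel_measurable_times borel_measurable_const) (use V_measurable[of 0] in auto)
  note [measurable] = V_measurable[OF t, of k]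
  have mD[measurable]: "D \<in> borel_measurable lborel" unfolding D_def by measurable
  \<comment> \<open>The test function depends on the time \<open>t\<close> of interest only, so it is constant while \<open>h n\<close> is differentiated.\<close>
  define \<psi> where "\<psi> \<xi> = ?I \<xi> (cnj (sgn (D \<xi>)))" for \<xi>
  have [measurable]: "cnj \<in> borel_measurable borel"
    by (intro borel_measurable_continuous_onI continuous_intros)
  have "(\<lambda>\<xi>. cnj (sgn (D \<xi>))) \<in> borel_measurable lborel" by measurable
  have m\<psi>[measurable]: "\<psi> \<in> borel_measurable lborel"
    unfolding \<psi>_def by (intro borel_measurable_scaleR borel_measurable_indicator) (simp, fact)
  have \<psi>1: "norm (\<psi> \<xi> * z) \<le> norm (?I \<xi> z)" for \<xi> z
    by (auto simp: \<psi>_def norm_mult norm_sgn indicator_def)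
  have \<psi>int: "integrable lborel (\<lambda>\<xi>. \<psi> \<xi> * F \<xi>)" "norm (LINT \<xi>|lborel. \<psi> \<xi> * F \<xi>) \<le> (LINT \<xi>|lborel. norm (?I \<xi> (F \<xi>)))"
    if i: "integrable lborel (\<lambda>\<xi>. ?I \<xi> (F \<xi>))" and [measurable]: "F \<in> borel_measurable lborel" for F
  proof -
    show i': "integrable lborel (\<lambda>\<xi>. \<psi> \<xi> * F \<xi>)"
      by (rule Bochner_Integration.integrable_bound[OF i _ AE_I2[OF \<psi>1]]) measurable
    have "norm (LINT \<xi>|lborel. \<psi> \<xi> * F \<xi>) \<le> (LINT \<xi>|lborel. norm (\<psi> \<xi> * F \<xi>))" by (rule integral_norm_bound)
    also have "\<dots> \<le> (LINT \<xi>|lborel. norm (?I \<xi> (F \<xi>)))"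
      by (intro integral_mono integrable_norm i i' \<psi>1)
    finally show "norm (LINT \<xi>|lborel. \<psi> \<xi> * F \<xi>) \<le> (LINT \<xi>|lborel. norm (?I \<xi> (F \<xi>)))" .
  qed
  define h where "h n \<tau> = (LINT \<xi>|lborel. \<psi> \<xi> * V n \<tau> \<xi>)" for n \<tau>
  have \<psi>V: "integrable lborel (\<lambda>\<xi>. \<psi> \<xi> * V n \<tau> \<xi>)" if "0 \<le> \<tau>" for n \<tau>
    by (rule \<psi>int(1)[OF Vint[OF that] V_measurable[OF that]])
  have h_le: "norm (h n \<tau>) \<le> A * X ^ n" if "\<tau> \<in> {0..t}" for n \<tau>
    unfolding h_def using \<psi>int(2)[OF Vint V_measurable, of \<tau> n] VA[OF that, of n] that by simp
  have h_deriv: "(h n has_vector_derivative h (Suc n) s) (at s within {0..})" if s: "0 \<le> s" for n s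
  proof (rule has_vector_derivative_withinI)
    let ?q = "\<lambda>\<tau> \<xi>. (V n \<tau> \<xi> - V n s \<xi>) / of_real (\<tau> - s) - V (Suc n) s \<xi>"
    have mq: "?q \<tau> \<in> borel_measurable lborel" if "0 \<le> \<tau>" for \<tau>
      using V_measurable[OF that, of n] V_measurable[OF s, of n] V_measurable[OF s, of "Suc n"] by measurable
    have l: "((\<lambda>\<tau>. LINT \<xi>|lborel. norm (?I \<xi> (?q \<tau> \<xi>))) \<longlongrightarrow> 0) (at s within {0..})"
    proof (rule loc0[OF _ mq])
      show "((\<lambda>\<tau>. L2_norm_sq (sobolev_weight (\<sigma> - real (Suc n)) (?q \<tau>))) \<longlongrightarrow> 0) (at s within {0..})"
        using V_deriv[OF s, of n] unfolding has_sobolev_deriv_def sobolev_hat_tendsto_def by (rule conjunct2)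
    qed
    show "((\<lambda>\<tau>. norm ((h n \<tau> - h n s) /\<^sub>R (\<tau> - s) - h (Suc n) s)) \<longlongrightarrow> 0) (at s within {0..})"
    proof (rule tendsto_sandwich[OF _ _ tendsto_const l])
      show "\<forall>\<^sub>F \<tau> in at s within {0..}. norm ((h n \<tau> - h n s) /\<^sub>R (\<tau> - s) - h (Suc n) s) \<le> (LINT \<xi>|lborel. norm (?I \<xi> (?q \<tau> \<xi>)))"
        using eventually_at_Ici
      proof eventually_elim
        case (elim \<tau>)
        have iq: "integrable lborel (\<lambda>\<xi>. ?I \<xi> (?q \<tau> \<xi>))"
        proof -
          have "integrable lborel (\<lambda>\<xi>. (?I \<xi> (V n \<tau> \<xi>) - ?I \<xi> (V n s \<xi>)) / of_real (\<tau> - s) - ?I \<xi> (V (Suc n) s \<xi>))"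
            using Vint[OF elim, of n] Vint[OF s, of n] Vint[OF s, of "Suc n"] by (intro Bochner_Integration.integrable_diff integrable_divide) auto
          then show ?thesis by (simp add: scaleR_conv_of_real algebra_simps diff_divide_distrib)
        qed
        have e1: "(h n \<tau> - h n s) /\<^sub>R (\<tau> - s) - h (Suc n) s = (LINT \<xi>|lborel. (\<psi> \<xi> * V n \<tau> \<xi> - \<psi> \<xi> * V n s \<xi>) / of_real (\<tau> - s) - \<psi> \<xi> * V (Suc n) s \<xi>)"
          unfolding h_def using \<psi>V[OF elim, of n] \<psi>V[OF s, of n] \<psi>V[OF s, of "Suc n"]
          by (simp add: scaleR_conv_of_real divide_inverse mult.commute)
        have e2: "(LINT \<xi>|lborel. (\<psi> \<xi> * V n \<tau> \<xi> - \<psi> \<xi> * V n s \<xi>) / of_real (\<tau> - s) - \<psi> \<xi> * V (Suc n) s \<xi>) = (LINT \<xi>|lborel. \<psi> \<xi> * ?q \<tau> \<xi>)"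
          by (rule Bochner_Integration.integral_cong) (auto simp: algebra_simps diff_divide_distrib)
        show ?case unfolding e1 e2 by (rule \<psi>int(2)[OF iq mq[OF elim]])
      qed
    qed auto
  qed
  have taylor: "norm (h k t - (\<Sum>i<Suc N. (t ^ i / fact i) *\<^sub>R h (i + k) 0)) \<le> (A * X ^ Suc k * t) * ((X * t) ^ N / fact N)" for N
  proof -
    have tt: "((\<lambda>x. ((t - x) ^ (Suc N - 1) / fact (Suc N - 1)) *\<^sub>R h (Suc N + k) x) has_integral
        h k t - (\<Sum>i<Suc N. ((t - 0) ^ i / fact i) *\<^sub>R h (i + k) 0)) {0..t}"
    proof (rule Taylor_has_integral[where Df = "\<lambda>i. h (i + k)"])
      show "((\<lambda>a. h (i + k) a) has_vector_derivative h (Suc i + k) s) (at s within {0..t})" if "i < Suc N" "0 \<le> s" "s \<le> t" for i s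
        using has_vector_derivative_within_subset[OF h_deriv[OF that(2), of "i + k"]] by auto
    qed (use t in auto)
    have "norm (h k t - (\<Sum>i<Suc N. ((t - 0) ^ i / fact i) *\<^sub>R h (i + k) 0)) \<le> (t ^ N / fact N * (A * X ^ (Suc N + k))) * Henstock_Kurzweil_Integration.content (cbox 0 t)"
    proof (rule has_integral_bound[OF _ tt[folded cbox_interval]])
      have A: "0 \<le> A" using h_le[of 0 0] t norm_ge_zero[of "h 0 0"] by (simp del: norm_ge_zero)
      show "0 \<le> t ^ N / fact N * (A * X ^ (Suc N + k))" using A X t by simp
      show "norm (((t - x) ^ (Suc N - 1) / fact (Suc N - 1)) *\<^sub>R h (Suc N + k) x) \<le> t ^ N / fact N * (A * X ^ (Suc N + k))" if "x \<in> cbox 0 t" for x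
        unfolding norm_scaleR
        by (intro mult_mono h_le) (use that t in \<open>auto intro!: divide_right_mono power_mono\<close>)
    qed
    then show ?thesis using t by (simp add: power_mult_distrib power_add mult_ac)
  qed
  have lim1: "(\<lambda>N. \<Sum>i<Suc N. (t ^ i / fact i) *\<^sub>R h (i + k) 0) \<longlonglongrightarrow> h k t"
  proof (rule LIM_zero_cancel, rule Lim_null_comparison)
    show "\<forall>\<^sub>F N in sequentially. norm ((\<Sum>i<Suc N. (t ^ i / fact i) *\<^sub>R h (i + k) 0) - h k t) \<le> (A * X ^ Suc k * t) * ((X * t) ^ N / fact N)"
      using taylor by (simp add: norm_minus_commute)
    have "(\<lambda>N. (X * t) ^ N / fact N) \<longlonglongrightarrow> 0"
      using summable_LIMSEQ_zero[OF summable_exp[of "X * t"]] by (simp add: divide_inverse mult.commute)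
    then show "(\<lambda>N. (A * X ^ Suc k * t) * ((X * t) ^ N / fact N)) \<longlonglongrightarrow> 0" by (rule tendsto_mult_right_zero)
  qed
  define S where "S N \<xi> = (\<Sum>i<Suc N. V (i + k) 0 \<xi> * of_real t ^ i / fact i)" for N \<xi>
  define W where "W \<xi> = X ^ k * exp (X * t) * (\<Sum>j<m. norm (?I \<xi> (U j 0 \<xi>)))" for \<xi>
  have Wint: "integrable lborel W" unfolding W_def
    using Uint[of 0] by (intro integrable_mult_right Bochner_Integration.integrable_sum integrable_norm) auto
  have gk: "norm (V (n + k) 0 \<xi>) \<le> (X ^ k * (\<Sum>j<m. norm (U j 0 \<xi>))) * X ^ n" if "norm \<xi> \<le> R" for n \<xi>
    using growth[OF that, of "n + k" 0] by (simp add: power_add mult_ac)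
  have S_lim: "(\<lambda>N. \<psi> \<xi> * S N \<xi>) \<longlonglongrightarrow> \<psi> \<xi> * E \<xi>" for \<xi>
  proof (cases "norm \<xi> \<le> R")
    case True
    have "(\<lambda>i. V (i + k) 0 \<xi> * of_real t ^ i / fact i) sums E \<xi>"
      unfolding E_def egf_def using egf_summable[OF exp_growthI[OF gk[OF True]], of t] by (rule summable_sums)
    then show ?thesis unfolding S_def sums_def
      by (intro tendsto_mult_left) (rule LIMSEQ_Suc)
  qed (simp add: \<psi>_def)
  have S_le: "norm (\<psi> \<xi> * S N \<xi>) \<le> W \<xi>" for N \<xi>
  proof (cases "norm \<xi> \<le> R")
    case True
    define B where "B = X ^ k * (\<Sum>j<m. norm (U j 0 \<xi>))"
    have B: "0 \<le> B" unfolding B_def using X by (intro mult_nonneg_nonneg sum_nonneg) auto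
    have sn: "summable (\<lambda>n. B * ((X * t) ^ n /\<^sub>R fact n))" by (intro summable_mult summable_exp_generic)
    have "norm (S N \<xi>) \<le> (\<Sum>i<Suc N. B * ((X * t) ^ i /\<^sub>R fact i))"
      unfolding S_def
    proof (rule sum_norm_le)
      fix i
      have "norm (V (i + k) 0 \<xi> * of_real t ^ i / fact i) = norm (V (i + k) 0 \<xi>) * t ^ i / fact i"
        using t by (simp add: norm_mult norm_divide norm_power)
      also have "\<dots> \<le> (B * X ^ i) * t ^ i / fact i"
        by (intro divide_right_mono mult_right_mono) (use gk[OF True, of i] t in \<open>auto simp: B_def\<close>)
      finally show "norm (V (i + k) 0 \<xi> * of_real t ^ i / fact i) \<le> B * ((X * t) ^ i /\<^sub>R fact i)"
        by (simp add: power_mult_distrib divide_inverse mult_ac)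
    qed
    also have "\<dots> \<le> (\<Sum>i. B * ((X * t) ^ i /\<^sub>R fact i))"
      by (rule sum_le_suminf[OF sn]) (use B X t in auto)
    also have "\<dots> = B * exp (X * t)"
      using sums_mult[OF exp_converges[of "X * t"], of B] by (simp add: sums_iff)
    finally have "norm (S N \<xi>) \<le> B * exp (X * t)" .
    then show ?thesis using \<psi>1[of \<xi> "S N \<xi>"] True by (simp add: W_def B_def mult_ac)
  qed (use X in \<open>simp add: \<psi>_def W_def\<close>)
  have mS[measurable]: "S N \<in> borel_measurable lborel" for N
    unfolding S_def
    by (intro borel_measurable_sum borel_measurable_divide borel_measurable_times borel_measurable_const) (use V_measurable[of 0] in auto)
  have lim2: "(\<lambda>N. LINT \<xi>|lborel. \<psi> \<xi> * S N \<xi>) \<longlonglongrightarrow> (LINT \<xi>|lborel. \<psi> \<xi> * E \<xi>)"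
    by (rule integral_dominated_convergence[OF _ _ Wint]) (use S_lim S_le in auto)
  have "(LINT \<xi>|lborel. \<psi> \<xi> * S N \<xi>) = (\<Sum>i<Suc N. (t ^ i / fact i) *\<^sub>R h (i + k) 0)" for N
  proof -
    have "(LINT \<xi>|lborel. \<psi> \<xi> * S N \<xi>) = (LINT \<xi>|lborel. (\<Sum>i<Suc N. of_real (t ^ i / fact i) * (\<psi> \<xi> * V (i + k) 0 \<xi>)))"
      unfolding S_def sum_distrib_left by (rule Bochner_Integration.integral_cong) (auto intro!: sum.cong simp: mult_ac)
    also have "\<dots> = (\<Sum>i<Suc N. LINT \<xi>|lborel. of_real (t ^ i / fact i) * (\<psi> \<xi> * V (i + k) 0 \<xi>))"
      using \<psi>V[of 0] by (intro Bochner_Integration.integral_sum integrable_mult_right) auto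
    also have "\<dots> = (\<Sum>i<Suc N. (t ^ i / fact i) *\<^sub>R h (i + k) 0)"
      by (rule sum.cong) (simp_all only: integral_mult_right_zero h_def scaleR_conv_of_real)
    finally show ?thesis .
  qed
  then have "h k t = (LINT \<xi>|lborel. \<psi> \<xi> * E \<xi>)"
    using LIMSEQ_unique[OF lim1] lim2 by simp
  moreover have iE: "integrable lborel (\<lambda>\<xi>. \<psi> \<xi> * E \<xi>)"
    by (rule integrable_dominated_convergence[OF _ _ Wint, of _ "\<lambda>N \<xi>. \<psi> \<xi> * S N \<xi>"]) (use S_lim S_le in auto)
  ultimately have "(LINT \<xi>|lborel. \<psi> \<xi> * V k t \<xi> - \<psi> \<xi> * E \<xi>) = 0"
    using \<psi>V[OF t, of k] by (simp add: h_def)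
  moreover have e: "\<psi> \<xi> * V k t \<xi> - \<psi> \<xi> * E \<xi> = of_real (indicator (cball 0 R) \<xi> * norm (D \<xi>))" for \<xi>
  proof -
    have "\<psi> \<xi> * V k t \<xi> - \<psi> \<xi> * E \<xi> = of_real (indicator (cball 0 R) \<xi>) * (cnj (sgn (D \<xi>)) * D \<xi>)"
      by (simp add: \<psi>_def D_def right_diff_distrib scaleR_conv_of_real)
    also have "cnj (sgn (D \<xi>)) * D \<xi> = of_real (norm (D \<xi>))"
    proof (cases "D \<xi> = 0")
      case False
      have "cnj (D \<xi>) * D \<xi> = of_real ((norm (D \<xi>))\<^sup>2)" by (metis complex_norm_square mult.commute of_real_power)
      then show ?thesis using False by (simp add: sgn_div_norm scaleR_conv_of_real power2_eq_square field_simps)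
    qed simp
    finally show ?thesis by simp
  qed
  ultimately have z: "(LINT \<xi>|lborel. complex_of_real (indicator (cball 0 R) \<xi> * norm (D \<xi>))) = 0"
    by simp
  have i: "integrable lborel (\<lambda>\<xi>. complex_of_real (indicator (cball 0 R) \<xi> * norm (D \<xi>)))"
    unfolding e[symmetric] by (intro Bochner_Integration.integrable_diff \<psi>V[OF t] iE)
  then have i': "integrable lborel (\<lambda>\<xi>. indicator (cball 0 R) \<xi> * norm (D \<xi>))"
    by (simp only: complex_of_real_integrable_eq)
  have "(LINT \<xi>|lborel. indicator (cball 0 R) \<xi> * norm (D \<xi>)) = 0"
    using z by (simp only: integral_complex_of_real of_real_eq_0_iff)
  then have "AE \<xi> in lborel. indicator (cball 0 R) \<xi> * norm (D \<xi>) = 0"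
    by (subst (asm) integral_nonneg_eq_0_iff_AE[OF i']) auto
  then show ?thesis
    by eventually_elim (auto simp: D_def E_def indicator_def split: if_splits)
qed

lemma U_series:
  assumes t: "0 \<le> t"
  shows "AE \<xi> in lborel. U k t \<xi> = egf (\<lambda>n. V (n + k) 0 \<xi>) t"
proof -
  have "AE \<xi> in lborel. \<forall>N :: nat. \<xi> \<in> cball 0 (real N) \<longrightarrow> V k t \<xi> = egf (\<lambda>n. V (n + k) 0 \<xi>) t"
    unfolding AE_all_countable using V_series_ball[OF t] by simp
  then show ?thesis using conjunct2[OF U_eq_V[OF t, of k]]
  proof eventually_elim
    case (elim \<xi>)
    obtain N :: nat where "norm \<xi> \<le> real N" using real_arch_simple by blast
    then have "\<xi> \<in> cball 0 (real N)" by simp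
    then show ?case using elim by metis
  qed
qed

end

section \<open>Fourier transforms of integrable functions\<close>

lemma fourier_integrand_measurable:
  fixes f :: "'a::euclidean_space \<Rightarrow> complex"
  assumes [measurable]: "f \<in> borel_measurable lborel"
  shows "(\<lambda>x. exp (- (\<i> * of_real (x \<bullet> \<xi>))) * f x) \<in> borel_measurable lborel"
proof -
  have [measurable]: "(\<lambda>x. exp (- (\<i> * complex_of_real (x \<bullet> \<xi>)))) \<in> borel_measurable borel"
    by (intro borel_measurable_continuous_onI continuous_intros)
  show ?thesis by measurable
qed

lemma norm_fourier_kernel: "norm (exp (- (\<i> * complex_of_real a)) * z) = norm z"
  by (simp add: norm_mult)

lemma norm_fourier_integral_le:
  assumes "integrable lborel f"
  shows "norm (fourier_integral f \<xi>) \<le> (LINT x|lborel. norm (f x))"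
  unfolding fourier_integral_def
  using integral_norm_bound[of lborel "\<lambda>x. exp (- (\<i> * of_real (x \<bullet> \<xi>))) * f x"]
  by (simp only: norm_fourier_kernel)

lemma fourier_integral_0: "fourier_integral f 0 = (LINT x|lborel. f x)"
  by (simp add: fourier_integral_def)

lemma isCont_fourier_integral:
  fixes f :: "'a::euclidean_space \<Rightarrow> complex"
  assumes f: "integrable lborel f"
  shows "isCont (fourier_integral f) \<xi>"
  unfolding continuous_at_sequentially o_def
proof (intro allI impI)
  fix X assume X: "X \<longlonglongrightarrow> \<xi>"
  show "(\<lambda>n. fourier_integral f (X n)) \<longlonglongrightarrow> fourier_integral f \<xi>"
    unfolding fourier_integral_def
  proof (rule integral_dominated_convergence[OF _ _ integrable_norm[OF f]])
    show "AE x in lborel. (\<lambda>n. exp (- (\<i> * complex_of_real (x \<bullet> X n))) * f x) \<longlonglongrightarrow> exp (- (\<i> * of_real (x \<bullet> \<xi>))) * f x"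
      by (intro AE_I2 tendsto_intros X)
  qed (use fourier_integrand_measurable[OF borel_measurable_integrable[OF f]] in \<open>auto simp only: norm_fourier_kernel order_refl AE_I2\<close>)
qed

lemma fourier_integral_measurable:
  "integrable lborel f \<Longrightarrow> fourier_integral f \<in> borel_measurable borel"
  by (intro borel_measurable_continuous_onI continuous_at_imp_continuous_on ballI isCont_fourier_integral)

text \<open>
  The truncated Fourier integrals converge pointwise by dominated convergence, and in \<open>L\<^sup>2\<close> by
  definition; the two limits agree by Fatou's lemma.
\<close>

lemma has_fourier_integrable_AE:
  fixes f :: "'a::euclidean_space \<Rightarrow> complex"
  assumes F: "has_fourier f g" and f: "integrable lborel f"
  shows "AE \<xi> in lborel. g \<xi> = fourier_integral f \<xi>"
proof -
  define h where "h n = fourier_integral (\<lambda>x. indicator (cball 0 (real n)) x *\<^sub>R f x)" for n :: nat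
  have fn: "integrable lborel (\<lambda>x. indicator (cball 0 (real n)) x *\<^sub>R f x)" for n :: nat
    by (rule integrable_mult_indicator[OF _ f]) simp
  have [measurable]: "h n \<in> borel_measurable lborel" for n
    unfolding h_def using fourier_integral_measurable[OF fn] by simp
  have [measurable]: "fourier_integral f \<in> borel_measurable lborel" "g \<in> borel_measurable lborel"
    using fourier_integral_measurable[OF f] F by (auto simp: has_fourier_def in_L2_def)
  have lim: "(\<lambda>n. h n \<xi>) \<longlonglongrightarrow> fourier_integral f \<xi>" for \<xi>
    unfolding h_def fourier_integral_def
  proof (rule integral_dominated_convergence[OF _ _ integrable_norm[OF f]])
    show "AE x in lborel. (\<lambda>n. exp (- (\<i> * complex_of_real (x \<bullet> \<xi>))) * (indicator (cball 0 (real n)) x *\<^sub>R f x))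
        \<longlonglongrightarrow> exp (- (\<i> * of_real (x \<bullet> \<xi>))) * f x"
    proof (intro AE_I2 tendsto_mult_left)
      fix x :: 'a
      obtain N :: nat where N: "norm x \<le> real N" using real_arch_simple by blast
      have "\<forall>\<^sub>F n in sequentially. f x = indicator (cball 0 (real n)) x *\<^sub>R f x"
        using eventually_ge_at_top[of N] by eventually_elim (use N in auto)
      then show "(\<lambda>n. indicator (cball 0 (real n)) x *\<^sub>R f x) \<longlonglongrightarrow> f x"
        by (rule Lim_transform_eventually[OF tendsto_const])
    qed
    show "AE x in lborel. norm (exp (- (\<i> * complex_of_real (x \<bullet> \<xi>))) * (indicator (cball 0 (real n)) x *\<^sub>R f x)) \<le> norm (f x)" for n
      unfolding norm_fourier_kernel by (intro AE_I2) (simp add: indicator_def)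
  qed (rule fourier_integrand_measurable[OF borel_measurable_integrable], rule f fn)+
  have L2: "(\<lambda>n. L2_norm_sq (\<lambda>\<xi>. h n \<xi> - g \<xi>)) \<longlonglongrightarrow> 0"
    unfolding h_def using F filterlim_compose[OF _ filterlim_real_sequentially] unfolding has_fourier_def by blast
  have "L2_norm_sq (\<lambda>\<xi>. fourier_integral f \<xi> - g \<xi>) = (\<integral>\<^sup>+ \<xi>. liminf (\<lambda>n. ennreal ((norm (h n \<xi> - g \<xi>))\<^sup>2)) \<partial>lborel)"
    unfolding L2_norm_sq_def
  proof (rule nn_integral_cong)
    fix \<xi>
    have "(\<lambda>n. ennreal ((norm (h n \<xi> - g \<xi>))\<^sup>2)) \<longlonglongrightarrow> ennreal ((norm (fourier_integral f \<xi> - g \<xi>))\<^sup>2)"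
      by (intro tendsto_ennrealI tendsto_intros lim)
    from lim_imp_Liminf[OF _ this]
    show "ennreal ((norm (fourier_integral f \<xi> - g \<xi>))\<^sup>2) = liminf (\<lambda>n. ennreal ((norm (h n \<xi> - g \<xi>))\<^sup>2))" by simp
  qed
  also have "\<dots> \<le> liminf (\<lambda>n. L2_norm_sq (\<lambda>\<xi>. h n \<xi> - g \<xi>))"
    unfolding L2_norm_sq_def by (rule nn_integral_liminf) measurable
  also have "\<dots> = 0" using lim_imp_Liminf[OF _ L2] by simp
  finally have "AE \<xi> in lborel. fourier_integral f \<xi> - g \<xi> = 0"
    by (intro L2_norm_sq_eq_0_imp_AE) auto
  then show ?thesis by eventually_elim simp
qed

lemma fourier_integrable_AE:
  assumes "in_sobolev \<sigma> f" "integrable lborel f"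
  shows "AE \<xi> in lborel. fourier f \<xi> = fourier_integral f \<xi>"
proof (rule has_fourier_integrable_AE[OF _ assms(2)])
  show "has_fourier f (fourier f)"
    unfolding fourier_def using assms(1) by (intro someI_ex[of "has_fourier f"]) (auto simp: in_sobolev_def)
qed

section \<open>Radial integrals\<close>

text \<open>
  Summing the bounds \<open>b\<^sub>j\<close> on sets \<open>A\<^sub>j\<close>, here dyadic shells, replaces integration in polar coordinates.
\<close>

lemma nn_integral_shells_finite:
  fixes A :: "nat \<Rightarrow> 'a::euclidean_space set" and b v :: "nat \<Rightarrow> real"
  assumes [measurable]: "\<And>j. A j \<in> sets borel" and "\<And>j. 0 \<le> b j" "\<And>j. 0 \<le> v j"
    and v: "\<And>j. emeasure lborel (A j) \<le> ennreal (v j)" and s: "summable (\<lambda>j. b j * v j)"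
  shows "(\<integral>\<^sup>+ x. (\<Sum>j. ennreal (b j) * indicator (A j) x) \<partial>lborel) < \<infinity>"
proof -
  have "(\<integral>\<^sup>+ x. (\<Sum>j. ennreal (b j) * indicator (A j) x) \<partial>lborel) = (\<Sum>j. \<integral>\<^sup>+ x. ennreal (b j) * indicator (A j) x \<partial>lborel)"
    by (rule nn_integral_suminf) measurable
  also have "\<dots> = (\<Sum>j. ennreal (b j) * emeasure lborel (A j))"
    by (intro suminf_cong nn_integral_cmult_indicator) simp
  also have "\<dots> \<le> (\<Sum>j. ennreal (b j * v j))"
  proof (rule suminf_le[OF _ summableI summableI])
    fix j
    show "ennreal (b j) * emeasure lborel (A j) \<le> ennreal (b j * v j)"
      unfolding ennreal_mult[OF assms(2,3)] by (rule mult_left_mono[OF v]) simp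
  qed
  also have "\<dots> < \<infinity>"
    unfolding infinity_ennreal_def less_top[symmetric]
    by (rule ennreal_suminf_neq_top[OF s mult_nonneg_nonneg[OF assms(2,3)]])
  finally show ?thesis .
qed

lemma le_suminf_indicator:
  fixes b :: "nat \<Rightarrow> real"
  assumes "x \<in> A j" "g \<le> b j"
  shows "ennreal g \<le> (\<Sum>j. ennreal (b j) * indicator (A j) x)"
proof -
  have "ennreal g \<le> ennreal (b j) * indicator (A j) x" using assms by (simp add: ennreal_leI)
  also have "\<dots> \<le> (\<Sum>j. ennreal (b j) * indicator (A j) x)"
  proof -
    have "f j \<le> suminf f" for f :: "nat \<Rightarrow> ennreal"
      using sum_le_suminf[OF summableI, of "{j}" f] by simp
    then show ?thesis .
  qed
  finally show ?thesis .
qed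

definition radial_weight :: "real \<Rightarrow> real \<Rightarrow> 'a::euclidean_space \<Rightarrow> real" where
  "radial_weight p \<kappa> \<xi> = norm \<xi> powr p * exp (- \<kappa> * (norm \<xi>)\<^sup>2)"

lemma radial_weight_nonneg [simp]: "0 \<le> radial_weight p \<kappa> \<xi>"
  by (simp add: radial_weight_def)

lemma radial_weight_measurable [measurable]: "radial_weight p \<kappa> \<in> borel_measurable lborel"
  unfolding radial_weight_def by (intro borel_measurable_times powr_real_measurable) auto

text \<open>
  On the shell with radii of order \<open>2\<^bsup>-j\<^esup>\<close> the integral is of order \<open>2\<^bsup>-j(p+n)\<^esup>\<close>, a geometric sequence for \<open>p > -n\<close>; on
  the shells of large radius the exponential factor beats every power.
\<close>

lemma radial_integral_finite:
  assumes p: "- real DIM('a::euclidean_space) < p" and \<kappa>: "0 < \<kappa>"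
  shows "(\<integral>\<^sup>+ \<xi>. ennreal (radial_weight p \<kappa> (\<xi> :: 'a)) \<partial>lborel) < \<infinity>"
proof -
  let ?d = "DIM('a)" and ?u = "unit_ball_vol (real DIM('a))"
  \<comment> \<open>Shells inside and outside of the unit sphere, with upper bounds for the integrand on them.\<close>
  define A where "A j = {\<xi> :: 'a. (1 / 2) ^ Suc j \<le> norm \<xi> \<and> norm \<xi> < (1 / 2) ^ j}" for j :: nat
  define A' where "A' j = {\<xi> :: 'a. 2 ^ j \<le> norm \<xi> \<and> norm \<xi> < 2 ^ Suc j}" for j :: nat
  define N where "N = nat \<lceil>p + real ?d + 1\<rceil>"
  define C where "C = fact N / \<kappa> ^ N"
  define b where "b j = 2 powr \<bar>p\<bar> * ((1 / 2) ^ j) powr p" for j :: nat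
  define b' where "b' j = C * (1 / 2) ^ (j * (?d + 1))" for j :: nat
  have C: "0 < C" using \<kappa> by (simp add: C_def)
  have le1: "radial_weight p \<kappa> \<xi> \<le> b j" if "\<xi> \<in> A j" for \<xi> j
  proof -
    let ?h = "(1 / 2 :: real) ^ j"
    define \<theta> where "\<theta> = norm \<xi> / ?h"
    have \<theta>: "1 / 2 \<le> \<theta>" "\<theta> \<le> 1" using that by (auto simp: A_def \<theta>_def field_simps)
    have "\<theta> powr p \<le> 2 powr \<bar>p\<bar>"
    proof (cases "0 \<le> p")
      case True
      then have "\<theta> powr p \<le> 1 powr p" using \<theta> by (intro powr_mono2) auto
      also have "1 powr p \<le> 2 powr \<bar>p\<bar>" by (simp add: ge_one_powr_ge_zero)
      finally show ?thesis .
    next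
      case False
      then have "\<theta> powr p \<le> (1 / 2) powr p" using \<theta> by (intro powr_mono2') auto
      also have "(1 / 2) powr p = 2 powr \<bar>p\<bar>" using False by (simp add: powr_divide powr_minus_divide)
      finally show ?thesis .
    qed
    moreover have "norm \<xi> powr p = \<theta> powr p * ?h powr p"
      using \<theta> by (subst powr_mult[symmetric]) (auto simp: \<theta>_def)
    ultimately have "norm \<xi> powr p \<le> b j" by (simp add: b_def mult_right_mono)
    moreover have "exp (- \<kappa> * (norm \<xi>)\<^sup>2) \<le> 1" using \<kappa> by simp
    ultimately show ?thesis unfolding radial_weight_def
      using mult_mono[of "norm \<xi> powr p" "b j" "exp (- \<kappa> * (norm \<xi>)\<^sup>2)" 1] by (simp add: b_def)
  qed
  have le2: "radial_weight p \<kappa> \<xi> \<le> b' j" if "\<xi> \<in> A' j" for \<xi> j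
  proof -
    let ?x = "norm \<xi>"
    have x: "2 ^ j \<le> ?x" "1 \<le> ?x"
    proof -
      show "2 ^ j \<le> ?x" using that by (simp add: A'_def)
      moreover have "(1::real) \<le> 2 ^ j" by simp
      ultimately show "1 \<le> ?x" by linarith
    qed
    have "?x powr (p + real ?d + 1) \<le> ?x powr real N"
      using x(2) unfolding N_def by (intro powr_mono real_nat_ceiling_ge)
    also have "\<dots> = ?x ^ N" by (rule powr_realpow) (use x(2) in linarith)
    also have "\<dots> \<le> (?x\<^sup>2) ^ N" using self_le_power[OF x(2), of 2] by (intro power_mono) auto
    also have "\<dots> \<le> C * exp (\<kappa> * ?x\<^sup>2)" unfolding C_def by (rule power_le_exp) (use \<kappa> in auto)
    finally have "?x powr (p + real ?d + 1) * exp (- \<kappa> * ?x\<^sup>2) \<le> C * exp (\<kappa> * ?x\<^sup>2) * exp (- \<kappa> * ?x\<^sup>2)"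
      by (rule mult_right_mono) auto
    also have "\<dots> = C" by (simp add: exp_minus)
    finally have "?x powr (p + real ?d + 1) * exp (- \<kappa> * ?x\<^sup>2) \<le> C" .
    moreover have "?x powr (p + real ?d + 1) = ?x powr p * ?x ^ (?d + 1)"
    proof -
      have "?x ^ (?d + 1) = ?x powr real (?d + 1)" by (rule powr_realpow[symmetric]) (use x(2) in linarith)
      also have "real (?d + 1) = real ?d + 1" by simp
      finally show ?thesis by (simp only: powr_add[symmetric] add.assoc)
    qed
    ultimately have "radial_weight p \<kappa> \<xi> * ?x ^ (?d + 1) \<le> C" by (simp add: radial_weight_def mult_ac)
    then have "radial_weight p \<kappa> \<xi> * (2 ^ j) ^ (?d + 1) \<le> C"
      using mult_left_mono[OF power_mono[OF x(1), of "?d + 1"], of "radial_weight p \<kappa> \<xi>"] by simp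
    moreover define e where "e = j * (?d + 1)"
    ultimately have "radial_weight p \<kappa> \<xi> * 2 ^ e \<le> C" by (simp only: power_mult)
    then have "radial_weight p \<kappa> \<xi> \<le> C * (1 / 2) ^ e" by (simp add: power_one_over pos_le_divide_eq)
    then show ?thesis by (simp only: b'_def e_def)
  qed
  have cover: "(\<exists>j. \<xi> \<in> A j) \<or> (\<exists>j. \<xi> \<in> A' j)" if "\<xi> \<noteq> 0" for \<xi>
  proof (cases "norm \<xi> < 1")
    case True
    have ex: "\<exists>j. (1 / 2) ^ Suc j \<le> norm \<xi>"
    proof -
      obtain n where "(1 / 2 :: real) ^ n < norm \<xi>" using real_arch_pow_inv[of "norm \<xi>" "1 / 2"] \<open>\<xi> \<noteq> 0\<close> by auto
      then have "(1 / 2 :: real) ^ Suc n \<le> norm \<xi>" unfolding power_Suc using norm_ge_zero[of \<xi>] by linarith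
      then show ?thesis by blast
    qed
    define j where "j = (LEAST j. (1 / 2) ^ Suc j \<le> norm \<xi>)"
    have "(1 / 2) ^ Suc j \<le> norm \<xi>" unfolding j_def using ex by (rule LeastI_ex)
    moreover have "norm \<xi> < (1 / 2) ^ j"
    proof (cases j)
      case (Suc i)
      then have "i < (LEAST j. (1 / 2) ^ Suc j \<le> norm \<xi>)" by (simp add: j_def)
      from not_less_Least[OF this] show ?thesis using Suc by simp
    qed (use True in simp)
    ultimately show ?thesis by (auto simp: A_def)
  next
    case False
    have ex: "\<exists>j. norm \<xi> < 2 ^ Suc j"
    proof -
      obtain n where "norm \<xi> < 2 ^ n" using real_arch_pow[of 2 "norm \<xi>"] by auto
      then have "norm \<xi> < 2 ^ Suc n" by (auto intro: less_le_trans)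
      then show ?thesis by blast
    qed
    define j where "j = (LEAST j. norm \<xi> < 2 ^ Suc j)"
    have "norm \<xi> < 2 ^ Suc j" unfolding j_def using ex by (rule LeastI_ex)
    moreover have "2 ^ j \<le> norm \<xi>"
    proof (cases j)
      case (Suc i)
      then have "i < (LEAST j. norm \<xi> < 2 ^ Suc j)" by (simp add: j_def)
      from not_less_Least[OF this] show ?thesis using Suc by simp
    qed (use False in simp)
    ultimately show ?thesis by (auto simp: A'_def)
  qed
  have mA[measurable]: "A j \<in> sets borel" "A' j \<in> sets borel" for j
    unfolding A_def A'_def by measurable
  have fin1: "(\<integral>\<^sup>+ x. (\<Sum>j. ennreal (b j) * indicator (A j) x) \<partial>lborel) < \<infinity>"
  proof (rule nn_integral_shells_finite[where v = "\<lambda>j. ?u * ((1 / 2) ^ j) ^ ?d"])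
    show "emeasure lborel (A j) \<le> ennreal (?u * ((1 / 2) ^ j) ^ ?d)" for j
      unfolding emeasure_ball[of "(1 / 2) ^ j" "0::'a", symmetric, simplified]
      by (rule emeasure_mono) (auto simp: A_def)
    have eq: "b j * (?u * ((1 / 2) ^ j) ^ ?d) = (2 powr \<bar>p\<bar> * ?u) * ((1 / 2) powr (p + real ?d)) ^ j" for j
    proof -
      have "((1 / 2) ^ j) ^ ?d = ((1 / 2 :: real) ^ j) powr real ?d" by (simp add: powr_realpow)
      then have "((1 / 2 :: real) ^ j) powr p * ((1 / 2) ^ j) ^ ?d = ((1 / 2) ^ j) powr (p + real ?d)" by (simp add: powr_add)
      also have "\<dots> = ((1 / 2) powr (p + real ?d)) ^ j" by (simp add: powr_realpow[symmetric] powr_powr mult.commute)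
      finally show ?thesis by (simp add: b_def mult_ac)
    qed
    have "summable (\<lambda>j. (2 powr \<bar>p\<bar> * ?u) * ((1 / 2) powr (p + real ?d)) ^ j)"
    proof (intro summable_mult summable_geometric)
      have "(1 / 2 :: real) powr (p + real ?d) < (1 / 2) powr 0" using p by (intro powr_less_mono') auto
      then show "norm ((1 / 2 :: real) powr (p + real ?d)) < 1" by simp
    qed
    then show "summable (\<lambda>j. b j * (?u * ((1 / 2) ^ j) ^ ?d))" by (simp only: eq)
  qed (auto simp: b_def)
  have fin2: "(\<integral>\<^sup>+ x. (\<Sum>j. ennreal (b' j) * indicator (A' j) x) \<partial>lborel) < \<infinity>"
  proof (rule nn_integral_shells_finite[where v = "\<lambda>j. ?u * (2 ^ Suc j) ^ ?d"])
    show "emeasure lborel (A' j) \<le> ennreal (?u * (2 ^ Suc j) ^ ?d)" for j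
    proof -
      have "emeasure lborel (A' j) \<le> emeasure lborel (ball (0::'a) (2 ^ Suc j))"
        by (rule emeasure_mono) (auto simp: A'_def)
      also have "\<dots> = ennreal (?u * (2 ^ Suc j) ^ ?d)" by (rule emeasure_ball) simp
      finally show ?thesis .
    qed
    have eq: "b' j * (?u * (2 ^ Suc j) ^ ?d) = (C * ?u * 2 ^ ?d) * (1 / 2) ^ j" for j
    proof -
      have "(1 / 2 :: real) ^ (j * (?d + 1)) = ((1 / 2) ^ j) ^ ?d * (1 / 2) ^ j" by (simp add: power_mult power_add)
      moreover have "((1 / 2 :: real) ^ j) ^ ?d * (2 ^ Suc j) ^ ?d = 2 ^ ?d"
        unfolding power_mult_distrib[symmetric] by (simp add: power_one_over)
      ultimately show ?thesis by (simp add: b'_def mult_ac)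
    qed
    have "summable (\<lambda>j. (C * ?u * 2 ^ ?d) * (1 / 2) ^ j)" by (intro summable_mult summable_geometric) simp
    then show "summable (\<lambda>j. b' j * (?u * (2 ^ Suc j) ^ ?d))" by (simp only: eq)
  qed (use C in \<open>auto simp: b'_def\<close>)
  have "(\<integral>\<^sup>+ \<xi>. ennreal (radial_weight p \<kappa> (\<xi> :: 'a)) \<partial>lborel)
      \<le> (\<integral>\<^sup>+ x. (\<Sum>j. ennreal (b j) * indicator (A j) x) + (\<Sum>j. ennreal (b' j) * indicator (A' j) x) \<partial>lborel)"
  proof (rule nn_integral_mono)
    fix \<xi> :: 'a
    show "ennreal (radial_weight p \<kappa> \<xi>) \<le> (\<Sum>j. ennreal (b j) * indicator (A j) \<xi>) + (\<Sum>j. ennreal (b' j) * indicator (A' j) \<xi>)"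
    proof (cases "\<xi> = 0")
      case False
      from cover[OF this] show ?thesis
        using le_suminf_indicator[of \<xi> A _ _ b] le_suminf_indicator[of \<xi> A' _ _ b'] le1 le2
        by (meson add_increasing add_increasing2 zero_le)
    qed (simp add: radial_weight_def)
  qed
  also have "\<dots> = (\<integral>\<^sup>+ x. (\<Sum>j. ennreal (b j) * indicator (A j) x) \<partial>lborel) + (\<integral>\<^sup>+ x. (\<Sum>j. ennreal (b' j) * indicator (A' j) x) \<partial>lborel)"
    by (rule nn_integral_add) measurable
  also have "\<dots> < \<infinity>" using fin1 fin2 by simp
  finally show ?thesis .
qed

text \<open>
  Substitution of \<open>t\<^bsup>-1/2\<^esup> \<xi>\<close> for \<open>\<xi>\<close>.
\<close>

lemma radial_integral_scaling:
  assumes t: "0 < t"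
  shows "(\<integral>\<^sup>+ \<xi>. ennreal (radial_weight p (\<kappa> * t) (\<xi> :: 'a::euclidean_space)) \<partial>lborel)
    = ennreal (t powr (- (p + real DIM('a)) / 2)) * (\<integral>\<^sup>+ \<xi>. ennreal (radial_weight p \<kappa> (\<xi> :: 'a)) \<partial>lborel)"
proof -
  define a where "a = t powr (- 1 / 2)"
  have a: "0 < a" using t by (simp add: a_def)
  have a2: "a\<^sup>2 * t = 1"
  proof -
    have "a\<^sup>2 = t powr (- 1)" unfolding a_def power2_eq_square by (simp add: powr_add[symmetric])
    then show ?thesis using t by (simp add: powr_minus)
  qed
  have w: "radial_weight p (\<kappa> * t) (a *\<^sub>R \<xi>) = a powr p * radial_weight p \<kappa> \<xi>" for \<xi> :: 'a
  proof -
    have "\<kappa> * t * (a * norm \<xi>)\<^sup>2 = \<kappa> * (a\<^sup>2 * t) * (norm \<xi>)\<^sup>2" by (simp add: power_mult_distrib mult_ac)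
    then have "\<kappa> * t * (a * norm \<xi>)\<^sup>2 = \<kappa> * (norm \<xi>)\<^sup>2" by (simp add: a2)
    then show ?thesis using a by (simp add: radial_weight_def powr_mult mult_ac)
  qed
  have [measurable]: "(\<lambda>x. radial_weight p (\<kappa> * t) (x :: 'a)) \<in> borel_measurable borel"
    using radial_weight_measurable[of p "\<kappa> * t"] by simp
  have "(\<integral>\<^sup>+ \<xi>. ennreal (radial_weight p (\<kappa> * t) (\<xi> :: 'a)) \<partial>lborel)
     = (\<integral>\<^sup>+ \<xi>. ennreal (radial_weight p (\<kappa> * t) (\<xi> :: 'a)) \<partial>density (distr lborel borel (\<lambda>x. 0 + a *\<^sub>R x)) (\<lambda>_. ennreal (\<bar>a\<bar> ^ DIM('a))))"
    using lborel_affine[of a "0::'a"] a by (simp add: ennreal_power)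
  also have "\<dots> = (\<integral>\<^sup>+ \<xi>. ennreal (\<bar>a\<bar> ^ DIM('a)) * ennreal (radial_weight p (\<kappa> * t) (a *\<^sub>R \<xi> :: 'a)) \<partial>lborel)"
    by (simp add: nn_integral_density nn_integral_distr)
  also have "\<dots> = (\<integral>\<^sup>+ \<xi>. ennreal (a powr (p + real DIM('a))) * ennreal (radial_weight p \<kappa> (\<xi> :: 'a)) \<partial>lborel)"
  proof (rule nn_integral_cong)
    fix \<xi> :: 'a
    have "\<bar>a\<bar> ^ DIM('a) * (a powr p * radial_weight p \<kappa> \<xi>) = a powr (p + real DIM('a)) * radial_weight p \<kappa> \<xi>"
      using a by (simp add: powr_add powr_realpow)
    then show "ennreal (\<bar>a\<bar> ^ DIM('a)) * ennreal (radial_weight p (\<kappa> * t) (a *\<^sub>R \<xi>)) = ennreal (a powr (p + real DIM('a))) * ennreal (radial_weight p \<kappa> \<xi>)"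
      unfolding w by (simp add: ennreal_mult[symmetric])
  qed
  also have "\<dots> = ennreal (a powr (p + real DIM('a))) * (\<integral>\<^sup>+ \<xi>. ennreal (radial_weight p \<kappa> (\<xi> :: 'a)) \<partial>lborel)"
    by (rule nn_integral_cmult) measurable
  also have "a powr (p + real DIM('a)) = t powr (- (p + real DIM('a)) / 2)"
  proof -
    have e: "(- 1 / 2) * (p + real DIM('a)) = - (p + real DIM('a)) / 2" by linarith
    show ?thesis unfolding a_def powr_powr e ..
  qed
  finally show ?thesis .
qed

section \<open>Decay of the difference to the profile\<close>

context dissipative_symbol
begin

text \<open>
  The classical solution at the frequency \<open>\<xi>\<close>, differentiated \<open>k\<close> times.
\<close>

definition evolution :: "(nat \<Rightarrow> real ^ 'n \<Rightarrow> complex) \<Rightarrow> nat \<Rightarrow> real \<Rightarrow> real ^ 'n \<Rightarrow> complex" where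
  "evolution f k t \<xi> = egf (\<lambda>n. rec_seq m (coeff (Q \<xi>)) (\<lambda>j. f j \<xi>) (n + k)) t"

definition scaled_profile :: "nat \<Rightarrow> complex \<Rightarrow> real \<Rightarrow> real ^ 'n \<Rightarrow> complex" where
  "scaled_profile k M t \<xi> = slow_profile k M t (\<xi> /\<^sub>R norm \<xi>) (norm \<xi>) / of_real (norm \<xi> ^ (r - 1))"

lemma rec_seq_Q:
  "shift_act (Q \<xi>) (rec_seq m (coeff (Q \<xi>)) y) n = 0" "j < m \<Longrightarrow> rec_seq m (coeff (Q \<xi>)) y j = y j"
  using rec_seq_shift_act[of "Q \<xi>" m y n] degree_Q coeff_Q_top by (auto simp: rec_seq_init)

lemma powr_le_sobolev_weight:
  assumes "1 \<le> (\<rho>::real)" "0 \<le> a"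
  shows "\<rho> powr a \<le> (1 + \<rho>\<^sup>2) powr (a / 2)"
proof -
  have "\<rho> powr a = (\<rho> powr 2) powr (a / 2)" by (simp add: powr_powr)
  also have "\<rho> powr 2 = \<rho>\<^sup>2" using assms(1) by (simp add: powr_numeral)
  also have "(\<rho>\<^sup>2) powr (a / 2) \<le> (1 + \<rho>\<^sup>2) powr (a / 2)" using assms by (intro powr_mono2) auto
  finally show ?thesis .
qed

text \<open>
  The \<open>j\<close>-th initial value enters the high-frequency estimate with the weight \<open>\<rho>\<^bsup>s + k - j\<^esup>\<close>, which \<open>k + s \<le> s0\<close> bounds
  by the weight of its Sobolev space. At middle frequencies all weights are comparable.
\<close>

lemma evolution_decay_away_from_0:
  assumes \<epsilon>: "0 < \<epsilon>" and s: "0 \<le> s" "real k + s \<le> s0" "real m - 1 \<le> s0"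
  obtains C d where "0 < C" "0 < d"
    "\<And>f \<xi> t. \<epsilon> \<le> norm \<xi> \<Longrightarrow> 0 \<le> t \<Longrightarrow>
       norm \<xi> powr s * norm (evolution f k t \<xi>)
       \<le> C * exp (- d * t) * (\<Sum>j<m. (1 + (norm \<xi>)\<^sup>2) powr ((s0 - real j) / 2) * norm (f j \<xi>))"
proof -
  obtain R C1 d1 where R: "1 \<le> R" and C1: "0 < C1" and d1: "0 < d1"
    and high: "\<And>\<xi> y t. \<lbrakk>R \<le> norm \<xi>; 0 \<le> t; \<And>n. shift_act (Q \<xi>) y n = 0\<rbrakk> \<Longrightarrow>
       norm (egf (\<lambda>n. y (n + k)) t) \<le> C1 * exp (- d1 * t) * (\<Sum>j<m. norm \<xi> ^ k / norm \<xi> ^ j * norm (y j))"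
    using high_frequencies[of k] by blast
  obtain C2 d2 where C2: "0 < C2" and d2: "0 < d2"
    and mid: "\<And>\<xi> y t. \<lbrakk>\<epsilon> \<le> norm \<xi>; norm \<xi> \<le> R; 0 \<le> t; \<And>n. shift_act (Q \<xi>) y n = 0\<rbrakk> \<Longrightarrow>
       norm (egf (\<lambda>n. y (n + k)) t) \<le> C2 * exp (- d2 * t) * (\<Sum>j<m. norm (y j))"
    using middle_frequencies[OF \<epsilon>, of R k] by blast
  define C where "C = C1 + R powr s * C2"
  define d where "d = min d1 d2"
  have RC: "0 < R powr s * C2" using R C2 by simp
  have C: "0 < C" "C1 \<le> C" "R powr s * C2 \<le> C" using C1 RC by (auto simp: C_def)
  have d: "0 < d" "d \<le> d1" "d \<le> d2" using d1 d2 by (auto simp: d_def)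
  have s0j: "0 \<le> s0 - real j" if "j < m" for j using that s by linarith
  have "norm \<xi> powr s * norm (evolution f k t \<xi>)
       \<le> C * exp (- d * t) * (\<Sum>j<m. (1 + (norm \<xi>)\<^sup>2) powr ((s0 - real j) / 2) * norm (f j \<xi>))"
    if \<xi>: "\<epsilon> \<le> norm \<xi>" and t: "0 \<le> t" for f \<xi> t
  proof -
    define \<rho> where "\<rho> = norm \<xi>"
    have \<rho>: "0 < \<rho>" using \<xi> \<epsilon> unfolding \<rho>_def by linarith
    let ?S = "\<Sum>j<m. (1 + \<rho>\<^sup>2) powr ((s0 - real j) / 2) * norm (f j \<xi>)"
    let ?y = "rec_seq m (coeff (Q \<xi>)) (\<lambda>j. f j \<xi>)"
    have S: "0 \<le> ?S" by (intro sum_nonneg) auto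
    have "\<rho> powr s * norm (evolution f k t \<xi>) \<le> C * exp (- d * t) * ?S"
    proof (cases "R \<le> \<rho>")
      case True
      have \<rho>1: "1 \<le> \<rho>" using True R by simp
      have "norm (evolution f k t \<xi>) \<le> C1 * exp (- d1 * t) * (\<Sum>j<m. \<rho> ^ k / \<rho> ^ j * norm (?y j))"
        unfolding evolution_def \<rho>_def by (rule high) (use True t in \<open>auto simp: \<rho>_def rec_seq_Q\<close>)
      also have "(\<Sum>j<m. \<rho> ^ k / \<rho> ^ j * norm (?y j)) = (\<Sum>j<m. \<rho> ^ k / \<rho> ^ j * norm (f j \<xi>))"
        by (simp add: rec_seq_Q)
      finally have "\<rho> powr s * norm (evolution f k t \<xi>)
          \<le> \<rho> powr s * (C1 * exp (- d1 * t) * (\<Sum>j<m. \<rho> ^ k / \<rho> ^ j * norm (f j \<xi>)))"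
        by (rule mult_left_mono) simp
      also have "\<dots> = C1 * exp (- d1 * t) * (\<Sum>j<m. (\<rho> powr s * (\<rho> ^ k / \<rho> ^ j)) * norm (f j \<xi>))"
        by (simp add: sum_distrib_left mult_ac)
      also have "\<dots> \<le> C * exp (- d * t) * ?S"
      proof (rule mult_mono)
        show "C1 * exp (- d1 * t) \<le> C * exp (- d * t)"
          using C d t C1 by (intro mult_mono) (auto intro: mult_right_mono)
        show "(\<Sum>j<m. (\<rho> powr s * (\<rho> ^ k / \<rho> ^ j)) * norm (f j \<xi>)) \<le> ?S"
        proof (intro sum_mono mult_right_mono)
          fix j assume j: "j \<in> {..<m}"
          have "\<rho> powr s * (\<rho> ^ k / \<rho> ^ j) = \<rho> powr (s + real k - real j)"
            using \<rho> by (simp add: powr_diff powr_add powr_realpow)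
          also have "\<dots> \<le> \<rho> powr (s0 - real j)" using \<rho>1 s by (intro powr_mono) auto
          also have "\<dots> \<le> (1 + \<rho>\<^sup>2) powr ((s0 - real j) / 2)"
            by (rule powr_le_sobolev_weight) (use \<rho>1 s0j j in auto)
          finally show "\<rho> powr s * (\<rho> ^ k / \<rho> ^ j) \<le> (1 + \<rho>\<^sup>2) powr ((s0 - real j) / 2)" .
        qed auto
        show "0 \<le> (\<Sum>j<m. (\<rho> powr s * (\<rho> ^ k / \<rho> ^ j)) * norm (f j \<xi>))" using \<rho> by (intro sum_nonneg) auto
      qed (use C in auto)
      finally show ?thesis .
    next
      case False
      have "norm (evolution f k t \<xi>) \<le> C2 * exp (- d2 * t) * (\<Sum>j<m. norm (?y j))"
        unfolding evolution_def by (rule mid) (use False \<xi> t in \<open>auto simp: \<rho>_def rec_seq_Q\<close>)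
      also have "(\<Sum>j<m. norm (?y j)) = (\<Sum>j<m. 1 * norm (f j \<xi>))" by (simp add: rec_seq_Q)
      also have "\<dots> \<le> ?S"
        by (intro sum_mono mult_right_mono ge_one_powr_ge_zero) (use s0j in auto)
      finally have "norm (evolution f k t \<xi>) \<le> C2 * exp (- d2 * t) * ?S" using C2 by (simp add: mult_left_mono)
      then have "\<rho> powr s * norm (evolution f k t \<xi>) \<le> R powr s * (C2 * exp (- d2 * t) * ?S)"
        by (rule mult_mono[rotated]) (use False \<rho> s R in \<open>auto intro!: powr_mono2\<close>)
      also have "\<dots> = (R powr s * C2) * exp (- d2 * t) * ?S" by (simp only: mult_ac)
      also have "\<dots> \<le> C * exp (- d * t) * ?S"
        by (intro mult_right_mono[OF _ S] mult_mono C) (use C d t in \<open>auto intro: mult_right_mono\<close>)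
      finally show ?thesis .
    qed
    then show ?thesis by (simp add: \<rho>_def)
  qed
  then show ?thesis using that C d by blast
qed

text \<open>
  For \<open>t \<ge> 1\<close> and \<open>\<rho> \<ge> \<epsilon>\<close> one writes \<open>\<rho>\<^sup>2 t\<close> as \<open>\<rho>\<^sup>2 + \<rho>\<^sup>2 (t - 1)\<close>: the first part makes the profile integrable at
  high frequencies, the second one yields the factor \<open>exp (- d t)\<close>.
\<close>

lemma scaled_profile_decay_away_from_0:
  fixes s :: real and k :: nat
  assumes \<epsilon>: "0 < \<epsilon>"
  defines "\<gamma> \<equiv> s + real k - (real r - 1)"
  obtains C d \<kappa> where "0 < C" "0 < d" "0 < \<kappa>"
    "\<And>\<xi> M t. \<epsilon> \<le> norm \<xi> \<Longrightarrow> 1 \<le> t \<Longrightarrow>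
       (norm \<xi> powr s * norm (scaled_profile k M t \<xi>))\<^sup>2 \<le> (C * (norm M)\<^sup>2 * exp (- d * t)) * radial_weight (2 * \<gamma>) \<kappa> \<xi>"
proof -
  obtain C0 \<kappa> where C0: "0 < C0" and \<kappa>: "0 < \<kappa>" and prof: "\<And>(\<omega> :: real ^ 'n) \<rho> M t. norm \<omega> = 1 \<Longrightarrow> 0 \<le> \<rho> \<Longrightarrow> 0 \<le> t \<Longrightarrow>
       norm (slow_profile k M t \<omega> \<rho>) \<le> C0 * norm M * (\<rho> + \<rho>\<^sup>2) ^ k * exp (- \<kappa> * \<rho>\<^sup>2 * t)"
    by (rule norm_slow_profile_le[of k], rule that)
  define B where "B = fact (2 * k) / \<kappa> ^ (2 * k) * exp (2 * \<kappa>)"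
  define d where "d = 2 * \<kappa> * \<epsilon>\<^sup>2"
  define C where "C = C0\<^sup>2 * B * exp d"
  have B: "0 < B" using \<kappa> by (simp add: B_def)
  have "(norm \<xi> powr s * norm (scaled_profile k M t \<xi>))\<^sup>2 \<le> (C * (norm M)\<^sup>2 * exp (- d * t)) * radial_weight (2 * \<gamma>) \<kappa> \<xi>"
    if \<xi>: "\<epsilon> \<le> norm \<xi>" and t: "1 \<le> t" for \<xi> M t
  proof -
    define \<rho> where "\<rho> = norm \<xi>"
    have \<rho>: "0 < \<rho>" "\<epsilon> \<le> \<rho>" using \<xi> \<epsilon> unfolding \<rho>_def by linarith+
    then have \<xi>0: "\<xi> \<noteq> 0" by (auto simp: \<rho>_def)
    have sp: "norm (slow_profile k M t (\<xi> /\<^sub>R norm \<xi>) \<rho>) \<le> C0 * norm M * (\<rho> + \<rho>\<^sup>2) ^ k * exp (- \<kappa> * \<rho>\<^sup>2 * t)"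
      by (rule prof) (use \<xi>0 \<rho> t in auto)
    have e: "(\<rho> + \<rho>\<^sup>2) ^ k = \<rho> ^ k * (1 + \<rho>) ^ k"
      by (simp add: power_mult_distrib[symmetric] algebra_simps power2_eq_square)
    have pw: "\<rho> powr s * (\<rho> ^ k / \<rho> ^ (r - 1)) = \<rho> powr \<gamma>"
      using \<rho> r1 by (simp add: \<gamma>_def powr_diff powr_add powr_realpow[symmetric] of_nat_diff)
    have "\<rho> powr s * norm (scaled_profile k M t \<xi>) \<le> \<rho> powr s * ((C0 * norm M * (\<rho> ^ k * (1 + \<rho>) ^ k) * exp (- \<kappa> * \<rho>\<^sup>2 * t)) / \<rho> ^ (r - 1))"
    proof -
      have n: "norm (scaled_profile k M t \<xi>) = norm (slow_profile k M t (\<xi> /\<^sub>R norm \<xi>) \<rho>) / \<rho> ^ (r - 1)"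
        by (simp add: scaled_profile_def norm_divide norm_power \<rho>_def)
      show ?thesis unfolding n
        by (intro mult_left_mono divide_right_mono sp[unfolded e]) (use \<rho> in auto)
    qed
    also have "\<dots> = C0 * norm M * (\<rho> powr s * (\<rho> ^ k / \<rho> ^ (r - 1))) * (1 + \<rho>) ^ k * exp (- \<kappa> * \<rho>\<^sup>2 * t)"
      by (simp add: mult_ac)
    finally have 1: "\<rho> powr s * norm (scaled_profile k M t \<xi>) \<le> C0 * norm M * \<rho> powr \<gamma> * (1 + \<rho>) ^ k * exp (- \<kappa> * \<rho>\<^sup>2 * t)"
      unfolding pw .
    have "(\<rho> powr s * norm (scaled_profile k M t \<xi>))\<^sup>2 \<le> (C0 * norm M * \<rho> powr \<gamma> * (1 + \<rho>) ^ k * exp (- \<kappa> * \<rho>\<^sup>2 * t))\<^sup>2"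
      by (rule power_mono[OF 1]) simp
    also have "\<dots> = C0\<^sup>2 * (norm M)\<^sup>2 * \<rho> powr (2 * \<gamma>) * (1 + \<rho>) ^ (2 * k) * exp (- 2 * \<kappa> * \<rho>\<^sup>2 * t)"
    proof -
      have "(\<rho> powr \<gamma>)\<^sup>2 = \<rho> powr (2 * \<gamma>)" by (simp add: power2_eq_square powr_add[symmetric])
      moreover have "(exp (- \<kappa> * \<rho>\<^sup>2 * t))\<^sup>2 = exp (- 2 * \<kappa> * \<rho>\<^sup>2 * t)"
        by (simp add: power2_eq_square exp_add[symmetric] del: mult_minus_left)
      moreover have "((1 + \<rho>) ^ k)\<^sup>2 = (1 + \<rho>) ^ (2 * k)" by (simp add: power_mult[symmetric] mult.commute)
      ultimately show ?thesis by (simp only: power_mult_distrib)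
    qed
    also have "\<dots> \<le> C0\<^sup>2 * (norm M)\<^sup>2 * \<rho> powr (2 * \<gamma>) * (B * exp (\<kappa> * \<rho>\<^sup>2)) * (exp (- 2 * \<kappa> * \<rho>\<^sup>2) * exp (- d * (t - 1)))"
    proof (intro mult_mono mult_nonneg_nonneg)
      have "(1 + \<rho>) ^ (2 * k) = ((1 + \<rho>)\<^sup>2) ^ k" by (simp add: power_mult)
      also have "\<dots> \<le> (2 + \<rho>\<^sup>2) ^ (2 * k)"
      proof -
        have "(1 + \<rho>)\<^sup>2 \<le> 2 * 1 + 2 * \<rho>\<^sup>2" using zero_le_power2[of "1 - \<rho>"] by (simp add: power2_eq_square algebra_simps)
        also have "\<dots> \<le> (2 + \<rho>\<^sup>2)\<^sup>2"
          using zero_le_power2[of "\<rho>\<^sup>2"] zero_le_power2[of \<rho>] by (simp add: power2_sum del: zero_le_power2)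
        finally have "((1 + \<rho>)\<^sup>2) ^ k \<le> ((2 + \<rho>\<^sup>2)\<^sup>2) ^ k" by (rule power_mono) simp
        then show ?thesis by (simp add: power_mult)
      qed
      also have "\<dots> \<le> fact (2 * k) / \<kappa> ^ (2 * k) * exp (\<kappa> * (2 + \<rho>\<^sup>2))" by (rule power_le_exp) (use \<kappa> in auto)
      also have "\<dots> = B * exp (\<kappa> * \<rho>\<^sup>2)" by (simp add: B_def exp_add distrib_left mult.commute)
      finally show "(1 + \<rho>) ^ (2 * k) \<le> B * exp (\<kappa> * \<rho>\<^sup>2)" .
      have "\<epsilon>\<^sup>2 * (t - 1) \<le> \<rho>\<^sup>2 * (t - 1)" using \<rho> \<epsilon> t by (intro mult_right_mono power_mono) auto
      then have "2 * \<kappa> * (\<epsilon>\<^sup>2 * (t - 1)) \<le> 2 * \<kappa> * (\<rho>\<^sup>2 * (t - 1))" using \<kappa> by (intro mult_left_mono) auto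
      then have "- 2 * \<kappa> * \<rho>\<^sup>2 * t \<le> - 2 * \<kappa> * \<rho>\<^sup>2 + - d * (t - 1)" by (simp add: d_def algebra_simps)
      then show "exp (- 2 * \<kappa> * \<rho>\<^sup>2 * t) \<le> exp (- 2 * \<kappa> * \<rho>\<^sup>2) * exp (- d * (t - 1))" unfolding exp_add[symmetric] by simp
    qed (use B \<rho> in auto)
    also have "\<dots> = (C * (norm M)\<^sup>2 * exp (- d * t)) * radial_weight (2 * \<gamma>) \<kappa> \<xi>"
    proof -
      have a: "exp (\<kappa> * \<rho>\<^sup>2) * exp (- 2 * \<kappa> * \<rho>\<^sup>2) = exp (- \<kappa> * \<rho>\<^sup>2)" unfolding exp_add[symmetric] by simp
      have b: "exp (- d * (t - 1)) = exp d * exp (- d * t)" unfolding exp_add[symmetric] by (simp add: algebra_simps)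
      have w: "radial_weight (2 * \<gamma>) \<kappa> \<xi> = \<rho> powr (2 * \<gamma>) * exp (- \<kappa> * \<rho>\<^sup>2)" by (simp add: radial_weight_def \<rho>_def)
      have "C0\<^sup>2 * (norm M)\<^sup>2 * \<rho> powr (2 * \<gamma>) * (B * exp (\<kappa> * \<rho>\<^sup>2)) * (exp (- 2 * \<kappa> * \<rho>\<^sup>2) * exp (- d * (t - 1)))
         = (C0\<^sup>2 * (norm M)\<^sup>2 * \<rho> powr (2 * \<gamma>) * B) * (exp (\<kappa> * \<rho>\<^sup>2) * exp (- 2 * \<kappa> * \<rho>\<^sup>2)) * exp (- d * (t - 1))"
        by (simp only: mult_ac)
      then show ?thesis unfolding a b w C_def by (simp only: mult_ac)
    qed
    finally show ?thesis by (simp add: \<rho>_def)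
  qed
  moreover have "0 < C" using C0 B by (simp add: C_def)
  moreover have "0 < d" using \<kappa> \<epsilon> by (simp add: d_def)
  ultimately show ?thesis using that \<kappa> by blast
qed

text \<open>
  Near the frequency \<open>0\<close> the difference is smaller than the profile by the factor \<open>\<eta>\<close>, up to an exponentially decaying
  term: the data are replaced by their value \<open>M\<close> at \<open>\<xi> = 0\<close>, where they are continuous because the initial
  values are integrable.
\<close>

lemma difference_near_0:
  fixes f :: "nat \<Rightarrow> real ^ 'n \<Rightarrow> complex" and s :: real and k :: nat
  assumes \<eta>: "0 < \<eta>" and s: "0 \<le> s"
    and cont: "\<And>j. j < m \<Longrightarrow> isCont (f j) 0" and bd: "\<And>j \<xi>. j < m \<Longrightarrow> norm (f j \<xi>) \<le> A"
    and M: "M = (\<Sum>j\<in>{r - 1..<m}. of_real (c (Suc j) (\<lambda>_. 0)) * f j 0)"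
    and low: "\<And>\<rho> \<omega> y t M. \<lbrakk>0 < \<rho>; \<rho> \<le> \<epsilon>0; norm \<omega> = 1; 0 \<le> t; \<And>n. shift_act (Q (\<rho> *\<^sub>R \<omega>)) y n = 0\<rbrakk> \<Longrightarrow>
       norm (egf (\<lambda>n. y (n + k)) t - slow_profile k M t \<omega> \<rho> / of_real (\<rho> ^ (r - 1)))
       \<le> C * (\<rho> ^ k / \<rho> ^ (r - 1)) * exp (- \<kappa> * \<rho>\<^sup>2 * t) *
           (norm ((\<Sum>j\<in>{r - 1..<m}. of_real (c (Suc j) (\<lambda>_. 0)) * y j) - M) + \<rho> * ((\<Sum>j<m. norm (y j)) + norm M))
         + C * (1 + \<rho> ^ k / \<rho> ^ (r - 1)) * exp (- d * t) * (\<Sum>j<m. norm (y j))"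
    and C: "0 < C" and \<epsilon>0: "0 < \<epsilon>0" "\<epsilon>0 \<le> 1"
  defines "\<gamma> \<equiv> s + real k - (real r - 1)"
  obtains \<epsilon> where "0 < \<epsilon>" "\<epsilon> \<le> 1" "\<And>\<xi> t. \<xi> \<noteq> 0 \<Longrightarrow> norm \<xi> < \<epsilon> \<Longrightarrow> 0 \<le> t \<Longrightarrow>
     norm \<xi> powr s * norm (evolution f k t \<xi> - scaled_profile k M t \<xi>)
     \<le> C * \<eta> * (norm \<xi> powr \<gamma> * exp (- \<kappa> * (norm \<xi>)\<^sup>2 * t)) + C * (real m * A) * ((1 + norm \<xi> powr \<gamma>) * exp (- d * t))"
proof -
  define g where "g \<xi> = norm ((\<Sum>j\<in>{r - 1..<m}. of_real (c (Suc j) (\<lambda>_. 0)) * f j \<xi>) - M)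
       + norm \<xi> * ((\<Sum>j<m. norm (f j \<xi>)) + norm M)" for \<xi>
  have "isCont g 0" unfolding g_def by (intro continuous_intros cont) auto
  moreover have "g 0 = 0" by (simp add: g_def M)
  ultimately have "(g \<longlongrightarrow> 0) (at 0)" by (simp add: isCont_def)
  then have "\<forall>\<^sub>F \<xi> in at 0. g \<xi> < \<eta>" using \<eta> by (rule order_tendstoD)
  then obtain \<epsilon>1 where \<epsilon>1: "0 < \<epsilon>1" "\<And>\<xi>. \<xi> \<noteq> 0 \<Longrightarrow> norm \<xi> < \<epsilon>1 \<Longrightarrow> g \<xi> < \<eta>"
    unfolding eventually_at by (auto simp: dist_norm)
  show ?thesis
  proof (rule that[of "min \<epsilon>0 \<epsilon>1"])
    fix \<xi> :: "real ^ 'n" and t :: real assume \<xi>: "\<xi> \<noteq> 0" "norm \<xi> < min \<epsilon>0 \<epsilon>1" and t: "0 \<le> t"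
    define \<rho> where "\<rho> = norm \<xi>"
    have \<rho>: "0 < \<rho>" "\<rho> \<le> \<epsilon>0" "\<rho> \<le> 1" using \<xi> \<epsilon>0 by (auto simp: \<rho>_def)
    obtain \<omega> where \<omega>: "norm \<omega> = 1" "\<xi> = \<rho> *\<^sub>R \<omega>" "\<omega> = \<xi> /\<^sub>R norm \<xi>" using polar[OF \<xi>(1)] unfolding \<rho>_def by metis
    let ?y = "rec_seq m (coeff (Q \<xi>)) (\<lambda>j. f j \<xi>)"
    let ?q = "\<rho> ^ k / \<rho> ^ (r - 1)"
    have sums: "(\<Sum>j\<in>{r - 1..<m}. of_real (c (Suc j) (\<lambda>_. 0)) * ?y j) = (\<Sum>j\<in>{r - 1..<m}. of_real (c (Suc j) (\<lambda>_. 0)) * f j \<xi>)"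
      "(\<Sum>j<m. norm (?y j)) = (\<Sum>j<m. norm (f j \<xi>))"
      by (auto intro!: sum.cong simp: rec_seq_Q)
    have pw: "\<rho> powr s * ?q = \<rho> powr \<gamma>"
      using \<rho> r1 by (simp add: \<gamma>_def powr_diff powr_add powr_realpow[symmetric] of_nat_diff)
    have mA: "(\<Sum>j<m. norm (f j \<xi>)) \<le> real m * A"
      using sum_mono[of "{..<m}" "\<lambda>j. norm (f j \<xi>)" "\<lambda>_. A"] bd by simp
    have s1: "\<rho> powr s \<le> 1" using powr_mono2[of s \<rho> 1] \<rho> s by simp
    have "norm (evolution f k t \<xi> - scaled_profile k M t \<xi>)
       \<le> C * ?q * exp (- \<kappa> * \<rho>\<^sup>2 * t) * g \<xi> + C * (1 + ?q) * exp (- d * t) * (\<Sum>j<m. norm (f j \<xi>))"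
      using low[OF \<rho>(1,2) \<omega>(1) t, of ?y M] rec_seq_Q(1)[of \<xi>] \<omega>(3)
      unfolding evolution_def scaled_profile_def g_def \<omega>(2)[symmetric] sums \<rho>_def[symmetric] by simp
    also have "\<dots> \<le> C * ?q * exp (- \<kappa> * \<rho>\<^sup>2 * t) * \<eta> + C * (1 + ?q) * exp (- d * t) * (real m * A)"
      by (intro add_mono mult_left_mono mA less_imp_le[OF \<epsilon>1(2)] mult_nonneg_nonneg) (use C \<rho> \<xi> in auto)
    finally have "\<rho> powr s * norm (evolution f k t \<xi> - scaled_profile k M t \<xi>)
        \<le> \<rho> powr s * (C * ?q * exp (- \<kappa> * \<rho>\<^sup>2 * t) * \<eta> + C * (1 + ?q) * exp (- d * t) * (real m * A))"
      by (rule mult_left_mono) simp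
    also have "\<dots> = C * \<eta> * ((\<rho> powr s * ?q) * exp (- \<kappa> * \<rho>\<^sup>2 * t)) + C * (real m * A) * ((\<rho> powr s + \<rho> powr s * ?q) * exp (- d * t))"
      by (simp add: algebra_simps)
    also have "\<dots> \<le> C * \<eta> * (\<rho> powr \<gamma> * exp (- \<kappa> * \<rho>\<^sup>2 * t)) + C * (real m * A) * ((1 + \<rho> powr \<gamma>) * exp (- d * t))"
    proof -
      have "0 \<le> real m * A" using mA sum_nonneg[of "{..<m}" "\<lambda>j. norm (f j \<xi>)"] by simp
      then show ?thesis unfolding pw using s1 C by (intro add_left_mono mult_left_mono mult_right_mono) auto
    qed
    finally show "norm \<xi> powr s * norm (evolution f k t \<xi> - scaled_profile k M t \<xi>)
     \<le> C * \<eta> * (norm \<xi> powr \<gamma> * exp (- \<kappa> * (norm \<xi>)\<^sup>2 * t)) + C * (real m * A) * ((1 + norm \<xi> powr \<gamma>) * exp (- d * t))"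
      by (simp add: \<rho>_def)
  qed (use \<epsilon>0 \<epsilon>1 in auto)
qed

end

lemma exp_decay_le_powr:
  fixes \<beta> :: real
  assumes "0 < d" "0 < \<delta>"
  shows "\<forall>\<^sub>F t in at_top. A * exp (- d * t) \<le> \<delta> * t powr (- \<beta>)"
proof -
  define N where "N = nat \<lceil>\<beta>\<rceil>"
  have "((\<lambda>t. t ^ N / exp (d * t)) \<longlongrightarrow> 0) at_top"
  proof -
    have "((\<lambda>t. (d * t) ^ N / exp (d * t)) \<longlongrightarrow> 0) at_top"
      by (rule filterlim_compose[OF tendsto_power_div_exp_0]) (use assms in \<open>auto intro: filterlim_tendsto_pos_mult_at_top[OF tendsto_const] filterlim_ident\<close>)
    then have "((\<lambda>t. (1 / d ^ N) * ((d * t) ^ N / exp (d * t))) \<longlongrightarrow> (1 / d ^ N) * 0) at_top"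
      by (rule tendsto_mult_left)
    then show ?thesis using assms by (simp add: power_mult_distrib)
  qed
  then have "((\<lambda>t. \<bar>A\<bar> * (t ^ N / exp (d * t))) \<longlongrightarrow> \<bar>A\<bar> * 0) at_top" by (rule tendsto_mult_left)
  then have "((\<lambda>t. \<bar>A\<bar> * (t ^ N / exp (d * t))) \<longlongrightarrow> 0) at_top" by simp
  then have "\<forall>\<^sub>F t in at_top. \<bar>A\<bar> * (t ^ N / exp (d * t)) < \<delta>" using assms(2) by (rule order_tendstoD)
  then show ?thesis using eventually_ge_at_top[of 1]
  proof eventually_elim
    case (elim t)
    have "t powr \<beta> \<le> t powr real N" unfolding N_def using elim by (intro powr_mono real_nat_ceiling_ge) auto
    also have "\<dots> = t ^ N" using elim by (intro powr_realpow) simp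
    finally have p: "t powr \<beta> \<le> t ^ N" .
    have "A * exp (- d * t) * t powr \<beta> \<le> \<bar>A\<bar> * exp (- d * t) * t ^ N"
      by (intro mult_mono p mult_right_mono) (use elim in auto)
    also have "\<dots> = \<bar>A\<bar> * (t ^ N / exp (d * t))" by (simp add: exp_minus divide_inverse mult_ac)
    also have "\<dots> \<le> \<delta>" using elim by simp
    finally show ?case using elim by (simp add: powr_minus field_simps)
  qed
qed

lemma integrable_radial_weight:
  assumes "- real DIM('a::euclidean_space) < p" "0 < \<kappa>"
  shows "integrable lborel (radial_weight p \<kappa> :: 'a \<Rightarrow> real)"
  by (intro integrableI_bounded radial_weight_measurable)
     (use radial_integral_finite[OF assms] in simp)

lemma integral_radial_weight_scaling:
  assumes "- real DIM('a::euclidean_space) < p" "0 < \<kappa>" "0 < t"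
  shows "(LINT \<xi>|lborel. radial_weight p (\<kappa> * t) (\<xi> :: 'a))
    = t powr (- (p + real DIM('a)) / 2) * (LINT \<xi>|lborel. radial_weight p \<kappa> (\<xi> :: 'a))"
proof -
  have "ennreal (LINT \<xi>|lborel. radial_weight p (\<kappa> * t) (\<xi> :: 'a)) = (\<integral>\<^sup>+ \<xi>. ennreal (radial_weight p (\<kappa> * t) (\<xi> :: 'a)) \<partial>lborel)"
    using assms by (intro nn_integral_eq_integral[symmetric] integrable_radial_weight) auto
  also have "\<dots> = ennreal (t powr (- (p + real DIM('a)) / 2)) * (\<integral>\<^sup>+ \<xi>. ennreal (radial_weight p \<kappa> (\<xi> :: 'a)) \<partial>lborel)"
    by (rule radial_integral_scaling[OF assms(3)])
  also have "(\<integral>\<^sup>+ \<xi>. ennreal (radial_weight p \<kappa> (\<xi> :: 'a)) \<partial>lborel) = ennreal (LINT \<xi>|lborel. radial_weight p \<kappa> (\<xi> :: 'a))"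
    using assms by (intro nn_integral_eq_integral integrable_radial_weight) auto
  also have "ennreal (t powr (- (p + real DIM('a)) / 2)) * ennreal (LINT \<xi>|lborel. radial_weight p \<kappa> (\<xi> :: 'a))
    = ennreal (t powr (- (p + real DIM('a)) / 2) * (LINT \<xi>|lborel. radial_weight p \<kappa> (\<xi> :: 'a)))"
    by (intro ennreal_mult[symmetric] integral_nonneg_AE) auto
  finally show ?thesis by (subst (asm) ennreal_inj) (auto intro!: mult_nonneg_nonneg integral_nonneg_AE)
qed

lemma power2_add_le: "((x::real) + y)\<^sup>2 \<le> 2 * x\<^sup>2 + 2 * y\<^sup>2"
  using zero_le_power2[of "x - y"] by (simp add: power2_sum power2_diff)

context dissipative_symbol
begin

text \<open>
  The square of the difference is at most \<open>2 (C \<eta>)\<^sup>2 \<rho>\<^bsup>2\<gamma>\<^esup> exp (- 2 \<kappa> \<rho>\<^sup>2 t)\<close> plus \<open>exp (- d t)\<close> times a fixed integrable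
  function \<open>G\<close>. The integral of the first term scales exactly like the claimed rate, and its constant is made
  small by the choice of \<open>\<eta>\<close>; the second term is negligible.
\<close>

lemma difference_decay:
  fixes f :: "nat \<Rightarrow> real ^ 'n \<Rightarrow> complex" and s s0 :: real and k :: nat
  assumes s: "0 \<le> s" "real k + s \<le> s0" "real m - 1 \<le> s0"
    and dim: "real r - 1 < real CARD('n) / 2 + real k + s"
    and cont: "\<And>j. j < m \<Longrightarrow> isCont (f j) 0" and bd: "\<And>j \<xi>. j < m \<Longrightarrow> norm (f j \<xi>) \<le> A"
    and f_in: "\<And>j. j < m \<Longrightarrow> in_sobolev_hat (s0 - real j) (f j)"
    and M: "M = (\<Sum>j\<in>{r - 1..<m}. of_real (c (Suc j) (\<lambda>_. 0)) * f j 0)"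
    and \<delta>: "0 < \<delta>"
  shows "\<forall>\<^sub>F t in at_top. L2_norm_sq (hdot_weight s (\<lambda>\<xi>. evolution f k t \<xi> - scaled_profile k M t \<xi>))
    \<le> ennreal (\<delta> * t powr (- (s + real k - (real r - 1) + real CARD('n) / 2)))"
proof -
  define \<gamma> where "\<gamma> = s + real k - (real r - 1)"
  have \<gamma>: "- real DIM(real ^ 'n) < 2 * \<gamma>" using dim by (simp add: \<gamma>_def)
  obtain \<epsilon>0 C \<kappa> d where \<epsilon>0: "0 < \<epsilon>0" "\<epsilon>0 \<le> 1" and C: "0 < C" and \<kappa>: "0 < \<kappa>" and d: "0 < d"
    and low: "\<And>\<rho> \<omega> y t M. \<lbrakk>0 < \<rho>; \<rho> \<le> \<epsilon>0; norm \<omega> = 1; 0 \<le> t; \<And>n. shift_act (Q (\<rho> *\<^sub>R \<omega>)) y n = 0\<rbrakk> \<Longrightarrow>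
       norm (egf (\<lambda>n. y (n + k)) t - slow_profile k M t \<omega> \<rho> / of_real (\<rho> ^ (r - 1)))
       \<le> C * (\<rho> ^ k / \<rho> ^ (r - 1)) * exp (- \<kappa> * \<rho>\<^sup>2 * t) *
           (norm ((\<Sum>j\<in>{r - 1..<m}. of_real (c (Suc j) (\<lambda>_. 0)) * y j) - M) + \<rho> * ((\<Sum>j<m. norm (y j)) + norm M))
         + C * (1 + \<rho> ^ k / \<rho> ^ (r - 1)) * exp (- d * t) * (\<Sum>j<m. norm (y j))"
    using low_frequencies[of k] by blast
  define J where "J = (LINT \<xi>|lborel. radial_weight (2 * \<gamma>) (2 * \<kappa>) (\<xi> :: real ^ 'n))"
  have J: "0 \<le> J" unfolding J_def by (intro integral_nonneg_AE) auto
  \<comment> \<open>The integral \<open>J\<close> is increased by \<open>1\<close> to avoid division by zero.\<close>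
  define v where "v = inverse (J + 1)"
  have v: "0 < v" "J * v \<le> 1" using J by (auto simp: v_def divide_inverse[symmetric])
  define \<eta> where "\<eta> = sqrt (\<delta> / 4 * v) / C"
  have \<eta>: "0 < \<eta>" using \<delta> C v by (simp add: \<eta>_def)
  have \<eta>J: "2 * (C * \<eta>)\<^sup>2 * J \<le> \<delta> / 2"
  proof -
    have "(C * \<eta>)\<^sup>2 = \<delta> / 4 * v" using \<delta> C v by (simp add: \<eta>_def)
    then have "2 * (C * \<eta>)\<^sup>2 * J = (\<delta> / 2) * (J * v)" by simp
    also have "\<dots> \<le> (\<delta> / 2) * 1" using \<delta> v by (intro mult_left_mono) auto
    finally show ?thesis by simp
  qed
  obtain \<epsilon> where \<epsilon>: "0 < \<epsilon>" "\<epsilon> \<le> 1" and near: "\<And>\<xi> t. \<xi> \<noteq> 0 \<Longrightarrow> norm \<xi> < \<epsilon> \<Longrightarrow> 0 \<le> t \<Longrightarrow>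
     norm \<xi> powr s * norm (evolution f k t \<xi> - scaled_profile k M t \<xi>)
     \<le> C * \<eta> * (norm \<xi> powr \<gamma> * exp (- \<kappa> * (norm \<xi>)\<^sup>2 * t)) + C * (real m * A) * ((1 + norm \<xi> powr \<gamma>) * exp (- d * t))"
    unfolding \<gamma>_def by (rule difference_near_0[OF \<eta> s(1) cont bd M low C \<epsilon>0]) auto
  obtain Ce de where Ce: "0 < Ce" and de: "0 < de" and evo: "\<And>f \<xi> t. \<epsilon> \<le> norm \<xi> \<Longrightarrow> 0 \<le> t \<Longrightarrow>
       norm \<xi> powr s * norm (evolution f k t \<xi>)
       \<le> Ce * exp (- de * t) * (\<Sum>j<m. (1 + (norm \<xi>)\<^sup>2) powr ((s0 - real j) / 2) * norm (f j \<xi>))"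
    using evolution_decay_away_from_0[OF \<epsilon>(1) s] by blast
  obtain Cp dp \<kappa>p where Cp: "0 < Cp" and dp: "0 < dp" and \<kappa>p: "0 < \<kappa>p" and prof: "\<And>\<xi> M t. \<epsilon> \<le> norm \<xi> \<Longrightarrow> 1 \<le> t \<Longrightarrow>
       (norm \<xi> powr s * norm (scaled_profile k M t \<xi>))\<^sup>2 \<le> (Cp * (norm M)\<^sup>2 * exp (- dp * t)) * radial_weight (2 * \<gamma>) \<kappa>p \<xi>"
    unfolding \<gamma>_def using scaled_profile_decay_away_from_0[OF \<epsilon>(1), of s k] by blast
  define N where "N j \<xi> = (norm (sobolev_weight (s0 - real j) (f j) \<xi>))\<^sup>2" for j \<xi>
  have N_int: "integrable lborel (N j)" if "j < m" for j
  proof -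
    have [measurable]: "sobolev_weight (s0 - real j) (f j) \<in> borel_measurable lborel"
      using f_in[OF that] by (simp add: in_sobolev_hat_def in_L2_def)
    show ?thesis
    proof (rule integrableI_bounded)
      show "N j \<in> borel_measurable lborel" unfolding N_def by measurable
      show "(\<integral>\<^sup>+ x. ennreal (norm (N j x)) \<partial>lborel) < \<infinity>"
        using in_sobolev_hat_finite[OF f_in[OF that]] by (simp add: N_def L2_norm_sq_def)
    qed
  qed
  define d3 where "d3 = min (2 * d) (min (2 * de) dp)"
  have d3: "0 < d3" "d3 \<le> 2 * d" "d3 \<le> 2 * de" "d3 \<le> dp" using d de dp by (auto simp: d3_def)
  define a1 where "a1 = 4 * (C * (real m * A))\<^sup>2 * exp 1"
  define a2 where "a2 = 2 * Ce\<^sup>2 * real m"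
  define a3 where "a3 = 2 * Cp * (norm M)\<^sup>2"
  define G where "G \<xi> = a1 * (radial_weight 0 1 \<xi> + radial_weight (2 * \<gamma>) 1 \<xi>) + a2 * (\<Sum>j<m. N j \<xi>) + a3 * radial_weight (2 * \<gamma>) \<kappa>p \<xi>" for \<xi> :: "real ^ 'n"
  have a: "0 \<le> a1" "0 \<le> a2" "0 \<le> a3" using Ce Cp by (auto simp: a1_def a2_def a3_def)
  have N0: "0 \<le> (\<Sum>j<m. N j \<xi>)" for \<xi> by (intro sum_nonneg) (simp add: N_def)
  have G_int: "integrable lborel G"
    unfolding G_def using \<gamma> \<kappa>p N_int
    by (intro Bochner_Integration.integrable_add integrable_mult_right Bochner_Integration.integrable_sum integrable_radial_weight) auto
  define H where "H t \<xi> = 2 * (C * \<eta>)\<^sup>2 * radial_weight (2 * \<gamma>) (2 * \<kappa> * t) \<xi> + exp (- d3 * t) * G \<xi>" for t and \<xi> :: "real ^ 'n"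
  have bound: "(norm \<xi> powr s * norm (evolution f k t \<xi> - scaled_profile k M t \<xi>))\<^sup>2 \<le> H t \<xi>"
    if \<xi>: "\<xi> \<noteq> 0" and t: "1 \<le> t" for \<xi> t
  proof -
    define \<rho> where "\<rho> = norm \<xi>"
    have \<rho>: "0 < \<rho>" using \<xi> by (simp add: \<rho>_def)
    have E3: "exp (- (2 * d) * t) \<le> exp (- d3 * t)" "exp (- (2 * de) * t) \<le> exp (- d3 * t)" "exp (- dp * t) \<le> exp (- d3 * t)"
      using d3 t by (auto intro: mult_right_mono)
    have sq_exp: "(exp (x * t))\<^sup>2 = exp (2 * x * t)" for x
      unfolding power2_eq_square exp_add[symmetric] by (rule arg_cong[of _ _ exp]) (simp add: algebra_simps)
    show ?thesis
    proof (cases "\<rho> < \<epsilon>")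
      case True
      let ?x = "C * \<eta> * (\<rho> powr \<gamma> * exp (- \<kappa> * \<rho>\<^sup>2 * t))" and ?y = "C * (real m * A) * ((1 + \<rho> powr \<gamma>) * exp (- d * t))"
      have "(\<rho> powr s * norm (evolution f k t \<xi> - scaled_profile k M t \<xi>))\<^sup>2 \<le> (?x + ?y)\<^sup>2"
        unfolding \<rho>_def by (rule power_mono[OF near]) (use True \<xi> t in \<open>auto simp: \<rho>_def\<close>)
      also have "\<dots> \<le> 2 * ?x\<^sup>2 + 2 * ?y\<^sup>2" by (rule power2_add_le)
      also have "\<dots> \<le> H t \<xi>"
      proof -
        have g2: "(\<rho> powr \<gamma>)\<^sup>2 = \<rho> powr (2 * \<gamma>)" by (simp add: power2_eq_square powr_add[symmetric])
        have "?x\<^sup>2 = (C * \<eta>)\<^sup>2 * (\<rho> powr (2 * \<gamma>) * (exp ((- \<kappa> * \<rho>\<^sup>2) * t))\<^sup>2)" by (simp only: power_mult_distrib g2 mult_ac)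
        also have "\<dots> = (C * \<eta>)\<^sup>2 * radial_weight (2 * \<gamma>) (2 * \<kappa> * t) \<xi>"
          unfolding sq_exp by (simp add: radial_weight_def \<rho>_def mult_ac)
        finally have x2: "?x\<^sup>2 = (C * \<eta>)\<^sup>2 * radial_weight (2 * \<gamma>) (2 * \<kappa> * t) \<xi>" .
        \<comment> \<open>A Gaussian factor turns the bound on the unit ball into a function integrable on the whole space.\<close>
        have r1: "1 \<le> exp 1 * exp (- \<rho>\<^sup>2)"
        proof -
          have "\<rho>\<^sup>2 \<le> 1" using True \<epsilon> \<rho> by (intro power_le_one) auto
          then show ?thesis unfolding exp_add[symmetric] by simp
        qed
        have "(1 + \<rho> powr \<gamma>)\<^sup>2 \<le> 2 * 1\<^sup>2 + 2 * (\<rho> powr \<gamma>)\<^sup>2" by (rule power2_add_le)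
        also have "\<dots> = 2 * (1 + \<rho> powr (2 * \<gamma>)) * 1" unfolding g2 by simp
        also have "\<dots> \<le> 2 * (1 + \<rho> powr (2 * \<gamma>)) * (exp 1 * exp (- \<rho>\<^sup>2))" by (intro mult_left_mono r1) auto
        also have "\<dots> = 2 * exp 1 * (radial_weight 0 1 \<xi> + radial_weight (2 * \<gamma>) 1 \<xi>)"
          using \<rho> by (simp add: radial_weight_def \<rho>_def algebra_simps)
        finally have p: "(1 + \<rho> powr \<gamma>)\<^sup>2 \<le> 2 * exp 1 * (radial_weight 0 1 \<xi> + radial_weight (2 * \<gamma>) 1 \<xi>)" .
        have "2 * ?y\<^sup>2 = 2 * (C * (real m * A))\<^sup>2 * ((1 + \<rho> powr \<gamma>)\<^sup>2 * exp (2 * (- d) * t))"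
          unfolding power_mult_distrib[of _ "(1 + \<rho> powr \<gamma>) * exp (- d * t)"] power_mult_distrib[of "1 + \<rho> powr \<gamma>"] sq_exp by (simp only: mult_ac)
        also have "\<dots> \<le> 2 * (C * (real m * A))\<^sup>2 * ((2 * exp 1 * (radial_weight 0 1 \<xi> + radial_weight (2 * \<gamma>) 1 \<xi>)) * exp (- d3 * t))"
          using E3(1) p by (intro mult_left_mono mult_mono) auto
        also have "\<dots> = exp (- d3 * t) * (a1 * (radial_weight 0 1 \<xi> + radial_weight (2 * \<gamma>) 1 \<xi>))" by (simp add: a1_def)
        also have "\<dots> \<le> exp (- d3 * t) * G \<xi>"
          unfolding G_def using a N0[of \<xi>] by (intro mult_left_mono) (auto intro!: add_increasing2 mult_nonneg_nonneg)
        finally show ?thesis unfolding H_def x2 by (simp add: mult_ac)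
      qed
      finally show ?thesis by (simp add: \<rho>_def)
    next
      case False
      then have \<epsilon>\<rho>: "\<epsilon> \<le> norm \<xi>" by (simp add: \<rho>_def)
      let ?S = "\<Sum>j<m. (1 + (norm \<xi>)\<^sup>2) powr ((s0 - real j) / 2) * norm (f j \<xi>)"
      have "norm \<xi> powr s * norm (evolution f k t \<xi> - scaled_profile k M t \<xi>)
         \<le> norm \<xi> powr s * (norm (evolution f k t \<xi>) + norm (scaled_profile k M t \<xi>))"
        by (intro mult_left_mono norm_triangle_ineq4) auto
      then have "norm \<xi> powr s * norm (evolution f k t \<xi> - scaled_profile k M t \<xi>)
         \<le> norm \<xi> powr s * norm (evolution f k t \<xi>) + norm \<xi> powr s * norm (scaled_profile k M t \<xi>)" by (simp only: distrib_left)
      then have "(norm \<xi> powr s * norm (evolution f k t \<xi> - scaled_profile k M t \<xi>))\<^sup>2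
         \<le> (norm \<xi> powr s * norm (evolution f k t \<xi>) + norm \<xi> powr s * norm (scaled_profile k M t \<xi>))\<^sup>2"
        by (rule power_mono) auto
      also have "\<dots> \<le> 2 * (norm \<xi> powr s * norm (evolution f k t \<xi>))\<^sup>2 + 2 * (norm \<xi> powr s * norm (scaled_profile k M t \<xi>))\<^sup>2"
        by (rule power2_add_le)
      also have "\<dots> \<le> exp (- d3 * t) * (a2 * (\<Sum>j<m. N j \<xi>)) + exp (- d3 * t) * (a3 * radial_weight (2 * \<gamma>) \<kappa>p \<xi>)"
      proof (rule add_mono)
        have "(norm \<xi> powr s * norm (evolution f k t \<xi>))\<^sup>2 \<le> (Ce * exp (- de * t) * ?S)\<^sup>2"
          by (rule power_mono[OF evo[OF \<epsilon>\<rho>]]) (use t in auto)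
        also have "\<dots> = Ce\<^sup>2 * exp (2 * (- de) * t) * ?S\<^sup>2" unfolding power_mult_distrib sq_exp ..
        also have "\<dots> \<le> Ce\<^sup>2 * exp (- d3 * t) * ((\<Sum>j<m. N j \<xi>) * real m)"
        proof (intro mult_mono mult_left_mono)
          have "?S\<^sup>2 \<le> (\<Sum>j<m. ((1 + (norm \<xi>)\<^sup>2) powr ((s0 - real j) / 2) * norm (f j \<xi>))\<^sup>2) * real (card {..<m})"
            by (rule sum_squared_le_sum_of_squares)
          then show "?S\<^sup>2 \<le> (\<Sum>j<m. N j \<xi>) * real m" by (simp add: N_def sobolev_weight_def)
          show "exp (2 * - de * t) \<le> exp (- d3 * t)" using E3(2) by simp
        qed auto
        also have "\<dots> = exp (- d3 * t) * (a2 * (\<Sum>j<m. N j \<xi>)) / 2" by (simp add: a2_def)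
        finally show "2 * (norm \<xi> powr s * norm (evolution f k t \<xi>))\<^sup>2 \<le> exp (- d3 * t) * (a2 * (\<Sum>j<m. N j \<xi>))" by simp
        have "(norm \<xi> powr s * norm (scaled_profile k M t \<xi>))\<^sup>2 \<le> (Cp * (norm M)\<^sup>2 * exp (- dp * t)) * radial_weight (2 * \<gamma>) \<kappa>p \<xi>"
          by (rule prof[OF \<epsilon>\<rho> t])
        also have "\<dots> \<le> (Cp * (norm M)\<^sup>2 * exp (- d3 * t)) * radial_weight (2 * \<gamma>) \<kappa>p \<xi>"
          using Cp E3(3) by (intro mult_right_mono mult_left_mono) auto
        finally show "2 * (norm \<xi> powr s * norm (scaled_profile k M t \<xi>))\<^sup>2 \<le> exp (- d3 * t) * (a3 * radial_weight (2 * \<gamma>) \<kappa>p \<xi>)"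
          by (simp add: a3_def mult_ac)
      qed
      also have "\<dots> \<le> exp (- d3 * t) * G \<xi>"
      proof -
        have "0 \<le> a1 * (radial_weight 0 1 \<xi> + radial_weight (2 * \<gamma>) 1 \<xi>)" using a by (intro mult_nonneg_nonneg) auto
        then show ?thesis unfolding G_def distrib_left[symmetric] by (intro mult_left_mono) auto
      qed
      also have "\<dots> \<le> H t \<xi>" unfolding H_def by simp
      finally show ?thesis .
    qed
  qed
  define K2 where "K2 = (LINT \<xi>|lborel. G \<xi>)"
  define e where "e = \<gamma> + real CARD('n) / 2"
  have L2: "L2_norm_sq (hdot_weight s (\<lambda>\<xi>. evolution f k t \<xi> - scaled_profile k M t \<xi>))
      \<le> ennreal (2 * (C * \<eta>)\<^sup>2 * (t powr (- e) * J) + exp (- d3 * t) * K2)" if t: "1 \<le> t" for t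
  proof -
    have i1: "integrable lborel (radial_weight (2 * \<gamma>) (2 * \<kappa> * t) :: real ^ 'n \<Rightarrow> real)"
      by (rule integrable_radial_weight[OF \<gamma>]) (use \<kappa> t in simp)
    have H_int: "integrable lborel (H t)"
      unfolding H_def by (intro Bochner_Integration.integrable_add integrable_mult_right i1 G_int)
    have H0: "0 \<le> H t \<xi>" for \<xi> unfolding H_def G_def using a N0[of \<xi>]
      by (intro add_nonneg_nonneg mult_nonneg_nonneg) auto
    have "L2_norm_sq (hdot_weight s (\<lambda>\<xi>. evolution f k t \<xi> - scaled_profile k M t \<xi>)) \<le> (\<integral>\<^sup>+ \<xi>. ennreal (H t \<xi>) \<partial>lborel)"
      unfolding L2_norm_sq_def
    proof (rule nn_integral_mono_AE)
      show "AE \<xi> in lborel. ennreal ((norm (hdot_weight s (\<lambda>\<xi>. evolution f k t \<xi> - scaled_profile k M t \<xi>) \<xi>))\<^sup>2) \<le> ennreal (H t \<xi>)"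
        using AE_lborel_singleton[of "0 :: real ^ 'n"]
        by eventually_elim (use bound[OF _ t] in \<open>auto simp: hdot_weight_def intro!: ennreal_leI\<close>)
    qed
    also have "\<dots> = ennreal (LINT \<xi>|lborel. H t \<xi>)"
      by (rule nn_integral_eq_integral[OF H_int]) (use H0 in auto)
    also have "(LINT \<xi>|lborel. H t \<xi>) = 2 * (C * \<eta>)\<^sup>2 * (LINT \<xi>|lborel. radial_weight (2 * \<gamma>) (2 * \<kappa> * t) (\<xi> :: real ^ 'n)) + exp (- d3 * t) * K2"
      unfolding H_def K2_def using i1 G_int by simp
    also have "(LINT \<xi>|lborel. radial_weight (2 * \<gamma>) (2 * \<kappa> * t) (\<xi> :: real ^ 'n)) = t powr (- e) * J"
    proof -
      have "- (2 * \<gamma> + real DIM(real ^ 'n)) / 2 = - e" by (simp add: e_def field_simps)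
      then show ?thesis unfolding J_def
        using integral_radial_weight_scaling[OF \<gamma>, of "2 * \<kappa>" t] \<kappa> t by simp
    qed
    finally show ?thesis .
  qed
  have "\<forall>\<^sub>F t in at_top. K2 * exp (- d3 * t) \<le> (\<delta> / 2) * t powr (- e)"
    by (rule exp_decay_le_powr) (use d3 \<delta> in auto)
  then show ?thesis using eventually_ge_at_top[of 1]
  proof eventually_elim
    case (elim t)
    have "2 * (C * \<eta>)\<^sup>2 * (t powr (- e) * J) + exp (- d3 * t) * K2 \<le> (\<delta> / 2) * t powr (- e) + (\<delta> / 2) * t powr (- e)"
    proof (rule add_mono)
      have "2 * (C * \<eta>)\<^sup>2 * (t powr (- e) * J) = (2 * (C * \<eta>)\<^sup>2 * J) * t powr (- e)" by (simp only: mult_ac)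
      also have "\<dots> \<le> (\<delta> / 2) * t powr (- e)" by (rule mult_right_mono[OF \<eta>J]) simp
      finally show "2 * (C * \<eta>)\<^sup>2 * (t powr (- e) * J) \<le> (\<delta> / 2) * t powr (- e)" .
      show "exp (- d3 * t) * K2 \<le> (\<delta> / 2) * t powr (- e)" using elim(1) by (simp add: mult.commute)
    qed
    also have "\<dots> = \<delta> * t powr (- e)" by simp
    finally show ?case using L2[OF elim(2)] unfolding e_def \<gamma>_def by (meson ennreal_leI order_trans)
  qed
qed

section \<open>The Riesz potential of the profile\<close>

text \<open>
  The polynomial \<open>P\<^sub>r / (\<lambda> - b)\<close> takes the value \<open>P\<^sub>r'(b)\<close> at \<open>b\<close>, and each summand of the profile is an exponential
  function of \<open>t\<close>, so that \<open>k\<close> derivatives multiply it by the \<open>k\<close>-th power of its exponent.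
\<close>

lemma riesz_profile_eq:
  assumes \<xi>: "\<xi> \<noteq> 0"
  shows "riesz_hat (real (r - 1)) (pointwise_dt k (profile_hat c r M) t) \<xi> = scaled_profile k M t \<xi>"
proof -
  define \<omega> where "\<omega> = \<xi> /\<^sub>R norm \<xi>"
  define \<rho> where "\<rho> = norm \<xi>"
  have \<rho>: "0 < \<rho>" using \<xi> by (simp add: \<rho>_def)
  define Z where "Z = {b. poly (symb c r \<omega>) b = 0}"
  define P' where "P' b = poly (pderiv (symb c r \<omega>)) b" for b
  have check: "poly (symb_check c r b \<omega>) b = P' b" if "b \<in> Z" for b
  proof -
    have "[:- b, 1:] dvd symb c r \<omega>" using that by (simp add: Z_def poly_eq_0_iff_dvd)
    then have e: "symb c r \<omega> = [:- b, 1:] * symb_check c r b \<omega>" unfolding symb_check_def by (rule dvd_mult_div_cancel[symmetric])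
    have "poly (pderiv ([:- b, 1:] * symb_check c r b \<omega>)) b = poly (symb_check c r b \<omega>) b"
      by (simp add: pderiv_mult pderiv_pCons del: mult_pCons_left mult_pCons_right)
    then show ?thesis unfolding P'_def using e by metis
  qed
  define \<mu> where "\<mu> b = slow_exponent \<omega> \<rho> b" for b
  define B where "B b = M / (\<i> ^ (r - 1) * of_real (P' b))" for b
  have prof: "profile_hat c r M \<tau> \<xi> = (\<Sum>b\<in>Z. B b * exp (\<mu> b * of_real \<tau>))" for \<tau>
  proof -
    have "profile_hat c r M \<tau> \<xi> = M * (\<Sum>b\<in>Z. exp (\<i> * of_real (\<rho> * b * \<tau>) + of_real (\<rho>\<^sup>2 * (poly (symb c (r + 1) \<omega>) b / poly (symb_check c r b \<omega>) b) * \<tau>))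
             / (\<i> ^ (r - 1) * of_real (poly (symb_check c r b \<omega>) b)))"
      by (simp add: profile_hat_def Let_def \<omega>_def \<rho>_def Z_def)
    also have "\<dots> = (\<Sum>b\<in>Z. B b * exp (\<mu> b * of_real \<tau>))"
      unfolding sum_distrib_left
    proof (rule sum.cong[OF refl])
      fix b assume b: "b \<in> Z"
      have "\<i> * of_real (\<rho> * b * \<tau>) + of_real (\<rho>\<^sup>2 * (poly (symb c (r + 1) \<omega>) b / poly (symb_check c r b \<omega>) b) * \<tau>) = \<mu> b * of_real \<tau>"
        unfolding check[OF b] by (simp add: \<mu>_def slow_exponent_def P'_def algebra_simps)
      then show "M * (exp (\<i> * of_real (\<rho> * b * \<tau>) + of_real (\<rho>\<^sup>2 * (poly (symb c (r + 1) \<omega>) b / poly (symb_check c r b \<omega>) b) * \<tau>))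
             / (\<i> ^ (r - 1) * of_real (poly (symb_check c r b \<omega>) b))) = B b * exp (\<mu> b * of_real \<tau>)"
        unfolding check[OF b] B_def by simp
    qed
    finally show ?thesis .
  qed
  have der: "((\<lambda>f \<tau>. vector_derivative f (at \<tau>)) ^^ k) (\<lambda>\<tau>. profile_hat c r M \<tau> \<xi>)
      = (\<lambda>\<tau>. \<Sum>b\<in>Z. B b * \<mu> b ^ k * exp (\<mu> b * of_real \<tau>))"
  proof (induction k)
    case 0
    then show ?case by (simp add: prof fun_eq_iff)
  next
    case (Suc k)
    have "((\<lambda>\<tau>. \<Sum>b\<in>Z. B b * \<mu> b ^ k * exp (\<mu> b * of_real \<tau>)) has_vector_derivative
        (\<Sum>b\<in>Z. B b * \<mu> b ^ Suc k * exp (\<mu> b * of_real \<tau>))) (at \<tau>)" for \<tau> :: real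
    proof (rule has_vector_derivative_sum)
      fix b
      have "((\<lambda>z. B b * \<mu> b ^ k * exp (\<mu> b * z)) has_field_derivative (B b * \<mu> b ^ Suc k * exp (\<mu> b * of_real \<tau>))) (at (of_real \<tau>))"
        by (auto intro!: derivative_eq_intros)
      from has_vector_derivative_real_field[OF this]
      show "((\<lambda>\<tau>. B b * \<mu> b ^ k * exp (\<mu> b * of_real \<tau>)) has_vector_derivative (B b * \<mu> b ^ Suc k * exp (\<mu> b * of_real \<tau>))) (at \<tau>)" .
    qed
    then show ?case unfolding funpow.simps o_def Suc by (intro ext vector_derivative_at)
  qed
  have "riesz_hat (real (r - 1)) (pointwise_dt k (profile_hat c r M) t) \<xi>
      = (\<Sum>b\<in>Z. B b * \<mu> b ^ k * exp (\<mu> b * of_real t)) / of_real (\<rho> ^ (r - 1))"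
    unfolding riesz_hat_def pointwise_dt_def der using \<rho>
    by (simp add: \<rho>_def powr_minus powr_realpow scaleR_conv_of_real divide_inverse mult.commute)
  also have "\<dots> = scaled_profile k M t \<xi>"
    unfolding scaled_profile_def slow_profile_def \<omega>_def[symmetric]
    unfolding \<rho>_def[symmetric] Z_def[symmetric] \<mu>_def[symmetric] P'_def[symmetric] sum_divide_distrib
    by (rule sum.cong) (simp_all add: B_def mult_ac)
  finally show ?thesis .
qed

text \<open>
  The sum of a continuous function over the roots is continuous: by the Newton estimate each root at a direction persists
  nearby, and the number of roots is constant.
\<close>

lemma continuous_on_root_sum:
  fixes h :: "real ^ 'n \<Rightarrow> real \<Rightarrow> complex"
  assumes h: "continuous_on {(\<xi>, b). \<xi> \<noteq> 0 \<and> poly (symb c r (\<xi> /\<^sub>R norm \<xi>)) b = 0} (\<lambda>(\<xi>, b). h \<xi> b)"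
  shows "continuous_on (- {0}) (\<lambda>\<xi>. \<Sum>b | poly (symb c r (\<xi> /\<^sub>R norm \<xi>)) b = 0. h \<xi> b)"
  unfolding continuous_on_sequentially o_def
proof (intro allI ballI impI)
  fix x :: "nat \<Rightarrow> real ^ 'n" and a assume a: "a \<in> - {0}" and x: "(\<forall>n. x n \<in> - {0}) \<and> x \<longlonglongrightarrow> a"
  define \<omega> where "\<omega> \<xi> = \<xi> /\<^sub>R norm \<xi>" for \<xi> :: "real ^ 'n"
  define Z where "Z \<xi> = {b. poly (symb c r (\<omega> \<xi>)) b = 0}" for \<xi>
  have n\<omega>: "norm (\<omega> \<xi>) = 1" if "\<xi> \<noteq> 0" for \<xi> using that by (simp add: \<omega>_def)
  have x0: "x n \<noteq> 0" for n using x by simp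
  have lim\<omega>: "(\<lambda>n. \<omega> (x n)) \<longlonglongrightarrow> \<omega> a" unfolding \<omega>_def using x a by (intro tendsto_intros) auto
  have fin: "finite (Z \<xi>)" "card (Z \<xi>) = r" if "\<xi> \<noteq> 0" for \<xi>
    using strictly_hyperbolic_card_roots[of c r "\<omega> \<xi>", OF sh_r lead_r n\<omega>[OF that]] by (auto simp: Z_def)
  have limP: "(\<lambda>n. poly (symb c r (\<omega> (x n))) b) \<longlonglongrightarrow> poly (symb c r (\<omega> a)) b"
    "(\<lambda>n. poly (pderiv (symb c r (\<omega> (x n)))) b) \<longlonglongrightarrow> poly (pderiv (symb c r (\<omega> a))) b" for b
    using continuous_on_tendsto_compose[OF continuous_on_poly_symb(1)[OF continuous_on_id continuous_on_const, of UNIV c r b] lim\<omega>]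
      continuous_on_tendsto_compose[OF continuous_on_poly_symb(2)[OF continuous_on_id continuous_on_const, of UNIV c r b] lim\<omega>] by auto
  have P'a: "poly (pderiv (symb c r (\<omega> a))) b \<noteq> 0" if "b \<in> Z a" for b
    using strictly_hyperbolic_pderiv_nonzero[OF sh_r n\<omega>[of a]] that a by (simp add: Z_def)
  have "\<exists>\<beta>. (\<forall>\<^sub>F n in sequentially. \<beta> n \<in> Z (x n)) \<and> \<beta> \<longlonglongrightarrow> b" if b: "b \<in> Z a" for b
  proof -
    let ?e = "\<lambda>n. real r * \<bar>poly (symb c r (\<omega> (x n))) b\<bar> / \<bar>poly (pderiv (symb c r (\<omega> (x n)))) b\<bar>"
    have "\<exists>b'. poly (pderiv (symb c r (\<omega> (x n)))) b \<noteq> 0 \<longrightarrow> b' \<in> Z (x n) \<and> \<bar>b' - b\<bar> \<le> ?e n" for n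
    proof (cases "poly (pderiv (symb c r (\<omega> (x n)))) b = 0")
      case False
      then have "poly (pderiv (csymb c r (\<omega> (x n)))) (of_real b) \<noteq> 0" by simp
      then obtain z where z: "poly (csymb c r (\<omega> (x n))) z = 0"
        "norm (z - of_real b) \<le> real (degree (csymb c r (\<omega> (x n)))) * norm (poly (csymb c r (\<omega> (x n))) (of_real b)) / norm (poly (pderiv (csymb c r (\<omega> (x n)))) (of_real b))"
        by (rule root_near_newton)
      have "z \<in> {z. poly (csymb c r (\<omega> (x n))) z = 0}" using z(1) by simp
      then have "z \<in> complex_of_real ` Z (x n)"
        unfolding strictly_hyperbolic_card_roots(3)[of c r "\<omega> (x n)", OF sh_r lead_r n\<omega>[OF x0]] Z_def .
      then obtain b' where b': "z = of_real b'" "b' \<in> Z (x n)" by blast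
      have "norm (z - of_real b) = \<bar>b' - b\<bar>" unfolding b'(1) of_real_diff[symmetric] by (rule norm_of_real)
      then show ?thesis using z(2) b' lead_r by (auto simp: degree_symb)
    qed simp
    then obtain \<beta> where \<beta>: "\<And>n. poly (pderiv (symb c r (\<omega> (x n)))) b \<noteq> 0 \<Longrightarrow> \<beta> n \<in> Z (x n) \<and> \<bar>\<beta> n - b\<bar> \<le> ?e n" by metis
    have ev: "\<forall>\<^sub>F n in sequentially. poly (pderiv (symb c r (\<omega> (x n)))) b \<noteq> 0"
      by (rule tendsto_imp_eventually_ne[OF limP(2) P'a[OF b]])
    have "?e \<longlonglongrightarrow> real r * \<bar>poly (symb c r (\<omega> a)) b\<bar> / \<bar>poly (pderiv (symb c r (\<omega> a))) b\<bar>"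
      using P'a[OF b] by (intro tendsto_intros limP) auto
    then have e0: "?e \<longlonglongrightarrow> 0" using b by (simp add: Z_def)
    have "\<beta> \<longlonglongrightarrow> b"
    proof (rule LIM_zero_cancel, rule Lim_null_comparison[OF _ e0])
      show "\<forall>\<^sub>F n in sequentially. norm (\<beta> n - b) \<le> ?e n" using ev by eventually_elim (use \<beta> in auto)
    qed
    moreover have "\<forall>\<^sub>F n in sequentially. \<beta> n \<in> Z (x n)" using ev by eventually_elim (use \<beta> in auto)
    ultimately show ?thesis by blast
  qed
  then obtain \<beta> where \<beta>: "\<And>b. b \<in> Z a \<Longrightarrow> \<forall>\<^sub>F n in sequentially. \<beta> b n \<in> Z (x n)" "\<And>b. b \<in> Z a \<Longrightarrow> \<beta> b \<longlonglongrightarrow> b"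
    by metis
  have a0: "a \<noteq> 0" using a by simp
  have ev_in: "\<forall>\<^sub>F n in sequentially. \<forall>b\<in>Z a. \<beta> b n \<in> Z (x n)"
    using fin(1)[OF a0] \<beta>(1) by (simp add: eventually_ball_finite_distrib)
  have ev_ne: "\<forall>\<^sub>F n in sequentially. \<forall>b\<in>Z a. \<forall>b'\<in>Z a. b \<noteq> b' \<longrightarrow> \<beta> b n \<noteq> \<beta> b' n"
  proof -
    have "\<forall>\<^sub>F n in sequentially. b \<noteq> b' \<longrightarrow> \<beta> b n \<noteq> \<beta> b' n" if "b \<in> Z a" "b' \<in> Z a" for b b'
    proof (cases "b = b'")
      case False
      have "(\<lambda>n. \<beta> b n - \<beta> b' n) \<longlonglongrightarrow> b - b'" by (intro tendsto_diff \<beta>(2) that)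
      from tendsto_imp_eventually_ne[OF this, of 0] show ?thesis using False by simp
    qed simp
    then show ?thesis using fin(1)[OF a0] by (simp add: eventually_ball_finite_distrib)
  qed
  have "\<forall>\<^sub>F n in sequentially. (\<Sum>b\<in>Z a. h (x n) (\<beta> b n)) = (\<Sum>b\<in>Z (x n). h (x n) b)"
    using ev_in ev_ne
  proof eventually_elim
    case (elim n)
    have inj: "inj_on (\<lambda>b. \<beta> b n) (Z a)" using elim(2) by (meson inj_onI)
    have "(\<lambda>b. \<beta> b n) ` Z a = Z (x n)"
      by (rule card_subset_eq) (use elim(1) fin[OF x0] fin[OF a0] inj in \<open>auto simp: card_image\<close>)
    then show ?case using sum.reindex[OF inj, of "h (x n)"] by simp
  qed
  moreover have "(\<lambda>n. \<Sum>b\<in>Z a. h (x n) (\<beta> b n)) \<longlonglongrightarrow> (\<Sum>b\<in>Z a. h a b)"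
  proof (rule tendsto_sum)
    fix b assume b: "b \<in> Z a"
    let ?D = "{(\<xi>, b). \<xi> \<noteq> 0 \<and> poly (symb c r (\<xi> /\<^sub>R norm \<xi>)) b = 0}"
    have "(\<lambda>n. (\<lambda>(\<xi>, b). h \<xi> b) (x n, \<beta> b n)) \<longlonglongrightarrow> (\<lambda>(\<xi>, b). h \<xi> b) (a, b)"
    proof (rule continuous_on_tendsto_compose[OF h])
      show "(\<lambda>n. (x n, \<beta> b n)) \<longlonglongrightarrow> (a, b)" using x \<beta>(2)[OF b] by (intro tendsto_Pair) auto
      show "(a, b) \<in> ?D" using b a0 by (simp add: Z_def \<omega>_def)
      show "\<forall>\<^sub>F n in sequentially. (x n, \<beta> b n) \<in> ?D"
        using \<beta>(1)[OF b] by eventually_elim (use x0 in \<open>auto simp: Z_def \<omega>_def\<close>)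
    qed
    then show "(\<lambda>n. h (x n) (\<beta> b n)) \<longlonglongrightarrow> h a b" by simp
  qed
  ultimately have "(\<lambda>n. \<Sum>b\<in>Z (x n). h (x n) b) \<longlonglongrightarrow> (\<Sum>b\<in>Z a. h a b)" by (rule Lim_transform_eventually[rotated])
  then show "(\<lambda>n. \<Sum>b | poly (symb c r (x n /\<^sub>R norm (x n))) b = 0. h (x n) b)
      \<longlonglongrightarrow> (\<Sum>b | poly (symb c r (a /\<^sub>R norm a)) b = 0. h a b)" by (simp add: Z_def \<omega>_def)
qed

lemma riesz_profile_measurable:
  "riesz_hat (real (r - 1)) (pointwise_dt k (profile_hat c r M) t) \<in> borel_measurable lborel"
proof -
  let ?F = "riesz_hat (real (r - 1)) (pointwise_dt k (profile_hat c r M) t)"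
  define D where "D = {(\<xi> :: real ^ 'n, b). \<xi> \<noteq> 0 \<and> poly (symb c r (\<xi> /\<^sub>R norm \<xi>)) b = 0}"
  have c\<omega>: "continuous_on D (\<lambda>x. fst x /\<^sub>R norm (fst x))" by (intro continuous_intros) (auto simp: D_def)
  have P'0: "poly (pderiv (symb c r (fst x /\<^sub>R norm (fst x)))) (snd x) \<noteq> 0" if "x \<in> D" for x
    by (rule strictly_hyperbolic_pderiv_nonzero[OF sh_r]) (use that in \<open>auto simp: D_def\<close>)
  have cont\<mu>: "continuous_on D (\<lambda>x. slow_exponent (fst x /\<^sub>R norm (fst x)) (norm (fst x)) (snd x))"
    unfolding slow_exponent_def using P'0
    by (intro continuous_intros continuous_on_poly_symb c\<omega>) auto
  have "continuous_on (- {0}) (\<lambda>\<xi>. slow_profile k M t (\<xi> /\<^sub>R norm \<xi>) (norm \<xi>))"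
    unfolding slow_profile_def
  proof (intro continuous_on_divide continuous_on_const continuous_on_root_sum)
    show "continuous_on {(\<xi>, b). \<xi> \<noteq> 0 \<and> poly (symb c r (\<xi> /\<^sub>R norm \<xi>)) b = 0}
      (\<lambda>(\<xi>, b). slow_exponent (\<xi> /\<^sub>R norm \<xi>) (norm \<xi>) b ^ k * (M / of_real (poly (pderiv (symb c r (\<xi> /\<^sub>R norm \<xi>))) b))
        * exp (slow_exponent (\<xi> /\<^sub>R norm \<xi>) (norm \<xi>) b * of_real t))"
      unfolding D_def[symmetric] case_prod_beta using P'0
      by (intro continuous_intros cont\<mu> continuous_on_poly_symb c\<omega>) auto
  qed auto
  then have "continuous_on (- {0}) (scaled_profile k M t)"
    unfolding scaled_profile_def[abs_def] by (intro continuous_intros) auto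
  then have "(\<lambda>\<xi>. indicator (- {0}) \<xi> *\<^sub>R scaled_profile k M t \<xi>) \<in> borel_measurable borel"
    by (intro borel_measurable_continuous_on_indicator) auto
  moreover have "(\<lambda>\<xi> :: real ^ 'n. indicator {0} \<xi> *\<^sub>R ?F 0) \<in> borel_measurable borel"
    by (intro borel_measurable_scaleR borel_measurable_indicator) auto
  ultimately have "(\<lambda>\<xi>. indicator (- {0}) \<xi> *\<^sub>R scaled_profile k M t \<xi> + indicator {0} \<xi> *\<^sub>R ?F 0) \<in> borel_measurable borel"
    by (rule borel_measurable_add)
  moreover have "(\<lambda>\<xi>. indicator (- {0}) \<xi> *\<^sub>R scaled_profile k M t \<xi> + indicator {0} \<xi> *\<^sub>R ?F 0) = ?F"
    using riesz_profile_eq by (auto simp: fun_eq_iff indicator_def)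
  ultimately show ?thesis by simp
qed

section \<open>The asymptotic profile of a solution\<close>

lemma coeff_Q_sobolev_bound:
  obtains C where "0 \<le> C" "\<And>j \<xi>. j < m \<Longrightarrow> norm (coeff (Q \<xi>) j) \<le> C * (1 + (norm \<xi>)\<^sup>2) powr (real (m - j) / 2)"
proof -
  obtain K where K: "0 < K" "\<And>\<xi> i. i \<le> m \<Longrightarrow> norm (coeff (Q \<xi>) i) \<le> K * (1 + norm \<xi>) ^ (m - i)"
    using coeff_Q_bound by metis
  show ?thesis
  proof (rule that[of "K * 2 ^ m"])
    fix j and \<xi> :: "real ^ 'n" assume j: "j < m"
    let ?w = "1 + (norm \<xi>)\<^sup>2"
    have w: "0 < ?w" by (simp add: add_pos_nonneg)
    have "(1 + norm \<xi>)\<^sup>2 \<le> 2 * 1\<^sup>2 + 2 * (norm \<xi>)\<^sup>2" by (rule power2_add_le)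
    also have "\<dots> \<le> (2 * sqrt ?w)\<^sup>2" using w by (simp add: power_mult_distrib)
    finally have "1 + norm \<xi> \<le> 2 * sqrt ?w" by (rule power2_le_imp_le) (use w in simp)
    then have "(1 + norm \<xi>) ^ (m - j) \<le> (2 * sqrt ?w) ^ (m - j)" by (rule power_mono) simp
    also have "\<dots> = 2 ^ (m - j) * ?w powr (real (m - j) / 2)"
    proof -
      have "sqrt ?w ^ (m - j) = (?w powr (1 / 2)) powr real (m - j)"
        using w by (simp add: powr_half_sqrt powr_realpow)
      then show ?thesis by (simp add: power_mult_distrib powr_powr)
    qed
    also have "\<dots> \<le> 2 ^ m * ?w powr (real (m - j) / 2)" by (intro mult_right_mono power_increasing) auto
    finally have "K * (1 + norm \<xi>) ^ (m - j) \<le> K * (2 ^ m * ?w powr (real (m - j) / 2))"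
      using K by (intro mult_left_mono) auto
    then show "norm (coeff (Q \<xi>) j) \<le> K * 2 ^ m * ?w powr (real (m - j) / 2)"
      using K(2)[of j \<xi>] j by (simp add: mult.assoc)
  qed (use K in simp)
qed

lemma sum_op_hat:
  "(\<Sum>l\<in>{r..m}. op_hat c l U \<xi>) = U m \<xi> + (\<Sum>j<m. coeff (Q \<xi>) j * U j \<xi>)"
proof -
  let ?s = "\<lambda>l k. symbol_coeff c l k (\<chi> i. \<i> * complex_of_real (\<xi> $ i))"
  have cQ: "coeff (Q \<xi>) k = (\<Sum>l\<in>{r..m}. if k \<le> l then ?s l k else 0)" for k
    unfolding full_symbol_def coeff_sum by (intro sum.cong refl) simp
  have "(\<Sum>l\<in>{r..m}. op_hat c l U \<xi>) = (\<Sum>l\<in>{r..m}. \<Sum>k\<le>m. (if k \<le> l then ?s l k else 0) * U k \<xi>)"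
    unfolding op_hat_def
    by (intro sum.cong refl sum.mono_neutral_cong_left) auto
  also have "\<dots> = (\<Sum>k\<le>m. coeff (Q \<xi>) k * U k \<xi>)"
    unfolding cQ sum_distrib_right by (rule sum.swap)
  also have "{..m} = insert m {..<m}" by auto
  finally show ?thesis by (simp add: coeff_Q_top)
qed

text \<open>
  Integrability of the initial values selects, in the class of their \<open>L\<^sup>2\<close> transforms, the continuous
  representatives given by the Fourier integral.
\<close>

lemma dt_hat_eq_evolution:
  assumes sol: "solves_cauchy c {r..m} m s0 u0 u"
    and u0: "\<And>j. j < m \<Longrightarrow> in_sobolev (s0 - real j) (u0 j)" "\<And>j. j < m \<Longrightarrow> integrable lborel (u0 j)"
  shows "0 \<le> t \<Longrightarrow> dt_hat s0 k u t \<in> borel_measurable lborel"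
    "0 \<le> t \<Longrightarrow> AE \<xi> in lborel. dt_hat s0 k u t \<xi> = evolution (\<lambda>j. fourier_integral (u0 j)) k t \<xi>"
    "j < m \<Longrightarrow> in_sobolev_hat (s0 - real j) (fourier_integral (u0 j))"
proof -
  obtain C where C: "0 \<le> C" "\<And>j \<xi>. j < m \<Longrightarrow> norm (coeff (Q \<xi>) j) \<le> C * (1 + (norm \<xi>)\<^sup>2) powr (real (m - j) / 2)"
    using coeff_Q_sobolev_bound by blast
  interpret S: sobolev_solution m s0 "\<lambda>j \<xi>. coeff (Q \<xi>) j" C "\<lambda>j. dt_hat s0 j u"
  proof
    show "(\<lambda>\<xi>. coeff (Q \<xi>) j) \<in> borel_measurable lborel" for j
      using borel_measurable_continuous_onI[OF continuous_on_coeff_Q[of UNIV j]] by simp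
    show "dt_hat s0 (Suc j) u t = (SOME G. has_sobolev_deriv (s0 - real (Suc j)) (dt_hat s0 j u) G t)" for j t
      by (simp add: dt_hat_def)
    show "0 < m" using rm by simp
    show "AE \<xi> in lborel. dt_hat s0 m u t \<xi> + (\<Sum>j<m. coeff (Q \<xi>) j * dt_hat s0 j u t \<xi>) = 0" if "0 \<le> t" for t
      using sol that unfolding solves_cauchy_def sum_op_hat by blast
  qed (use C sol in \<open>auto simp: solves_cauchy_def\<close>)
  have init: "AE \<xi> in lborel. dt_hat s0 j u 0 \<xi> = fourier_integral (u0 j) \<xi>" if j: "j < m" for j
  proof -
    have "AE \<xi> in lborel. dt_hat s0 j u 0 \<xi> = fourier (u0 j) \<xi>"
      using sol j unfolding solves_cauchy_def by blast
    then show ?thesis using fourier_integrable_AE[OF u0(1)[OF j] u0(2)[OF j]] by eventually_elim simp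
  qed
  show "in_sobolev_hat (s0 - real j) (fourier_integral (u0 j))" if j: "j < m"
    by (rule in_sobolev_hat_cong_AE[OF S.U_in init[OF j]])
       (use j fourier_integral_measurable[OF u0(2)[OF j]] in auto)
  assume t: "0 \<le> t"
  show "dt_hat s0 k u t \<in> borel_measurable lborel" using S.U_eq_V[OF t] by blast
  have "AE \<xi> in lborel. \<forall>j\<in>{..<m}. dt_hat s0 j u 0 \<xi> = fourier_integral (u0 j) \<xi>"
    using init by (subst AE_ball_countable) auto
  then show "AE \<xi> in lborel. dt_hat s0 k u t \<xi> = evolution (\<lambda>j. fourier_integral (u0 j)) k t \<xi>"
    using S.U_series[OF t, of k]
  proof eventually_elim
    case (elim \<xi>)
    have "S.V n 0 \<xi> = rec_seq m (coeff (Q \<xi>)) (\<lambda>j. fourier_integral (u0 j) \<xi>) n" for n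
      unfolding S.V_def by (rule rec_seq_cong) (use elim(1) in auto)
    then show ?case using elim(2) by (simp add: evolution_def)
  qed
qed

text \<open>
  The decay estimate for the transforms, with arbitrarily small constants, becomes the statement about the
  norms after taking square roots and replacing \<open>t\<close> by \<open>1 + t \<le> 2 t\<close>.
\<close>

lemma asymptotic_profile:
  assumes s0: "real m - 1 \<le> s0"
    and u0: "\<And>j. j < m \<Longrightarrow> in_sobolev (s0 - real j) (u0 j)" "\<And>j. j < m \<Longrightarrow> integrable lborel (u0 j)"
    and sol: "solves_cauchy c {r..m} m s0 u0 u"
    and M: "M = (\<Sum>j\<in>{r - 1..<m}. of_real (c (Suc j) (\<lambda>_. 0)) * (LINT x|lborel. u0 j x))"
    and s: "0 \<le> s" "real k + s \<le> s0" and dim: "real r - 1 < real CARD('n) / 2 + real k + s"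
  defines "D \<equiv> \<lambda>t \<xi>. dt_hat s0 k u t \<xi> - riesz_hat (real r - 1) (pointwise_dt k (profile_hat c r M) t) \<xi>"
  shows "\<forall>\<^sub>F t in at_top. in_hdot_hat s (D t)"
    "(\<lambda>t. hdot_norm_hat s (D t)) \<in> o(\<lambda>t. (1 + t) powr (- real CARD('n) / 4 - (real k + s - (real r - 1)) / 2))"
proof -
  define f where "f = (\<lambda>j. fourier_integral (u0 j))"
  define A where "A = (\<Sum>j<m. LINT x|lborel. norm (u0 j x))"
  define \<beta> where "\<beta> = real CARD('n) / 4 + (real k + s - (real r - 1)) / 2"
  have \<beta>: "0 < \<beta>" 
  proof -
    have "0 < (real CARD('n) / 2 + real k + s - (real r - 1)) / 2" using dim by simp
    also have "\<dots> = \<beta>" by (simp add: \<beta>_def field_simps)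
    finally show ?thesis .
  qed
  have rr: "real r - 1 = real (r - 1)" using r1 by simp
  have fA: "norm (f j \<xi>) \<le> A" if j: "j < m" for j \<xi>
  proof -
    have "norm (f j \<xi>) \<le> (LINT x|lborel. norm (u0 j x))" unfolding f_def by (rule norm_fourier_integral_le[OF u0(2)[OF j]])
    also have "\<dots> \<le> A" unfolding A_def
      by (rule member_le_sum) (use j in \<open>auto intro!: integral_nonneg_AE\<close>)
    finally show ?thesis .
  qed
  have Mf: "M = (\<Sum>j\<in>{r - 1..<m}. of_real (c (Suc j) (\<lambda>_. 0)) * f j 0)"
    unfolding M f_def by (simp add: fourier_integral_0)
  have decay: "\<forall>\<^sub>F t in at_top. L2_norm_sq (hdot_weight s (D t)) \<le> ennreal (\<delta> * t powr (- (2 * \<beta>)))" if \<delta>: "0 < \<delta>" for \<delta>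
  proof -
    have "\<forall>\<^sub>F t in at_top. L2_norm_sq (hdot_weight s (\<lambda>\<xi>. evolution f k t \<xi> - scaled_profile k M t \<xi>))
      \<le> ennreal (\<delta> * t powr (- (s + real k - (real r - 1) + real CARD('n) / 2)))"
    proof (rule difference_decay[where f = f and s = s and k = k and s0 = s0 and A = A and M = M and \<delta> = \<delta>])
      show "isCont (f j) 0" if "j < m" for j unfolding f_def by (rule isCont_fourier_integral[OF u0(2)[OF that]])
      show "in_sobolev_hat (s0 - real j) (f j)" if "j < m" for j unfolding f_def by (rule dt_hat_eq_evolution(3)[OF sol u0 that])
    qed (use s s0 dim fA Mf \<delta> in auto)
    then show ?thesis using eventually_ge_at_top[of 0]
    proof eventually_elim
      case (elim t)
      have "AE \<xi> in lborel. dt_hat s0 k u t \<xi> = evolution (\<lambda>j. fourier_integral (u0 j)) k t \<xi>"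
        by (rule dt_hat_eq_evolution(2)[OF sol u0 elim(2)])
      then have "AE \<xi> in lborel. hdot_weight s (D t) \<xi> = hdot_weight s (\<lambda>\<xi>. evolution f k t \<xi> - scaled_profile k M t \<xi>) \<xi>"
        using AE_lborel_singleton[of "0 :: real ^ 'n"]
        by eventually_elim (simp only: hdot_weight_def D_def f_def rr riesz_profile_eq not_False_eq_True)
      then have "L2_norm_sq (hdot_weight s (D t)) = L2_norm_sq (hdot_weight s (\<lambda>\<xi>. evolution f k t \<xi> - scaled_profile k M t \<xi>))"
        by (rule L2_norm_sq_cong_AE)
      moreover have "s + real k - (real r - 1) + real CARD('n) / 2 = 2 * \<beta>" by (simp add: \<beta>_def field_simps)
      ultimately show ?case using elim(1) by simp
    qed
  qed
  show "\<forall>\<^sub>F t in at_top. in_hdot_hat s (D t)"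
    using decay[of 1, OF zero_less_one] eventually_ge_at_top[of 0]
  proof eventually_elim
    case (elim t)
    have "D t \<in> borel_measurable lborel"
      unfolding D_def rr by (intro borel_measurable_diff dt_hat_eq_evolution(1)[OF sol u0 elim(2)] riesz_profile_measurable)
    then have "hdot_weight s (D t) \<in> borel_measurable lborel"
      unfolding hdot_weight_def by (intro borel_measurable_scaleR powr_real_measurable) auto
    moreover have "L2_norm_sq (hdot_weight s (D t)) < \<infinity>"
      by (rule le_less_trans[OF elim(1)]) simp
    ultimately show ?case by (simp add: in_hdot_hat_def in_L2_def)
  qed
  have "(\<lambda>t. hdot_norm_hat s (D t)) \<in> o(\<lambda>t. (1 + t) powr (- \<beta>))"
  proof (rule landau_o.smallI)
    fix K :: real assume K: "0 < K"
    define a where "a = K * 2 powr (- \<beta>)"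
    have a: "0 < a" using K by (simp add: a_def)
    then have "0 < a\<^sup>2" by simp
    from decay[OF this] show "\<forall>\<^sub>F t in at_top. norm (hdot_norm_hat s (D t)) \<le> K * norm ((1 + t) powr (- \<beta>))"
      using eventually_ge_at_top[of 1]
    proof eventually_elim
      case (elim t)
      have "enn2real (L2_norm_sq (hdot_weight s (D t))) \<le> a\<^sup>2 * t powr (- (2 * \<beta>))"
        using enn2real_mono[OF elim(1)] by simp
      also have "\<dots> = (a * t powr (- \<beta>))\<^sup>2"
        by (simp add: power_mult_distrib) (simp add: power2_eq_square powr_add[symmetric])
      finally have "hdot_norm_hat s (D t) \<le> a * t powr (- \<beta>)"
        unfolding hdot_norm_hat_def L2_norm_def using a by (intro real_le_lsqrt) auto
      also have "\<dots> = K * (2 * t) powr (- \<beta>)" using elim by (simp add: a_def powr_mult)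
      also have "\<dots> \<le> K * (1 + t) powr (- \<beta>)"
        using K elim \<beta> by (intro mult_left_mono powr_mono2') auto
      finally show ?case by (simp add: hdot_norm_hat_def L2_norm_def)
    qed
  qed
  moreover have "- real CARD('n) / 4 - (real k + s - (real r - 1)) / 2 = - \<beta>" by (simp add: \<beta>_def)
  ultimately show "(\<lambda>t. hdot_norm_hat s (D t)) \<in> o(\<lambda>t. (1 + t) powr (- real CARD('n) / 4 - (real k + s - (real r - 1)) / 2))"
    by simp
qed

end

section \<open>Interlacing and dissipation\<close>

lemma poly_linear_factors:
  "poly (\<Prod>x\<leftarrow>xs. [:- x, 1:]) (z :: real) = (\<Prod>j<length xs. z - xs ! j)"
  "pderiv (\<Prod>x\<leftarrow>xs. [:- x, 1:]) = pderiv (\<Prod>j<length xs. [:- (xs ! j :: real), 1:])"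
proof -
  have e: "(\<Prod>x\<leftarrow>xs. [:- x, 1:]) = (\<Prod>j<length xs. [:- (xs ! j :: real), 1:])"
    by (simp add: prod.list_conv_set_nth atLeast0LessThan)
  show "poly (\<Prod>x\<leftarrow>xs. [:- x, 1:]) z = (\<Prod>j<length xs. z - xs ! j)"
    unfolding e by (simp add: poly_prod)
  show "pderiv (\<Prod>x\<leftarrow>xs. [:- x, 1:]) = pderiv (\<Prod>j<length xs. [:- (xs ! j :: real), 1:])"
    unfolding e ..
qed

text \<open>
  The signs at the roots are obtained by pairing each linear factor of one polynomial with a factor of the
  other one of the same sign; at a root of \<open>p\<close> one negative factor of \<open>q\<close> remains.
\<close>

lemma strictly_interlace_signs:
  assumes I: "strictly_interlace p q" and lead: "0 < lead_coeff p" "0 < lead_coeff q"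
  shows "poly q y = 0 \<Longrightarrow> 0 < poly p y / poly (pderiv q) y"
    and "poly p x = 0 \<Longrightarrow> poly q x / poly (pderiv p) x < 0"
proof -
  obtain xs ys where so: "sorted xs" "sorted ys" and len: "length ys = Suc (length xs)"
    and p: "p = smult (lead_coeff p) (\<Prod>x\<leftarrow>xs. [:- x, 1:])" and q: "q = smult (lead_coeff q) (\<Prod>y\<leftarrow>ys. [:- y, 1:])"
    and il: "\<And>i. i < length xs \<Longrightarrow> ys ! i < xs ! i \<and> xs ! i < ys ! Suc i"
    using I unfolding strictly_interlace_def by blast
  define n where "n = length xs"
  have pz: "poly p z = lead_coeff p * (\<Prod>j<n. z - xs ! j)" and qz: "poly q z = lead_coeff q * (\<Prod>j<Suc n. z - ys ! j)" for z
    using arg_cong[OF p, of "\<lambda>p. poly p z"] arg_cong[OF q, of "\<lambda>p. poly p z"] by (simp_all only: poly_smult poly_linear_factors n_def len)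
  have p': "poly (pderiv p) (xs ! i) = lead_coeff p * (\<Prod>j\<in>{..<n} - {i}. xs ! i - xs ! j)" if "i < n" for i
    using arg_cong[OF p, of "\<lambda>p. poly (pderiv p) (xs ! i)"] pderiv_prod_linear_root[of "{..<n}" i "\<lambda>j. xs ! j"] that
    by (simp only: pderiv_smult poly_smult poly_linear_factors n_def finite_lessThan lessThan_iff)
  have q': "poly (pderiv q) (ys ! i) = lead_coeff q * (\<Prod>j\<in>{..<Suc n} - {i}. ys ! i - ys ! j)" if "i < Suc n" for i
    using arg_cong[OF q, of "\<lambda>p. poly (pderiv p) (ys ! i)"] pderiv_prod_linear_root[of "{..<Suc n}" i "\<lambda>j. ys ! j"] that
    by (simp only: pderiv_smult poly_smult poly_linear_factors len n_def finite_lessThan lessThan_iff)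
  have ysm: "ys ! i \<le> ys ! j" if "i \<le> j" "j \<le> n" for i j
    using so(2) that len by (simp add: sorted_nth_mono n_def)
  have lt1: "ys ! i < xs ! j" if "i \<le> j" "j < n" for i j
    using ysm[of i j] il[of j] that by (force simp: n_def)
  have lt2: "xs ! j < ys ! i" if "j < i" "i \<le> n" for i j
    using ysm[of "Suc j" i] il[of j] that by (force simp: n_def)
  have ylt: "ys ! i < ys ! j" if "i < j" "j \<le> n" for i j
    using lt1[of i i] lt2[of i j] that by simp
  have xlt: "xs ! i < xs ! j" if "i < j" "j < n" for i j
    using lt2[of i j] lt1[of j j] that by simp
  show "0 < poly p y / poly (pderiv q) y" if "poly q y = 0"
  proof -
    have "\<exists>i\<in>{..<Suc n}. y - ys ! i = 0" using that lead(2) unfolding qz by (auto simp: prod_zero_iff simp del: prod.lessThan_Suc)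
    then obtain i where i: "i < Suc n" "y = ys ! i" by auto
    have sets: "{..<n} = {..<i} \<union> {i..<n}" "{..<Suc n} - {i} = {..<i} \<union> {Suc i..<Suc n}" using i by auto
    let ?a = "\<Prod>j<i. ys ! i - xs ! j" and ?b = "\<Prod>j=i..<n. ys ! i - xs ! j"
    let ?c = "\<Prod>j<i. ys ! i - ys ! j" and ?d = "\<Prod>j=i..<n. ys ! i - ys ! Suc j"
    have "(\<Prod>j<n. ys ! i - xs ! j) = ?a * ?b" unfolding sets(1) by (rule prod.union_disjoint) auto
    moreover have "(\<Prod>j\<in>{..<Suc n} - {i}. ys ! i - ys ! j) = ?c * ?d"
    proof -
      have "(\<Prod>j=Suc i..<Suc n. ys ! i - ys ! j) = ?d" by (rule prod.shift_bounds_Suc_ivl)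
      then show ?thesis unfolding sets(2) by (subst prod.union_disjoint) (auto simp del: prod.op_ivl_Suc)
    qed
    moreover have "0 < ?a" "0 < ?c" using i by (auto intro!: prod_pos lt2 ylt)
    moreover have "0 < ?b * ?d" unfolding prod.distrib[symmetric]
      using i by (intro prod_pos) (auto intro!: mult_neg_neg lt1 ylt)
    ultimately have eq: "poly p y * poly (pderiv q) y = (lead_coeff p * lead_coeff q * ?a * ?c) * (?b * ?d)"
      and pos: "0 < ?a" "0 < ?c" "0 < ?b * ?d"
      unfolding i(2) pz q'[OF i(1)] by (simp_all only: mult_ac)
    have "0 < poly p y * poly (pderiv q) y"
      unfolding eq using mult_pos_pos[OF mult_pos_pos[OF mult_pos_pos[OF mult_pos_pos[OF lead] pos(1)] pos(2)] pos(3)] .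
    then show ?thesis by (simp add: zero_less_divide_iff zero_less_mult_iff)
  qed
  show "poly q x / poly (pderiv p) x < 0" if "poly p x = 0"
  proof -
    have "\<exists>i\<in>{..<n}. x - xs ! i = 0" using that lead(1) unfolding pz by (auto simp: prod_zero_iff)
    then obtain i where i: "i < n" "x = xs ! i" by auto
    have sets: "{..<n} - {i} = {..<i} \<union> {Suc i..<n}" "{..<Suc n} = {..<Suc i} \<union> {Suc i..<Suc n}" "{i..<n} = insert i {Suc i..<n}" using i by auto
    let ?a = "\<Prod>j<i. xs ! i - xs ! j" and ?b = "\<Prod>j=Suc i..<n. xs ! i - xs ! j"
    let ?c = "\<Prod>j<Suc i. xs ! i - ys ! j" and ?d = "\<Prod>j=Suc i..<n. xs ! i - ys ! Suc j" and ?e = "xs ! i - ys ! Suc i"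
    have "(\<Prod>j\<in>{..<n} - {i}. xs ! i - xs ! j) = ?a * ?b" unfolding sets(1) by (rule prod.union_disjoint) auto
    moreover have "(\<Prod>j<Suc n. xs ! i - ys ! j) = ?c * (?e * ?d)"
    proof -
      have "(\<Prod>j=Suc i..<Suc n. xs ! i - ys ! j) = (\<Prod>j=i..<n. xs ! i - ys ! Suc j)" by (rule prod.shift_bounds_Suc_ivl)
      also have "\<dots> = ?e * ?d" unfolding sets(3) by (subst prod.insert) auto
      finally show ?thesis unfolding sets(2)
        by (subst prod.union_disjoint) (auto simp del: prod.op_ivl_Suc prod.lessThan_Suc)
    qed
    moreover have "0 < ?a" using i by (auto intro!: prod_pos xlt)
    moreover have "0 < ?c" using i by (intro prod_pos) (auto intro!: lt1)
    moreover have "?e < 0" using i by (auto intro!: lt2)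
    moreover have "0 < ?b * ?d" unfolding prod.distrib[symmetric]
      using i by (intro prod_pos) (auto intro!: mult_neg_neg lt2 xlt)
    ultimately have eq: "poly q x * poly (pderiv p) x = (lead_coeff q * lead_coeff p * ?c * ?a) * (?b * ?d) * ?e"
      and signs: "0 < ?a" "0 < ?c" "?e < 0" "0 < ?b * ?d"
      unfolding i(2) qz p'[OF i(1)] by (simp_all only: mult_ac)
    have "poly q x * poly (pderiv p) x < 0" unfolding eq
      by (rule mult_pos_neg[OF mult_pos_pos[OF mult_pos_pos[OF mult_pos_pos[OF mult_pos_pos[OF lead(2,1)] signs(2)] signs(1)] signs(4)] signs(3)])
    then show ?thesis by (simp add: divide_less_0_iff mult_less_0_iff)
  qed
qed

text \<open>
  By partial fractions \<open>P\<^sub>l\<^sub>' / P\<^sub>l\<close> is a sum of \<open>\<gamma> / (z - a)\<close> with \<open>\<gamma> > 0\<close> over the real roots \<open>a\<close> of \<open>P\<^sub>l\<close>, and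
  therefore maps the lower half-plane to the upper one.
\<close>

lemma Im_symbol_quotient_pos:
  fixes c :: "'n::finite coeffs"
  assumes sh: "strictly_hyperbolic c l" and lead: "c l (\<lambda>_. 0) \<noteq> 0" and \<omega>: "norm \<omega> = 1" and l: "l' < l"
    and pos: "\<And>a. poly (symb c l \<omega>) a = 0 \<Longrightarrow> 0 < poly (symb c l' \<omega>) a / poly (pderiv (symb c l \<omega>)) a"
    and z: "Im z < 0"
  shows "poly (csymb c l \<omega>) z \<noteq> 0" "0 < Im (poly (csymb c l' \<omega>) z / poly (csymb c l \<omega>) z)"
proof -
  note roots = strictly_hyperbolic_card_roots[of c l \<omega>, OF sh lead \<omega>]
  define Z where "Z = {a. poly (symb c l \<omega>) a = 0}"
  define B where "B = complex_of_real ` Z"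
  define S where "S = (\<Prod>b\<in>B. [:- b, 1:])"
  have finB: "finite B" and cardB: "card B = l"
    using roots by (auto simp: B_def Z_def card_image inj_on_def)
  have Broot: "B = {z. poly (csymb c l \<omega>) z = 0}" using roots(3) by (simp add: B_def Z_def)
  have nreal: "z \<noteq> b" if "b \<in> B" for b using that z by (auto simp: B_def)
  show Pz: "poly (csymb c l \<omega>) z \<noteq> 0" using nreal Broot by auto
  have deg: "degree (csymb c l \<omega>) = l" using lead by (simp add: degree_symb)
  obtain g where g: "csymb c l \<omega> = S * g"
    using prod_linear_dvd[OF finB, of "csymb c l \<omega>"] unfolding S_def Broot by (auto elim: dvdE)
  have nz: "csymb c l \<omega> \<noteq> 0" using Pz by auto
  then have nz': "S \<noteq> 0" "g \<noteq> 0" using g by auto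
  have "degree g = 0"
    using degree_mult_eq[OF nz'] g deg degree_prod_linear[OF finB] cardB by (simp add: S_def)
  then obtain g0 where g0: "g = [:g0:]" by (rule degree_eq_zeroE)
  have P: "csymb c l \<omega> = smult g0 S" using g g0 by (simp add: mult.commute)
  have g00: "g0 \<noteq> 0" using nz P by auto
  have P': "poly (pderiv (csymb c l \<omega>)) b = g0 * poly (pderiv S) b" for b unfolding P by (simp add: pderiv_smult)
  let ?\<gamma> = "\<lambda>b. poly (csymb c l' \<omega>) b / poly (pderiv (csymb c l \<omega>)) b"
  have "degree (csymb c l' \<omega>) < card B" using degree_symb_le[of c l' \<omega>] l cardB by simp
  from arg_cong[OF lagrange_interpolation[OF finB this], of "\<lambda>p. poly p z"]
  have "poly (csymb c l' \<omega>) z = (\<Sum>b\<in>B. poly (csymb c l' \<omega>) b / poly (pderiv S) b * (\<Prod>b'\<in>B - {b}. z - b'))"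
    unfolding S_def by (simp add: poly_sum poly_prod)
  also have "\<dots> = (\<Sum>b\<in>B. ?\<gamma> b / (z - b)) * poly (csymb c l \<omega>) z"
    unfolding sum_distrib_right
  proof (rule sum.cong[OF refl])
    fix b assume b: "b \<in> B"
    have "poly S z = (z - b) * (\<Prod>b'\<in>B - {b}. z - b')"
      unfolding S_def using prod.remove[OF finB b, of "\<lambda>b. z - b"] by (simp add: poly_prod)
    then show "poly (csymb c l' \<omega>) b / poly (pderiv S) b * (\<Prod>b'\<in>B - {b}. z - b') = ?\<gamma> b / (z - b) * poly (csymb c l \<omega>) z"
      unfolding P' unfolding P using g00 nreal[OF b] by simp
  qed
  finally have "poly (csymb c l' \<omega>) z / poly (csymb c l \<omega>) z = (\<Sum>b\<in>B. ?\<gamma> b / (z - b))" using Pz by simp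
  also have "Im \<dots> = (\<Sum>b\<in>B. Im (?\<gamma> b / (z - b)))" by simp
  also have "0 < \<dots>"
  proof (rule sum_pos[OF finB])
    show "B \<noteq> {}" using cardB l by auto
    fix b assume b: "b \<in> B"
    then obtain a where a: "b = of_real a" "a \<in> Z" by (auto simp: B_def)
    define \<gamma> where "\<gamma> = poly (symb c l' \<omega>) a / poly (pderiv (symb c l \<omega>)) a"
    have \<gamma>: "0 < \<gamma>" unfolding \<gamma>_def using a by (intro pos) (simp add: Z_def)
    have "?\<gamma> b / (z - b) = of_real \<gamma> / (z - of_real a)" by (simp add: a \<gamma>_def)
    then have "Im (?\<gamma> b / (z - b)) = - \<gamma> * Im z / ((Re z - a)\<^sup>2 + (Im z)\<^sup>2)" by (simp add: Im_divide)
    moreover have "0 < (Re z - a)\<^sup>2 + (Im z)\<^sup>2" using z by (simp add: sum_power2_gt_zero_iff)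
    ultimately show "0 < Im (?\<gamma> b / (z - b))" using \<gamma> z by (simp add: divide_neg_pos mult_pos_neg)
  qed
  finally show "0 < Im (poly (csymb c l' \<omega>) z / poly (csymb c l \<omega>) z)" .
qed

text \<open>
  The exponents solve \<open>P\<^sub>m\<^sub>-\<^sub>1(z) / P\<^sub>m(z) = - i \<rho>\<close>. The right-hand side lies in the lower half-plane, the left-hand side
  in the upper one if \<open>Im z < 0\<close>. A real solution would be a common root of \<open>P\<^sub>m\<^sub>-\<^sub>1\<close> and \<open>P\<^sub>m\<close>.
\<close>

lemma dissipative_symbol_two_orders:
  fixes c :: "'n::finite coeffs"
  assumes m: "2 \<le> m" and lead: "c m (\<lambda>_. 0) = 1" "0 < c (m - 1) (\<lambda>_. 0)"
    and sh: "strictly_hyperbolic c m" "strictly_hyperbolic c (m - 1)"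
    and il: "\<And>\<omega>. norm \<omega> = 1 \<Longrightarrow> strictly_interlace (symb c (m - 1) \<omega>) (symb c m \<omega>)"
  shows "dissipative_symbol c m (m - 1)"
proof -
  have m1: "Suc (m - 1) = m" "m - (m - 1) = 1" using m by auto
  have fast: "0 < poly (symb c (m - 1) \<omega>) a / poly (pderiv (symb c m \<omega>)) a" if "norm \<omega> = 1" "poly (symb c m \<omega>) a = 0" for \<omega> a
    by (rule strictly_interlace_signs(1)[OF il[OF that(1)] _ _ that(2)]) (use lead in \<open>simp_all add: lead_coeff_symb\<close>)
  have slow: "poly (symb c m \<omega>) a / poly (pderiv (symb c (m - 1) \<omega>)) a < 0" if "norm \<omega> = 1" "poly (symb c (m - 1) \<omega>) a = 0" for \<omega> a
    by (rule strictly_interlace_signs(2)[OF il[OF that(1)] _ _ that(2)]) (use lead in \<open>simp_all add: lead_coeff_symb\<close>)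
  show ?thesis
  proof
    fix \<omega> :: "real ^ 'n" and \<rho> :: real and z
    assume \<omega>: "norm \<omega> = 1" and \<rho>: "0 < \<rho>"
      and "poly (\<Sum>i\<le>m - (m - 1). smult ((\<i> * of_real \<rho>) ^ i) (csymb c (m - 1 + i) \<omega>)) z = 0"
    then have eq: "poly (csymb c (m - 1) \<omega>) z + \<i> * of_real \<rho> * poly (csymb c m \<omega>) z = 0"
      using m1 by simp
    show "0 < Im z"
    proof (rule ccontr)
      assume "\<not> 0 < Im z"
      then consider "Im z < 0" | "Im z = 0" by linarith
      then show False
      proof cases
        case 1
        have P: "poly (csymb c m \<omega>) z \<noteq> 0" "0 < Im (poly (csymb c (m - 1) \<omega>) z / poly (csymb c m \<omega>) z)"
          using Im_symbol_quotient_pos[of c m \<omega> "m - 1" z, OF sh(1) _ \<omega> _ fast[OF \<omega>] 1] lead m by auto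
        have "poly (csymb c (m - 1) \<omega>) z / poly (csymb c m \<omega>) z = - (\<i> * of_real \<rho>)"
          using eq P(1) by (simp add: field_simps eq_neg_iff_add_eq_0)
        then show False using P(2) \<rho> by simp
      next
        case 2
        then obtain x where x: "z = of_real x" by (metis complex_is_Real_iff Reals_cases)
        have "complex_of_real (poly (symb c (m - 1) \<omega>) x) + \<i> * of_real (\<rho> * poly (symb c m \<omega>) x) = 0"
          using eq by (simp add: x mult.assoc)
        then have "poly (symb c (m - 1) \<omega>) x = 0" "poly (symb c m \<omega>) x = 0"
          using \<rho> by (auto simp: complex_eq_iff)
        then show False using fast[OF \<omega>, of x] by simp
      qed
    qed
  next
    fix l assume "poly (\<Sum>i\<le>m - (m - 1). monom (complex_of_real (c (m - 1 + i) (\<lambda>_. 0))) i) l = 0"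
    then have "complex_of_real (c (m - 1) (\<lambda>_. 0)) + l = 0" using m1 lead by (simp add: poly_monom)
    then have "l = - complex_of_real (c (m - 1) (\<lambda>_. 0))" by (simp add: eq_neg_iff_add_eq_0 add.commute)
    then show "Re l < 0" using lead by simp
  qed (use m m1 lead sh fast slow in auto)
qed

text \<open>
  Division of the equation by \<open>P\<^sub>m\<^sub>-\<^sub>1(z)\<close> gives \<open>P\<^sub>m\<^sub>-\<^sub>2 / P\<^sub>m\<^sub>-\<^sub>1 + i \<rho> - \<rho>\<^sup>2 P\<^sub>m / P\<^sub>m\<^sub>-\<^sub>1 = 0\<close>. For \<open>Im z < 0\<close> all three summands
  have nonnegative imaginary part, because inversion exchanges the half-planes. At a real solution \<open>z\<close> both
  \<open>P\<^sub>m\<^sub>-\<^sub>1(z) = 0\<close> and \<open>P\<^sub>m\<^sub>-\<^sub>2(z) = \<rho>\<^sup>2 P\<^sub>m(z)\<close> hold, whereas \<open>P\<^sub>m\<^sub>-\<^sub>2\<close> and \<open>P\<^sub>m\<close> have opposite signs at the roots of \<open>P\<^sub>m\<^sub>-\<^sub>1\<close>.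
\<close>

lemma dissipative_symbol_three_orders:
  fixes c :: "'n::finite coeffs"
  assumes m: "3 \<le> m" and lead: "c m (\<lambda>_. 0) = 1" "0 < c (m - 1) (\<lambda>_. 0)" "0 < c (m - 2) (\<lambda>_. 0)"
    and sh: "strictly_hyperbolic c m" "strictly_hyperbolic c (m - 1)" "strictly_hyperbolic c (m - 2)"
    and il: "\<And>\<omega>. norm \<omega> = 1 \<Longrightarrow> strictly_interlace (symb c (m - 1) \<omega>) (symb c m \<omega>)"
      "\<And>\<omega>. norm \<omega> = 1 \<Longrightarrow> strictly_interlace (symb c (m - 2) \<omega>) (symb c (m - 1) \<omega>)"
  shows "dissipative_symbol c m (m - 2)"
proof -
  have m1: "Suc (m - 2) = m - 1" "m - (m - 2) = 2" "Suc (m - 1) = m" "m - 2 + 2 = m" using m by auto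
  have set2: "{..2::nat} = {0, 1, 2}" by auto
  have fast: "0 < poly (symb c (m - 1) \<omega>) a / poly (pderiv (symb c m \<omega>)) a" if "norm \<omega> = 1" "poly (symb c m \<omega>) a = 0" for \<omega> a
    by (rule strictly_interlace_signs(1)[OF il(1)[OF that(1)] _ _ that(2)]) (use lead in \<open>simp_all add: lead_coeff_symb\<close>)
  have slow1: "poly (symb c m \<omega>) a / poly (pderiv (symb c (m - 1) \<omega>)) a < 0" if "norm \<omega> = 1" "poly (symb c (m - 1) \<omega>) a = 0" for \<omega> a
    by (rule strictly_interlace_signs(2)[OF il(1)[OF that(1)] _ _ that(2)]) (use lead in \<open>simp_all add: lead_coeff_symb\<close>)
  have fast1: "0 < poly (symb c (m - 2) \<omega>) a / poly (pderiv (symb c (m - 1) \<omega>)) a" if "norm \<omega> = 1" "poly (symb c (m - 1) \<omega>) a = 0" for \<omega> a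
    by (rule strictly_interlace_signs(1)[OF il(2)[OF that(1)] _ _ that(2)]) (use lead in \<open>simp_all add: lead_coeff_symb\<close>)
  have slow: "poly (symb c (m - 1) \<omega>) a / poly (pderiv (symb c (m - 2) \<omega>)) a < 0" if "norm \<omega> = 1" "poly (symb c (m - 2) \<omega>) a = 0" for \<omega> a
    by (rule strictly_interlace_signs(2)[OF il(2)[OF that(1)] _ _ that(2)]) (use lead in \<open>simp_all add: lead_coeff_symb\<close>)
  show ?thesis
  proof
    fix \<omega> :: "real ^ 'n" and \<rho> :: real and z
    assume \<omega>: "norm \<omega> = 1" and \<rho>: "0 < \<rho>"
      and "poly (\<Sum>i\<le>m - (m - 2). smult ((\<i> * of_real \<rho>) ^ i) (csymb c (m - 2 + i) \<omega>)) z = 0"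
    then have eq: "poly (csymb c (m - 2) \<omega>) z + \<i> * of_real \<rho> * poly (csymb c (m - 1) \<omega>) z - of_real (\<rho>\<^sup>2) * poly (csymb c m \<omega>) z = 0"
      using m1 by (simp add: set2 power2_eq_square algebra_simps)
    show "0 < Im z"
    proof (rule ccontr)
      assume "\<not> 0 < Im z"
      then consider "Im z < 0" | "Im z = 0" by linarith
      then show False
      proof cases
        case 1
        have P: "poly (csymb c m \<omega>) z \<noteq> 0" "0 < Im (poly (csymb c (m - 1) \<omega>) z / poly (csymb c m \<omega>) z)"
          using Im_symbol_quotient_pos[of c m \<omega> "m - 1" z, OF sh(1) _ \<omega> _ fast[OF \<omega>] 1] lead m by auto
        have P1: "poly (csymb c (m - 1) \<omega>) z \<noteq> 0" "0 < Im (poly (csymb c (m - 2) \<omega>) z / poly (csymb c (m - 1) \<omega>) z)"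
          using Im_symbol_quotient_pos[of c "m - 1" \<omega> "m - 2" z, OF sh(2) _ \<omega> _ fast1[OF \<omega>] 1] lead m by auto
        define w where "w = poly (csymb c (m - 1) \<omega>) z / poly (csymb c m \<omega>) z"
        have "poly (csymb c (m - 2) \<omega>) z / poly (csymb c (m - 1) \<omega>) z + \<i> * of_real \<rho> - of_real (\<rho>\<^sup>2) * (1 / w) = 0"
          using arg_cong[OF eq, of "\<lambda>x. x / poly (csymb c (m - 1) \<omega>) z"] P1(1) by (simp add: w_def add_divide_distrib diff_divide_distrib)
        then have "Im (poly (csymb c (m - 2) \<omega>) z / poly (csymb c (m - 1) \<omega>) z + \<i> * of_real \<rho> - of_real (\<rho>\<^sup>2) * (1 / w)) = 0" by simp
        moreover have "Im (of_real (\<rho>\<^sup>2) * (1 / w)) \<le> 0"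
        proof -
          have "Im (of_real (\<rho>\<^sup>2) * (1 / w)) = - (\<rho>\<^sup>2 * Im w / ((Re w)\<^sup>2 + (Im w)\<^sup>2))" by (simp add: Im_divide)
          moreover have "0 \<le> \<rho>\<^sup>2 * Im w / ((Re w)\<^sup>2 + (Im w)\<^sup>2)" using P(2) by (intro divide_nonneg_nonneg) (auto simp: w_def)
          ultimately show ?thesis by simp
        qed
        ultimately show False using P1(2) \<rho> by simp
      next
        case 2
        then obtain x where x: "z = of_real x" by (metis complex_is_Real_iff Reals_cases)
        have "complex_of_real (poly (symb c (m - 2) \<omega>) x - \<rho>\<^sup>2 * poly (symb c m \<omega>) x) + \<i> * of_real (\<rho> * poly (symb c (m - 1) \<omega>) x) = 0"
          using eq by (simp add: x algebra_simps)
        then have e: "poly (symb c (m - 2) \<omega>) x = \<rho>\<^sup>2 * poly (symb c m \<omega>) x" "poly (symb c (m - 1) \<omega>) x = 0"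
          using \<rho> by (auto simp: complex_eq_iff)
        have "poly (symb c (m - 2) \<omega>) x / poly (pderiv (symb c (m - 1) \<omega>)) x = \<rho>\<^sup>2 * (poly (symb c m \<omega>) x / poly (pderiv (symb c (m - 1) \<omega>)) x)"
          unfolding e(1) by simp
        also have "\<dots> < 0" using slow1[OF \<omega> e(2)] \<rho> by (intro mult_pos_neg) auto
        finally show False using fast1[OF \<omega> e(2)] by simp
      qed
    qed
  next
    fix l :: complex assume "poly (\<Sum>i\<le>m - (m - 2). monom (complex_of_real (c (m - 2 + i) (\<lambda>_. 0))) i) l = 0"
    then have "complex_of_real (c (m - 2) (\<lambda>_. 0)) + complex_of_real (c (m - 1) (\<lambda>_. 0)) * l + l\<^sup>2 = 0"
      using m1 lead by (simp add: poly_monom set2 add.assoc)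
    then have re: "c (m - 2) (\<lambda>_. 0) + c (m - 1) (\<lambda>_. 0) * Re l + ((Re l)\<^sup>2 - (Im l)\<^sup>2) = 0"
      and im: "c (m - 1) (\<lambda>_. 0) * Im l + 2 * Re l * Im l = 0"
      by (auto simp: complex_eq_iff power2_eq_square algebra_simps)
    from im have "Im l = 0 \<or> c (m - 1) (\<lambda>_. 0) + 2 * Re l = 0" by (metis distrib_right mult_eq_0_iff)
    then show "Re l < 0"
    proof
      assume "Im l = 0"
      show ?thesis
      proof (rule ccontr)
        assume "\<not> Re l < 0"
        then have "0 \<le> c (m - 1) (\<lambda>_. 0) * Re l" using lead by simp
        moreover have "0 \<le> (Re l)\<^sup>2" by simp
        moreover have "c (m - 2) (\<lambda>_. 0) + c (m - 1) (\<lambda>_. 0) * Re l + (Re l)\<^sup>2 = 0" using re \<open>Im l = 0\<close> by simp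
        ultimately show False using lead(3) by linarith
      qed
    qed (use lead in linarith)
  qed (use m m1 lead sh fast slow in auto)
qed

theorem theorem3:
  fixes c :: "'n::finite coeffs"
    and m :: nat
    and s0 :: real
    and u0 :: "nat \<Rightarrow> real ^ 'n \<Rightarrow> complex"
  assumes "m \<ge> 3"
    and "c m (\<lambda>_. 0) = 1" and "c (m - 1) (\<lambda>_. 0) > 0"
    and "strictly_hyperbolic c m" and "strictly_hyperbolic c (m - 1)"
    and "\<forall>\<xi>' \<in> sphere 0 1. strictly_interlace (symb c (m - 1) \<xi>') (symb c m \<xi>')"
    and "s0 \<ge> real m - 1"
    and "\<forall>j<m. in_sobolev (s0 - real j) (u0 j) \<and> integrable lborel (u0 j)"
  shows
    "(\<forall>M u. M = (LINT x|lborel. u0 (m - 1) x + of_real (c (m - 1) (\<lambda>_. 0)) * u0 (m - 2) x) \<longrightarrow>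
        solves_cauchy c {m, m - 1} m s0 u0 u \<longrightarrow>
        (\<forall>(k::nat) (s::real). s \<ge> 0 \<longrightarrow> real k + s \<le> s0 \<longrightarrow>
           real CARD('n) / 2 + real k + s > real m - 2 \<longrightarrow>
           (let D = (\<lambda>t \<xi>. dt_hat s0 k u t \<xi>
                  - riesz_hat (real m - 2) (pointwise_dt k (profile_hat c (m - 1) M) t) \<xi>)
            in (\<forall>\<^sub>F t in at_top. in_hdot_hat s (D t)) \<and>
               (\<lambda>t. hdot_norm_hat s (D t)) \<in>
                 o(\<lambda>t. (1 + t) powr (- real CARD('n) / 4 - (real k + s - (real m - 2)) / 2)))))
     \<and>
     (c (m - 2) (\<lambda>_. 0) > 0 \<longrightarrow> strictly_hyperbolic c (m - 2) \<longrightarrow>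
      (\<forall>\<xi>' \<in> sphere 0 1. strictly_interlace (symb c (m - 2) \<xi>') (symb c (m - 1) \<xi>')) \<longrightarrow>
      (\<forall>M u. M = (LINT x|lborel. u0 (m - 1) x + of_real (c (m - 1) (\<lambda>_. 0)) * u0 (m - 2) x
                              + of_real (c (m - 2) (\<lambda>_. 0)) * u0 (m - 3) x) \<longrightarrow>
        solves_cauchy c {m, m - 1, m - 2} m s0 u0 u \<longrightarrow>
        (\<forall>(k::nat) (s::real). s \<ge> 0 \<longrightarrow> real k + s \<le> s0 \<longrightarrow>
           real CARD('n) / 2 + real k + s > real m - 3 \<longrightarrow>
           (let D = (\<lambda>t \<xi>. dt_hat s0 k u t \<xi>
                  - riesz_hat (real m - 3) (pointwise_dt k (profile_hat c (m - 2) M) t) \<xi>)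
            in (\<forall>\<^sub>F t in at_top. in_hdot_hat s (D t)) \<and>
               (\<lambda>t. hdot_norm_hat s (D t)) \<in>
                 o(\<lambda>t. (1 + t) powr (- real CARD('n) / 4 - (real k + s - (real m - 3)) / 2))))))"
proof (intro conjI impI allI)
  fix M u and k :: nat and s :: real
  assume M: "M = (LINT x|lborel. u0 (m - 1) x + of_real (c (m - 1) (\<lambda>_. 0)) * u0 (m - 2) x)"
    and sol: "solves_cauchy c {m, m - 1} m s0 u0 u"
    and s: "0 \<le> s" "real k + s \<le> s0" and dim: "real m - 2 < real CARD('n) / 2 + real k + s"
  interpret dissipative_symbol c m "m - 1"
    by (rule dissipative_symbol_two_orders) (use assms in auto)
  have u0: "in_sobolev (s0 - real j) (u0 j)" "integrable lborel (u0 j)" if "j < m" for j using assms(8) that by auto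
  have R: "{m, m - 1} = {m - 1..m}" using assms(1) by auto
  have rr: "real (m - 1) - 1 = real m - 2" using assms(1) by simp
  have J: "{m - 1 - 1..<m} = {m - 2, m - 1}" "m - 2 \<noteq> m - 1" "Suc (m - 2) = m - 1" "Suc (m - 1) = m" using assms(1) by auto
  have "M = (\<Sum>j\<in>{m - 1 - 1..<m}. of_real (c (Suc j) (\<lambda>_. 0)) * (LINT x|lborel. u0 j x))"
    unfolding M J(1) using u0[of "m - 1"] u0[of "m - 2"] assms(1,2) J by (simp add: add.commute)
  from asymptotic_profile[OF assms(7) u0 sol[unfolded R] this s]
  show "let D = (\<lambda>t \<xi>. dt_hat s0 k u t \<xi> - riesz_hat (real m - 2) (pointwise_dt k (profile_hat c (m - 1) M) t) \<xi>)
     in (\<forall>\<^sub>F t in at_top. in_hdot_hat s (D t)) \<and>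
        (\<lambda>t. hdot_norm_hat s (D t)) \<in> o(\<lambda>t. (1 + t) powr (- real CARD('n) / 4 - (real k + s - (real m - 2)) / 2))"
    unfolding rr Let_def using dim by blast
next
  fix M u and k :: nat and s :: real
  assume lead: "c (m - 2) (\<lambda>_. 0) > 0" and sh: "strictly_hyperbolic c (m - 2)"
    and il: "\<forall>\<xi>' \<in> sphere 0 1. strictly_interlace (symb c (m - 2) \<xi>') (symb c (m - 1) \<xi>')"
    and M: "M = (LINT x|lborel. u0 (m - 1) x + of_real (c (m - 1) (\<lambda>_. 0)) * u0 (m - 2) x
                              + of_real (c (m - 2) (\<lambda>_. 0)) * u0 (m - 3) x)"
    and sol: "solves_cauchy c {m, m - 1, m - 2} m s0 u0 u"
    and s: "0 \<le> s" "real k + s \<le> s0" and dim: "real m - 3 < real CARD('n) / 2 + real k + s"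
  interpret dissipative_symbol c m "m - 2"
    by (rule dissipative_symbol_three_orders) (use assms lead sh il in auto)
  have u0: "in_sobolev (s0 - real j) (u0 j)" "integrable lborel (u0 j)" if "j < m" for j using assms(8) that by auto
  have R: "{m, m - 1, m - 2} = {m - 2..m}" using assms(1) by auto
  have rr: "real (m - 2) - 1 = real m - 3" using assms(1) by simp
  have J: "{m - 2 - 1..<m} = {m - 3, m - 2, m - 1}" "m - 3 \<noteq> m - 2" "m - 3 \<noteq> m - 1" "m - 2 \<noteq> m - 1"
    "Suc (m - 3) = m - 2" "Suc (m - 2) = m - 1" "Suc (m - 1) = m" using assms(1) by auto
  have "M = (\<Sum>j\<in>{m - 2 - 1..<m}. of_real (c (Suc j) (\<lambda>_. 0)) * (LINT x|lborel. u0 j x))"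
    unfolding M J(1) using u0[of "m - 1"] u0[of "m - 2"] u0[of "m - 3"] assms(1,2) J by (simp add: add_ac)
  from asymptotic_profile[OF assms(7) u0 sol[unfolded R] this s]
  show "let D = (\<lambda>t \<xi>. dt_hat s0 k u t \<xi> - riesz_hat (real m - 3) (pointwise_dt k (profile_hat c (m - 2) M) t) \<xi>)
     in (\<forall>\<^sub>F t in at_top. in_hdot_hat s (D t)) \<and>
        (\<lambda>t. hdot_norm_hat s (D t)) \<in> o(\<lambda>t. (1 + t) powr (- real CARD('n) / 4 - (real k + s - (real m - 3)) / 2))"
    unfolding rr Let_def using dim by blast
qed

end
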